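(* Let $G$ be a locally compact group with a $C^1$-continuous amenable action on a differentiable manifold $X$. Then there is a family $(\lambda_p)_{p\ge1}$ of $G$-equivariant strong linear liftings $\lambda_p\colon L^\infty(X^p)\to\mathscr{L}^\infty(X^p)$ (for the diagonal $G$-action on $X^p$) such that: (i) the family intertwines the homogeneous coboundary maps $d\colon L^\infty(X^p)\to L^\infty(X^{p+1})$ and $d\colon\mathscr{L}^\infty(X^p)\to\mathscr{L}^\infty(X^{p+1})$, i.e. $\lambda_{p+1}(d\varphi)=d(\lambda_p\varphi)$ for all $p\ge1$ and all $\varphi\in L^\infty(X^p)$; (ii) each $\lambda_p$ is compatible with permuting coordinates, i.e. commutes with the action of the symmetric group on $p$ letters by permutation of the coordinates of $X^p$.
   Context: Measure: differentiable manifolds ($X$ and its powers $X^p$) are endowed with the Lebesgue measure associated to some Riemannian structure (the spaces below do not depend on the choice). Function spaces: for such a manifold $Y$, $\mathscr{L}^\infty(Y)$ is the space of (everywhere defined) bounded Lebesgue-measurable functions on $Y$ (real or complex), with the sup-norm; $L^\infty(Y)$ is the space of classes $[f]$ of such functions, two functions being identified if they agree locally almost everywhere. Linear lifting: a positive linear map $\lambda\colon L^\infty(Y)\to\mathscr{L}^\infty(Y)$ such that $\lambda(\varphi)\in\varphi$ for all $\varphi\in L^\infty(Y)$ and $\lambda([\mathbf 1_Y])=\mathbf 1_Y$. It is strong if $\lambda([f])=f$ for every (bounded) continuous function $f$ on $Y$. Equivariance is with respect to $(sf)(y)=f(s^{-1}y)$. Homogeneous coboundary: $d=\sum_{j=0}^p(-1)^jd_j$,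 where $(d_jf)(x_0,\ldots,x_p)=f(x_0,\ldots,\widehat{x_j},\ldots,x_p)$ omits the $j$-th coordinate; the same formula defines $d$ on function classes. $C^1$-continuous action: a continuous action of a topological group $G$ on a differentiable manifold $X$ such that each $g\in G$ has a derivative at each $x\in X$ and the derivative depends continuously on $(g,x)\in G\times X$. Amenable action (topological amenability): with $dg$ a left Haar measure on $G$, there is a net $(\mu_i)_{i\in I}$ of non-negative continuous functions on $G\times X$ such that (a) $\int_G\mu_i(g,x)\,dg=1$ for all $i\in I$ and all $x\in X$; (b) $\lim_{i\in I}\int_G|\mu_i(sg,sx)-\mu_i(g,x)|\,dg=0$ uniformly for $(s,x)$ in compact subsets of $G\times X$. *)

theory Defs
  imports
    "HOL-Analysis.Analysis"
    "Jordan_Normal_Form.Determinant"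
begin

text \<open>The powers of a manifold have varying dimensions, so the dimension is a natural number
  and \<open>\<real>\<^sup>n\<close> consists of the extensional functions on \<open>{..<n}\<close>.\<close>

definition Rn :: "nat \<Rightarrow> (nat \<Rightarrow> real) topology" where
  "Rn n = product_topology (\<lambda>_. euclideanreal) {..<n}"

definition Rn_lebesgue :: "nat \<Rightarrow> (nat \<Rightarrow> real) measure" where
  "Rn_lebesgue n = completion (Pi\<^sub>M {..<n} (\<lambda>_. lborel))"

text \<open>\<open>has_jacobian n m f J u\<close>: the map \<open>f\<close> (into \<open>\<real>\<^sup>m\<close>, of interest only near the point \<open>u\<close>
  of \<open>\<real>\<^sup>n\<close>) is Frechet differentiable at \<open>u\<close> with matrix \<open>J\<close>. The library derivative needs a
  normed space type.\<close>

definition has_jacobian ::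
  "nat \<Rightarrow> nat \<Rightarrow> ((nat \<Rightarrow> real) \<Rightarrow> (nat \<Rightarrow> real)) \<Rightarrow> (nat \<Rightarrow> nat \<Rightarrow> real) \<Rightarrow> (nat \<Rightarrow> real) \<Rightarrow> bool" where
  "has_jacobian n m f J u \<longleftrightarrow>
     (\<forall>e>0. \<exists>d>0. \<forall>v\<in>topspace (Rn n). L2_set (\<lambda>j. v j - u j) {..<n} < d \<longrightarrow>
        L2_set (\<lambda>i. f v i - f u i - (\<Sum>j<n. J i j * (v j - u j))) {..<m}
          \<le> e * L2_set (\<lambda>j. v j - u j) {..<n})"

type_synonym 'a chart = "'a set \<times> ('a \<Rightarrow> nat \<Rightarrow> real)"

record 'a manifold =
  mtop :: "'a topology"
  mdim :: nat
  atlas :: "'a chart set"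

definition is_chart :: "'a topology \<Rightarrow> nat \<Rightarrow> 'a chart \<Rightarrow> bool" where
  "is_chart T n c \<longleftrightarrow>
     openin T (fst c) \<and> openin (Rn n) (snd c ` fst c) \<and>
     homeomorphic_map (subtopology T (fst c)) (subtopology (Rn n) (snd c ` fst c)) (snd c)"

text \<open>\<open>J\<close> is the matrix, in the charts \<open>c\<close> and \<open>c'\<close>, of the derivative of \<open>f\<close> at \<open>x\<close>.\<close>

definition has_derivative_in_charts ::
  "nat \<Rightarrow> 'a chart \<Rightarrow> 'a chart \<Rightarrow> ('a \<Rightarrow> 'a) \<Rightarrow> (nat \<Rightarrow> nat \<Rightarrow> real) \<Rightarrow> 'a \<Rightarrow> bool" where
  "has_derivative_in_charts n c c' f J x \<longleftrightarrow>
     has_jacobian n n (snd c' \<circ> f \<circ> inv_into (fst c) (snd c)) J (snd c x)"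

definition C1_compatible :: "'a topology \<Rightarrow> nat \<Rightarrow> 'a chart \<Rightarrow> 'a chart \<Rightarrow> bool" where
  "C1_compatible T n c c' \<longleftrightarrow>
     (\<exists>J. (\<forall>x\<in>fst c \<inter> fst c'. has_derivative_in_charts n c c' id (J x) x) \<and>
          (\<forall>i<n. \<forall>j<n. continuous_map (subtopology T (fst c \<inter> fst c')) euclideanreal
              (\<lambda>x. J x i j)))"

definition paracompact_space :: "'a topology \<Rightarrow> bool" where
  "paracompact_space T \<longleftrightarrow>
     (\<forall>\<U>. (\<forall>U\<in>\<U>. openin T U) \<and> \<Union>\<U> = topspace T \<longrightarrow>
        (\<exists>\<V>. (\<forall>V\<in>\<V>. openin T V \<and> (\<exists>U\<in>\<U>. V \<subseteq> U)) \<and> \<Union>\<V> = topspace T \<and>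
             locally_finite_in T \<V>))"

text \<open>The manifold is of class (at least) \<open>C\<^sup>1\<close>. Existence of a Riemannian structure amounts to
  paracompactness; second countability is not required.\<close>

definition differentiable_manifold :: "'a manifold \<Rightarrow> bool" where
  "differentiable_manifold Y \<longleftrightarrow>
     Hausdorff_space (mtop Y) \<and> paracompact_space (mtop Y) \<and>
     (\<Union>c\<in>atlas Y. fst c) = topspace (mtop Y) \<and>
     (\<forall>c\<in>atlas Y. is_chart (mtop Y) (mdim Y) c) \<and>
     (\<forall>c\<in>atlas Y. \<forall>c'\<in>atlas Y. C1_compatible (mtop Y) (mdim Y) c c')"

text \<open>Points of \<open>X\<^sup>p\<close> are extensional functions on \<open>{..<p}\<close>; in a product chart, the \<open>i\<close>-th factor
  provides the \<open>n\<close> coordinates with indices \<open>i * n, \<dots>, i * n + n - 1\<close>.\<close>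

definition power_chart :: "nat \<Rightarrow> nat \<Rightarrow> (nat \<Rightarrow> 'a chart) \<Rightarrow> (nat \<Rightarrow> 'a) chart" where
  "power_chart n p c =
     (Pi\<^sub>E {..<p} (\<lambda>i. fst (c i)),
      \<lambda>x. \<lambda>k\<in>{..<p * n}. snd (c (k div n)) (x (k div n)) (k mod n))"

definition power_manifold :: "nat \<Rightarrow> 'a manifold \<Rightarrow> (nat \<Rightarrow> 'a) manifold" where
  "power_manifold p X =
     \<lparr> mtop = product_topology (\<lambda>_. mtop X) {..<p},
       mdim = p * mdim X,
       atlas = {power_chart (mdim X) p c | c. \<forall>i<p. c i \<in> atlas X} \<rparr>"

text \<open>\<open>g c x i j\<close> is the \<open>(i,j)\<close> coefficient of the metric at \<open>x\<close> in the chart \<open>c\<close>.\<close>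

definition riemannian_metric ::
  "'a manifold \<Rightarrow> ('a chart \<Rightarrow> 'a \<Rightarrow> nat \<Rightarrow> nat \<Rightarrow> real) \<Rightarrow> bool" where
  "riemannian_metric Y g \<longleftrightarrow>
     (\<forall>c\<in>atlas Y.
        (\<forall>i<mdim Y. \<forall>j<mdim Y.
           continuous_map (subtopology (mtop Y) (fst c)) euclideanreal (\<lambda>x. g c x i j)) \<and>
        (\<forall>x\<in>fst c.
           (\<forall>i<mdim Y. \<forall>j<mdim Y. g c x i j = g c x j i) \<and>
           (\<forall>v. (\<exists>i<mdim Y. v i \<noteq> 0) \<longrightarrow>
              0 < (\<Sum>i<mdim Y. \<Sum>j<mdim Y. g c x i j * v i * v j)))) \<and>
     (\<forall>c\<in>atlas Y. \<forall>c'\<in>atlas Y. \<forall>x\<in>fst c \<inter> fst c'. \<forall>J.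
        has_derivative_in_charts (mdim Y) c c' id J x \<longrightarrow>
        (\<forall>i<mdim Y. \<forall>j<mdim Y.
           g c x i j = (\<Sum>k<mdim Y. \<Sum>l<mdim Y. g c' x k l * J k i * J l j)))"

text \<open>\<open>M\<close> lives on the Lebesgue measurable sets and has density \<open>sqrt \<bar>det g\<bar>\<close> in every chart.
  This determines \<open>M\<close> on all sigma-compact sets; on a manifold that is not sigma-compact, the
  various conventions for larger sets have the same locally null sets.\<close>

definition riemannian_measure ::
  "'a manifold \<Rightarrow> ('a chart \<Rightarrow> 'a \<Rightarrow> nat \<Rightarrow> nat \<Rightarrow> real) \<Rightarrow> 'a measure \<Rightarrow> bool" where
  "riemannian_measure Y g M \<longleftrightarrow>
     space M = topspace (mtop Y) \<and>
     sets M = {A. A \<subseteq> topspace (mtop Y) \<and>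
       (\<forall>c\<in>atlas Y. snd c ` (A \<inter> fst c) \<in> sets (Rn_lebesgue (mdim Y)))} \<and>
     (\<forall>c\<in>atlas Y. \<forall>A\<in>sets M. A \<subseteq> fst c \<longrightarrow>
        emeasure M A =
          (\<integral>\<^sup>+u. indicator (snd c ` A) u *
             ennreal (sqrt \<bar>Determinant.det (Matrix.mat (mdim Y) (mdim Y)
               (\<lambda>(i, j). g c (inv_into (fst c) (snd c) u) i j))\<bar>) \<partial>Rn_lebesgue (mdim Y)))"

text \<open>Functions on \<open>Y\<close> are represented by functions on the whole type that vanish off \<open>Y\<close>.
  The scalars \<open>'k\<close> are the real or the complex numbers.\<close>

definition bounded_measurable ::
  "'a topology \<Rightarrow> 'a measure \<Rightarrow> ('a \<Rightarrow> 'k::real_normed_field) set" where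
  "bounded_measurable T M =
     {f. f \<in> borel_measurable M \<and> bounded (f ` topspace T) \<and> (\<forall>y. y \<notin> topspace T \<longrightarrow> f y = 0)}"

definition locally_AE :: "'a topology \<Rightarrow> 'a measure \<Rightarrow> ('a \<Rightarrow> bool) \<Rightarrow> bool" where
  "locally_AE T M P \<longleftrightarrow> (\<forall>K. compactin T K \<longrightarrow> (AE y in M. y \<in> K \<longrightarrow> P y))"

definition Linf_class ::
  "'a topology \<Rightarrow> 'a measure \<Rightarrow> ('a \<Rightarrow> 'k::real_normed_field) \<Rightarrow> ('a \<Rightarrow> 'k) set" where
  "Linf_class T M f = {h \<in> bounded_measurable T M. locally_AE T M (\<lambda>y. h y = f y)}"

definition Linf ::
  "'a topology \<Rightarrow> 'a measure \<Rightarrow> ('a \<Rightarrow> 'k::real_normed_field) set set" where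
  "Linf T M = Linf_class T M ` bounded_measurable T M"

definition nonneg_scalar :: "'k::real_normed_field \<Rightarrow> bool" where
  "nonneg_scalar z \<longleftrightarrow> (\<exists>r\<ge>0. z = of_real r)"

text \<open>As usual, operations on \<open>L\<^sup>\<infinity>\<close> are expressed through representatives.\<close>

definition linear_lifting ::
  "'a topology \<Rightarrow> 'a measure \<Rightarrow> (('a \<Rightarrow> 'k::real_normed_field) set \<Rightarrow> 'a \<Rightarrow> 'k) \<Rightarrow> bool" where
  "linear_lifting T M \<Lambda> \<longleftrightarrow>
     (\<forall>\<phi>\<in>Linf T M. \<Lambda> \<phi> \<in> \<phi>) \<and>
     (\<forall>f\<in>bounded_measurable T M. \<forall>h\<in>bounded_measurable T M. \<forall>a b.
        \<Lambda> (Linf_class T M (\<lambda>y. a * f y + b * h y)) =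
          (\<lambda>y. a * \<Lambda> (Linf_class T M f) y + b * \<Lambda> (Linf_class T M h) y)) \<and>
     (\<forall>f\<in>bounded_measurable T M. locally_AE T M (\<lambda>y. nonneg_scalar (f y)) \<longrightarrow>
        (\<forall>y. nonneg_scalar (\<Lambda> (Linf_class T M f) y))) \<and>
     \<Lambda> (Linf_class T M (indicator (topspace T))) = indicator (topspace T)"

definition strong_linear_lifting ::
  "'a topology \<Rightarrow> 'a measure \<Rightarrow> (('a \<Rightarrow> 'k::real_normed_field) set \<Rightarrow> 'a \<Rightarrow> 'k) \<Rightarrow> bool" where
  "strong_linear_lifting T M \<Lambda> \<longleftrightarrow>
     linear_lifting T M \<Lambda> \<and>
     (\<forall>f. continuous_map T euclidean f \<and> bounded (f ` topspace T) \<and>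
          (\<forall>y. y \<notin> topspace T \<longrightarrow> f y = 0) \<longrightarrow> \<Lambda> (Linf_class T M f) = f)"

text \<open>The group is written additively but need not be commutative.\<close>

definition continuous_action ::
  "'a topology \<Rightarrow> ('g::topological_group_add \<Rightarrow> 'a \<Rightarrow> 'a) \<Rightarrow> bool" where
  "continuous_action T act \<longleftrightarrow>
     (\<forall>s. \<forall>x\<in>topspace T. act s x \<in> topspace T) \<and>
     (\<forall>x\<in>topspace T. act 0 x = x) \<and>
     (\<forall>s t. \<forall>x\<in>topspace T. act (s + t) x = act s (act t x)) \<and>
     continuous_map (prod_topology euclidean T) T (\<lambda>(s, x). act s x)"

definition C1_continuous_action ::
  "'a manifold \<Rightarrow> ('g::topological_group_add \<Rightarrow> 'a \<Rightarrow> 'a) \<Rightarrow> bool" where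
  "C1_continuous_action X act \<longleftrightarrow>
     continuous_action (mtop X) act \<and>
     (\<forall>c\<in>atlas X. \<forall>c'\<in>atlas X. \<exists>J :: 'g \<Rightarrow> 'a \<Rightarrow> nat \<Rightarrow> nat \<Rightarrow> real.
        (\<forall>s x. x \<in> fst c \<and> act s x \<in> fst c' \<longrightarrow>
           has_derivative_in_charts (mdim X) c c' (act s) (J s x) x) \<and>
        (\<forall>i<mdim X. \<forall>j<mdim X.
           continuous_map
             (subtopology (prod_topology euclidean (mtop X))
                {(s, x). x \<in> fst c \<and> act s x \<in> fst c'})
             euclideanreal (\<lambda>(s, x). J s x i j)))"

text \<open>A left Haar measure is a nonzero left-invariant Radon measure.\<close>

definition left_haar_measure :: "'g::{topological_group_add, t2_space} measure \<Rightarrow> bool" where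
  "left_haar_measure \<nu> \<longleftrightarrow>
     sets \<nu> = sets borel \<and>
     emeasure \<nu> UNIV \<noteq> 0 \<and>
     (\<forall>K. compact K \<longrightarrow> emeasure \<nu> K < \<infinity>) \<and>
     (\<forall>A\<in>sets borel. emeasure \<nu> A = (INF U\<in>{U. open U \<and> A \<subseteq> U}. emeasure \<nu> U)) \<and>
     (\<forall>U. open U \<longrightarrow> emeasure \<nu> U = (SUP K\<in>{K. compact K \<and> K \<subseteq> U}. emeasure \<nu> K)) \<and>
     (\<forall>s. \<forall>A\<in>sets borel. emeasure \<nu> ((+) s ` A) = emeasure \<nu> A)"

definition directed_set :: "'i set \<Rightarrow> ('i \<Rightarrow> 'i \<Rightarrow> bool) \<Rightarrow> bool" where
  "directed_set I rel \<longleftrightarrow>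
     I \<noteq> {} \<and> (\<forall>i\<in>I. rel i i) \<and>
     (\<forall>i\<in>I. \<forall>j\<in>I. \<forall>k\<in>I. rel i j \<and> rel j k \<longrightarrow> rel i k) \<and>
     (\<forall>i\<in>I. \<forall>j\<in>I. \<exists>k\<in>I. rel i k \<and> rel j k)"

text \<open>One cannot quantify over types inside a formula, so the type \<open>'i\<close> of the indices of the net
  is a parameter; theorems assuming amenability leave it arbitrary.\<close>

definition amenable_action ::
  "'i itself \<Rightarrow> 'a topology \<Rightarrow> ('g::{topological_group_add, t2_space} \<Rightarrow> 'a \<Rightarrow> 'a) \<Rightarrow> bool" where
  "amenable_action (_ :: 'i itself) T act \<longleftrightarrow>
     (\<exists>(\<nu> :: 'g measure) (I :: 'i set) rel (\<mu> :: 'i \<Rightarrow> 'g \<Rightarrow> 'a \<Rightarrow> real).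
        left_haar_measure \<nu> \<and> directed_set I rel \<and>
        (\<forall>i\<in>I. continuous_map (prod_topology euclidean T) euclideanreal (\<lambda>(g, x). \<mu> i g x) \<and>
               (\<forall>g. \<forall>x\<in>topspace T. 0 \<le> \<mu> i g x) \<and>
               (\<forall>x\<in>topspace T. (\<integral>g. \<mu> i g x \<partial>\<nu>) = 1)) \<and>
        (\<forall>K. compactin (prod_topology euclidean T) K \<longrightarrow>
           (\<forall>e>0. \<exists>i0\<in>I. \<forall>i\<in>I. rel i0 i \<longrightarrow>
              (\<forall>(s, x)\<in>K. (\<integral>g. \<bar>\<mu> i (s + g) (act s x) - \<mu> i g x\<bar> \<partial>\<nu>) < e))))"

abbreviation power_top :: "'a topology \<Rightarrow> nat \<Rightarrow> (nat \<Rightarrow> 'a) topology" where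
  "power_top T p \<equiv> product_topology (\<lambda>_. T) {..<p}"

definition translate ::
  "'a topology \<Rightarrow> ('g::group_add \<Rightarrow> 'a \<Rightarrow> 'a) \<Rightarrow> nat \<Rightarrow> 'g \<Rightarrow> ((nat \<Rightarrow> 'a) \<Rightarrow> 'k::zero) \<Rightarrow> (nat \<Rightarrow> 'a) \<Rightarrow> 'k"
  where
  "translate T act p s f =
     (\<lambda>x. if x \<in> topspace (power_top T p) then f (\<lambda>i\<in>{..<p}. act (- s) (x i)) else 0)"

definition permute_coords ::
  "'a topology \<Rightarrow> nat \<Rightarrow> (nat \<Rightarrow> nat) \<Rightarrow> ((nat \<Rightarrow> 'a) \<Rightarrow> 'k::zero) \<Rightarrow> (nat \<Rightarrow> 'a) \<Rightarrow> 'k" where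
  "permute_coords T p \<pi> f =
     (\<lambda>x. if x \<in> topspace (power_top T p) then f (\<lambda>i\<in>{..<p}. x (\<pi> i)) else 0)"

text \<open>\<open>coboundary T p\<close> maps functions on \<open>X\<^sup>p\<close> to functions on \<open>X\<^sup>p\<^sup>+\<^sup>1\<close>, whose points are
  \<open>(x\<^sub>0, \<dots>, x\<^sub>p)\<close>.\<close>

definition omit_coord :: "nat \<Rightarrow> nat \<Rightarrow> (nat \<Rightarrow> 'a) \<Rightarrow> nat \<Rightarrow> 'a" where
  "omit_coord p j x = (\<lambda>i\<in>{..<p}. if i < j then x i else x (Suc i))"

definition coboundary ::
  "'a topology \<Rightarrow> nat \<Rightarrow> ((nat \<Rightarrow> 'a) \<Rightarrow> 'k::comm_ring_1) \<Rightarrow> (nat \<Rightarrow> 'a) \<Rightarrow> 'k" where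
  "coboundary T p f =
     (\<lambda>x. if x \<in> topspace (power_top T (Suc p))
          then (\<Sum>j\<le>p. (- 1) ^ j * f (omit_coord p j x)) else 0)"

definition equivariant_strong_lifting_family ::
  "'a topology \<Rightarrow> ('g::group_add \<Rightarrow> 'a \<Rightarrow> 'a) \<Rightarrow> (nat \<Rightarrow> (nat \<Rightarrow> 'a) measure) \<Rightarrow>
   (nat \<Rightarrow> ((nat \<Rightarrow> 'a) \<Rightarrow> 'k::real_normed_field) set \<Rightarrow> (nat \<Rightarrow> 'a) \<Rightarrow> 'k) \<Rightarrow> bool" where
  "equivariant_strong_lifting_family T act M \<Lambda> \<longleftrightarrow>
     (\<forall>p\<ge>1. strong_linear_lifting (power_top T p) (M p) (\<Lambda> p) \<and>
        (\<forall>s. \<forall>f\<in>bounded_measurable (power_top T p) (M p).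
           \<Lambda> p (Linf_class (power_top T p) (M p) (translate T act p s f)) =
             translate T act p s (\<Lambda> p (Linf_class (power_top T p) (M p) f))))"

definition intertwines_coboundary ::
  "'a topology \<Rightarrow> (nat \<Rightarrow> (nat \<Rightarrow> 'a) measure) \<Rightarrow>
   (nat \<Rightarrow> ((nat \<Rightarrow> 'a) \<Rightarrow> 'k::real_normed_field) set \<Rightarrow> (nat \<Rightarrow> 'a) \<Rightarrow> 'k) \<Rightarrow> bool" where
  "intertwines_coboundary T M \<Lambda> \<longleftrightarrow>
     (\<forall>p\<ge>1. \<forall>f\<in>bounded_measurable (power_top T p) (M p).
        \<Lambda> (Suc p) (Linf_class (power_top T (Suc p)) (M (Suc p)) (coboundary T p f)) =
          coboundary T p (\<Lambda> p (Linf_class (power_top T p) (M p) f)))"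

definition commutes_with_permutations ::
  "'a topology \<Rightarrow> (nat \<Rightarrow> (nat \<Rightarrow> 'a) measure) \<Rightarrow>
   (nat \<Rightarrow> ((nat \<Rightarrow> 'a) \<Rightarrow> 'k::real_normed_field) set \<Rightarrow> (nat \<Rightarrow> 'a) \<Rightarrow> 'k) \<Rightarrow> bool" where
  "commutes_with_permutations T M \<Lambda> \<longleftrightarrow>
     (\<forall>p\<ge>1. \<forall>\<pi>. \<pi> permutes {..<p} \<longrightarrow> (\<forall>f\<in>bounded_measurable (power_top T p) (M p).
        \<Lambda> p (Linf_class (power_top T p) (M p) (permute_coords T p \<pi> f)) =
          permute_coords T p \<pi> (\<Lambda> p (Linf_class (power_top T p) (M p) f))))"

end

theory Submission
  imports Defs "HOL-Probability.Probability" "HOL-Analysis.Function_Metric"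
begin

text \<open>Let \<open>\<kappa>\<^sub>n(y)\<close> be a mixture of the uniform distributions on chart cubes of size about \<open>1/n\<close> around
  \<open>y\<close>, and let \<open>K\<^sub>i\<^sub>,\<^sub>n(x)\<close> be the average over \<open>g\<close>, with weight \<open>\<mu>\<^sub>i(g, x)\<close>, of the image of
  \<open>\<kappa>\<^sub>n(g\<^sup>-\<^sup>1 x)\<close> under \<open>g\<close>. Since \<open>g\<close> is \<open>C\<^sup>1\<close>, hence locally Lipschitz, most of \<open>K\<^sub>i\<^sub>,\<^sub>n(x)\<close> is dominated by a
  constant (not depending on \<open>n\<close>) times the uniform distribution on a cube of size of order \<open>1/n\<close>
  around \<open>x\<close>; no Jacobian and no lower bound on the image of a cube is needed. By the Lebesgue
  density theorem, the integrals of \<open>f\<close> against \<open>K\<^sub>i\<^sub>,\<^sub>n(x\<^sub>1) \<otimes> \<dots> \<otimes> K\<^sub>i\<^sub>,\<^sub>n(x\<^sub>p)\<close> converge to \<open>f(x)\<close> as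
  \<open>n \<rightarrow> \<infinity>\<close> for almost all \<open>x\<close>, and for every \<open>x\<close> if \<open>f\<close> is continuous. The translate of
  \<open>K\<^sub>i\<^sub>,\<^sub>n(x)\<close> by \<open>s\<close> and \<open>K\<^sub>i\<^sub>,\<^sub>n(s x)\<close> differ only in the weights, which agree in the limit over \<open>i\<close>. A
  cluster point of the integrals, taken by Tychonoff's theorem for all \<open>p\<close>, \<open>f\<close> and \<open>x\<close> at once, is therefore
  an equivariant strong lifting. Because the kernels are products of one kernel on \<open>X\<close>, it
  commutes with every map that permutes or omits coordinates.\<close>

section \<open>Cubes and Lebesgue density in \<open>\<real>\<^sup>n\<close>\<close>

text \<open>The weight \<open>\<mu> i g x\<close> need not have compact support in \<open>g\<close>,
  so no single Lipschitz constant serves all \<open>g\<close>. Domination by cubes therefore holds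
  only after a small part of the mass is cut off (\<open>Kw_concentration\<close>), with constants
  that depend on \<open>i\<close> and \<open>x\<close>. This dictates the order of the limits:
  \<open>n\<close> before \<open>i\<close>. All factors of a product kernel share the same
  \<open>n\<close>. The dominating product of cubes is then a cube of one size, and the ordinary
  density theorem applies; unequal sizes would call for the strong one. An omitted coordinate is
  integrated against a probability measure and disappears. \<open>X\<close> may fail to be second
  countable. Hence null means locally null, the powers carry the product sigma-algebra of
  \<open>BX\<close>, and every statement on Lebesgue measurable sets passes through a product chart,
  where rational cubes give countable covers. Measurability of the limit in \<open>x\<close> comes
  from its agreement with \<open>f\<close> off a locally null set, not from measurability of the
  kernels.\<close>

abbreviation leb :: "nat \<Rightarrow> (nat \<Rightarrow> real) measure" where
  "leb N \<equiv> Pi\<^sub>M {..<N} (\<lambda>_. lborel)"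

definition cube :: "nat \<Rightarrow> (nat \<Rightarrow> real) \<Rightarrow> real \<Rightarrow> (nat \<Rightarrow> real) set" where
  "cube N x r = Pi\<^sub>E {..<N} (\<lambda>i. {x i - r <..< x i + r})"

interpretation lborel_prod: product_sigma_finite "\<lambda>_::nat. lborel :: real measure" ..

lemma mem_cube: "u \<in> cube N x r \<longleftrightarrow> u \<in> extensional {..<N} \<and> (\<forall>i<N. \<bar>u i - x i\<bar> < r)"
  by (auto simp: cube_def PiE_iff abs_less_iff; force)

lemma space_leb: "space (leb N) = extensional {..<N}"
  by (auto simp: space_PiM PiE_def)

lemma topspace_Rn: "topspace (Rn N) = extensional {..<N}"
  by (auto simp: Rn_def PiE_def)

lemma cube_subset: "cube N x r \<subseteq> extensional {..<N}"
  by (auto simp: mem_cube)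

lemma cube_mono: "r \<le> s \<Longrightarrow> cube N x r \<subseteq> cube N x s"
  by (force simp: mem_cube)

lemma sets_cube [measurable, simp]: "cube N x r \<in> sets (leb N)"
  unfolding cube_def by (intro sets_PiM_I_finite) auto

lemma emeasure_cube: "r \<ge> 0 \<Longrightarrow> emeasure (leb N) (cube N x r) = ennreal ((2 * r) ^ N)"
  unfolding cube_def by (subst lborel_prod.emeasure_PiM) (auto simp: ennreal_power)

lemma center_in_cube: "u \<in> extensional {..<N} \<Longrightarrow> r > 0 \<Longrightarrow> u \<in> cube N u r"
  by (auto simp: mem_cube)

lemma openin_Rn:
  "openin (Rn N) U \<longleftrightarrow> U \<subseteq> extensional {..<N} \<and> (\<forall>u\<in>U. \<exists>r>0. cube N u r \<subseteq> U)"
proof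
  assume U: "openin (Rn N) U"
  have sub: "U \<subseteq> extensional {..<N}" using openin_subset[OF U] by (simp add: topspace_Rn)
  moreover have "\<exists>r>0. cube N u r \<subseteq> U" if "u \<in> U" for u
  proof -
    have "\<exists>A. finite {i \<in> {..<N}. A i \<noteq> topspace euclideanreal} \<and>
        (\<forall>i\<in>{..<N}. openin euclideanreal (A i)) \<and> u \<in> Pi\<^sub>E {..<N} A \<and> Pi\<^sub>E {..<N} A \<subseteq> U"
      by (rule bspec[OF U[unfolded Rn_def openin_product_topology_alt] that])
    then obtain A where A: "\<forall>i\<in>{..<N}. openin euclideanreal (A i)" "u \<in> Pi\<^sub>E {..<N} A" "Pi\<^sub>E {..<N} A \<subseteq> U"
      by (elim exE conjE)
    have "\<forall>i\<in>{..<N}. \<exists>r>0. \<forall>y. \<bar>y - u i\<bar> < r \<longrightarrow> y \<in> A i"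
      using A(1,2) by (auto simp: open_dist dist_real_def PiE_iff)
    then obtain r where r: "\<And>i. i < N \<Longrightarrow> r i > 0 \<and> (\<forall>y. \<bar>y - u i\<bar> < r i \<longrightarrow> y \<in> A i)"
      by (metis lessThan_iff)
    \<comment> \<open>The inserted 1 keeps the minimum defined when \<open>N\<close> is 0; the
      device recurs below.\<close>
    define m where "m = Min (insert 1 (r ` {..<N}))"
    have "m > 0" unfolding m_def by (subst Min_gr_iff) (auto simp: r)
    have le: "m \<le> r i" if "i < N" for i unfolding m_def using that by (intro Min_le) auto
    have "cube N u m \<subseteq> Pi\<^sub>E {..<N} A"
    proof
      fix w assume w: "w \<in> cube N u m"
      have "w i \<in> A i" if "i < N" for i
      proof -
        have "\<bar>w i - u i\<bar> < r i" using w that le[OF that] by (auto simp: mem_cube)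
        then show ?thesis using r[OF that] by blast
      qed
      then show "w \<in> Pi\<^sub>E {..<N} A" using w by (auto simp: mem_cube PiE_iff)
    qed
    with A(3) \<open>m > 0\<close> show ?thesis by blast
  qed
  ultimately show "U \<subseteq> extensional {..<N} \<and> (\<forall>u\<in>U. \<exists>r>0. cube N u r \<subseteq> U)" by blast
next
  assume U: "U \<subseteq> extensional {..<N} \<and> (\<forall>u\<in>U. \<exists>r>0. cube N u r \<subseteq> U)"
  show "openin (Rn N) U" unfolding Rn_def openin_product_topology_alt
  proof
    fix u assume "u \<in> U"
    then obtain r where r: "r > 0" "cube N u r \<subseteq> U" using U by blast
    then show "\<exists>A. finite {i \<in> {..<N}. A i \<noteq> topspace euclideanreal} \<and>
        (\<forall>i\<in>{..<N}. openin euclideanreal (A i)) \<and> u \<in> Pi\<^sub>E {..<N} A \<and> Pi\<^sub>E {..<N} A \<subseteq> U"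
      using U \<open>u \<in> U\<close> by (intro exI[of _ "\<lambda>i. {u i - r <..< u i + r}"])
        (auto simp: cube_def PiE_iff)
  qed
qed

lemma openin_cube [simp]: "openin (Rn N) (cube N x r)"
  unfolding openin_Rn
proof (intro conjI ballI cube_subset)
  fix u assume u: "u \<in> cube N x r"
  define m where "m = Min (insert 1 ((\<lambda>i. r - \<bar>u i - x i\<bar>) ` {..<N}))"
  have "m > 0" unfolding m_def using u by (subst Min_gr_iff) (auto simp: mem_cube)
  moreover have "cube N u m \<subseteq> cube N x r"
  proof
    fix w assume w: "w \<in> cube N u m"
    have "\<bar>w i - x i\<bar> < r" if "i < N" for i
    proof -
      have "\<bar>w i - u i\<bar> < m" using w that by (simp add: mem_cube)
      moreover have "m \<le> r - \<bar>u i - x i\<bar>" unfolding m_def using that by (intro Min_le) auto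
      ultimately show ?thesis by linarith
    qed
    then show "w \<in> cube N x r" using w by (simp add: mem_cube)
  qed
  ultimately show "\<exists>m>0. cube N u m \<subseteq> cube N x r" by blast
qed

definition ratcubes :: "nat \<Rightarrow> ((nat \<Rightarrow> real) \<times> real) set" where
  "ratcubes N = (Pi\<^sub>E {..<N} (\<lambda>_. \<rat>)) \<times> (\<rat> \<inter> {0<..})"

lemma countable_ratcubes: "countable (ratcubes N)"
  unfolding ratcubes_def
  by (intro countable_SIGMA countable_PiE countable_subset[OF _ countable_rat]) (auto simp: countable_rat)

text \<open>Lets an arbitrary cube be replaced by a rational one at the cost of a bounded factor in
  volume, so that uncountable covers become countable. The centre moves by less than
  \<open>R / 2\<close>, hence a radius just above \<open>3 / 2 * R\<close> suffices.\<close>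

lemma ratcube_between:
  assumes "u \<in> extensional {..<N}" "R > 0"
  shows "\<exists>q \<rho>. (q, \<rho>) \<in> ratcubes N \<and> cube N u R \<subseteq> cube N q \<rho> \<and> cube N q \<rho> \<subseteq> cube N u (3 * R) \<and> \<rho> \<le> 2 * R"
proof -
  have "\<forall>i. \<exists>a\<in>\<rat>. u i < a \<and> a < u i + R / 2" using Rats_dense_in_real[of "u _" "u _ + R/2"] assms(2) by auto
  then obtain a where a: "\<And>i. a i \<in> \<rat>" "\<And>i. u i < a i" "\<And>i. a i < u i + R / 2" by metis
  obtain \<rho> where \<rho>: "\<rho> \<in> \<rat>" "3/2*R < \<rho>" "\<rho> < 2*R"
    using Rats_dense_in_real[of "3/2*R" "2*R"] assms(2) by auto
  have d: "\<bar>u i - a i\<bar> < R/2" for i using a(2,3)[of i] by auto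
  show ?thesis
  proof (intro exI conjI)
    show "cube N u R \<subseteq> cube N (restrict a {..<N}) \<rho>"
    proof
      fix w assume w: "w \<in> cube N u R"
      have "\<bar>w i - a i\<bar> < \<rho>" if "i < N" for i
      proof -
        have "\<bar>w i - u i\<bar> < R" using w that by (simp add: mem_cube)
        with d[of i] \<rho> show ?thesis by linarith
      qed
      then show "w \<in> cube N (restrict a {..<N}) \<rho>" using w by (simp add: mem_cube)
    qed
    show "cube N (restrict a {..<N}) \<rho> \<subseteq> cube N u (3 * R)"
    proof
      fix w assume w: "w \<in> cube N (restrict a {..<N}) \<rho>"
      have "\<bar>w i - u i\<bar> < 3 * R" if "i < N" for i
      proof -
        have "\<bar>w i - a i\<bar> < \<rho>" using w that by (simp add: mem_cube)
        with d[of i] \<rho> show ?thesis by linarith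
      qed
      then show "w \<in> cube N u (3 * R)" using w by (simp add: mem_cube)
    qed
    show "(restrict a {..<N}, \<rho>) \<in> ratcubes N" using a \<rho> assms by (auto simp: ratcubes_def)
    show "\<rho> \<le> 2 * R" using \<rho> by simp
  qed
qed

lemma openin_ratcube:
  assumes "openin (Rn N) U" "u \<in> U"
  shows "\<exists>q \<rho>. (q, \<rho>) \<in> ratcubes N \<and> u \<in> cube N q \<rho> \<and> cube N q \<rho> \<subseteq> U"
proof -
  obtain r where r: "r > 0" "cube N u r \<subseteq> U" and u: "u \<in> extensional {..<N}"
    using assms unfolding openin_Rn by blast
  from ratcube_between[OF u, of "r/3"] r(1) obtain q \<rho> where
    q: "(q, \<rho>) \<in> ratcubes N" "cube N u (r/3) \<subseteq> cube N q \<rho>" "cube N q \<rho> \<subseteq> cube N u r" by auto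
  moreover have "u \<in> cube N u (r/3)" using u r by (intro center_in_cube) auto
  ultimately show ?thesis using r by blast
qed

lemma openin_sets_leb [measurable]:
  assumes "openin (Rn N) U" shows "U \<in> sets (leb N)"
proof -
  have "U = (\<Union>(q, \<rho>)\<in>{(q, \<rho>)\<in>ratcubes N. cube N q \<rho> \<subseteq> U}. cube N q \<rho>)"
  proof (intro equalityI subsetI)
    fix u assume "u \<in> U"
    from openin_ratcube[OF assms this] obtain q \<rho> where "(q, \<rho>) \<in> ratcubes N" "u \<in> cube N q \<rho>" "cube N q \<rho> \<subseteq> U" by blast
    then show "u \<in> (\<Union>(q, \<rho>)\<in>{(q, \<rho>)\<in>ratcubes N. cube N q \<rho> \<subseteq> U}. cube N q \<rho>)" by blast
  qed auto
  also have "\<dots> \<in> sets (leb N)"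
    by (rule sets.countable_UN'') (auto intro: countable_subset[OF _ countable_ratcubes[of N]])
  finally show ?thesis .
qed

text \<open>\<open>outer_regular\<close> concerns a finite measure on a Polish type. So Lebesgue
  measure on the cube is transported to \<open>nat \<Rightarrow> real\<close> by extending points
  with zeros, and the open set found there is pulled back. Cutting down to the cube makes the
  measure finite.\<close>

lemma outer_regular_leb:
  assumes E: "E \<in> sets (leb N)" "E \<subseteq> cube N z R" and "\<eta> > 0"
  shows "\<exists>U. openin (Rn N) U \<and> E \<subseteq> U \<and> U \<subseteq> cube N z R \<and> emeasure (leb N) U \<le> emeasure (leb N) E + ennreal \<eta>"
proof -
  let ?i = "\<lambda>(u::nat\<Rightarrow>real) i. if i < N then u i else 0"
  have i_meas: "?i \<in> measurable (leb N) borel"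
  proof (rule measurable_coordinatewise_then_product)
    show "(\<lambda>u. if i < N then u i else 0) \<in> borel_measurable (leb N)" for i by (cases "i < N") simp_all
  qed
  define Q where "Q = density (leb N) (indicator (cube N z R))"
  define P where "P = distr Q borel ?i"
  have iQ: "?i \<in> measurable Q borel" unfolding Q_def using i_meas by simp
  have Qe: "emeasure Q A = emeasure (leb N) (A \<inter> cube N z R)" if "A \<in> sets (leb N)" for A
    unfolding Q_def using that by (subst emeasure_density) (auto simp: nn_integral_indicator[symmetric] indicator_inter_arith mult.commute intro!: nn_integral_cong)
  have fin: "emeasure P (space P) \<noteq> \<infinity>"
  proof -
    have "emeasure P (space P) = emeasure Q (space (leb N))"
      unfolding P_def using iQ by (subst emeasure_distr) (auto simp: Q_def)
    \<comment> \<open>\<open>R\<close> may be negative, whereas \<open>emeasure_cube\<close> asks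
      for a nonnegative radius.\<close>
    also have "\<dots> \<le> emeasure (leb N) (cube N z (\<bar>R\<bar>))"
      by (subst Qe) (use cube_mono[of R "\<bar>R\<bar>" N z] in \<open>auto intro!: emeasure_mono simp del: abs_ge_self simp: subset_iff\<close>)
    also have "\<dots> < \<infinity>" by (subst emeasure_cube) auto
    finally show ?thesis by auto
  qed
  define E' where "E' = {w :: nat \<Rightarrow> real. restrict w {..<N} \<in> E}"
  have "(\<lambda>w::nat\<Rightarrow>real. restrict w {..<N}) \<in> measurable borel (leb N)"
    by (rule measurable_restrict) auto
  then have E'b: "E' \<in> sets borel" using E(1) using measurable_sets[of "\<lambda>w. restrict w {..<N}" borel "leb N" E]
    by (simp add: E'_def vimage_def)
  have iE: "?i u \<in> E' \<longleftrightarrow> u \<in> E" if "u \<in> extensional {..<N}" for u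
  proof -
    have "restrict (?i u) {..<N} = u" using that by (auto simp: extensional_def restrict_def)
    then show ?thesis by (simp only: E'_def mem_Collect_eq)
  qed
  have Pe: "emeasure P A = emeasure (leb N) (?i -` A \<inter> cube N z R)" if "A \<in> sets borel" for A
  proof -
    have m: "?i -` A \<inter> space (leb N) \<in> sets (leb N)" using i_meas that by (rule measurable_sets)
    have "emeasure P A = emeasure Q (?i -` A \<inter> space Q)" unfolding P_def using iQ that by (subst emeasure_distr) auto
    also have "\<dots> = emeasure (leb N) (?i -` A \<inter> space (leb N) \<inter> cube N z R)"
      using m by (subst Qe[symmetric]) (auto simp: Q_def)
    also have "?i -` A \<inter> space (leb N) \<inter> cube N z R = ?i -` A \<inter> cube N z R"
      using cube_subset[of N z R] by (auto simp: space_leb)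
    finally show ?thesis .
  qed
  have PE: "emeasure P E' = emeasure (leb N) E"
  proof -
    have "?i -` E' \<inter> cube N z R = E" using iE E(2) cube_subset[of N z R] by blast
    then show ?thesis by (simp add: Pe E'b)
  qed
  have "emeasure P E' = (INF U \<in> {U. E' \<subseteq> U \<and> open U}. emeasure P U)"
    by (rule outer_regular) (use fin E'b in \<open>auto simp: P_def\<close>)
  moreover have "emeasure P E' < emeasure P E' + ennreal \<eta>"
  proof -
    have "emeasure P E' \<le> emeasure P (space P)" by (rule emeasure_space)
    with fin have "emeasure P E' \<noteq> \<infinity>" by (metis infinity_ennreal_def neq_top_trans)
    then show ?thesis using \<open>\<eta> > 0\<close>
      by (cases "emeasure P E'") (auto simp: ennreal_plus[symmetric] ennreal_less_iff simp del: ennreal_plus)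
  qed
  ultimately have "(INF U \<in> {U. E' \<subseteq> U \<and> open U}. emeasure P U) < emeasure P E' + ennreal \<eta>" by simp
  then obtain U where U: "E' \<subseteq> U" "open U" "emeasure P U < emeasure P E' + ennreal \<eta>"
    by (auto simp: INF_less_iff)
  have cont: "continuous_map (Rn N) euclidean ?i"
    unfolding euclidean_product_topology[symmetric] Rn_def
    by (rule iffD2[OF continuous_map_componentwise]) (auto intro: continuous_map_product_projection)
  have "openin (Rn N) {u \<in> topspace (Rn N). ?i u \<in> U}"
    by (rule openin_continuous_map_preimage[OF cont]) (use U(2) in auto)
  then have o: "openin (Rn N) ({u \<in> topspace (Rn N). ?i u \<in> U} \<inter> cube N z R)" by (rule openin_Int) simp
  have eq: "{u \<in> topspace (Rn N). ?i u \<in> U} \<inter> cube N z R = ?i -` U \<inter> cube N z R"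
    using cube_subset[of N z R] by (auto simp: topspace_Rn)
  show ?thesis
  proof (intro exI conjI)
    show "openin (Rn N) (?i -` U \<inter> cube N z R)" using o eq by simp
    show "E \<subseteq> ?i -` U \<inter> cube N z R" using iE E(2) cube_subset[of N z R] U(1) by blast
    show "emeasure (leb N) (?i -` U \<inter> cube N z R) \<le> emeasure (leb N) E + ennreal \<eta>"
      using U(3) by (simp add: Pe[symmetric] U(2) PE)
  qed auto
qed

section \<open>Vitali covering, the maximal inequality and density points\<close>

lemma finite_Vitali_cubes:
  assumes "finite F" "\<And>q r. (q, r) \<in> F \<Longrightarrow> r > 0"
  shows "\<exists>F'\<subseteq>F. disjoint_family_on (\<lambda>(q, r). cube N q r) F' \<and>
           (\<forall>(q, r)\<in>F. \<exists>(q', r')\<in>F'. cube N q r \<subseteq> cube N q' (3 * r'))"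
  using assms
proof (induction "card F" arbitrary: F rule: less_induct)
  case less
  show ?case
  proof (cases "F = {}")
    case False
    \<comment> \<open>Greedy choice: a cube of maximal radius swallows, once tripled, every cube
      that meets it. The cubes disjoint from it form the strictly smaller family \<open>G\<close>,
      to which the induction hypothesis applies.\<close>
    define m where "m = Max (snd ` F)"
    have "m \<in> snd ` F" unfolding m_def using False less.prems by (intro Max_in) auto
    then obtain q0 where q0: "(q0, m) \<in> F" by auto
    have mx: "r \<le> m" if "(q, r) \<in> F" for q r
      unfolding m_def using that less.prems by (intro Max_ge) (auto intro: rev_image_eqI)
    define G where "G = {(q, r)\<in>F. cube N q r \<inter> cube N q0 m = {}}"
    have ne: "cube N q r \<noteq> {}" if "(q, r) \<in> F" for q r
    proof -
      have "restrict q {..<N} \<in> cube N q r" using less.prems(2)[OF that] by (auto simp: mem_cube)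
      then show ?thesis by blast
    qed
    have "G \<subset> F" using q0 ne[OF q0] by (auto simp: G_def)
    then have "card G < card F" using less.prems(1) by (rule psubset_card_mono[rotated])
    moreover have "finite G" "\<And>q r. (q, r) \<in> G \<Longrightarrow> r > 0"
      using \<open>G \<subset> F\<close> less.prems finite_subset by auto
    ultimately have "\<exists>F'\<subseteq>G. disjoint_family_on (\<lambda>(q, r). cube N q r) F' \<and>
           (\<forall>(q, r)\<in>G. \<exists>(q', r')\<in>F'. cube N q r \<subseteq> cube N q' (3 * r'))" by (rule less.hyps)
    then obtain G' where G': "G' \<subseteq> G" "disjoint_family_on (\<lambda>(q, r). cube N q r) G'"
      and G3: "\<forall>(q, r)\<in>G. \<exists>(q', r')\<in>G'. cube N q r \<subseteq> cube N q' (3 * r')"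
      by (elim exE conjE)
    show ?thesis
    proof (intro exI conjI)
      show "insert (q0, m) G' \<subseteq> F" using G'(1) \<open>G \<subset> F\<close> q0 by auto
      show "disjoint_family_on (\<lambda>(q, r). cube N q r) (insert (q0, m) G')"
        using G'(1,2) unfolding G_def disjoint_family_on_def by fast
      show "\<forall>(q, r)\<in>F. \<exists>(q', r')\<in>insert (q0, m) G'. cube N q r \<subseteq> cube N q' (3 * r')"
      proof (clarify)
        fix q r assume qr: "(q, r) \<in> F"
        show "\<exists>(q', r')\<in>insert (q0, m) G'. cube N q r \<subseteq> cube N q' (3 * r')"
        proof (cases "cube N q r \<inter> cube N q0 m = {}")
          case True
          then have "(q, r) \<in> G" using qr by (simp add: G_def)
          from bspec[OF G3 this] show ?thesis by auto
        next
          case False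
          then obtain w where w: "w \<in> cube N q r" "w \<in> cube N q0 m" by blast
          have "cube N q r \<subseteq> cube N q0 (3 * m)"
          proof
            fix u assume u: "u \<in> cube N q r"
            have "\<bar>u i - q0 i\<bar> < 3 * m" if "i < N" for i
            proof -
              have "\<bar>u i - q i\<bar> < r" "\<bar>w i - q i\<bar> < r" "\<bar>w i - q0 i\<bar> < m" "r \<le> m"
                using u w that mx[OF qr] by (auto simp: mem_cube)
              then show ?thesis by linarith
            qed
            then show "u \<in> cube N q0 (3 * m)" using u by (simp add: mem_cube)
          qed
          then show ?thesis by blast
        qed
      qed
    qed
  qed (auto simp: disjoint_family_on_def)
qed

text \<open>The weak-type bound for the maximal function of the indicator of \<open>E\<close>: over
  a disjoint subfamily the portions of \<open>E\<close> add up to at most \<open>E\<close>, and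
  tripling costs \<open>3 ^ N\<close> in volume.\<close>

lemma maximal_inequality_finite:
  assumes "finite F" "\<And>q r. (q, r) \<in> F \<Longrightarrow> r > 0" "E \<in> sets (leb N)" "a > 0"
    and "\<And>q r. (q, r) \<in> F \<Longrightarrow> ennreal (a * (2 * r) ^ N) \<le> emeasure (leb N) (cube N q r \<inter> E)"
  shows "ennreal a * emeasure (leb N) (\<Union>(q, r)\<in>F. cube N q r) \<le> ennreal (3 ^ N) * emeasure (leb N) E"
proof -
  have "\<exists>F'\<subseteq>F. disjoint_family_on (\<lambda>(q, r). cube N q r) F' \<and>
           (\<forall>(q, r)\<in>F. \<exists>(q', r')\<in>F'. cube N q r \<subseteq> cube N q' (3 * r'))"
    by (rule finite_Vitali_cubes[OF assms(1)]) (rule assms(2))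
  then obtain F' where F': "F' \<subseteq> F" "disjoint_family_on (\<lambda>(q, r). cube N q r) F'"
    and F3: "\<forall>(q, r)\<in>F. \<exists>(q', r')\<in>F'. cube N q r \<subseteq> cube N q' (3 * r')"
    by (elim exE conjE)
  have fin: "finite F'" using F'(1) assms(1) by (rule finite_subset)
  have "(\<Union>(q, r)\<in>F. cube N q r) \<subseteq> (\<Union>(q, r)\<in>F'. cube N q (3 * r))"
  proof clarify
    fix w q r assume "(q, r) \<in> F" "w \<in> cube N q r"
    with bspec[OF F3 this(1)] show "w \<in> (\<Union>(q, r)\<in>F'. cube N q (3 * r))" by auto
  qed
  then have "emeasure (leb N) (\<Union>(q, r)\<in>F. cube N q r) \<le> emeasure (leb N) (\<Union>(q, r)\<in>F'. cube N q (3 * r))"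
    using fin by (intro emeasure_mono sets.finite_UN) auto
  also have "\<dots> \<le> (\<Sum>(q, r)\<in>F'. emeasure (leb N) (cube N q (3 * r)))"
    using emeasure_subadditive_finite[OF fin, of "\<lambda>(q, r). cube N q (3 * r)" "leb N"] by (simp add: split_def image_subset_iff)
  also have "\<dots> = (\<Sum>(q, r)\<in>F'. ennreal (3 ^ N) * ennreal ((2 * r) ^ N))"
  proof (rule sum.cong, simp, clarify)
    fix q r assume "(q, r) \<in> F'"
    then have "r > 0" using assms(2) F'(1) by auto
    have "(2 * (3 * r)) ^ N = 3 ^ N * (2 * r) ^ N" unfolding power_mult_distrib[symmetric] by (simp add: mult_ac)
    then show "emeasure (leb N) (cube N q (3 * r)) = ennreal (3 ^ N) * ennreal ((2 * r) ^ N)"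
      using \<open>r > 0\<close> by (simp add: emeasure_cube ennreal_mult mult.assoc)
  qed
  finally have "ennreal a * emeasure (leb N) (\<Union>(q, r)\<in>F. cube N q r) \<le>
      ennreal a * (\<Sum>(q, r)\<in>F'. ennreal (3 ^ N) * ennreal ((2 * r) ^ N))" by (rule mult_left_mono) simp
  also have "\<dots> = ennreal (3 ^ N) * (\<Sum>(q, r)\<in>F'. ennreal (a * (2 * r) ^ N))"
    unfolding sum_distrib_left
  proof (rule sum.cong, simp, clarify)
    fix q r assume "(q, r) \<in> F'"
    then have "r > 0" using assms(2) F'(1) by auto
    then show "ennreal a * (ennreal (3 ^ N) * ennreal ((2 * r) ^ N)) = ennreal (3 ^ N) * ennreal (a * (2 * r) ^ N)"
      using \<open>a > 0\<close> by (simp add: ennreal_mult mult_ac)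
  qed
  also have "\<dots> \<le> ennreal (3 ^ N) * (\<Sum>(q, r)\<in>F'. emeasure (leb N) (cube N q r \<inter> E))"
    using assms(5) F'(1) by (intro mult_left_mono sum_mono) auto
  also have "(\<Sum>(q, r)\<in>F'. emeasure (leb N) (cube N q r \<inter> E)) = emeasure (leb N) (\<Union>(q, r)\<in>F'. cube N q r \<inter> E)"
    using F'(2) fin assms(3) sum_emeasure[of "\<lambda>(q, r). cube N q r \<inter> E" F' "leb N"]
    by (auto simp: split_def disjoint_family_on_def image_subset_iff)
  also have "\<dots> \<le> emeasure (leb N) E" using assms(3) by (intro emeasure_mono) auto
  finally show ?thesis by (simp add: mult_left_mono)
qed

lemma maximal_inequality:
  assumes "countable C" "\<And>q r. (q, r) \<in> C \<Longrightarrow> r > 0" "E \<in> sets (leb N)" "a > 0"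
    and "\<And>q r. (q, r) \<in> C \<Longrightarrow> ennreal (a * (2 * r) ^ N) \<le> emeasure (leb N) (cube N q r \<inter> E)"
  shows "ennreal a * emeasure (leb N) (\<Union>(q, r)\<in>C. cube N q r) \<le> ennreal (3 ^ N) * emeasure (leb N) E"
proof (cases "C = {}")
  case False
  define f where "f = from_nat_into C"
  have f: "range f = C" unfolding f_def using False assms(1) by (simp add: range_from_nat_into)
  define A where "A n = (\<Union>(q, r)\<in>f ` {..n}. cube N q r)" for n
  have A: "A n \<in> sets (leb N)" for n unfolding A_def by (intro sets.finite_UN) auto
  have inc: "incseq A" unfolding A_def incseq_def by (intro allI impI UN_mono image_mono) auto
  have U: "(\<Union>(q, r)\<in>C. cube N q r) = (\<Union>n. A n)" 
  proof (intro equalityI subsetI)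
    fix w assume "w \<in> (\<Union>(q, r)\<in>C. cube N q r)"
    then obtain p where p: "p \<in> C" "w \<in> (case p of (q, r) \<Rightarrow> cube N q r)" by (rule UN_E)
    then obtain n where "p = f n" using f by blast
    with p have "w \<in> A n" unfolding A_def by (intro UN_I[of p]) auto
    then show "w \<in> (\<Union>n. A n)" by blast
  next
    fix w assume "w \<in> (\<Union>n. A n)"
    then obtain n where "w \<in> A n" by (rule UN_E)
    then obtain p where "p \<in> f ` {..n}" "w \<in> (case p of (q, r) \<Rightarrow> cube N q r)" unfolding A_def by (rule UN_E)
    moreover have "f ` {..n} \<subseteq> C" using f by blast
    ultimately show "w \<in> (\<Union>(q, r)\<in>C. cube N q r)" by (intro UN_I[of p]) auto
  qed
  have "ennreal a * emeasure (leb N) (A n) \<le> ennreal (3 ^ N) * emeasure (leb N) E" for n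
    unfolding A_def using f assms by (intro maximal_inequality_finite) auto
  then have "(SUP n. ennreal a * emeasure (leb N) (A n)) \<le> ennreal (3 ^ N) * emeasure (leb N) E"
    by (intro SUP_least) auto
  also have "(SUP n. ennreal a * emeasure (leb N) (A n)) = ennreal a * emeasure (leb N) (\<Union>n. A n)"
    unfolding SUP_mult_left_ennreal[symmetric] using A inc by (subst SUP_emeasure_incseq) auto
  finally show ?thesis unfolding U .
qed simp

lemma null_cover_from_small_covers:
  assumes "\<And>\<eta>::real. \<eta> > 0 \<Longrightarrow> \<exists>V\<in>sets M. B \<subseteq> V \<and> emeasure M V \<le> ennreal \<eta>"
  shows "\<exists>Z\<in>null_sets M. B \<subseteq> Z"
proof -
  have "\<forall>n::nat. \<exists>V\<in>sets M. B \<subseteq> V \<and> emeasure M V \<le> ennreal (1 / Suc n)" using assms by simp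
  then obtain V where V: "\<And>n. V n \<in> sets M" "\<And>n. B \<subseteq> V n" "\<And>n. emeasure M (V n) \<le> ennreal (1 / Suc n)" by metis
  have m: "(\<Inter>n. V n) \<in> sets M" using V(1) by auto
  have "emeasure M (\<Inter>n. V n) \<le> ennreal \<eta>" if eta: "\<eta> > 0" for \<eta> :: real
  proof -
    obtain n where n: "1 / Suc n < \<eta>" by (rule nat_approx_posE[OF eta])
    have "emeasure M (\<Inter>n. V n) \<le> emeasure M (V n)" using V(1) by (intro emeasure_mono) auto
    also have "\<dots> \<le> ennreal (1 / Suc n)" by (rule V)
    also have "\<dots> \<le> ennreal \<eta>" using n by (intro ennreal_leI) simp
    finally show ?thesis .
  qed
  note small = this
  have "emeasure M (\<Inter>n. V n) \<le> 0"
  proof (rule ennreal_le_epsilon)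
    fix e :: real assume "0 < e"
    from small[OF this] show "emeasure M (\<Inter>n. V n) \<le> 0 + ennreal e" by (simp only: add_0)
  qed
  then show ?thesis using V(2) m by (intro bexI[of _ "\<Inter>n. V n"]) (auto simp: null_sets_def)
qed

text \<open>Take an open \<open>U\<close> around \<open>E\<close> with \<open>U - E\<close> small.
  At a point of \<open>Bad a\<close> there are arbitrarily small cubes inside \<open>U\<close> in
  which \<open>U - E\<close> has density above \<open>a\<close>. So \<open>Bad a\<close> is covered
  by cubes to which the maximal inequality for \<open>U - E\<close> applies, and its outer measure
  is as small as desired.\<close>

lemma density_point_bounded:
  assumes E: "E \<in> sets (leb N)" "E \<subseteq> cube N z R"
  shows "\<exists>Z\<in>null_sets (leb N). \<forall>x\<in>E - Z. \<forall>a>0. \<exists>r0>0. \<forall>r. 0 < r \<and> r < r0 \<longrightarrow>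
           emeasure (leb N) (cube N x r - E) \<le> ennreal (a * (2 * r) ^ N)"
proof -
  define Bad where "Bad a = {x\<in>E. \<forall>r0>0. \<exists>r. 0 < r \<and> r < r0 \<and>
     ennreal (a * (2 * r) ^ N) < emeasure (leb N) (cube N x r - E)}" for a :: real
  have "\<exists>Z\<in>null_sets (leb N). Bad a \<subseteq> Z" if "a > 0" for a
  proof (rule null_cover_from_small_covers)
    fix \<eta> :: real assume "\<eta> > 0"
    \<comment> \<open>A rational cube of radius at most \<open>2 * r\<close> has at most
      \<open>2 ^ N\<close> times the volume of the cube it replaces, so the density threshold drops
      from \<open>a\<close> to \<open>b\<close>.\<close>
    define b where "b = a / 2 ^ N"
    have "b > 0" using that by (simp add: b_def)
    \<comment> \<open>Solves \<open>3 ^ N * \<eta>' = b * \<eta>\<close>, the form in which the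
      maximal inequality returns the bound.\<close>
    define \<eta>' where "\<eta>' = \<eta> * b / 3 ^ N"
    have "\<eta>' > 0" using \<open>\<eta> > 0\<close> \<open>b > 0\<close> by (simp add: \<eta>'_def)
    from outer_regular_leb[OF E this] obtain U where U: "openin (Rn N) U" "E \<subseteq> U" "U \<subseteq> cube N z R"
      "emeasure (leb N) U \<le> emeasure (leb N) E + ennreal \<eta>'" by blast
    have Um: "U \<in> sets (leb N)" using U(1) by (rule openin_sets_leb)
    have "emeasure (leb N) E \<le> emeasure (leb N) (cube N z \<bar>R\<bar>)"
      using E(2) cube_mono[of R "\<bar>R\<bar>" N z] by (intro emeasure_mono) (auto simp: subset_iff)
    then have fin: "emeasure (leb N) E \<noteq> \<infinity>"
      by (metis abs_ge_zero emeasure_cube ennreal_neq_top infinity_ennreal_def neq_top_trans)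
    have UE: "emeasure (leb N) (U - E) \<le> ennreal \<eta>'"
    proof -
      have "emeasure (leb N) (U - E) = emeasure (leb N) U - emeasure (leb N) E"
        using fin U(2) Um E(1) by (intro emeasure_Diff) auto
      also have "\<dots> \<le> (emeasure (leb N) E + ennreal \<eta>') - emeasure (leb N) E" using U(4) by (rule ennreal_minus_mono) simp
      also have "\<dots> = ennreal \<eta>'" using fin by simp
      finally show ?thesis .
    qed
    define C where "C = {(q, \<rho>)\<in>ratcubes N. cube N q \<rho> \<subseteq> U \<and>
       ennreal (b * (2 * \<rho>) ^ N) \<le> emeasure (leb N) (cube N q \<rho> \<inter> (U - E))}"
    have cC: "countable C" unfolding C_def by (rule countable_subset[OF _ countable_ratcubes[of N]]) auto
    have Vm: "(\<Union>(q, r)\<in>C. cube N q r) \<in> sets (leb N)" using cC by (intro sets.countable_UN'') auto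
    have "Bad a \<subseteq> (\<Union>(q, r)\<in>C. cube N q r)"
    proof
      fix x assume x: "x \<in> Bad a"
      then have "x \<in> U" using U(2) by (auto simp: Bad_def)
      then obtain r1 where r1: "r1 > 0" "cube N x r1 \<subseteq> U" using U(1) unfolding openin_Rn by blast
      have xe: "x \<in> extensional {..<N}" using \<open>x \<in> U\<close> U(1) unfolding openin_Rn by blast
      \<comment> \<open>The rational cube may reach out to radius \<open>3 * r\<close>, which must
        stay below \<open>r1\<close> so that it lies in \<open>U\<close>.\<close>
      obtain r where r: "0 < r" "r < r1 / 3" "ennreal (a * (2 * r) ^ N) < emeasure (leb N) (cube N x r - E)"
      proof -
        have "\<forall>r0>0. \<exists>r. 0 < r \<and> r < r0 \<and> ennreal (a * (2 * r) ^ N) < emeasure (leb N) (cube N x r - E)"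
          using x unfolding Bad_def by simp
        from this[rule_format, of "r1 / 3"] r1(1) show thesis using that by auto
      qed
      from ratcube_between[OF xe r(1)] obtain q \<rho> where q: "(q, \<rho>) \<in> ratcubes N" "cube N x r \<subseteq> cube N q \<rho>"
        "cube N q \<rho> \<subseteq> cube N x (3 * r)" "\<rho> \<le> 2 * r" by blast
      have qU: "cube N q \<rho> \<subseteq> U" using q(3) cube_mono[of "3 * r" r1 N x] r r1 by auto
      have "\<rho> > 0" using q(1) by (simp add: ratcubes_def)
      have "b * (2 * \<rho>) ^ N = a * \<rho> ^ N" by (simp add: b_def power_mult_distrib)
      also have "\<dots> \<le> a * (2 * r) ^ N" using q(4) \<open>\<rho> > 0\<close> that by (intro mult_left_mono power_mono) auto
      finally have "ennreal (b * (2 * \<rho>) ^ N) \<le> ennreal (a * (2 * r) ^ N)" by (rule ennreal_leI)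
      also have "\<dots> \<le> emeasure (leb N) (cube N x r - E)" using r(3) by simp
      also have "\<dots> \<le> emeasure (leb N) (cube N q \<rho> \<inter> (U - E))"
        using q(2) qU Um E(1) by (intro emeasure_mono) auto
      finally have "(q, \<rho>) \<in> C" using q(1) qU by (simp add: C_def)
      moreover have "x \<in> cube N q \<rho>" using center_in_cube[OF xe r(1)] q(2) by blast
      ultimately show "x \<in> (\<Union>(q, r)\<in>C. cube N q r)" by blast
    qed
    moreover have "emeasure (leb N) (\<Union>(q, r)\<in>C. cube N q r) \<le> ennreal \<eta>"
    proof -
      have "ennreal b * emeasure (leb N) (\<Union>(q, r)\<in>C. cube N q r) \<le> ennreal (3 ^ N) * emeasure (leb N) (U - E)"
        using cC \<open>b > 0\<close> E(1) Um by (intro maximal_inequality) (auto simp: C_def ratcubes_def)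
      also have "\<dots> \<le> ennreal (3 ^ N) * ennreal \<eta>'" using UE by (intro mult_left_mono) auto
      also have "\<dots> = ennreal b * ennreal \<eta>" using \<open>\<eta> > 0\<close> \<open>b > 0\<close> \<open>\<eta>' > 0\<close>
        by (simp add: ennreal_mult[symmetric] \<eta>'_def mult_ac)
      finally show ?thesis using \<open>b > 0\<close> by (subst (asm) ennreal_mult_le_mult_iff) auto
    qed
    ultimately show "\<exists>V\<in>sets (leb N). Bad a \<subseteq> V \<and> emeasure (leb N) V \<le> ennreal \<eta>" using Vm by blast
  qed
  then have "\<forall>n::nat. \<exists>Z\<in>null_sets (leb N). Bad (1 / Suc n) \<subseteq> Z" by simp
  then obtain Z where Z: "\<And>n::nat. Z n \<in> null_sets (leb N)" "\<And>n::nat. Bad (1 / Suc n) \<subseteq> Z n" by metis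
  show ?thesis
  proof (intro bexI[of _ "\<Union>n. Z n"] ballI allI impI)
    fix x and a :: real assume x: "x \<in> E - (\<Union>n. Z n)" and "a > 0"
    obtain n :: nat where n: "1 / Suc n < a" by (rule nat_approx_posE[OF \<open>a > 0\<close>])
    have "x \<notin> Bad (1 / Suc n)" using x Z(2) by blast
    then have "\<not> (\<forall>r0>0. \<exists>r. 0 < r \<and> r < r0 \<and> ennreal (1 / Suc n * (2 * r) ^ N) < emeasure (leb N) (cube N x r - E))"
      using x unfolding Bad_def by blast
    then obtain r0 where r0: "r0 > 0" "\<not> (\<exists>r. 0 < r \<and> r < r0 \<and> ennreal (1 / Suc n * (2 * r) ^ N) < emeasure (leb N) (cube N x r - E))"
      by blast
    show "\<exists>r0>0. \<forall>r. 0 < r \<and> r < r0 \<longrightarrow> emeasure (leb N) (cube N x r - E) \<le> ennreal (a * (2 * r) ^ N)"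
    proof (intro exI[of _ r0] conjI allI impI r0(1))
      fix r assume r: "0 < r \<and> r < r0"
      have "ennreal (1 / Suc n * (2 * r) ^ N) \<le> ennreal (a * (2 * r) ^ N)"
        using n r by (intro ennreal_leI mult_right_mono) auto
      moreover have "emeasure (leb N) (cube N x r - E) \<le> ennreal (1 / Suc n * (2 * r) ^ N)"
        using r0(2) r not_le by blast
      ultimately show "emeasure (leb N) (cube N x r - E) \<le> ennreal (a * (2 * r) ^ N)" by order
    qed
  qed (use Z(1) in auto)
qed

lemma extensional_in_nat_cube: "x \<in> extensional {..<N} \<Longrightarrow> \<exists>n::nat. x \<in> cube N (\<lambda>_. 0) n"
proof -
  assume x: "x \<in> extensional {..<N}"
  obtain n :: nat where "Max (insert 0 ((\<lambda>i. \<bar>x i\<bar>) ` {..<N})) < n" using reals_Archimedean2 by blast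
  then have "\<bar>x i\<bar> < n" if "i < N" for i using that by (auto simp: Max_less_iff)
  then show ?thesis using x by (auto simp: mem_cube)
qed

text \<open>The case in which no null set is excluded. It yields convergence at every point for open
  boxes, hence strongness of the lifting.\<close>

lemma density_at_interior_point:
  assumes S: "openin (Rn N) S" "u \<in> S"
  shows "\<exists>r0>0. \<forall>r. 0 < r \<and> r < r0 \<longrightarrow> emeasure (leb N) (cube N u r - S) \<le> ennreal (a * (2 * r) ^ N)"
proof -
  obtain r0 where r0: "r0 > 0" "cube N u r0 \<subseteq> S" using S unfolding openin_Rn by blast
  have "emeasure (leb N) (cube N u r - S) = 0" if "r < r0" for r
  proof -
    have e: "cube N u r - S = {}" using cube_mono[of r r0 N u] that r0(2) by auto
    show ?thesis unfolding e by simp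
  qed
  then show ?thesis using r0(1) by (intro exI[of _ r0] conjI allI impI) simp_all
qed

text \<open>Density is measured against the Borel part \<open>S\<close> of \<open>E\<close>, because
  the kernels are later evaluated on sets that correspond to members of \<open>leb N\<close>.
  Unbounded sets are exhausted by cubes of integer radius.\<close>

lemma Lebesgue_density:
  assumes E: "E \<in> sets (Rn_lebesgue N)"
  shows "\<exists>S\<in>sets (leb N). \<exists>Z\<in>null_sets (leb N). S \<subseteq> E \<and> E - S \<subseteq> Z \<and>
           (\<forall>x\<in>E - Z. \<forall>a>0. \<exists>r0>0. \<forall>r. 0 < r \<and> r < r0 \<longrightarrow>
             emeasure (leb N) (cube N x r - S) \<le> ennreal (a * (2 * r) ^ N))"
proof -
  obtain S K K' where S: "E = S \<union> K" "K \<subseteq> K'" "K' \<in> null_sets (leb N)" "S \<in> sets (leb N)"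
    using E unfolding Rn_lebesgue_def by (rule sets_completionE)
  have "\<forall>n::nat. \<exists>Z\<in>null_sets (leb N). \<forall>x\<in>S \<inter> cube N (\<lambda>_. 0) n - Z. \<forall>a>0. \<exists>r0>0. \<forall>r. 0 < r \<and> r < r0 \<longrightarrow>
           emeasure (leb N) (cube N x r - S \<inter> cube N (\<lambda>_. 0) n) \<le> ennreal (a * (2 * r) ^ N)"
    using S(4) by (intro allI density_point_bounded[where z="\<lambda>_. 0" and R="real _"]) auto
  then obtain Z where Z: "\<And>n::nat. Z n \<in> null_sets (leb N)"
    "\<And>n x a. x\<in>S \<inter> cube N (\<lambda>_. 0) (real n) - Z n \<Longrightarrow> a > 0 \<Longrightarrow> \<exists>r0>0. \<forall>r. 0 < r \<and> r < r0 \<longrightarrow>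
           emeasure (leb N) (cube N x r - S \<inter> cube N (\<lambda>_. 0) n) \<le> ennreal (a * (2 * r) ^ N)" by metis
  show ?thesis
  proof (rule bexI[of _ S], rule bexI[of _ "K' \<union> (\<Union>n. Z n)"], intro conjI ballI allI impI)
    fix x and a :: real assume x: "x \<in> E - (K' \<union> (\<Union>n. Z n))" and "a > 0"
    then have xS: "x \<in> S" using S(1,2) by blast
    then have "x \<in> extensional {..<N}" using sets.sets_into_space[OF S(4)] by (auto simp: space_leb)
    then obtain n :: nat where "x \<in> cube N (\<lambda>_. 0) n" using extensional_in_nat_cube by blast
    then obtain r0 where r0: "r0 > 0" "\<forall>r. 0 < r \<and> r < r0 \<longrightarrow>
           emeasure (leb N) (cube N x r - S \<inter> cube N (\<lambda>_. 0) n) \<le> ennreal (a * (2 * r) ^ N)"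
      using Z(2)[of x n a] x xS \<open>a > 0\<close> by auto
    have "emeasure (leb N) (cube N x r - S) \<le> emeasure (leb N) (cube N x r - S \<inter> cube N (\<lambda>_. 0) n)" for r
      using S(4) by (intro emeasure_mono) auto
    then show "\<exists>r0>0. \<forall>r. 0 < r \<and> r < r0 \<longrightarrow> emeasure (leb N) (cube N x r - S) \<le> ennreal (a * (2 * r) ^ N)"
      using r0 order_trans by blast
  qed (use S Z(1) in auto)
qed

section \<open>Dyadic cells and the volume of preimages under expansive maps\<close>

definition cell :: "nat \<Rightarrow> nat \<Rightarrow> (nat \<Rightarrow> int) \<Rightarrow> (nat \<Rightarrow> real) set" where
  "cell N k z = Pi\<^sub>E {..<N} (\<lambda>i. {real_of_int (z i) / 2 ^ k ..< (real_of_int (z i) + 1) / 2 ^ k})"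

lemma mem_cell: "u \<in> cell N k z \<longleftrightarrow> u \<in> extensional {..<N} \<and> (\<forall>i<N. \<lfloor>2 ^ k * u i\<rfloor> = z i)"
proof -
  have "x \<in> {real_of_int m / 2 ^ k ..< (real_of_int m + 1) / 2 ^ k} \<longleftrightarrow> \<lfloor>2 ^ k * x\<rfloor> = m" for x m
    by (simp add: floor_eq_iff divide_le_eq less_divide_eq mult.commute)
  then show ?thesis unfolding cell_def PiE_iff by auto
qed

lemma sets_cell [simp, measurable]: "cell N k z \<in> sets (leb N)"
  unfolding cell_def by (intro sets_PiM_I_finite) auto

lemma emeasure_cell: "emeasure (leb N) (cell N k z) = ennreal ((1 / 2 ^ k) ^ N)"
  unfolding cell_def
  by (subst lborel_prod.emeasure_PiM) (auto simp: ennreal_power divide_right_mono diff_divide_distrib[symmetric])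

text \<open>Half-open cells of one level tile the space exactly, so their volumes add up without
  loss; open cubes would miss the faces.\<close>

lemma disjoint_cells: "disjoint_family_on (cell N k) (Pi\<^sub>E {..<N} (\<lambda>_. UNIV))"
unfolding disjoint_family_on_def
proof (intro ballI impI)
  fix z z' :: "nat \<Rightarrow> int" assume z: "z \<in> Pi\<^sub>E {..<N} (\<lambda>_. UNIV)" "z' \<in> Pi\<^sub>E {..<N} (\<lambda>_. UNIV)" "z \<noteq> z'"
  then obtain i where "i < N" "z i \<noteq> z' i" by (metis PiE_ext lessThan_iff)
  then show "cell N k z \<inter> cell N k z' = {}" by (auto simp: mem_cell)
qed

text \<open>The hypothesis says that the inverse of \<open>\<psi>\<close> is
  \<open>L\<close>-Lipschitz. The preimage of a dyadic cell then has diameter of the order of the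
  side of the cell, so its volume is comparable with that of the cell. An open set is the increasing
  limit of the unions of the cells it contains.\<close>

lemma expansive_emeasure_open:
  assumes U: "openin (Rn N) U" and "L > 0"
    and meas: "\<And>E. E \<in> sets (leb N) \<Longrightarrow> S \<inter> \<psi> -` E \<in> sets (leb N)"
    and ext: "\<And>u. u \<in> S \<Longrightarrow> u \<in> extensional {..<N} \<and> \<psi> u \<in> extensional {..<N}"
    and expansive: "\<And>u v r. u \<in> S \<Longrightarrow> v \<in> S \<Longrightarrow> (\<And>i. i < N \<Longrightarrow> \<bar>\<psi> u i - \<psi> v i\<bar> < r) \<Longrightarrow> (\<And>i. i < N \<Longrightarrow> \<bar>u i - v i\<bar> \<le> L * r)"
  shows "emeasure (leb N) (S \<inter> \<psi> -` U) \<le> ennreal ((4 * L) ^ N) * emeasure (leb N) U"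
proof -
  define Z where "Z k = {z \<in> Pi\<^sub>E {..<N} (\<lambda>_. UNIV). cell N k z \<subseteq> U}" for k
  define V where "V k = (\<Union>z\<in>Z k. cell N k z)" for k
  have "countable (Pi\<^sub>E {..<N} (\<lambda>_. UNIV :: int set))" by (intro countable_PiE) auto
  then have cZ: "countable (Z k)" for k unfolding Z_def by (rule countable_subset[rotated]) auto
  have dZ: "disjoint_family_on (cell N k) (Z k)" for k
    using disjoint_cells by (rule disjoint_family_on_mono[rotated]) (auto simp: Z_def)
  have Vm: "V k \<in> sets (leb N)" for k unfolding V_def using cZ by (intro sets.countable_UN'') auto
  have VU: "V k \<subseteq> U" for k by (auto simp: V_def Z_def)
  have inV: "u \<in> V k" if u: "u \<in> U" and c: "\<And>w. w \<in> extensional {..<N} \<Longrightarrow> (\<And>i. i < N \<Longrightarrow> \<lfloor>2 ^ k * w i\<rfloor> = \<lfloor>2 ^ k * u i\<rfloor>) \<Longrightarrow> w \<in> U" for u k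
  proof -
    let ?z = "\<lambda>i\<in>{..<N}. \<lfloor>2 ^ k * u i\<rfloor>"
    have "cell N k ?z \<subseteq> U" using c by (auto simp: mem_cell)
    then have "?z \<in> Z k" by (auto simp: Z_def)
    moreover have "u \<in> cell N k ?z" using u U by (auto simp: mem_cell openin_Rn)
    ultimately show ?thesis unfolding V_def by blast
  qed
  have inc: "incseq V"
  proof (rule incseq_SucI, rule subsetI)
    fix k u assume "u \<in> V k"
    then obtain z where z: "cell N k z \<subseteq> U" "u \<in> cell N k z" by (auto simp: V_def Z_def)
    show "u \<in> V (Suc k)"
    proof (rule inV)
      show "u \<in> U" using z by blast
      fix w :: "nat \<Rightarrow> real" assume w: "w \<in> extensional {..<N}" "\<And>i. i < N \<Longrightarrow> \<lfloor>2 ^ Suc k * w i\<rfloor> = \<lfloor>2 ^ Suc k * u i\<rfloor>"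
      \<comment> \<open>The cell of level \<open>k\<close> that contains a point is determined by
        its cell of level \<open>Suc k\<close>; this makes \<open>V\<close> increasing.\<close>
      have half: "\<lfloor>2 ^ k * x\<rfloor> = \<lfloor>2 ^ Suc k * x\<rfloor> div 2" for x :: real
      proof -
        have "\<lfloor>(2 ^ Suc k * x) / real_of_int 2\<rfloor> = \<lfloor>2 ^ Suc k * x\<rfloor> div 2" by (rule floor_divide_real_eq_div) simp
        then show ?thesis by simp
      qed
      have "\<lfloor>2 ^ k * w i\<rfloor> = \<lfloor>2 ^ k * u i\<rfloor>" if "i < N" for i
        using w(2)[OF that] unfolding half by simp
      then have "w \<in> cell N k z" using z(2) w(1) by (simp add: mem_cell)
      then show "w \<in> U" using z(1) by blast
    qed
  qed
  have UV: "(\<Union>k. V k) = U"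
  proof
    show "U \<subseteq> (\<Union>k. V k)"
    proof
      fix u assume u: "u \<in> U"
      then obtain r where r: "r > 0" "cube N u r \<subseteq> U" using U unfolding openin_Rn by blast
      obtain k where k: "(1/2) ^ k < r" using r(1) real_arch_pow_inv[of r "1/2"] by auto
      have "u \<in> V k"
      proof (rule inV[OF u])
        fix w :: "nat \<Rightarrow> real" assume w: "w \<in> extensional {..<N}" "\<And>i. i < N \<Longrightarrow> \<lfloor>2 ^ k * w i\<rfloor> = \<lfloor>2 ^ k * u i\<rfloor>"
        have "\<bar>w i - u i\<bar> < r" if "i < N" for i
        proof -
          have "\<bar>2 ^ k * w i - 2 ^ k * u i\<bar> < 1" using w(2)[OF that] by linarith
          then have "2 ^ k * \<bar>w i - u i\<bar> < 1" by (simp add: abs_mult right_diff_distrib[symmetric])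
          then have "\<bar>w i - u i\<bar> < (1/2) ^ k" by (simp add: power_divide field_simps)
          then show ?thesis using k by simp
        qed
        then have "w \<in> cube N u r" using w(1) by (simp add: mem_cube)
        then show "w \<in> U" using r(2) by blast
      qed
      then show "u \<in> (\<Union>k. V k)" by blast
    qed
  qed (use VU in blast)
  have cellb: "emeasure (leb N) (S \<inter> \<psi> -` cell N k z) \<le> ennreal ((4 * L) ^ N) * emeasure (leb N) (cell N k z)" for k z
  proof (cases "S \<inter> \<psi> -` cell N k z = {}")
    case False
    then obtain v where v: "v \<in> S" "\<psi> v \<in> cell N k z" by blast
    \<comment> \<open>Preimages of two points of the cell differ by at most \<open>L / 2 ^ k\<close>
      in each coordinate; doubling the radius turns this into membership in an open cube. The side
      of that cube is \<open>4 * L\<close> times the side of the cell, whence the constant.\<close>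
    have "S \<inter> \<psi> -` cell N k z \<subseteq> cube N v (2 * L / 2 ^ k)"
    proof
      fix u assume u: "u \<in> S \<inter> \<psi> -` cell N k z"
      have "\<bar>u i - v i\<bar> \<le> L * (1 / 2 ^ k)" if "i < N" for i
      proof (rule expansive[OF _ _ _ that])
        fix i assume "i < N"
        then have "\<lfloor>2 ^ k * \<psi> u i\<rfloor> = \<lfloor>2 ^ k * \<psi> v i\<rfloor>" using u v by (simp add: mem_cell)
        then have "\<bar>2 ^ k * \<psi> u i - 2 ^ k * \<psi> v i\<bar> < 1" by linarith
        then have "2 ^ k * \<bar>\<psi> u i - \<psi> v i\<bar> < 1" by (simp add: abs_mult right_diff_distrib[symmetric])
        then show "\<bar>\<psi> u i - \<psi> v i\<bar> < 1 / 2 ^ k" by (simp add: field_simps)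
      qed (use u v in auto)
      moreover have "L * (1 / 2 ^ k) < 2 * L / 2 ^ k" using \<open>L > 0\<close> by (simp add: field_simps)
      ultimately show "u \<in> cube N v (2 * L / 2 ^ k)" using ext u by (force simp: mem_cube)
    qed
    then have "emeasure (leb N) (S \<inter> \<psi> -` cell N k z) \<le> emeasure (leb N) (cube N v (2 * L / 2 ^ k))"
      by (intro emeasure_mono) auto
    also have "\<dots> = ennreal ((2 * (2 * L / 2 ^ k)) ^ N)" using \<open>L > 0\<close> by (intro emeasure_cube) simp
    also have "(2 * (2 * L / 2 ^ k)) ^ N = (4 * L) ^ N * (1 / 2 ^ k) ^ N"
      unfolding power_mult_distrib[symmetric] by simp
    also have "ennreal \<dots> = ennreal ((4 * L) ^ N) * emeasure (leb N) (cell N k z)"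
      using \<open>L > 0\<close> unfolding emeasure_cell by (intro ennreal_mult) auto
    finally show ?thesis .
  qed simp
  have Vb: "emeasure (leb N) (S \<inter> \<psi> -` V k) \<le> ennreal ((4 * L) ^ N) * emeasure (leb N) U" for k
  proof -
    have "S \<inter> \<psi> -` V k = (\<Union>z\<in>Z k. S \<inter> \<psi> -` cell N k z)" by (auto simp: V_def)
    also have "emeasure (leb N) \<dots> = (\<integral>\<^sup>+z. emeasure (leb N) (S \<inter> \<psi> -` cell N k z) \<partial>count_space (Z k))"
      by (rule emeasure_UN_countable[OF _ cZ]) (use dZ meas in \<open>auto simp: disjoint_family_on_def\<close>)
    also have "\<dots> \<le> (\<integral>\<^sup>+z. ennreal ((4 * L) ^ N) * emeasure (leb N) (cell N k z) \<partial>count_space (Z k))"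
      by (intro nn_integral_mono cellb)
    also have "\<dots> = ennreal ((4 * L) ^ N) * (\<integral>\<^sup>+z. emeasure (leb N) (cell N k z) \<partial>count_space (Z k))"
      by (rule nn_integral_cmult) simp
    also have "(\<integral>\<^sup>+z. emeasure (leb N) (cell N k z) \<partial>count_space (Z k)) = emeasure (leb N) (V k)"
      unfolding V_def by (rule emeasure_UN_countable[OF _ cZ dZ, symmetric]) auto
    also have "\<dots> \<le> emeasure (leb N) U" by (rule emeasure_mono[OF VU]) (rule openin_sets_leb[OF U])
    finally show ?thesis by (simp add: mult_left_mono)
  qed
  have "S \<inter> \<psi> -` U = (\<Union>k. S \<inter> \<psi> -` V k)" using UV by blast
  also have "emeasure (leb N) \<dots> = (SUP k. emeasure (leb N) (S \<inter> \<psi> -` V k))"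
    using meas Vm inc by (intro SUP_emeasure_incseq[symmetric]) (auto simp: incseq_def subset_iff)
  also have "\<dots> \<le> ennreal ((4 * L) ^ N) * emeasure (leb N) U" by (intro SUP_least Vb)
  finally show ?thesis .
qed

text \<open>Outer regularity passes from open to measurable sets; it is available for bounded sets,
  hence the exhaustion by cubes of integer radius.\<close>

lemma expansive_emeasure:
  assumes E: "E \<in> sets (leb N)" and "L > 0"
    and meas: "\<And>E. E \<in> sets (leb N) \<Longrightarrow> S \<inter> \<psi> -` E \<in> sets (leb N)"
    and ext: "\<And>u. u \<in> S \<Longrightarrow> u \<in> extensional {..<N} \<and> \<psi> u \<in> extensional {..<N}"
    and expansive: "\<And>u v r. u \<in> S \<Longrightarrow> v \<in> S \<Longrightarrow> (\<And>i. i < N \<Longrightarrow> \<bar>\<psi> u i - \<psi> v i\<bar> < r) \<Longrightarrow> (\<And>i. i < N \<Longrightarrow> \<bar>u i - v i\<bar> \<le> L * r)"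
  shows "emeasure (leb N) (S \<inter> \<psi> -` E) \<le> ennreal ((4 * L) ^ N) * emeasure (leb N) E"
proof -
  let ?c = "(4 * L) ^ N"
  have c: "?c > 0" using \<open>L > 0\<close> by simp
  have b: "emeasure (leb N) (S \<inter> \<psi> -` (E \<inter> cube N (\<lambda>_. 0) n)) \<le> ennreal ?c * emeasure (leb N) E" for n :: nat
  proof (rule ennreal_le_epsilon)
    fix e :: real assume "0 < e"
    then have "e / ?c > 0" using c by simp
    from outer_regular_leb[OF _ _ this, of "E \<inter> cube N (\<lambda>_. 0) n" N "\<lambda>_. 0" n] E obtain U where
      U: "openin (Rn N) U" "E \<inter> cube N (\<lambda>_. 0) n \<subseteq> U" "emeasure (leb N) U \<le> emeasure (leb N) (E \<inter> cube N (\<lambda>_. 0) n) + ennreal (e / ?c)"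
      by auto
    have "emeasure (leb N) (S \<inter> \<psi> -` (E \<inter> cube N (\<lambda>_. 0) n)) \<le> emeasure (leb N) (S \<inter> \<psi> -` U)"
      using U(2) meas[OF openin_sets_leb[OF U(1)]] by (intro emeasure_mono) auto
    also have "\<dots> \<le> ennreal ?c * emeasure (leb N) U"
      using U(1) \<open>L > 0\<close> meas ext expansive by (rule expansive_emeasure_open)
    also have "\<dots> \<le> ennreal ?c * (emeasure (leb N) E + ennreal (e / ?c))"
      using U(3) E by (intro mult_left_mono order_trans[OF U(3)] add_right_mono emeasure_mono) auto
    also have "\<dots> = ennreal ?c * emeasure (leb N) E + ennreal ?c * ennreal (e / ?c)" by (rule distrib_left)
    also have "ennreal ?c * ennreal (e / ?c) = ennreal (?c * (e / ?c))" using c \<open>0 < e\<close> by (intro ennreal_mult[symmetric]) simp_all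
    also have "?c * (e / ?c) = e" using c by (simp only: nonzero_mult_div_cancel_left times_divide_eq_right)
    finally show "emeasure (leb N) (S \<inter> \<psi> -` (E \<inter> cube N (\<lambda>_. 0) n)) \<le> ennreal ?c * emeasure (leb N) E + ennreal e" .
  qed
  have "E \<subseteq> extensional {..<N}" using sets.sets_into_space[OF E] by (simp add: space_leb)
  have "S \<inter> \<psi> -` E = (\<Union>n::nat. S \<inter> \<psi> -` (E \<inter> cube N (\<lambda>_. 0) n))"
  proof (intro equalityI subsetI)
    fix u assume u: "u \<in> S \<inter> \<psi> -` E"
    then have "\<psi> u \<in> extensional {..<N}" using \<open>E \<subseteq> extensional {..<N}\<close> by blast
    then obtain n :: nat where "\<psi> u \<in> cube N (\<lambda>_. 0) n" using extensional_in_nat_cube by blast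
    then show "u \<in> (\<Union>n::nat. S \<inter> \<psi> -` (E \<inter> cube N (\<lambda>_. 0) n))" using u by (intro UN_I[of n]) auto
  qed auto
  also have "emeasure (leb N) \<dots> = (SUP n::nat. emeasure (leb N) (S \<inter> \<psi> -` (E \<inter> cube N (\<lambda>_. 0) n)))"
  proof (rule SUP_emeasure_incseq[symmetric])
    show "range (\<lambda>n::nat. S \<inter> \<psi> -` (E \<inter> cube N (\<lambda>_. 0) n)) \<subseteq> sets (leb N)"
      by (intro image_subsetI meas sets.Int E sets_cube)
    have "cube N (\<lambda>_. 0) (real m) \<subseteq> cube N (\<lambda>_. 0) (real n)" if "m \<le> n" for m n using that by (intro cube_mono) simp
    then show "incseq (\<lambda>n::nat. S \<inter> \<psi> -` (E \<inter> cube N (\<lambda>_. 0) n))" 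
      unfolding incseq_def by (intro allI impI Int_mono vimage_mono order_refl)
  qed
  also have "\<dots> \<le> ennreal ?c * emeasure (leb N) E" by (intro SUP_least b)
  finally show ?thesis .
qed

text \<open>The section at \<open>g0\<close> is a countable union of rational cubes, each contained
  in the sections at all \<open>g\<close> near \<open>g0\<close>. Finitely many of these cubes
  already have measure above \<open>a\<close>, and finitely many neighbourhoods of \<open>g0\<close>
  can be intersected.\<close>

lemma section_emeasure_lower_semicontinuous:
  fixes g0 :: "'g::topological_space"
  assumes O: "openin (prod_topology euclidean (Rn N)) W" and a: "a < emeasure (leb N) {u. (g0, u) \<in> W}"
  shows "eventually (\<lambda>g. a < emeasure (leb N) {u. (g, u) \<in> W}) (nhds g0)"
proof -
  have sec: "\<exists>A B. open A \<and> openin (Rn N) B \<and> g \<in> A \<and> u \<in> B \<and> A \<times> B \<subseteq> W" if "(g, u) \<in> W" for g u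
    using O[unfolded openin_prod_topology_alt, rule_format, OF that] by (simp only: open_openin)
  have Wopen: "openin (Rn N) {u. (g, u) \<in> W}" for g
  proof (subst openin_subopen, intro ballI)
    fix u assume "u \<in> {u. (g, u) \<in> W}"
    then have "(g, u) \<in> W" by simp
    from sec[OF this] obtain A B where "g \<in> A" "openin (Rn N) B" "u \<in> B" "A \<times> B \<subseteq> W" by (elim exE conjE)
    then show "\<exists>T. openin (Rn N) T \<and> u \<in> T \<and> T \<subseteq> {u. (g, u) \<in> W}" by blast
  qed
  define C where "C = {c \<in> ratcubes N. \<exists>A. open A \<and> g0 \<in> A \<and> A \<times> cube N (fst c) (snd c) \<subseteq> W}"
  have cov: "{u. (g0, u) \<in> W} = (\<Union>c\<in>C. cube N (fst c) (snd c))"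
  proof (intro equalityI subsetI)
    fix u assume "u \<in> {u. (g0, u) \<in> W}"
    then have "(g0, u) \<in> W" by simp
    from sec[OF this] obtain A B where AB: "open A" "g0 \<in> A" "openin (Rn N) B" "u \<in> B" "A \<times> B \<subseteq> W" by (elim exE conjE)
    from openin_ratcube[OF AB(3,4)] obtain q \<rho> where q: "(q, \<rho>) \<in> ratcubes N" "u \<in> cube N q \<rho>" "cube N q \<rho> \<subseteq> B" by blast
    have "A \<times> cube N q \<rho> \<subseteq> W" using AB(5) q(3) by blast
    then have "(q, \<rho>) \<in> C" using AB q(1) by (auto simp: C_def)
    then show "u \<in> (\<Union>c\<in>C. cube N (fst c) (snd c))" using q(2) by (intro UN_I[of "(q, \<rho>)"]) auto
  next
    fix u assume "u \<in> (\<Union>c\<in>C. cube N (fst c) (snd c))"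
    then show "u \<in> {u. (g0, u) \<in> W}" unfolding C_def by blast
  qed
  have "C \<noteq> {}" using a cov by auto
  have cC: "countable C" unfolding C_def by (rule countable_subset[OF _ countable_ratcubes[of N]]) auto
  define f where "f = from_nat_into C"
  have f: "f n \<in> C" for n unfolding f_def using \<open>C \<noteq> {}\<close> by (rule from_nat_into)
  have fr: "range f = C" unfolding f_def using \<open>C \<noteq> {}\<close> cC by (rule range_from_nat_into)
  define V where "V n = (\<Union>i\<le>n. cube N (fst (f i)) (snd (f i)))" for n :: nat
  have "incseq V" unfolding V_def incseq_def by (intro allI impI UN_mono) auto
  moreover have Vm: "V n \<in> sets (leb N)" for n unfolding V_def by auto
  moreover have "(\<Union>n. V n) = {u. (g0, u) \<in> W}"
  proof -
    have "(\<Union>n. V n) = (\<Union>i. cube N (fst (f i)) (snd (f i)))" unfolding V_def by auto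
    also have "\<dots> = (\<Union>c\<in>range f. cube N (fst c) (snd c))" by simp
    finally show ?thesis by (simp only: cov fr)
  qed
  ultimately have "(SUP n. emeasure (leb N) (V n)) = emeasure (leb N) {u. (g0, u) \<in> W}"
    using SUP_emeasure_incseq[of V "leb N"] by (simp add: image_subset_iff)
  with a have "a < (SUP n. emeasure (leb N) (V n))" by simp
  then obtain n where n: "a < emeasure (leb N) (V n)" by (auto simp: less_SUP_iff)
  have "\<forall>i. \<exists>A. open A \<and> g0 \<in> A \<and> A \<times> cube N (fst (f i)) (snd (f i)) \<subseteq> W" using f by (simp add: C_def)
  then obtain A where A: "\<And>i. open (A i)" "\<And>i. g0 \<in> A i" "\<And>i. A i \<times> cube N (fst (f i)) (snd (f i)) \<subseteq> W" by metis
  have "open (\<Inter>i\<le>n. A i)" using A(1) by (intro open_INT) auto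
  moreover have "g0 \<in> (\<Inter>i\<le>n. A i)" using A(2) by blast
  moreover have "a < emeasure (leb N) {u. (g, u) \<in> W}" if "g \<in> (\<Inter>i\<le>n. A i)" for g
  proof -
    have "V n \<subseteq> {u. (g, u) \<in> W}" using A(3) that unfolding V_def by blast
    then have "emeasure (leb N) (V n) \<le> emeasure (leb N) {u. (g, u) \<in> W}"
      using openin_sets_leb[OF Wopen] by (intro emeasure_mono)
    with n show ?thesis by order
  qed
  ultimately show ?thesis unfolding eventually_nhds by blast
qed

section \<open>Comparison and images of finite product measures\<close>

lemma nn_integral_le_scaled:
  assumes sets: "sets \<rho> = sets \<sigma>" and le: "\<And>A. A \<in> sets \<sigma> \<Longrightarrow> emeasure \<rho> A \<le> c * emeasure \<sigma> A"
    and f: "f \<in> borel_measurable \<sigma>"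
  shows "(\<integral>\<^sup>+x. f x \<partial>\<rho>) \<le> c * (\<integral>\<^sup>+x. f x \<partial>\<sigma>)"
  using f
proof (induction rule: borel_measurable_induct)
  case (cong f g)
  have "(\<integral>\<^sup>+x. g x \<partial>\<rho>) = (\<integral>\<^sup>+x. f x \<partial>\<rho>)" "(\<integral>\<^sup>+x. g x \<partial>\<sigma>) = (\<integral>\<^sup>+x. f x \<partial>\<sigma>)"
    using cong sets_eq_imp_space_eq[OF sets] by (auto intro!: nn_integral_cong)
  then show ?case using cong by simp
next
  case (set A)
  then show ?case using le[of A] sets by simp
next
  case (mult u d)
  have "u \<in> borel_measurable \<rho>" using mult(1,2) measurable_cong_sets[OF sets refl] by blast
  then have "(\<integral>\<^sup>+x. d * u x \<partial>\<rho>) = d * (\<integral>\<^sup>+x. u x \<partial>\<rho>)" by (rule nn_integral_cmult)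
  also have "\<dots> \<le> d * (c * (\<integral>\<^sup>+x. u x \<partial>\<sigma>))" using mult by (intro mult_left_mono) auto
  also have "\<dots> = c * (\<integral>\<^sup>+x. d * u x \<partial>\<sigma>)" using mult(2) by (simp add: nn_integral_cmult mult.left_commute)
  finally show ?case .
next
  case (add u v)
  have "u \<in> borel_measurable \<rho>" "v \<in> borel_measurable \<rho>" using add measurable_cong_sets[OF sets refl] by blast+
  then have "(\<integral>\<^sup>+x. v x + u x \<partial>\<rho>) = (\<integral>\<^sup>+x. v x \<partial>\<rho>) + (\<integral>\<^sup>+x. u x \<partial>\<rho>)" by (intro nn_integral_add)
  also have "\<dots> \<le> c * (\<integral>\<^sup>+x. v x \<partial>\<sigma>) + c * (\<integral>\<^sup>+x. u x \<partial>\<sigma>)" using add by (intro add_mono) auto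
  also have "\<dots> = c * (\<integral>\<^sup>+x. v x + u x \<partial>\<sigma>)" using add by (simp add: nn_integral_add distrib_left)
  finally show ?case .
next
  case (seq U)
  have U: "U i \<in> borel_measurable \<rho>" for i using seq measurable_cong_sets[OF sets refl] by blast
  have "(\<integral>\<^sup>+x. (SUP i. U i x) \<partial>\<rho>) = (SUP i. \<integral>\<^sup>+x. U i x \<partial>\<rho>)"
    using seq U by (intro nn_integral_monotone_convergence_SUP) auto
  also have "\<dots> \<le> (SUP i. c * (\<integral>\<^sup>+x. U i x \<partial>\<sigma>))" by (rule SUP_mono') (rule seq)
  also have "\<dots> = c * (SUP i. \<integral>\<^sup>+x. U i x \<partial>\<sigma>)" by (rule SUP_mult_left_ennreal[symmetric])
  also have "(SUP i. \<integral>\<^sup>+x. U i x \<partial>\<sigma>) = (\<integral>\<^sup>+x. (SUP i. U i x) \<partial>\<sigma>)"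
    using seq by (intro nn_integral_monotone_convergence_SUP[symmetric]) auto
  finally show ?case by (simp add: SUP_apply[abs_def])
qed

text \<open>\<open>product_sigma_finite\<close> speaks of every index, while the kernels are
  controlled on \<open>I\<close> only. Replacing the factors off \<open>I\<close> by a trivial
  measure does not change the product over \<open>I\<close>.\<close>

lemma product_sigma_finite_extend:
  assumes "\<And>i. i \<in> I \<Longrightarrow> sigma_finite_measure (M i)"
  defines "M' \<equiv> \<lambda>i. if i \<in> I then M i else count_space {}"
  shows "product_sigma_finite M'" "Pi\<^sub>M I M' = Pi\<^sub>M I M" "\<And>i. i \<in> I \<Longrightarrow> M' i = M i"
  using assms by (auto simp: product_sigma_finite_def sigma_finite_measure_count_space_finite intro!: PiM_cong)

lemma emeasure_PiM_box:
  assumes "finite I" "\<And>i. i \<in> I \<Longrightarrow> sigma_finite_measure (M i)" "\<And>i. i \<in> I \<Longrightarrow> A i \<in> sets (M i)"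
  shows "emeasure (Pi\<^sub>M I M) (Pi\<^sub>E I A) = (\<Prod>i\<in>I. emeasure (M i) (A i))"
proof -
  note e = product_sigma_finite_extend[of I M, OF assms(2)]
  have "emeasure (Pi\<^sub>M I (\<lambda>i. if i \<in> I then M i else count_space {})) (Pi\<^sub>E I A) = 
     (\<Prod>i\<in>I. emeasure (if i \<in> I then M i else count_space {}) (A i))"
    by (rule product_sigma_finite.emeasure_PiM[OF e(1)]) (use assms in auto)
  then show ?thesis using e(2) by simp
qed

lemma PiM_eq_box:
  assumes "finite I" "\<And>i. i \<in> I \<Longrightarrow> sigma_finite_measure (M i)" "sets P = sets (Pi\<^sub>M I M)"
    "\<And>A. (\<And>i. i \<in> I \<Longrightarrow> A i \<in> sets (M i)) \<Longrightarrow> emeasure P (Pi\<^sub>E I A) = (\<Prod>i\<in>I. emeasure (M i) (A i))"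
  shows "P = Pi\<^sub>M I M"
proof -
  note e = product_sigma_finite_extend[of I M, OF assms(2)]
  have "P = Pi\<^sub>M I (\<lambda>i. if i \<in> I then M i else count_space {})"
    by (rule product_sigma_finite.PiM_eqI[OF e(1) assms(1)]) (use assms e in auto)
  then show ?thesis using e(2) by simp
qed

text \<open>Fubini splits off one factor; the induction hypothesis compares the inner integrals and
  \<open>nn_integral_le_scaled\<close> the outer one, so the constants multiply.\<close>

lemma nn_integral_PiM_le_scaled_total:
  assumes "product_sigma_finite \<rho>" "product_sigma_finite \<sigma>" "finite I"
    "\<And>i. i \<in> I \<Longrightarrow> sets (\<rho> i) = sets (\<sigma> i)"
    "\<And>i A. i \<in> I \<Longrightarrow> A \<in> sets (\<sigma> i) \<Longrightarrow> emeasure (\<rho> i) A \<le> c i * emeasure (\<sigma> i) A"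
    "f \<in> borel_measurable (Pi\<^sub>M I \<sigma>)"
  shows "(\<integral>\<^sup>+x. f x \<partial>Pi\<^sub>M I \<rho>) \<le> (\<Prod>i\<in>I. c i) * (\<integral>\<^sup>+x. f x \<partial>Pi\<^sub>M I \<sigma>)"
  using assms(3-6)
proof (induction I arbitrary: f rule: finite_induct)
  case empty
  have "f \<in> borel_measurable (count_space {\<lambda>_. undefined})" by simp
  then show ?case by (simp add: PiM_empty)
next
  case (insert i I)
  interpret R: product_sigma_finite \<rho> by fact
  interpret S: product_sigma_finite \<sigma> by fact
  have seq: "sets (Pi\<^sub>M (insert i I) \<rho>) = sets (Pi\<^sub>M (insert i I) \<sigma>)" using insert by (intro sets_PiM_cong) auto
  note [measurable] = insert.prems(3)
  have fR: "f \<in> borel_measurable (Pi\<^sub>M (insert i I) \<rho>)" using insert.prems(3) measurable_cong_sets[OF seq refl] by blast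
  interpret SI: sigma_finite_measure "Pi\<^sub>M I \<sigma>" using insert.hyps(1) by (rule S.sigma_finite)
  have upd: "(\<lambda>x. f (x(i := y))) \<in> borel_measurable (Pi\<^sub>M I \<sigma>)" if "y \<in> space (\<sigma> i)" for y
    using that insert by measurable
  have "(\<lambda>p. f ((snd p)(i := fst p))) \<in> borel_measurable (\<sigma> i \<Otimes>\<^sub>M Pi\<^sub>M I \<sigma>)"
    by (rule measurable_compose[OF _ insert.prems(3)], rule measurable_fun_upd[where J = I]) auto
  then have inner: "(\<lambda>y. \<integral>\<^sup>+x. f (x(i := y)) \<partial>Pi\<^sub>M I \<sigma>) \<in> borel_measurable (\<sigma> i)"
    by (intro SI.borel_measurable_nn_integral) (simp add: split_def)
  have sp: "space (\<rho> i) = space (\<sigma> i)" using insert.prems(1)[of i] by (intro sets_eq_imp_space_eq) simp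
  have "(\<integral>\<^sup>+x. f x \<partial>Pi\<^sub>M (insert i I) \<rho>) = (\<integral>\<^sup>+y. \<integral>\<^sup>+x. f (x(i := y)) \<partial>Pi\<^sub>M I \<rho> \<partial>\<rho> i)"
    using insert.hyps fR by (rule R.product_nn_integral_insert_rev)
  also have "\<dots> \<le> (\<integral>\<^sup>+y. (\<Prod>i\<in>I. c i) * (\<integral>\<^sup>+x. f (x(i := y)) \<partial>Pi\<^sub>M I \<sigma>) \<partial>\<rho> i)"
  proof (rule nn_integral_mono)
    fix y assume "y \<in> space (\<rho> i)"
    then show "(\<integral>\<^sup>+x. f (x(i := y)) \<partial>Pi\<^sub>M I \<rho>) \<le> (\<Prod>i\<in>I. c i) * (\<integral>\<^sup>+x. f (x(i := y)) \<partial>Pi\<^sub>M I \<sigma>)"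
      unfolding sp by (intro insert.IH insert.prems(1,2) upd insertI2)
  qed
  also have "\<dots> \<le> c i * (\<integral>\<^sup>+y. (\<Prod>i\<in>I. c i) * (\<integral>\<^sup>+x. f (x(i := y)) \<partial>Pi\<^sub>M I \<sigma>) \<partial>\<sigma> i)"
    using insert.prems inner by (intro nn_integral_le_scaled borel_measurable_times) auto
  also have "\<dots> = c i * ((\<Prod>i\<in>I. c i) * (\<integral>\<^sup>+y. (\<integral>\<^sup>+x. f (x(i := y)) \<partial>Pi\<^sub>M I \<sigma>) \<partial>\<sigma> i))"
    using inner by (simp add: nn_integral_cmult)
  also have "(\<integral>\<^sup>+y. (\<integral>\<^sup>+x. f (x(i := y)) \<partial>Pi\<^sub>M I \<sigma>) \<partial>\<sigma> i) = (\<integral>\<^sup>+x. f x \<partial>Pi\<^sub>M (insert i I) \<sigma>)"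
    using insert.hyps insert.prems(3) by (rule S.product_nn_integral_insert_rev[symmetric])
  finally show ?case using insert.hyps by (simp add: mult.assoc)
qed

lemma emeasure_PiM_le_scaled:
  assumes "finite I" "\<And>i. i \<in> I \<Longrightarrow> sigma_finite_measure (\<rho> i)" "\<And>i. i \<in> I \<Longrightarrow> sigma_finite_measure (\<sigma> i)"
    "\<And>i. i \<in> I \<Longrightarrow> sets (\<rho> i) = sets (\<sigma> i)"
    "\<And>i A. i \<in> I \<Longrightarrow> A \<in> sets (\<sigma> i) \<Longrightarrow> emeasure (\<rho> i) A \<le> c i * emeasure (\<sigma> i) A"
    "A \<in> sets (Pi\<^sub>M I \<sigma>)"
  shows "emeasure (Pi\<^sub>M I \<rho>) A \<le> (\<Prod>i\<in>I. c i) * emeasure (Pi\<^sub>M I \<sigma>) A"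
proof -
  note e = product_sigma_finite_extend[of I \<rho>, OF assms(2)] and e' = product_sigma_finite_extend[of I \<sigma>, OF assms(3)]
  have "sets (Pi\<^sub>M I \<rho>) = sets (Pi\<^sub>M I \<sigma>)" using assms(4) by (intro sets_PiM_cong) auto
  moreover have "(\<integral>\<^sup>+x. indicator A x \<partial>Pi\<^sub>M I (\<lambda>i. if i \<in> I then \<rho> i else count_space {})) \<le>
      (\<Prod>i\<in>I. c i) * (\<integral>\<^sup>+x. indicator A x \<partial>Pi\<^sub>M I (\<lambda>i. if i \<in> I then \<sigma> i else count_space {}))"
    by (rule nn_integral_PiM_le_scaled_total[OF e(1) e'(1) assms(1)]) (use assms e'(2) in auto)
  ultimately show ?thesis using e(2) e'(2) assms(6) by simp
qed

lemma emeasure_PiM_mono: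
  assumes "finite I" "\<And>i. i \<in> I \<Longrightarrow> sigma_finite_measure (\<rho> i)" "\<And>i. i \<in> I \<Longrightarrow> sigma_finite_measure (\<sigma> i)"
    "\<And>i. i \<in> I \<Longrightarrow> sets (\<rho> i) = sets (\<sigma> i)"
    "\<And>i A. i \<in> I \<Longrightarrow> A \<in> sets (\<sigma> i) \<Longrightarrow> emeasure (\<rho> i) A \<le> emeasure (\<sigma> i) A"
    "A \<in> sets (Pi\<^sub>M I \<sigma>)"
  shows "emeasure (Pi\<^sub>M I \<rho>) A \<le> emeasure (Pi\<^sub>M I \<sigma>) A"
  using emeasure_PiM_le_scaled[of I \<rho> \<sigma> "\<lambda>_. 1" A] assms by simp

text \<open>Almost every slice of \<open>f\<close> has integral zero, and absolute continuity
  carries "almost every" from \<open>\<sigma> i\<close> to \<open>\<rho> i\<close>. This is the null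
  set analogue of the previous comparison, without densities.\<close>

lemma nn_integral_PiM_zero_total:
  assumes "product_sigma_finite \<rho>" "product_sigma_finite \<sigma>" "finite I"
    "\<And>i. i \<in> I \<Longrightarrow> sets (\<rho> i) = sets (\<sigma> i)"
    "\<And>i. i \<in> I \<Longrightarrow> absolutely_continuous (\<sigma> i) (\<rho> i)"
    "f \<in> borel_measurable (Pi\<^sub>M I \<sigma>)" "(\<integral>\<^sup>+x. f x \<partial>Pi\<^sub>M I \<sigma>) = 0"
  shows "(\<integral>\<^sup>+x. f x \<partial>Pi\<^sub>M I \<rho>) = 0"
  using assms(3-7)
proof (induction I arbitrary: f rule: finite_induct)
  case empty
  then show ?case by (simp add: PiM_empty)
next
  case (insert i I)
  interpret R: product_sigma_finite \<rho> by fact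
  interpret S: product_sigma_finite \<sigma> by fact
  have seq: "sets (Pi\<^sub>M (insert i I) \<rho>) = sets (Pi\<^sub>M (insert i I) \<sigma>)" using insert by (intro sets_PiM_cong) auto
  have fR: "f \<in> borel_measurable (Pi\<^sub>M (insert i I) \<rho>)" using insert.prems(3) measurable_cong_sets[OF seq refl] by blast
  interpret SI: sigma_finite_measure "Pi\<^sub>M I \<sigma>" using insert.hyps(1) by (rule S.sigma_finite)
  note [measurable] = insert.prems(3)
  have upd: "(\<lambda>x. f (x(i := y))) \<in> borel_measurable (Pi\<^sub>M I \<sigma>)" if "y \<in> space (\<sigma> i)" for y
    using that insert by measurable
  have "(\<lambda>p. f ((snd p)(i := fst p))) \<in> borel_measurable (\<sigma> i \<Otimes>\<^sub>M Pi\<^sub>M I \<sigma>)"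
    by (rule measurable_compose[OF _ insert.prems(3)], rule measurable_fun_upd[where J = I]) auto
  then have inner: "(\<lambda>y. \<integral>\<^sup>+x. f (x(i := y)) \<partial>Pi\<^sub>M I \<sigma>) \<in> borel_measurable (\<sigma> i)"
    by (intro SI.borel_measurable_nn_integral) (simp add: split_def)
  have "(\<integral>\<^sup>+y. (\<integral>\<^sup>+x. f (x(i := y)) \<partial>Pi\<^sub>M I \<sigma>) \<partial>\<sigma> i) = 0"
    by (rule trans[OF S.product_nn_integral_insert_rev[OF insert.hyps insert.prems(3), symmetric] insert.prems(4)])
  then have "AE y in \<sigma> i. (\<integral>\<^sup>+x. f (x(i := y)) \<partial>Pi\<^sub>M I \<sigma>) = 0"
    using inner by (simp add: nn_integral_0_iff_AE)
  then have "AE y in \<sigma> i. (\<integral>\<^sup>+x. f (x(i := y)) \<partial>Pi\<^sub>M I \<rho>) = 0"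
    using AE_space[of "\<sigma> i"]
  proof eventually_elim
    case (elim y)
    then show ?case by (intro insert.IH insert.prems(1,2) upd insertI2)
  qed
  then have ae: "AE y in \<rho> i. (\<integral>\<^sup>+x. f (x(i := y)) \<partial>Pi\<^sub>M I \<rho>) = 0"
    using insert.prems(1,2)[of i] by (auto intro: absolutely_continuous_AE)
  have "(\<integral>\<^sup>+x. f x \<partial>Pi\<^sub>M (insert i I) \<rho>) = (\<integral>\<^sup>+y. \<integral>\<^sup>+x. f (x(i := y)) \<partial>Pi\<^sub>M I \<rho> \<partial>\<rho> i)"
    using insert.hyps fR by (rule R.product_nn_integral_insert_rev)
  also have "\<dots> = (\<integral>\<^sup>+y. 0 \<partial>\<rho> i)" using ae by (rule nn_integral_cong_AE)
  finally show ?case by simp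
qed

lemma absolutely_continuous_PiM:
  assumes "finite I" "\<And>i. i \<in> I \<Longrightarrow> sigma_finite_measure (\<rho> i)" "\<And>i. i \<in> I \<Longrightarrow> sigma_finite_measure (\<sigma> i)"
    "\<And>i. i \<in> I \<Longrightarrow> sets (\<rho> i) = sets (\<sigma> i)"
    "\<And>i. i \<in> I \<Longrightarrow> absolutely_continuous (\<sigma> i) (\<rho> i)"
  shows "absolutely_continuous (Pi\<^sub>M I \<sigma>) (Pi\<^sub>M I \<rho>)"
  unfolding absolutely_continuous_def
proof
  fix A assume A: "A \<in> null_sets (Pi\<^sub>M I \<sigma>)"
  note e = product_sigma_finite_extend[of I \<rho>, OF assms(2)] and e' = product_sigma_finite_extend[of I \<sigma>, OF assms(3)]
  have s: "sets (Pi\<^sub>M I \<rho>) = sets (Pi\<^sub>M I \<sigma>)" using assms(4) by (intro sets_PiM_cong) auto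
  moreover have "(\<integral>\<^sup>+x. indicator A x \<partial>Pi\<^sub>M I (\<lambda>i. if i \<in> I then \<rho> i else count_space {})) = 0"
    by (rule nn_integral_PiM_zero_total[OF e(1) e'(1) assms(1)]) (use assms e'(2) A in \<open>auto simp: null_sets_def\<close>)
  ultimately show "A \<in> null_sets (Pi\<^sub>M I \<rho>)" using e(2) A by (auto simp: null_sets_def)
qed

text \<open>A coordinate outside the range of \<open>\<tau>\<close> contributes its total mass,
  which is why probability is required exactly there. Compatibility of the lifting with the omission
  of a coordinate rests on this.\<close>

lemma distr_PiM_reindex_map:
  assumes I: "finite I" and J: "finite J" and \<tau>: "inj_on \<tau> J" "\<tau> ` J \<subseteq> I"
    and \<rho>: "\<And>i. i \<in> I \<Longrightarrow> finite_measure (\<rho> i)" "\<And>i. i \<in> I - \<tau> ` J \<Longrightarrow> prob_space (\<rho> i)"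
    and \<phi>: "\<And>j. j \<in> J \<Longrightarrow> \<phi> j \<in> measurable (\<rho> (\<tau> j)) (N j)"
  shows "distr (Pi\<^sub>M I \<rho>) (Pi\<^sub>M J N) (\<lambda>y. \<lambda>j\<in>J. \<phi> j (y (\<tau> j))) = Pi\<^sub>M J (\<lambda>j. distr (\<rho> (\<tau> j)) (N j) (\<phi> j))"
proof (rule PiM_eq_box[OF J])
  have p: "finite_measure (distr (\<rho> (\<tau> j)) (N j) (\<phi> j))" if "j \<in> J" for j
    using that \<rho> \<phi> \<tau>(2) by (intro finite_measure.finite_measure_distr) auto
  then show "sigma_finite_measure (distr (\<rho> (\<tau> j)) (N j) (\<phi> j))" if "j \<in> J" for j
    using that by (auto simp: finite_measure_def)
  show "sets (distr (Pi\<^sub>M I \<rho>) (Pi\<^sub>M J N) (\<lambda>y. \<lambda>j\<in>J. \<phi> j (y (\<tau> j)))) = sets (Pi\<^sub>M J (\<lambda>j. distr (\<rho> (\<tau> j)) (N j) (\<phi> j)))"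
    by (simp, rule sets_PiM_cong) auto
  have m: "(\<lambda>y. \<lambda>j\<in>J. \<phi> j (y (\<tau> j))) \<in> measurable (Pi\<^sub>M I \<rho>) (Pi\<^sub>M J N)"
  proof (rule measurable_restrict)
    fix j assume "j \<in> J"
    then show "(\<lambda>y. \<phi> j (y (\<tau> j))) \<in> measurable (Pi\<^sub>M I \<rho>) (N j)"
      using \<tau>(2) \<phi> by (intro measurable_compose[OF measurable_component_singleton]) auto
  qed
  fix A assume "\<And>j. j \<in> J \<Longrightarrow> A j \<in> sets (distr (\<rho> (\<tau> j)) (N j) (\<phi> j))"
  then have A: "A j \<in> sets (N j)" if "j \<in> J" for j using that by simp
  define B where "B i = (if i \<in> \<tau> ` J then \<phi> (the_inv_into J \<tau> i) -` A (the_inv_into J \<tau> i) \<inter> space (\<rho> i) else space (\<rho> i))" for i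
  have B\<tau>: "B (\<tau> j) = \<phi> j -` A j \<inter> space (\<rho> (\<tau> j))" if "j \<in> J" for j
    using that \<tau>(1) by (simp add: B_def the_inv_into_f_f)
  have Bm: "B i \<in> sets (\<rho> i)" if "i \<in> I" for i
  proof (cases "i \<in> \<tau> ` J")
    case True
    then obtain j where "j \<in> J" "i = \<tau> j" by blast
    then show ?thesis using B\<tau>[of j] measurable_sets[OF \<phi> A, of j] by simp
  qed (simp add: B_def)
  have "emeasure (distr (Pi\<^sub>M I \<rho>) (Pi\<^sub>M J N) (\<lambda>y. \<lambda>j\<in>J. \<phi> j (y (\<tau> j)))) (Pi\<^sub>E J A)
      = emeasure (Pi\<^sub>M I \<rho>) ((\<lambda>y. \<lambda>j\<in>J. \<phi> j (y (\<tau> j))) -` Pi\<^sub>E J A \<inter> space (Pi\<^sub>M I \<rho>))"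
    using m J A by (intro emeasure_distr sets_PiM_I_finite) auto
  also have "(\<lambda>y. \<lambda>j\<in>J. \<phi> j (y (\<tau> j))) -` Pi\<^sub>E J A \<inter> space (Pi\<^sub>M I \<rho>) = Pi\<^sub>E I B"
  proof (intro equalityI subsetI)
    fix y assume y: "y \<in> (\<lambda>y. \<lambda>j\<in>J. \<phi> j (y (\<tau> j))) -` Pi\<^sub>E J A \<inter> space (Pi\<^sub>M I \<rho>)"
    then have sp: "y \<in> Pi\<^sub>E I (\<lambda>i. space (\<rho> i))" by (simp add: space_PiM)
    have "y i \<in> B i" if "i \<in> I" for i
    proof (cases "i \<in> \<tau> ` J")
      case True
      then obtain j where "j \<in> J" "i = \<tau> j" by blast
      moreover have "\<phi> j (y (\<tau> j)) \<in> A j" if "j \<in> J" for j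
        using y that by (auto simp: PiE_iff restrict_def)
      moreover have "y i \<in> space (\<rho> i)" using sp \<open>i \<in> I\<close> by (rule PiE_mem)
      ultimately show ?thesis using B\<tau>[of j] by simp
    next
      case False
      then show ?thesis using PiE_mem[OF sp \<open>i \<in> I\<close>] by (simp add: B_def)
    qed
    then show "y \<in> Pi\<^sub>E I B" using sp by (simp add: PiE_iff)
  next
    fix y assume y: "y \<in> Pi\<^sub>E I B"
    have "B i \<subseteq> space (\<rho> i)" for i by (auto simp: B_def)
    then have "y \<in> space (Pi\<^sub>M I \<rho>)" using y by (auto simp: space_PiM PiE_iff)
    moreover have "\<phi> j (y (\<tau> j)) \<in> A j" if "j \<in> J" for j
    proof -
      have "\<tau> j \<in> I" using that \<tau>(2) by blast
      from PiE_mem[OF y this] B\<tau>[OF that] show ?thesis by simp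
    qed
    ultimately show "y \<in> (\<lambda>y. \<lambda>j\<in>J. \<phi> j (y (\<tau> j))) -` Pi\<^sub>E J A \<inter> space (Pi\<^sub>M I \<rho>)" by auto
  qed
  also have "emeasure (Pi\<^sub>M I \<rho>) (Pi\<^sub>E I B) = (\<Prod>i\<in>I. emeasure (\<rho> i) (B i))"
    using I \<rho> Bm by (intro emeasure_PiM_box) (auto simp: finite_measure_def)
  also have "\<dots> = (\<Prod>i\<in>\<tau> ` J. emeasure (\<rho> i) (B i))"
    by (rule prod.mono_neutral_right[OF I \<tau>(2)]) (auto simp: B_def \<rho> prob_space.emeasure_space_1)
  also have "\<dots> = (\<Prod>j\<in>J. emeasure (\<rho> (\<tau> j)) (B (\<tau> j)))" using \<tau>(1) by (subst prod.reindex) auto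
  also have "\<dots> = (\<Prod>j\<in>J. emeasure (distr (\<rho> (\<tau> j)) (N j) (\<phi> j)) (A j))"
    using A \<phi> by (intro prod.cong refl) (simp add: B\<tau> emeasure_distr)
  finally show "emeasure (distr (Pi\<^sub>M I \<rho>) (Pi\<^sub>M J N) (\<lambda>y. \<lambda>j\<in>J. \<phi> j (y (\<tau> j)))) (Pi\<^sub>E J A) =
      (\<Prod>j\<in>J. emeasure (distr (\<rho> (\<tau> j)) (N j) (\<phi> j)) (A j))" .
qed

text \<open>Identifies the \<open>p\<close>-fold power of the \<open>d\<close>-dimensional space
  with the \<open>p * d\<close>-dimensional one, with the index convention of
  \<open>power_chart\<close>.\<close>

definition unblock :: "nat \<Rightarrow> nat \<Rightarrow> (nat \<Rightarrow> nat \<Rightarrow> real) \<Rightarrow> nat \<Rightarrow> real" where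
  "unblock p d v = (\<lambda>k\<in>{..<p * d}. v (k div d) (k mod d))"

definition block :: "nat \<Rightarrow> nat \<Rightarrow> (nat \<Rightarrow> real) \<Rightarrow> nat \<Rightarrow> nat \<Rightarrow> real" where
  "block p d u = (\<lambda>i\<in>{..<p}. \<lambda>k\<in>{..<d}. u (i * d + k))"

lemma block_index: "i < p \<Longrightarrow> k < d \<Longrightarrow> i * d + k < p * (d::nat)"
proof -
  assume "i < p" "k < d"
  then have "i * d + k < Suc i * d" by simp
  also have "\<dots> \<le> p * d" using \<open>i < p\<close> by (intro mult_le_mono1) simp
  finally show ?thesis .
qed

lemma block_div: "k < p * d \<Longrightarrow> k div d < (p::nat)" "k < p * d \<Longrightarrow> k mod d < d"
  by (auto simp: less_mult_imp_div_less intro: mod_less_divisor) (metis gr0I mod_less_divisor mult_0_right not_less0)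

lemma unblock_block: "u \<in> extensional {..<p * d} \<Longrightarrow> unblock p d (block p d u) = u"
  by (rule ext) (auto simp: unblock_def block_def extensional_def block_div)

lemma block_unblock: "v \<in> Pi\<^sub>E {..<p} (\<lambda>_. extensional {..<d}) \<Longrightarrow> block p d (unblock p d v) = v"
  by (intro ext) (auto simp: unblock_def block_def extensional_def PiE_iff block_index restrict_def)

lemma measurable_unblock [measurable]: "unblock p d \<in> measurable (Pi\<^sub>M {..<p} (\<lambda>_. leb d)) (leb (p * d))"
  unfolding unblock_def
proof (rule measurable_restrict)
  fix k assume "k \<in> {..<p * d}"
  then show "(\<lambda>v. v (k div d) (k mod d)) \<in> measurable (Pi\<^sub>M {..<p} (\<lambda>_. leb d)) lborel"
    by (intro measurable_compose[OF measurable_component_singleton[of "k div d" "{..<p}"] measurable_component_singleton])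
      (auto simp: block_div)
qed

lemma measurable_block [measurable]: "block p d \<in> measurable (leb (p * d)) (Pi\<^sub>M {..<p} (\<lambda>_. leb d))"
  unfolding block_def
  by (intro measurable_restrict measurable_component_singleton) (auto simp: block_index)

lemma sigma_finite_leb: "sigma_finite_measure (leb N)"
  by (rule lborel_prod.sigma_finite) simp

lemma distr_unblock: "distr (Pi\<^sub>M {..<p} (\<lambda>_. leb d)) (leb (p * d)) (unblock p d) = leb (p * d)"
proof (rule PiM_eq_box)
  fix A :: "nat \<Rightarrow> real set" assume A: "\<And>k. k \<in> {..<p * d} \<Longrightarrow> A k \<in> sets lborel"
  have "unblock p d -` Pi\<^sub>E {..<p * d} A \<inter> space (Pi\<^sub>M {..<p} (\<lambda>_. leb d)) =
      Pi\<^sub>E {..<p} (\<lambda>i. Pi\<^sub>E {..<d} (\<lambda>k. A (i * d + k)))"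
  proof (intro equalityI subsetI)
    fix v assume v: "v \<in> unblock p d -` Pi\<^sub>E {..<p * d} A \<inter> space (Pi\<^sub>M {..<p} (\<lambda>_. leb d))"
    then have "v k \<in> extensional {..<d}" if "k < p" for k using that by (auto simp: space_PiM space_leb PiE_iff)
    moreover have "v i k \<in> A (i * d + k)" if "i < p" "k < d" for i k
    proof -
      have "unblock p d v (i * d + k) \<in> A (i * d + k)" using v block_index[OF that] by (auto simp: PiE_iff)
      then show ?thesis using block_index[OF that] that by (simp add: unblock_def)
    qed
    ultimately show "v \<in> Pi\<^sub>E {..<p} (\<lambda>i. Pi\<^sub>E {..<d} (\<lambda>k. A (i * d + k)))" using v by (auto simp: space_PiM PiE_iff)
  next
    fix v assume v: "v \<in> Pi\<^sub>E {..<p} (\<lambda>i. Pi\<^sub>E {..<d} (\<lambda>k. A (i * d + k)))"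
    have "v (k div d) (k mod d) \<in> A k" if "k < p * d" for k
    proof -
      have "v (k div d) \<in> Pi\<^sub>E {..<d} (\<lambda>j. A (k div d * d + j))" using v block_div(1)[OF that] by (auto elim!: PiE_mem)
      from PiE_mem[OF this, of "k mod d"] have "v (k div d) (k mod d) \<in> A (k div d * d + k mod d)"
        using block_div(2)[OF that] by simp
      then show ?thesis by (simp only: div_mult_mod_eq)
    qed
    then have "unblock p d v \<in> Pi\<^sub>E {..<p * d} A" by (simp add: unblock_def PiE_iff)
    then show "v \<in> unblock p d -` Pi\<^sub>E {..<p * d} A \<inter> space (Pi\<^sub>M {..<p} (\<lambda>_. leb d))"
      using v by (auto simp: space_PiM PiE_iff)
  qed
  then have "emeasure (distr (Pi\<^sub>M {..<p} (\<lambda>_. leb d)) (leb (p * d)) (unblock p d)) (Pi\<^sub>E {..<p * d} A) =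
      emeasure (Pi\<^sub>M {..<p} (\<lambda>_. leb d)) (Pi\<^sub>E {..<p} (\<lambda>i. Pi\<^sub>E {..<d} (\<lambda>k. A (i * d + k))))"
    using A by (subst emeasure_distr) (auto intro!: sets_PiM_I_finite)
  also have "\<dots> = (\<Prod>i<p. emeasure (leb d) (Pi\<^sub>E {..<d} (\<lambda>k. A (i * d + k))))"
    using A sigma_finite_leb by (intro emeasure_PiM_box) (auto intro!: sets_PiM_I_finite simp: block_index)
  also have "\<dots> = (\<Prod>i<p. \<Prod>k<d. emeasure lborel (A (i * d + k)))"
    using A by (intro prod.cong refl lborel_prod.emeasure_PiM) (auto simp: block_index)
  also have "\<dots> = (\<Prod>i<p. \<Prod>k\<in>{i * d..<i * d + d}. emeasure lborel (A k))"
  proof (rule prod.cong[OF refl])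
    fix i
    show "(\<Prod>k<d. emeasure lborel (A (i * d + k))) = (\<Prod>k\<in>{i * d..<i * d + d}. emeasure lborel (A k))"
      by (rule prod.reindex_bij_witness[of _ "\<lambda>k. k - i * d" "\<lambda>k. i * d + k"]) auto
  qed
  also have "\<dots> = (\<Prod>k<p * d. emeasure lborel (A k))" by (rule prod.nat_group)
  finally show "emeasure (distr (Pi\<^sub>M {..<p} (\<lambda>_. leb d)) (leb (p * d)) (unblock p d)) (Pi\<^sub>E {..<p * d} A) =
      (\<Prod>k<p * d. emeasure lborel (A k))" .
qed (auto intro: lborel.sigma_finite_measure_axioms)

section \<open>Jacobians and the mean value inequality\<close>

lemma has_jacobian_imp_DERIV_line:
  assumes J: "has_jacobian n m f J (\<lambda>j\<in>{..<n}. v j + t * (u j - v j))" and i: "i < m"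
  shows "((\<lambda>t. f (\<lambda>j\<in>{..<n}. v j + t * (u j - v j)) i) has_real_derivative (\<Sum>j<n. J i j * (u j - v j))) (at t)"
proof -
  define w where "w t = (\<lambda>j\<in>{..<n}. v j + t * (u j - v j))" for t
  define K where "K = L2_set (\<lambda>j. u j - v j) {..<n}"
  have K: "K \<ge> 0" unfolding K_def by simp
  have dist: "L2_set (\<lambda>j. w t' j - w t j) {..<n} = \<bar>t' - t\<bar> * K" for t'
  proof -
    have "L2_set (\<lambda>j. w t' j - w t j) {..<n} = L2_set (\<lambda>j. (t' - t) * (u j - v j)) {..<n}"
      by (rule L2_set_cong) (simp_all add: w_def algebra_simps)
    also have "\<dots> = \<bar>t' - t\<bar> * K"
      unfolding L2_set_def K_def power_mult_distrib sum_distrib_left[symmetric] real_sqrt_mult by simp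
    finally show ?thesis .
  qed
  show ?thesis
    unfolding has_field_derivative_def has_derivative_at_alt w_def[symmetric]
  proof (intro conjI allI impI bounded_linear_mult_right)
    fix e :: real assume "e > 0"
    \<comment> \<open>\<open>K\<close> vanishes when \<open>u\<close> and \<open>v\<close> agree;
      \<open>K + 1\<close> covers this case as well.\<close>
    then have "e / (K + 1) > 0" using K by simp
    then obtain \<delta> where \<delta>: "\<delta> > 0" "\<And>z. z \<in> topspace (Rn n) \<Longrightarrow> L2_set (\<lambda>j. z j - w t j) {..<n} < \<delta> \<Longrightarrow>
        L2_set (\<lambda>i. f z i - f (w t) i - (\<Sum>j<n. J i j * (z j - w t j))) {..<m} \<le> e / (K + 1) * L2_set (\<lambda>j. z j - w t j) {..<n}"
      using J unfolding has_jacobian_def w_def[symmetric] by blast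
    show "\<exists>\<delta>>0. \<forall>y. norm (y - t) < \<delta> \<longrightarrow>
       norm (f (w y) i - f (w t) i - (\<Sum>j<n. J i j * (u j - v j)) * (y - t)) \<le> e * norm (y - t)"
    proof (intro exI conjI allI impI)
      show "\<delta> / (K + 1) > 0" using \<delta>(1) K by simp
      fix y assume y: "norm (y - t) < \<delta> / (K + 1)"
      have "\<bar>y - t\<bar> * K \<le> \<bar>y - t\<bar> * (K + 1)" using K by (simp add: algebra_simps)
      also have "\<dots> < \<delta>" using y K by (simp add: pos_less_divide_eq)
      finally have lt: "L2_set (\<lambda>j. w y j - w t j) {..<n} < \<delta>" by (simp add: dist)
      have wt: "w y \<in> topspace (Rn n)" by (simp add: w_def topspace_Rn)
      from \<delta>(2)[OF wt lt] have le: "L2_set (\<lambda>i. f (w y) i - f (w t) i - (\<Sum>j<n. J i j * (w y j - w t j))) {..<m} \<le> e / (K + 1) * (\<bar>y - t\<bar> * K)"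
        by (simp only: dist)
      have eq: "(\<Sum>j<n. J i j * (w y j - w t j)) = (\<Sum>j<n. J i j * (u j - v j)) * (y - t)"
        unfolding sum_distrib_right by (rule sum.cong) (auto simp: w_def algebra_simps)
      have "\<bar>f (w y) i - f (w t) i - (\<Sum>j<n. J i j * (w y j - w t j))\<bar> \<le>
          L2_set (\<lambda>i. f (w y) i - f (w t) i - (\<Sum>j<n. J i j * (w y j - w t j))) {..<m}"
        using member_le_L2_set[of "{..<m}" i "\<lambda>i. \<bar>f (w y) i - f (w t) i - (\<Sum>j<n. J i j * (w y j - w t j))\<bar>"] i
        by (simp add: L2_set_def)
      also have "\<dots> \<le> e / (K + 1) * (\<bar>y - t\<bar> * K)" by (rule le)
      also have "\<dots> = e * \<bar>y - t\<bar> * (K / (K + 1))" by simp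
      also have "\<dots> \<le> e * \<bar>y - t\<bar> * 1" using K \<open>e > 0\<close> by (intro mult_left_mono) auto
      finally show "norm (f (w y) i - f (w t) i - (\<Sum>j<n. J i j * (u j - v j)) * (y - t)) \<le> e * norm (y - t)"
        by (simp add: eq)
    qed
  qed
qed

text \<open>Cubes are convex, so the mean value theorem applies along the segment from
  \<open>v\<close> to \<open>u\<close>. The factor \<open>real n\<close> counts the entries of a row
  of the Jacobian.\<close>

lemma has_jacobian_cube_Lipschitz:
  assumes J: "\<And>w. w \<in> cube n z \<rho> \<Longrightarrow> has_jacobian n m f (J w) w"
    and B: "\<And>w i j. w \<in> cube n z \<rho> \<Longrightarrow> i < m \<Longrightarrow> j < n \<Longrightarrow> \<bar>J w i j\<bar> \<le> B"
    and u: "u \<in> cube n z \<rho>" and v: "v \<in> cube n z \<rho>" and r: "\<And>j. j < n \<Longrightarrow> \<bar>u j - v j\<bar> \<le> r" and i: "i < m"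
  shows "\<bar>f u i - f v i\<bar> \<le> real n * (B * r)"
proof -
  define w where "w t = (\<lambda>j\<in>{..<n}. v j + t * (u j - v j))" for t
  have w1: "w 1 = u" using u by (auto simp: w_def mem_cube extensional_def restrict_def)
  have w0: "w 0 = v" using v by (auto simp: w_def mem_cube extensional_def restrict_def)
  have wc: "w t \<in> cube n z \<rho>" if t: "0 \<le> t" "t \<le> 1" for t
  proof -
    have "\<bar>v j + t * (u j - v j) - z j\<bar> < \<rho>" if "j < n" for j
    proof -
      have a: "\<bar>u j - z j\<bar> < \<rho>" "\<bar>v j - z j\<bar> < \<rho>" using u v that by (auto simp: mem_cube)
      have "v j + t * (u j - v j) - z j = (1 - t) * (v j - z j) + t * (u j - z j)" by (simp add: algebra_simps)
      also have "\<bar>\<dots>\<bar> \<le> (1 - t) * \<bar>v j - z j\<bar> + t * \<bar>u j - z j\<bar>"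
        using t abs_triangle_ineq[of "(1 - t) * (v j - z j)" "t * (u j - z j)"] by (simp add: abs_mult)
      also have "\<dots> < \<rho>"
      proof (cases "t = 0")
        case False
        then have "t * \<bar>u j - z j\<bar> < t * \<rho>" using t a by simp
        moreover have "(1 - t) * \<bar>v j - z j\<bar> \<le> (1 - t) * \<rho>" using t a by (intro mult_left_mono) auto
        ultimately show ?thesis by (simp add: algebra_simps)
      qed (use a in simp)
      finally show ?thesis .
    qed
    then show ?thesis by (simp add: mem_cube w_def)
  qed
  have D: "((\<lambda>t. f (w t) i) has_real_derivative (\<Sum>j<n. J (w t) i j * (u j - v j))) (at t)" if "0 \<le> t" "t \<le> 1" for t
    unfolding w_def by (rule has_jacobian_imp_DERIV_line[OF _ i]) (rule J[OF wc[OF that], unfolded w_def])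
  obtain t where t: "0 < t" "t < 1" "f (w 1) i - f (w 0) i = (1 - 0) * (\<Sum>j<n. J (w t) i j * (u j - v j))"
    using MVT2[of 0 1 "\<lambda>t. f (w t) i" "\<lambda>t. (\<Sum>j<n. J (w t) i j * (u j - v j))"] D by auto
  have "\<bar>f u i - f v i\<bar> = \<bar>\<Sum>j<n. J (w t) i j * (u j - v j)\<bar>" using t(3) by (simp add: w0 w1)
  also have "\<dots> \<le> (\<Sum>j<n. \<bar>J (w t) i j * (u j - v j)\<bar>)" by (rule sum_abs)
  also have "\<dots> \<le> (\<Sum>j<n. B * r)"
  proof (rule sum_mono)
    fix j assume j: "j \<in> {..<n}"
    have "\<bar>J (w t) i j\<bar> \<le> B" using t j i by (intro B wc) auto
    moreover have "\<bar>u j - v j\<bar> \<le> r" using j r by simp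
    ultimately show "\<bar>J (w t) i j * (u j - v j)\<bar> \<le> B * r" unfolding abs_mult by (intro mult_mono) auto
  qed
  finally show ?thesis by simp
qed

section \<open>Borel sets, charts and the action\<close>

text \<open>A point of \<open>X\<close> is needed as the junk value of \<open>cinv\<close>; the
  empty manifold is treated in \<open>lifting_family_empty\<close>.\<close>

locale C1_action =
  fixes X :: "'x manifold" and act :: "'g::{topological_group_add, t2_space} \<Rightarrow> 'x \<Rightarrow> 'x"
  assumes manifold: "differentiable_manifold X"
    and C1: "C1_continuous_action X act"
    and nonempty: "topspace (mtop X) \<noteq> {}"
begin

abbreviation "T \<equiv> mtop X"
abbreviation "dm \<equiv> mdim X"

text \<open>The Borel sigma-algebra of \<open>X\<close>. The powers will carry its product
  sigma-algebra, which can be smaller than the Borel sigma-algebra of the power when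
  \<open>X\<close> is not second countable.\<close>

definition BX :: "'x measure" where
  "BX = sigma (topspace T) {U. openin T U}"

text \<open>Total extensions of a chart and its inverse, with junk values off their domains, so that both are Borel on the whole space.\<close>

definition cinv :: "'x chart \<Rightarrow> (nat \<Rightarrow> real) \<Rightarrow> 'x" where
  "cinv c u = (if u \<in> snd c ` fst c then inv_into (fst c) (snd c) u else (SOME x. x \<in> topspace T))"

definition crd :: "'x chart \<Rightarrow> 'x \<Rightarrow> nat \<Rightarrow> real" where
  "crd c x = (if x \<in> fst c then snd c x else (\<lambda>i\<in>{..<dm}. 0))"

lemma space_BX [simp]: "space BX = topspace T"
  unfolding BX_def by (rule space_measure_of) (use openin_subset in blast)

lemma sets_BX: "sets BX = sigma_sets (topspace T) {U. openin T U}"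
  unfolding BX_def by (rule sets_measure_of) (use openin_subset in blast)

lemma openin_sets_BX [intro]: "openin T U \<Longrightarrow> U \<in> sets BX"
  unfolding sets_BX by (rule sigma_sets.Basic) simp

lemma chart: "c \<in> atlas X \<Longrightarrow> is_chart T dm c"
  using manifold by (simp add: differentiable_manifold_def)

lemma chart_cover: "x \<in> topspace T \<Longrightarrow> \<exists>c\<in>atlas X. x \<in> fst c"
  using manifold unfolding differentiable_manifold_def by blast

context
  fixes c assumes c: "c \<in> atlas X"
begin

lemma chart_open: "openin T (fst c)" "openin (Rn dm) (snd c ` fst c)"
  using chart[OF c] by (simp_all add: is_chart_def)

lemma chart_subset: "fst c \<subseteq> topspace T"
  using chart_open(1) by (rule openin_subset)

lemma chart_image_subset: "snd c ` fst c \<subseteq> extensional {..<dm}"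
  using openin_subset[OF chart_open(2)] by (simp add: topspace_Rn)

lemma chart_homeo: "homeomorphic_map (subtopology T (fst c)) (subtopology (Rn dm) (snd c ` fst c)) (snd c)"
  using chart[OF c] by (simp add: is_chart_def)

lemma chart_inj: "inj_on (snd c) (fst c)"
  using homeomorphic_imp_injective_map[OF chart_homeo] chart_subset by (simp add: Int_absorb1)

lemma cinv_chart [simp]: "x \<in> fst c \<Longrightarrow> cinv c (snd c x) = x"
  using chart_inj by (simp add: cinv_def)

lemma cinv_in: "u \<in> snd c ` fst c \<Longrightarrow> cinv c u \<in> fst c \<and> snd c (cinv c u) = u"
  by auto

lemma cinv_topspace: "cinv c u \<in> topspace T"
proof (cases "u \<in> snd c ` fst c")
  case True
  then show ?thesis using cinv_in chart_subset by blast
next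
  case False
  then show ?thesis using nonempty by (auto simp: cinv_def some_in_eq)
qed

lemma chart_open_image: "openin T U \<Longrightarrow> openin (Rn dm) (snd c ` (U \<inter> fst c))"
proof -
  assume U: "openin T U"
  have "open_map (subtopology T (fst c)) (subtopology (Rn dm) (snd c ` fst c)) (snd c)"
    using chart_homeo by (rule homeomorphic_imp_open_map)
  moreover have "openin (subtopology T (fst c)) (U \<inter> fst c)" using U by (rule openin_subtopology_Int)
  ultimately have "openin (subtopology (Rn dm) (snd c ` fst c)) (snd c ` (U \<inter> fst c))"
    unfolding open_map_def by blast
  then show ?thesis using chart_open(2) openin_trans_full by blast
qed

lemma chart_open_preimage: "openin (Rn dm) W \<Longrightarrow> openin T {x \<in> fst c. snd c x \<in> W}"
proof -
  assume W: "openin (Rn dm) W"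
  have "continuous_map (subtopology T (fst c)) (Rn dm) (snd c)"
    using homeomorphic_imp_continuous_map[OF chart_homeo] by (rule continuous_map_into_fulltopology)
  from openin_continuous_map_preimage[OF this W]
  have "openin (subtopology T (fst c)) {x \<in> fst c. snd c x \<in> W}"
    using chart_subset by (simp add: Int_absorb1)
  then show ?thesis using chart_open(1) openin_trans_full by blast
qed

lemma measurable_crd [measurable]: "crd c \<in> measurable BX (leb dm)"
proof (rule measurable_PiM_single')
  show "crd c \<in> space BX \<rightarrow> Pi\<^sub>E {..<dm} (\<lambda>i. space lborel)"
  proof
    fix x
    show "crd c x \<in> Pi\<^sub>E {..<dm} (\<lambda>i. space lborel)"
      using chart_image_subset imageI[of x "fst c" "snd c"] by (auto simp: crd_def PiE_def simp del: imageI)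
  qed
  fix i assume i: "i \<in> {..<dm}"
  have "(\<lambda>x. crd c x i) \<in> borel_measurable BX"
  proof (rule borel_measurableI)
    fix A :: "real set" assume A: "open A"
    have "openin (Rn dm) {u \<in> topspace (Rn dm). u i \<in> A}"
      using i A unfolding Rn_def by (intro openin_continuous_map_preimage[OF continuous_map_product_projection]) auto
    from openin_sets_BX[OF chart_open_preimage[OF this]]
    have 1: "{x \<in> fst c. snd c x \<in> {u \<in> topspace (Rn dm). u i \<in> A}} \<in> sets BX" .
    have 2: "fst c \<in> sets BX" using chart_open(1) by blast
    have "(\<lambda>x. crd c x i) -` A \<inter> space BX =
        {x \<in> fst c. snd c x \<in> {u \<in> topspace (Rn dm). u i \<in> A}} \<union> (if 0 \<in> A then space BX - fst c else {})"
      using i chart_subset chart_image_subset by (auto simp: crd_def topspace_Rn split: if_splits)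
    also have "\<dots> \<in> sets BX" using 1 2 by auto
    finally show "(\<lambda>x. crd c x i) -` A \<inter> space BX \<in> sets BX" .
  qed
  then show "(\<lambda>x. crd c x i) \<in> measurable BX lborel" by simp
qed

lemma measurable_cinv [measurable]: "cinv c \<in> measurable (leb dm) BX"
  unfolding BX_def
proof (rule measurable_measure_of)
  show "{U. openin T U} \<subseteq> Pow (topspace T)" using openin_subset by blast
  show "cinv c \<in> space (leb dm) \<rightarrow> topspace T" using cinv_topspace by blast
  fix U assume "U \<in> {U. openin T U}"
  then have U: "openin T U" by simp
  have "cinv c -` U \<inter> space (leb dm) = snd c ` (U \<inter> fst c) \<union>
      (if (SOME x. x \<in> topspace T) \<in> U then space (leb dm) - snd c ` fst c else {})"
  proof (intro equalityI subsetI)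
    fix u assume u: "u \<in> cinv c -` U \<inter> space (leb dm)"
    show "u \<in> snd c ` (U \<inter> fst c) \<union> (if (SOME x. x \<in> topspace T) \<in> U then space (leb dm) - snd c ` fst c else {})"
    proof (cases "u \<in> snd c ` fst c")
      case True
      from cinv_in[OF this] u have "u = snd c (cinv c u)" "cinv c u \<in> U \<inter> fst c" by auto
      then show ?thesis by blast
    next
      case False
      then show ?thesis using u by (auto simp: cinv_def)
    qed
  next
    fix u assume u: "u \<in> snd c ` (U \<inter> fst c) \<union> (if (SOME x. x \<in> topspace T) \<in> U then space (leb dm) - snd c ` fst c else {})"
    show "u \<in> cinv c -` U \<inter> space (leb dm)"
    proof (cases "u \<in> snd c ` fst c")
      case True
      from u True obtain x where "u = snd c x" "x \<in> U" "x \<in> fst c" by (auto split: if_splits)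
      then show ?thesis using chart_image_subset by (auto simp: space_leb)
    next
      case False
      then show ?thesis using u by (auto simp: space_leb cinv_def[of c u] split: if_splits)
    qed
  qed
  also have "\<dots> \<in> sets (leb dm)"
    using openin_sets_leb[OF chart_open_image[OF U]] openin_sets_leb[OF chart_open(2)] by auto
  finally show "cinv c -` U \<inter> space (leb dm) \<in> sets (leb dm)" .
qed

lemma chart_image_sets: "E \<in> sets BX \<Longrightarrow> snd c ` (E \<inter> fst c) \<in> sets (leb dm)"
proof -
  assume E: "E \<in> sets BX"
  have "snd c ` (E \<inter> fst c) = (cinv c -` E \<inter> space (leb dm)) \<inter> snd c ` fst c"
  proof (intro equalityI subsetI)
    fix u assume u: "u \<in> (cinv c -` E \<inter> space (leb dm)) \<inter> snd c ` fst c"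
    then have "u = snd c (cinv c u)" "cinv c u \<in> E \<inter> fst c" using cinv_in[of u] by auto
    then show "u \<in> snd c ` (E \<inter> fst c)" by blast
  qed (use chart_image_subset in \<open>auto simp: space_leb\<close>)
  also have "\<dots> \<in> sets (leb dm)"
    using measurable_sets[OF measurable_cinv E] openin_sets_leb[OF chart_open(2)] by auto
  finally show ?thesis .
qed

lemma chart_cube_at:
  assumes x: "x \<in> fst c" and U: "openin T U" "x \<in> U"
  shows "\<exists>r>0. cube dm (snd c x) r \<subseteq> snd c ` (U \<inter> fst c)"
  using chart_open_image[OF U(1)] x U(2) unfolding openin_Rn by blast

end

lemma act_in: "x \<in> topspace T \<Longrightarrow> act s x \<in> topspace T"
  using C1 unfolding C1_continuous_action_def continuous_action_def by blast

lemma act_0 [simp]: "x \<in> topspace T \<Longrightarrow> act 0 x = x"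
  using C1 unfolding C1_continuous_action_def continuous_action_def by blast

lemma act_add: "x \<in> topspace T \<Longrightarrow> act (s + t) x = act s (act t x)"
  using C1 unfolding C1_continuous_action_def continuous_action_def by blast

lemma act_minus [simp]: "x \<in> topspace T \<Longrightarrow> act (- s) (act s x) = x" "x \<in> topspace T \<Longrightarrow> act s (act (- s) x) = x"
  using act_add[of x "- s" s] act_add[of x s "- s"] by auto

lemma act_continuous: "continuous_map (prod_topology euclidean T) T (\<lambda>(s, x). act s x)"
  using C1 unfolding C1_continuous_action_def continuous_action_def by blast

lemma act_continuous_right: "continuous_map T T (act s)"
proof -
  have "continuous_map T (prod_topology euclidean T) (\<lambda>x. (s, x))"
    by (intro continuous_map_pairedI) auto
  from continuous_map_compose[OF this act_continuous] show ?thesis by (simp add: comp_def)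
qed

lemma measurable_act [measurable]: "act s \<in> measurable BX BX"
  unfolding BX_def
proof (rule measurable_measure_of)
  show "{U. openin T U} \<subseteq> Pow (topspace T)" using openin_subset by blast
  show "act s \<in> space (sigma (topspace T) {U. openin T U}) \<rightarrow> topspace T"
    using act_in space_BX unfolding BX_def by auto
  fix U assume "U \<in> {U. openin T U}"
  then have "openin T {x \<in> topspace T. act s x \<in> U}"
    by (intro openin_continuous_map_preimage[OF act_continuous_right]) simp
  moreover have "act s -` U \<inter> topspace T = {x \<in> topspace T. act s x \<in> U}" by auto
  ultimately show "act s -` U \<inter> space (sigma (topspace T) {U. openin T U}) \<in> sets (sigma (topspace T) {U. openin T U})"
    using openin_sets_BX space_BX unfolding BX_def by metis
qed

text \<open>The Jacobian is continuous in the group element and the point jointly, hence bounded on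
  a product neighbourhood of \<open>(s0, x0)\<close>; the mean value inequality gives one Lipschitz
  constant for all \<open>s\<close> near \<open>s0\<close>. This uniformity in \<open>s\<close> is
  what the local bounds on the kernels use.\<close>

lemma act_Lipschitz:
  assumes c: "c \<in> atlas X" and c': "c' \<in> atlas X" and x0: "x0 \<in> fst c" and s0: "act s0 x0 \<in> fst c'"
  shows "\<exists>A \<rho> B. open A \<and> s0 \<in> A \<and> \<rho> > 0 \<and> B \<ge> 0 \<and> cube dm (snd c x0) \<rho> \<subseteq> snd c ` fst c \<and>
    (\<forall>s\<in>A. \<forall>u\<in>cube dm (snd c x0) \<rho>. act s (cinv c u) \<in> fst c') \<and>
    (\<forall>s\<in>A. \<forall>u\<in>cube dm (snd c x0) \<rho>. \<forall>v\<in>cube dm (snd c x0) \<rho>. \<forall>r. (\<forall>j<dm. \<bar>u j - v j\<bar> \<le> r) \<longrightarrow>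
      (\<forall>i<dm. \<bar>snd c' (act s (cinv c u)) i - snd c' (act s (cinv c v)) i\<bar> \<le> B * r))"
proof -
  let ?\<Omega> = "{(s, x). x \<in> fst c \<and> act s x \<in> fst c'}"
  let ?P = "prod_topology (euclidean :: 'g topology) T"
  obtain J where J: "\<And>s x. x \<in> fst c \<Longrightarrow> act s x \<in> fst c' \<Longrightarrow> has_derivative_in_charts dm c c' (act s) (J s x) x"
    and Jc: "\<And>i j. i < dm \<Longrightarrow> j < dm \<Longrightarrow> continuous_map (subtopology ?P ?\<Omega>) euclideanreal (\<lambda>(s, x). J s x i j)"
    using C1 c c' unfolding C1_continuous_action_def by blast
  have \<Omega>: "openin ?P ?\<Omega>"
  proof -
    have 1: "openin ?P {z \<in> topspace ?P. (\<lambda>(s, x). act s x) z \<in> fst c'}"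
      by (rule openin_continuous_map_preimage[OF act_continuous chart_open(1)[OF c']])
    have 2: "openin ?P {z \<in> topspace ?P. snd z \<in> fst c}"
      by (rule openin_continuous_map_preimage[OF continuous_map_snd chart_open(1)[OF c]])
    have "?\<Omega> = {z \<in> topspace ?P. (\<lambda>(s, x). act s x) z \<in> fst c'} \<inter> {z \<in> topspace ?P. snd z \<in> fst c}"
      using chart_subset[OF c] by auto
    then show ?thesis using openin_Int[OF 1 2] by simp
  qed
  \<comment> \<open>The summand 1 makes the bound strict at \<open>(s0, x0)\<close>, so that it
    persists on an open set; the inserted 0 covers dimension 0.\<close>
  define B where "B = 1 + Max (insert 0 ((\<lambda>(i, j). \<bar>J s0 x0 i j\<bar>) ` ({..<dm} \<times> {..<dm})))"
  have B: "\<bar>J s0 x0 i j\<bar> < B" if "i < dm" "j < dm" for i j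
  proof -
    have "\<bar>J s0 x0 i j\<bar> \<le> Max (insert 0 ((\<lambda>(i, j). \<bar>J s0 x0 i j\<bar>) ` ({..<dm} \<times> {..<dm})))"
      using that by (intro Max_ge) (auto intro!: image_eqI[of _ _ "(i, j)"])
    then show ?thesis by (simp add: B_def)
  qed
  have "B \<ge> 1" unfolding B_def using Max_ge[of "insert 0 ((\<lambda>(i, j). \<bar>J s0 x0 i j\<bar>) ` ({..<dm} \<times> {..<dm}))" 0] by simp
  define \<Omega>' where "\<Omega>' = {z \<in> ?\<Omega>. \<forall>i<dm. \<forall>j<dm. \<bar>J (fst z) (snd z) i j\<bar> < B}"
  define W where "W = (\<lambda>(i, j). {z \<in> ?\<Omega>. (\<lambda>(s, x). J s x i j) z \<in> {- B <..< B}})"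
  have "openin ?P (W ij)" if ij0: "ij \<in> {..<dm} \<times> {..<dm}" for ij
  proof -
    obtain i j where ij: "ij = (i, j)" "i < dm" "j < dm" using ij0 by auto
    have o: "openin (subtopology ?P ?\<Omega>) {z \<in> topspace (subtopology ?P ?\<Omega>). (\<lambda>(s, x). J s x i j) z \<in> {- B <..< B}}"
      by (rule openin_continuous_map_preimage[OF Jc[OF ij(2,3)]]) auto
    have e: "topspace (subtopology ?P ?\<Omega>) = ?\<Omega>" using openin_subset[OF \<Omega>] by auto
    from openin_trans_full[OF o[unfolded e] \<Omega>] show ?thesis by (simp add: W_def ij(1))
  qed
  then have "openin ?P (\<Inter> (insert ?\<Omega> (W ` ({..<dm} \<times> {..<dm}))))"
    using \<Omega> by (intro openin_Inter) auto
  moreover have "\<Inter> (insert ?\<Omega> (W ` ({..<dm} \<times> {..<dm}))) = \<Omega>'"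
  proof (intro equalityI subsetI)
    fix z assume z: "z \<in> \<Inter> (insert ?\<Omega> (W ` ({..<dm} \<times> {..<dm})))"
    have "\<bar>J (fst z) (snd z) i j\<bar> < B" if "i < dm" "j < dm" for i j
    proof -
      have "z \<in> W (i, j)" using z that by blast
      then show ?thesis by (auto simp: W_def abs_less_iff)
    qed
    then show "z \<in> \<Omega>'" using z unfolding \<Omega>'_def by blast
  next
    fix z assume z: "z \<in> \<Omega>'"
    have "z \<in> W (i, j)" if "i < dm" "j < dm" for i j
    proof -
      have "\<bar>J (fst z) (snd z) i j\<bar> < B" "z \<in> ?\<Omega>" using z that unfolding \<Omega>'_def by blast+
      then show ?thesis by (simp add: W_def split_def abs_less_iff)
    qed
    then show "z \<in> \<Inter> (insert ?\<Omega> (W ` ({..<dm} \<times> {..<dm})))" using z unfolding \<Omega>'_def by blast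
  qed
  ultimately have "openin ?P \<Omega>'" by simp
  moreover have "(s0, x0) \<in> \<Omega>'" unfolding \<Omega>'_def using B x0 s0 by simp
  ultimately have "\<exists>U V. openin euclidean U \<and> openin T V \<and> s0 \<in> U \<and> x0 \<in> V \<and> U \<times> V \<subseteq> \<Omega>'"
    unfolding openin_prod_topology_alt by blast
  then obtain A V where AV: "openin euclidean A" "openin T V" "s0 \<in> A" "x0 \<in> V" "A \<times> V \<subseteq> \<Omega>'" by (elim exE conjE)
  from chart_cube_at[OF c x0 AV(2,4)] obtain \<rho> where \<rho>: "\<rho> > 0" "cube dm (snd c x0) \<rho> \<subseteq> snd c ` (V \<inter> fst c)" by blast
  have sub: "cube dm (snd c x0) \<rho> \<subseteq> snd c ` fst c" using \<rho>(2) by blast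
  have inV: "cinv c u \<in> V \<inter> fst c \<and> snd c (cinv c u) = u" if "u \<in> cube dm (snd c x0) \<rho>" for u
    using that \<rho>(2) c by auto
  have in\<Omega>: "(s, cinv c u) \<in> \<Omega>'" if "s \<in> A" "u \<in> cube dm (snd c x0) \<rho>" for s u
    using inV[OF that(2)] that(1) AV(5) by blast
  show ?thesis
  proof (rule exI[of _ A], rule exI[of _ \<rho>], rule exI[of _ "real dm * B"], intro conjI ballI allI impI)
    show "open A" using AV(1) by (simp only: open_openin)
    show "s0 \<in> A" "\<rho> > 0" "cube dm (snd c x0) \<rho> \<subseteq> snd c ` fst c" by fact+
    show "0 \<le> real dm * B" using \<open>B \<ge> 1\<close> by simp
    show "act s (cinv c u) \<in> fst c'" if "s \<in> A" "u \<in> cube dm (snd c x0) \<rho>" for s u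
      using in\<Omega>[OF that] unfolding \<Omega>'_def by blast
    fix s u v r i assume s: "s \<in> A" and u: "u \<in> cube dm (snd c x0) \<rho>" and v: "v \<in> cube dm (snd c x0) \<rho>"
      and r: "\<forall>j<dm. \<bar>u j - v j\<bar> \<le> r" and i: "i < dm"
    let ?f = "snd c' \<circ> act s \<circ> inv_into (fst c) (snd c)"
    have f: "?f w = snd c' (act s (cinv c w))" if "w \<in> cube dm (snd c x0) \<rho>" for w
    proof -
      have "w \<in> snd c ` fst c" using that sub by (rule subsetD[rotated])
      then show ?thesis by (simp only: cinv_def if_True comp_apply)
    qed
    have "\<bar>?f u i - ?f v i\<bar> \<le> real dm * (B * r)"
    proof (rule has_jacobian_cube_Lipschitz[OF _ _ u v _ i])
      fix w assume w: "w \<in> cube dm (snd c x0) \<rho>"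
      have "has_derivative_in_charts dm c c' (act s) (J s (cinv c w)) (cinv c w)"
      proof (rule J)
        show "cinv c w \<in> fst c" "act s (cinv c w) \<in> fst c'" using in\<Omega>[OF s w] unfolding \<Omega>'_def by blast+
      qed
      then show "has_jacobian dm dm ?f (J s (cinv c w)) w"
        unfolding has_derivative_in_charts_def using inV[OF w] by simp
      show "\<bar>J s (cinv c w) i j\<bar> \<le> B" if "i < dm" "j < dm" for i j
        using in\<Omega>[OF s w] that by (simp add: \<Omega>'_def less_imp_le)
    qed (use r in auto)
    then show "\<bar>snd c' (act s (cinv c u)) i - snd c' (act s (cinv c v)) i\<bar> \<le> real dm * B * r"
      by (simp only: f[OF u] f[OF v] mult.assoc)
  qed
qed

end

text \<open>The Lindelof property of the coordinate space. It turns local statements about null sets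
  and measurability inside a chart into countable unions.\<close>

lemma ratcubes_localize:
  assumes "\<And>u. u \<in> A \<Longrightarrow> \<exists>S. openin (Rn N) S \<and> u \<in> S \<and> P S"
    and "\<And>S q \<rho>. P S \<Longrightarrow> cube N q \<rho> \<subseteq> S \<Longrightarrow> P (cube N q \<rho>)"
  shows "\<exists>Q. countable Q \<and> A \<subseteq> (\<Union>c\<in>Q. cube N (fst c) (snd c)) \<and> (\<forall>c\<in>Q. P (cube N (fst c) (snd c)))"
proof (intro exI conjI)
  let ?Q = "{c \<in> ratcubes N. P (cube N (fst c) (snd c))}"
  show "countable ?Q" by (rule countable_subset[OF _ countable_ratcubes[of N]]) auto
  show "A \<subseteq> (\<Union>c\<in>?Q. cube N (fst c) (snd c))"
  proof
    fix u assume "u \<in> A"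
    from assms(1)[OF this] obtain S where S: "openin (Rn N) S" "u \<in> S" "P S" by blast
    from openin_ratcube[OF S(1,2)] obtain q \<rho> where q: "(q, \<rho>) \<in> ratcubes N" "u \<in> cube N q \<rho>" "cube N q \<rho> \<subseteq> S" by blast
    from assms(2)[OF S(3) q(3)] q show "u \<in> (\<Union>c\<in>?Q. cube N (fst c) (snd c))"
      by (intro UN_I[of "(q, \<rho>)"]) auto
  qed
qed auto

lemma emeasure_density_indicator:
  "S \<in> sets M \<Longrightarrow> Y \<in> sets M \<Longrightarrow> emeasure (density M (indicator S)) Y = emeasure M (S \<inter> Y)"
  by (simp add: emeasure_density indicator_inter_arith[symmetric])

lemma PiM_density_indicator:
  assumes I: "finite I" and sf: "\<And>i. i \<in> I \<Longrightarrow> sigma_finite_measure (\<rho> i)"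
    and sf': "\<And>i. i \<in> I \<Longrightarrow> sigma_finite_measure (density (\<rho> i) (indicator (A i)))"
    and A: "\<And>i. i \<in> I \<Longrightarrow> A i \<in> sets (\<rho> i)"
  shows "Pi\<^sub>M I (\<lambda>i. density (\<rho> i) (indicator (A i))) = density (Pi\<^sub>M I \<rho>) (indicator (Pi\<^sub>E I A))"
proof (rule PiM_eq_box[OF I sf', symmetric])
  show "sets (density (Pi\<^sub>M I \<rho>) (indicator (Pi\<^sub>E I A))) = sets (Pi\<^sub>M I (\<lambda>i. density (\<rho> i) (indicator (A i))))"
    by (simp, rule sets_PiM_cong) auto
  fix B assume "\<And>i. i \<in> I \<Longrightarrow> B i \<in> sets (density (\<rho> i) (indicator (A i)))"
  then have B: "B i \<in> sets (\<rho> i)" if "i \<in> I" for i using that by simp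
  have "emeasure (density (Pi\<^sub>M I \<rho>) (indicator (Pi\<^sub>E I A))) (Pi\<^sub>E I B) = emeasure (Pi\<^sub>M I \<rho>) (Pi\<^sub>E I A \<inter> Pi\<^sub>E I B)"
    using I A B by (intro emeasure_density_indicator sets_PiM_I_finite)
  also have "Pi\<^sub>E I A \<inter> Pi\<^sub>E I B = Pi\<^sub>E I (\<lambda>i. A i \<inter> B i)" by (rule PiE_Int)
  also have "emeasure (Pi\<^sub>M I \<rho>) \<dots> = (\<Prod>i\<in>I. emeasure (\<rho> i) (A i \<inter> B i))"
    using A B by (intro emeasure_PiM_box I sf) auto
  also have "\<dots> = (\<Prod>i\<in>I. emeasure (density (\<rho> i) (indicator (A i))) (B i))"
    using A B by (intro prod.cong refl emeasure_density_indicator[symmetric])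
  finally show "emeasure (density (Pi\<^sub>M I \<rho>) (indicator (Pi\<^sub>E I A))) (Pi\<^sub>E I B) =
     (\<Prod>i\<in>I. emeasure (density (\<rho> i) (indicator (A i))) (B i))" .
qed

lemma open_blocks:
  assumes "\<And>i. i < p \<Longrightarrow> openin (Rn d) (I i)"
  shows "openin (Rn (p * d)) {u \<in> extensional {..<p * d}. \<forall>i<p. block p d u i \<in> I i}"
  unfolding openin_Rn
proof (intro conjI ballI)
  fix u assume u: "u \<in> {u \<in> extensional {..<p * d}. \<forall>i<p. block p d u i \<in> I i}"
  have "\<forall>i. \<exists>r>0. i < p \<longrightarrow> cube d (block p d u i) r \<subseteq> I i"
  proof
    fix i
    show "\<exists>r>0. i < p \<longrightarrow> cube d (block p d u i) r \<subseteq> I i"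
    proof (cases "i < p")
      case True
      then have "block p d u i \<in> I i" using u by blast
      then show ?thesis using assms[OF True] unfolding openin_Rn by blast
    qed (auto intro: exI[of _ 1])
  qed
  then obtain r where r: "\<And>i. r i > 0" "\<And>i. i < p \<Longrightarrow> cube d (block p d u i) (r i) \<subseteq> I i" by metis
  define m where "m = Min (insert 1 (r ` {..<p}))"
  have "m > 0" unfolding m_def using r(1) by (subst Min_gr_iff) auto
  moreover have "cube (p * d) u m \<subseteq> {u \<in> extensional {..<p * d}. \<forall>i<p. block p d u i \<in> I i}"
  proof
    fix w assume w: "w \<in> cube (p * d) u m"
    have "block p d w i \<in> I i" if i: "i < p" for i
    proof -
      have le: "m \<le> r i" unfolding m_def using i by (intro Min_le) auto
      have "\<bar>block p d w i k - block p d u i k\<bar> < r i" if "k < d" for k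
        using w block_index[OF i that] le i that by (force simp: mem_cube block_def)
      then have "block p d w i \<in> cube d (block p d u i) (r i)" using i by (simp add: mem_cube block_def)
      then show ?thesis using r(2)[OF i] by blast
    qed
    then show "w \<in> {u \<in> extensional {..<p * d}. \<forall>i<p. block p d u i \<in> I i}" using w by (simp add: mem_cube)
  qed
  ultimately show "\<exists>r>0. cube (p * d) u r \<subseteq> {u \<in> extensional {..<p * d}. \<forall>i<p. block p d u i \<in> I i}" by blast
qed auto

section \<open>Null sets of \<open>X\<close> and of its powers\<close>

context C1_action
begin

text \<open>The Lipschitz constant \<open>B\<close> belongs to \<open>act (- s)\<close>: in charts,
  \<open>act s\<close> is expansive because its inverse is Lipschitz. This bounds the volume of a
  preimage under \<open>act s\<close> although no Jacobian determinant is computed.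
  \<open>B + 1\<close> makes the constant positive.\<close>

lemma expansive_chart:
  assumes c: "c \<in> atlas X" and c': "c' \<in> atlas X" and S: "S \<in> sets (leb dm)" "S \<subseteq> snd c ` fst c"
    and SQ: "\<And>u. u \<in> S \<Longrightarrow> act s (cinv c u) \<in> fst c' \<and> snd c' (act s (cinv c u)) \<in> Q"
    and B: "B \<ge> 0" "\<And>v w r i. v \<in> Q \<Longrightarrow> w \<in> Q \<Longrightarrow> (\<And>j. j < dm \<Longrightarrow> \<bar>v j - w j\<bar> \<le> r) \<Longrightarrow> i < dm \<Longrightarrow>
        \<bar>snd c (act (- s) (cinv c' v)) i - snd c (act (- s) (cinv c' w)) i\<bar> \<le> B * r"
    and E: "E \<in> sets (leb dm)"
  shows "emeasure (leb dm) (S \<inter> {u. snd c' (act s (cinv c u)) \<in> E}) \<le> ennreal ((4 * (B + 1)) ^ dm) * emeasure (leb dm) E"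
proof -
  let ?\<psi> = "\<lambda>u. crd c' (act s (cinv c u))"
  have \<psi>: "?\<psi> u = snd c' (act s (cinv c u))" if "u \<in> S" for u using SQ[OF that] by (simp add: crd_def)
  have inv: "snd c (act (- s) (cinv c' (?\<psi> u))) = u" if "u \<in> S" for u
  proof -
    have "cinv c' (?\<psi> u) = act s (cinv c u)" using SQ[OF that] c' by (simp add: \<psi>[OF that])
    moreover have "act (- s) (act s (cinv c u)) = cinv c u" using cinv_topspace[OF c] by simp
    ultimately show ?thesis using cinv_in[OF c, of u] S(2) that by auto
  qed
  have m: "?\<psi> \<in> measurable (leb dm) (leb dm)"
    by (rule measurable_compose[OF measurable_compose[OF measurable_cinv[OF c] measurable_act] measurable_crd[OF c']])
  have "emeasure (leb dm) (S \<inter> ?\<psi> -` E) \<le> ennreal ((4 * (B + 1)) ^ dm) * emeasure (leb dm) E"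
  proof (rule expansive_emeasure[OF E])
    show "B + 1 > 0" using B by simp
    show "S \<inter> ?\<psi> -` E' \<in> sets (leb dm)" if "E' \<in> sets (leb dm)" for E'
    proof -
      have "S \<inter> ?\<psi> -` E' = S \<inter> (?\<psi> -` E' \<inter> space (leb dm))" using sets.sets_into_space[OF S(1)] by blast
      then show ?thesis using measurable_sets[OF m that] S(1) by auto
    qed
    show "u \<in> extensional {..<dm} \<and> ?\<psi> u \<in> extensional {..<dm}" if "u \<in> S" for u
      using sets.sets_into_space[OF S(1)] that measurable_space[OF m, of u] by (auto simp: space_leb)
    fix u v r i assume uv: "u \<in> S" "v \<in> S" and r: "\<And>i. i < dm \<Longrightarrow> \<bar>?\<psi> u i - ?\<psi> v i\<bar> < r" and i: "i < dm"
    have "\<bar>snd c (act (- s) (cinv c' (?\<psi> u))) i - snd c (act (- s) (cinv c' (?\<psi> v))) i\<bar> \<le> B * r"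
      using r by (intro B(2) i) (use SQ uv in \<open>auto simp: \<psi> intro: less_imp_le\<close>)
    then have "\<bar>u i - v i\<bar> \<le> B * r" by (simp only: inv[OF uv(1)] inv[OF uv(2)])
    also have "\<dots> \<le> (B + 1) * r" using r[OF i] by (intro mult_right_mono) auto
    finally show "\<bar>u i - v i\<bar> \<le> (B + 1) * r" .
  qed
  moreover have "S \<inter> ?\<psi> -` E = S \<inter> {u. snd c' (act s (cinv c u)) \<in> E}" using \<psi> by auto
  ultimately show ?thesis by simp
qed

text \<open>Describes the null sets of the Lebesgue measure class without choosing a measure on
  \<open>X\<close>. They are null only locally, as \<open>X\<close> need not be
  sigma-compact.\<close>

definition locnull :: "'x set \<Rightarrow> bool" where
  "locnull E \<longleftrightarrow> E \<in> sets BX \<and> (\<forall>c\<in>atlas X. snd c ` (E \<inter> fst c) \<in> null_sets (leb dm))"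

text \<open>One suitable chart around each point of \<open>E\<close> is assumed, all charts are
  reached in the conclusion; so invariance under the action and independence of the chart are proved
  at once. Near each point the bound of \<open>expansive_chart\<close> is a multiple of zero, and
  countably many cubes cover the chart image.\<close>

lemma locnull_act_vimage:
  assumes E: "E \<in> sets BX" and loc: "\<And>y. y \<in> E \<Longrightarrow> \<exists>c\<in>atlas X. y \<in> fst c \<and> snd c ` (E \<inter> fst c) \<in> null_sets (leb dm)"
  shows "locnull {x \<in> topspace T. act s x \<in> E}"
  unfolding locnull_def
proof (intro conjI ballI)
  let ?E = "{x \<in> topspace T. act s x \<in> E}"
  have "?E = act s -` E \<inter> space BX" by auto
  then show E': "?E \<in> sets BX" using measurable_sets[OF measurable_act E] by simp
  fix c assume c: "c \<in> atlas X"
  let ?N = "snd c ` (?E \<inter> fst c)"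
  have Nm: "?N \<in> sets (leb dm)" by (rule chart_image_sets[OF c E'])
  have "\<exists>Q. countable Q \<and> ?N \<subseteq> (\<Union>c\<in>Q. cube dm (fst c) (snd c)) \<and> (\<forall>c\<in>Q. ?N \<inter> cube dm (fst c) (snd c) \<in> null_sets (leb dm))"
  proof (rule ratcubes_localize[where P = "\<lambda>S. ?N \<inter> S \<in> null_sets (leb dm)"])
    fix u assume "u \<in> ?N"
    then obtain x where x: "u = snd c x" "x \<in> fst c" "x \<in> topspace T" "act s x \<in> E" by blast
    obtain c' where c': "c' \<in> atlas X" "act s x \<in> fst c'" "snd c' ` (E \<inter> fst c') \<in> null_sets (leb dm)"
      using loc[OF x(4)] by blast
    have "act (- s) (act s x) \<in> fst c" using x by simp
    from act_Lipschitz[OF c'(1) c c'(2) this] obtain A \<rho> B where AB: "- s \<in> A" "\<rho> > 0" "B \<ge> 0"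
      and sub: "cube dm (snd c' (act s x)) \<rho> \<subseteq> snd c' ` fst c'"
      and Lip: "\<forall>sa\<in>A. \<forall>u\<in>cube dm (snd c' (act s x)) \<rho>. \<forall>v\<in>cube dm (snd c' (act s x)) \<rho>. \<forall>r. (\<forall>j<dm. \<bar>u j - v j\<bar> \<le> r) \<longrightarrow>
      (\<forall>i<dm. \<bar>snd c (act sa (cinv c' u)) i - snd c (act sa (cinv c' v)) i\<bar> \<le> B * r)"
      by (elim exE conjE) (rule that, assumption+)
    let ?Q = "cube dm (snd c' (act s x)) \<rho>"
    \<comment> \<open>The points that \<open>act s\<close> carries into the cube on which
      \<open>act (- s)\<close> has its Lipschitz bound.\<close>
    let ?O = "{y \<in> topspace T. act s y \<in> {z \<in> fst c'. snd c' z \<in> ?Q}}"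
    have O: "openin T ?O"
      by (rule openin_continuous_map_preimage[OF act_continuous_right chart_open_preimage[OF c'(1) openin_cube]])
    define S where "S = snd c ` (?O \<inter> fst c)"
    have So: "openin (Rn dm) S" unfolding S_def by (rule chart_open_image[OF c O])
    have "snd c' (act s x) \<in> ?Q" using c'(2) chart_image_subset[OF c'(1)] AB(2) by (intro center_in_cube) blast+
    then have uS: "u \<in> S" unfolding S_def using x c'(2) by blast
    have Sc: "cinv c v \<in> ?O \<inter> fst c" if "v \<in> S" for v using that c unfolding S_def by auto
    have "emeasure (leb dm) (S \<inter> {u. snd c' (act s (cinv c u)) \<in> snd c' ` (E \<inter> fst c')}) \<le>
        ennreal ((4 * (B + 1)) ^ dm) * emeasure (leb dm) (snd c' ` (E \<inter> fst c'))"
    proof (rule expansive_chart[OF c c'(1) openin_sets_leb[OF So] _ _ AB(3)])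
      show "S \<subseteq> snd c ` fst c" unfolding S_def by blast
      show "act s (cinv c u) \<in> fst c' \<and> snd c' (act s (cinv c u)) \<in> ?Q" if "u \<in> S" for u
        using Sc[OF that] by blast
      show "\<bar>snd c (act (- s) (cinv c' v)) i - snd c (act (- s) (cinv c' w)) i\<bar> \<le> B * r"
        if "v \<in> ?Q" "w \<in> ?Q" "\<And>j. j < dm \<Longrightarrow> \<bar>v j - w j\<bar> \<le> r" "i < dm" for v w r i
        by (rule Lip[rule_format, OF AB(1) that(1,2)]) (use that in auto)
    qed (use c'(3) in auto)
    also have "\<dots> = 0" using c'(3) by (simp add: null_sets_def)
    finally have z: "emeasure (leb dm) (S \<inter> {u. snd c' (act s (cinv c u)) \<in> snd c' ` (E \<inter> fst c')}) = 0" by simp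
    have meas: "S \<inter> {u. snd c' (act s (cinv c u)) \<in> snd c' ` (E \<inter> fst c')} = ?N \<inter> S"
    proof (intro equalityI subsetI)
      fix v assume v: "v \<in> S \<inter> {u. snd c' (act s (cinv c u)) \<in> snd c' ` (E \<inter> fst c')}"
      then have "cinv c v \<in> ?O \<inter> fst c" using Sc by blast
      moreover obtain y where "y \<in> E" "y \<in> fst c'" "snd c' (act s (cinv c v)) = snd c' y" using v by blast
      ultimately have "act s (cinv c v) \<in> E" using chart_inj[OF c'(1)] by (auto dest: inj_onD)
      moreover have "v = snd c (cinv c v)" using v c unfolding S_def by auto
      ultimately show "v \<in> ?N \<inter> S" using v \<open>cinv c v \<in> ?O \<inter> fst c\<close> by blast
    next
      fix v assume v: "v \<in> ?N \<inter> S"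
      then obtain y where y: "v = snd c y" "y \<in> fst c" "act s y \<in> E" by blast
      then have cy: "cinv c v = y" using c by simp
      moreover have "act s y \<in> fst c'" using Sc[of v] v cy by blast
      ultimately show "v \<in> S \<inter> {u. snd c' (act s (cinv c u)) \<in> snd c' ` (E \<inter> fst c')}" using v y by blast
    qed
    have "?N \<inter> S \<in> null_sets (leb dm)" using z Nm openin_sets_leb[OF So] unfolding meas by (auto simp: null_sets_def)
    then show "\<exists>S. openin (Rn dm) S \<and> u \<in> S \<and> ?N \<inter> S \<in> null_sets (leb dm)" using So uS by blast
  next
    fix S q \<rho> assume n: "?N \<inter> S \<in> null_sets (leb dm)" and sub: "cube dm q \<rho> \<subseteq> S"
    show "?N \<inter> cube dm q \<rho> \<in> null_sets (leb dm)"
      by (rule null_sets_subset[OF n sets.Int[OF Nm sets_cube]]) (use sub in blast)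
  qed
  then obtain Q where Q: "countable Q" "?N \<subseteq> (\<Union>c\<in>Q. cube dm (fst c) (snd c))"
    "\<And>c. c\<in>Q \<Longrightarrow> ?N \<inter> cube dm (fst c) (snd c) \<in> null_sets (leb dm)" by blast
  have "(\<Union>c\<in>Q. ?N \<inter> cube dm (fst c) (snd c)) \<in> null_sets (leb dm)"
    using Q(1,3) by (rule null_sets_UN')
  moreover have "(\<Union>c\<in>Q. ?N \<inter> cube dm (fst c) (snd c)) = ?N" using Q(2) by blast
  ultimately show "?N \<in> null_sets (leb dm)" by simp
qed

text \<open>The neutral element acts trivially, so this is the case \<open>s = 0\<close> of the
  preceding lemma.\<close>

lemma locnullI:
  assumes "E \<in> sets BX" "\<And>y. y \<in> E \<Longrightarrow> \<exists>c\<in>atlas X. y \<in> fst c \<and> snd c ` (E \<inter> fst c) \<in> null_sets (leb dm)"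
  shows "locnull E"
proof -
  have "{x \<in> topspace T. act 0 x \<in> E} = E" using sets.sets_into_space[OF assms(1)] by auto
  then show ?thesis using locnull_act_vimage[OF assms, of 0] by simp
qed

lemma locnull_act: "locnull E \<Longrightarrow> locnull {x \<in> topspace T. act s x \<in> E}"
proof (rule locnull_act_vimage)
  assume E: "locnull E"
  then show "E \<in> sets BX" by (simp add: locnull_def)
  fix y assume "y \<in> E"
  then have "y \<in> topspace T" using sets.sets_into_space[of E BX] E by (auto simp: locnull_def)
  then show "\<exists>c\<in>atlas X. y \<in> fst c \<and> snd c ` (E \<inter> fst c) \<in> null_sets (leb dm)"
    using chart_cover E by (auto simp: locnull_def)
qed

text \<open>Absolute continuity with respect to the Lebesgue measure class. These are the test
  measures for null sets in the powers, and the kernels belong to them.\<close>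

definition ac_prob :: "'x measure \<Rightarrow> bool" where
  "ac_prob \<rho> \<longleftrightarrow> prob_space \<rho> \<and> sets \<rho> = sets BX \<and> (\<forall>E. locnull E \<longrightarrow> emeasure \<rho> E = 0)"

lemma act_vimage_sets: "E \<in> sets BX \<Longrightarrow> {y \<in> topspace T. act s y \<in> E} \<in> sets BX"
proof -
  assume E: "E \<in> sets BX"
  have "{y \<in> topspace T. act s y \<in> E} = act s -` E \<inter> space BX" by auto
  then show ?thesis using measurable_sets[OF measurable_act E] by simp
qed

lemma ac_prob_distr_act: "ac_prob \<rho> \<Longrightarrow> ac_prob (distr \<rho> BX (act s))"
  unfolding ac_prob_def
proof (intro conjI allI impI)
  assume \<rho>: "prob_space \<rho> \<and> sets \<rho> = sets BX \<and> (\<forall>E. locnull E \<longrightarrow> emeasure \<rho> E = 0)"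
  then have [measurable_cong]: "sets \<rho> = sets BX" by simp
  have m: "act s \<in> measurable \<rho> BX" by simp
  show "prob_space (distr \<rho> BX (act s))" using \<rho> m by (intro prob_space.prob_space_distr) auto
  fix E assume E: "locnull E"
  have "act s -` E \<inter> space \<rho> = {x \<in> topspace T. act s x \<in> E}" using \<rho> sets_eq_imp_space_eq[of \<rho> BX] by auto
  then show "emeasure (distr \<rho> BX (act s)) E = 0"
    using E m \<rho> locnull_act[OF E] by (subst emeasure_distr) (auto simp: locnull_def)
qed simp

lemma ac_prob_uniform_cube:
  assumes c: "c \<in> atlas X" and r: "r > 0" and sub: "cube dm z r \<subseteq> snd c ` fst c"
  shows "ac_prob (distr (uniform_measure (leb dm) (cube dm z r)) BX (cinv c))"
  unfolding ac_prob_def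
proof (intro conjI allI impI)
  let ?Q = "cube dm z r"
  have m: "cinv c \<in> measurable (uniform_measure (leb dm) ?Q) BX" using measurable_cinv[OF c] by simp
  show "prob_space (distr (uniform_measure (leb dm) ?Q) BX (cinv c))"
    using r m by (intro prob_space.prob_space_distr prob_space_uniform_measure) (auto simp: emeasure_cube)
  fix E assume E: "locnull E"
  then have Em: "E \<in> sets BX" by (simp add: locnull_def)
  have "?Q \<inter> (cinv c -` E \<inter> space (leb dm)) \<subseteq> snd c ` (E \<inter> fst c)"
  proof
    fix u assume u: "u \<in> ?Q \<inter> (cinv c -` E \<inter> space (leb dm))"
    then have "u \<in> snd c ` fst c" using sub by blast
    from cinv_in[OF c this] u show "u \<in> snd c ` (E \<inter> fst c)" by (metis Int_iff image_eqI vimage_eq)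
  qed
  then have "emeasure (leb dm) (?Q \<inter> (cinv c -` E \<inter> space (leb dm))) \<le> emeasure (leb dm) (snd c ` (E \<inter> fst c))"
    by (rule emeasure_mono) (rule chart_image_sets[OF c Em])
  also have "\<dots> = 0" using E c by (auto simp: locnull_def null_sets_def)
  finally show "emeasure (distr (uniform_measure (leb dm) ?Q) BX (cinv c)) E = 0"
    using m Em measurable_sets[OF measurable_cinv[OF c] Em] by (subst emeasure_distr) (auto simp: emeasure_uniform_measure)
qed simp

abbreviation "BXp p \<equiv> Pi\<^sub>M {..<p} (\<lambda>_::nat. BX)"

text \<open>In charts these are the Lebesgue null sets (\<open>knull_if_chart_null\<close>, \<open>chart_null_if_knull\<close>); this definition is invariant under the diagonal action without any change of variables.\<close>

definition knull :: "nat \<Rightarrow> (nat \<Rightarrow> 'x) set \<Rightarrow> bool" where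
  "knull p N \<longleftrightarrow> N \<in> sets (BXp p) \<and> (\<forall>\<rho>. (\<forall>j<p. ac_prob (\<rho> j)) \<longrightarrow> emeasure (Pi\<^sub>M {..<p} \<rho>) N = 0)"

definition W :: "nat \<Rightarrow> (nat \<Rightarrow> 'x chart) \<Rightarrow> (nat \<Rightarrow> 'x) set" where
  "W p c = Pi\<^sub>E {..<p} (\<lambda>i. fst (c i))"

text \<open>\<open>Cm\<close> is the product chart, \<open>Ci\<close> its inverse, and \<open>Cr\<close> the Borel extension of \<open>Cm\<close> off the chart domain.\<close>

definition Cm :: "nat \<Rightarrow> (nat \<Rightarrow> 'x chart) \<Rightarrow> (nat \<Rightarrow> 'x) \<Rightarrow> nat \<Rightarrow> real" where
  "Cm p c = snd (power_chart dm p c)"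

definition Ci :: "nat \<Rightarrow> (nat \<Rightarrow> 'x chart) \<Rightarrow> (nat \<Rightarrow> real) \<Rightarrow> nat \<Rightarrow> 'x" where
  "Ci p c u = (\<lambda>i\<in>{..<p}. cinv (c i) (block p dm u i))"

definition Cr :: "nat \<Rightarrow> (nat \<Rightarrow> 'x chart) \<Rightarrow> (nat \<Rightarrow> 'x) \<Rightarrow> nat \<Rightarrow> real" where
  "Cr p c x = unblock p dm (\<lambda>i\<in>{..<p}. crd (c i) (x i))"

definition charts :: "nat \<Rightarrow> (nat \<Rightarrow> 'x chart) \<Rightarrow> bool" where
  "charts p c \<longleftrightarrow> (\<forall>i<p. c i \<in> atlas X)"

lemma Cr_eq_Cm: "x \<in> W p c \<Longrightarrow> Cr p c x = Cm p c x"
  by (rule ext) (auto simp: Cr_def Cm_def power_chart_def unblock_def crd_def W_def PiE_iff block_div)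

context
  fixes p c assumes ch: "charts p c"
begin

lemma W_sets: "W p c \<in> sets (BXp p)"
proof -
  have "fst (c i) \<in> sets BX" if "i < p" for i
    using openin_sets_BX[OF chart_open(1)[of "c i"]] ch that by (simp add: charts_def)
  then show ?thesis unfolding W_def by (intro sets_PiM_I_finite) auto
qed

lemma measurable_Cr [measurable]: "Cr p c \<in> measurable (BXp p) (leb (p * dm))"
proof -
  have "(\<lambda>x. \<lambda>i\<in>{..<p}. crd (c i) (x i)) \<in> measurable (BXp p) (Pi\<^sub>M {..<p} (\<lambda>_. leb dm))"
  proof (rule measurable_restrict)
    fix i assume i: "i \<in> {..<p}"
    then have "crd (c i) \<in> measurable BX (leb dm)" using ch measurable_crd by (simp add: charts_def)
    then show "(\<lambda>x. crd (c i) (x i)) \<in> measurable (BXp p) (leb dm)"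
      by (rule measurable_compose[OF measurable_component_singleton[OF i]])
  qed
  from measurable_compose[OF this measurable_unblock] show ?thesis unfolding Cr_def .
qed

lemma measurable_Ci [measurable]: "Ci p c \<in> measurable (leb (p * dm)) (BXp p)"
  unfolding Ci_def
  using ch by (intro measurable_restrict measurable_compose[OF measurable_compose[OF measurable_block measurable_component_singleton] measurable_cinv])
    (auto simp: charts_def)

lemma Ci_Cm [simp]: "x \<in> W p c \<Longrightarrow> Ci p c (Cm p c x) = x"
proof -
  assume x: "x \<in> W p c"
  have xi: "snd (c i) (x i) \<in> extensional {..<dm}" "cinv (c i) (snd (c i) (x i)) = x i" if "i < p" for i
  proof -
    have a: "c i \<in> atlas X" "x i \<in> fst (c i)" using ch x that by (auto simp: charts_def W_def)
    show "snd (c i) (x i) \<in> extensional {..<dm}" using chart_image_subset[OF a(1)] a(2) by blast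
    show "cinv (c i) (snd (c i) (x i)) = x i" using a by simp
  qed
  have "block p dm (Cm p c x) = (\<lambda>i\<in>{..<p}. snd (c i) (x i))"
  proof -
    have "Cm p c x = unblock p dm (\<lambda>i\<in>{..<p}. snd (c i) (x i))"
      by (rule ext) (auto simp: Cm_def power_chart_def unblock_def block_div)
    then show ?thesis using block_unblock[of "\<lambda>i\<in>{..<p}. snd (c i) (x i)" p dm] xi(1) by simp
  qed
  then show ?thesis using xi(2) x by (auto simp: Ci_def W_def PiE_iff extensional_def restrict_def)
qed

lemma Cm_block: "x \<in> W p c \<Longrightarrow> i < p \<Longrightarrow> block p dm (Cm p c x) i = snd (c i) (x i)"
proof -
  assume x: "x \<in> W p c" and i: "i < p"
  have a: "c i \<in> atlas X" "x i \<in> fst (c i)" using ch x i by (auto simp: charts_def W_def)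
  then have e: "snd (c i) (x i) \<in> extensional {..<dm}" using chart_image_subset[OF a(1)] by blast
  show ?thesis
  proof
    fix k
    show "block p dm (Cm p c x) i k = snd (c i) (x i) k"
    proof (cases "k < dm")
      case True
      then show ?thesis using block_index[OF i True] i by (simp add: block_def Cm_def power_chart_def)
    next
      case False
      then show ?thesis using i e by (simp add: block_def extensional_def)
    qed
  qed
qed

lemma Cm_Ci [simp]: "u \<in> extensional {..<p * dm} \<Longrightarrow> (\<And>i. i < p \<Longrightarrow> block p dm u i \<in> snd (c i) ` fst (c i)) \<Longrightarrow> Ci p c u \<in> W p c \<and> Cm p c (Ci p c u) = u"
proof -
  assume u: "u \<in> extensional {..<p * dm}" and b: "\<And>i. i < p \<Longrightarrow> block p dm u i \<in> snd (c i) ` fst (c i)"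
  have ci: "cinv (c i) (block p dm u i) \<in> fst (c i) \<and> snd (c i) (cinv (c i) (block p dm u i)) = block p dm u i" if "i < p" for i
    using ch b[OF that] that by (intro cinv_in) (auto simp: charts_def)
  then have w: "Ci p c u \<in> W p c" by (simp add: Ci_def W_def PiE_iff)
  have "Cm p c (Ci p c u) = unblock p dm (\<lambda>i\<in>{..<p}. snd (c i) (Ci p c u i))"
    by (rule ext) (auto simp: Cm_def power_chart_def unblock_def block_div)
  also have "(\<lambda>i\<in>{..<p}. snd (c i) (Ci p c u i)) = block p dm u"
    by (rule ext) (use ci in \<open>simp add: Ci_def restrict_def block_def\<close>)
  finally show ?thesis using unblock_block[OF u] w by simp
qed

lemma Cm_ext: "Cm p c x \<in> extensional {..<p * dm}"
  by (simp add: Cm_def power_chart_def)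

lemma Cm_image_box:
  assumes "\<And>i. i < p \<Longrightarrow> openin T (Ob i)"
  shows "openin (Rn (p * dm)) (Cm p c ` (Pi\<^sub>E {..<p} Ob \<inter> W p c))"
proof -
  have "Cm p c ` (Pi\<^sub>E {..<p} Ob \<inter> W p c) = {u \<in> extensional {..<p * dm}. \<forall>i<p. block p dm u i \<in> snd (c i) ` (Ob i \<inter> fst (c i))}"
  proof (intro equalityI subsetI)
    fix u assume "u \<in> Cm p c ` (Pi\<^sub>E {..<p} Ob \<inter> W p c)"
    then obtain x where x: "u = Cm p c x" "x \<in> W p c" "x \<in> Pi\<^sub>E {..<p} Ob" by blast
    then have "x i \<in> Ob i \<inter> fst (c i)" if "i < p" for i using that by (auto simp: W_def)
    then show "u \<in> {u \<in> extensional {..<p * dm}. \<forall>i<p. block p dm u i \<in> snd (c i) ` (Ob i \<inter> fst (c i))}"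
      using Cm_ext x Cm_block[OF x(2)] by auto
  next
    fix u assume u: "u \<in> {u \<in> extensional {..<p * dm}. \<forall>i<p. block p dm u i \<in> snd (c i) ` (Ob i \<inter> fst (c i))}"
    then have 1: "Ci p c u \<in> W p c \<and> Cm p c (Ci p c u) = u" by (intro Cm_Ci) auto
    have "Ci p c u i \<in> Ob i" if i: "i < p" for i
    proof -
      obtain y where y: "block p dm u i = snd (c i) y" "y \<in> Ob i" "y \<in> fst (c i)" using u i by blast
      then have "cinv (c i) (block p dm u i) = y" using ch i by (simp add: charts_def)
      then show ?thesis using y i by (simp add: Ci_def)
    qed
    then have "Ci p c u \<in> Pi\<^sub>E {..<p} Ob" by (simp add: Ci_def PiE_iff)
    with 1 show "u \<in> Cm p c ` (Pi\<^sub>E {..<p} Ob \<inter> W p c)" by (metis IntI image_eqI)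
  qed
  moreover have "openin (Rn (p * dm)) {u \<in> extensional {..<p * dm}. \<forall>i<p. block p dm u i \<in> snd (c i) ` (Ob i \<inter> fst (c i))}"
    using ch assms by (intro open_blocks chart_open_image) (auto simp: charts_def)
  ultimately show ?thesis by simp
qed

lemma Cm_image_open: "openin (Rn (p * dm)) (Cm p c ` W p c)"
proof -
  have "openin (Rn (p * dm)) (Cm p c ` (Pi\<^sub>E {..<p} (\<lambda>i. fst (c i)) \<inter> W p c))"
    using ch chart_open(1) by (intro Cm_image_box) (auto simp: charts_def)
  then show ?thesis by (simp add: W_def)
qed

lemma Cm_image_sets: "Y \<in> sets (BXp p) \<Longrightarrow> Cm p c ` (Y \<inter> W p c) \<in> sets (leb (p * dm))"
proof -
  assume Y: "Y \<in> sets (BXp p)"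
  have "Cm p c ` (Y \<inter> W p c) = (Ci p c -` Y \<inter> space (leb (p * dm))) \<inter> Cm p c ` W p c"
    by (auto simp: Cm_ext space_leb)
  then show ?thesis using measurable_sets[OF measurable_Ci Y] openin_sets_leb[OF Cm_image_open] by auto
qed

lemma Cm_vimage_sets: "S \<in> sets (leb (p * dm)) \<Longrightarrow> {x \<in> W p c. Cm p c x \<in> S} \<in> sets (BXp p)"
proof -
  assume S: "S \<in> sets (leb (p * dm))"
  have "{x \<in> W p c. Cm p c x \<in> S} = W p c \<inter> (Cr p c -` S \<inter> space (BXp p))"
    using sets.sets_into_space[OF W_sets] by (auto simp: Cr_eq_Cm)
  then show ?thesis using measurable_sets[OF measurable_Cr S] W_sets by auto
qed

end

lemma blocks_Ci_sets:
  assumes ch: "charts p c" and Q: "\<And>j. j < p \<Longrightarrow> Q j \<in> sets (leb dm)" and Y: "Y \<in> sets (BXp p)"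
  shows "{u \<in> extensional {..<p * dm}. (\<forall>j<p. block p dm u j \<in> Q j) \<and> Ci p c u \<in> Y} \<in> sets (leb (p * dm))"
proof -
  have "Pi\<^sub>E {..<p} Q \<in> sets (Pi\<^sub>M {..<p} (\<lambda>_. leb dm))" using Q by (intro sets_PiM_I_finite) auto
  from measurable_sets[OF measurable_block this]
  have 1: "block p dm -` Pi\<^sub>E {..<p} Q \<inter> space (leb (p * dm)) \<in> sets (leb (p * dm))" .
  have 2: "Ci p c -` Y \<inter> space (leb (p * dm)) \<in> sets (leb (p * dm))"
    using measurable_Ci[OF ch] Y by (rule measurable_sets)
  have "block p dm u \<in> Pi\<^sub>E {..<p} Q \<longleftrightarrow> (\<forall>j<p. block p dm u j \<in> Q j)" for u
  proof -
    have "block p dm u \<in> extensional {..<p}" by (simp add: block_def)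
    then show ?thesis by (simp add: PiE_iff Ball_def)
  qed
  then have "{u \<in> extensional {..<p * dm}. (\<forall>j<p. block p dm u j \<in> Q j) \<and> Ci p c u \<in> Y} =
     (block p dm -` Pi\<^sub>E {..<p} Q \<inter> space (leb (p * dm))) \<inter> (Ci p c -` Y \<inter> space (leb (p * dm)))"
    unfolding space_leb by blast
  then show ?thesis using sets.Int[OF 1 2] by simp
qed

text \<open>Trades a product of measures on \<open>X\<close> for Lebesgue measure in a product
  chart: the factors are pushed forward one by one, and \<open>unblock\<close> concatenates their
  coordinates.\<close>

lemma emeasure_PiM_cubes:
  assumes ch: "charts p c" and Q: "\<And>j. j < p \<Longrightarrow> Q j \<in> sets (leb dm) \<and> emeasure (leb dm) (Q j) \<noteq> \<infinity>" and Y: "Y \<in> sets (BXp p)"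
  shows "emeasure (Pi\<^sub>M {..<p} (\<lambda>j. distr (density (leb dm) (indicator (Q j))) BX (cinv (c j)))) Y =
    emeasure (leb (p * dm)) {u \<in> extensional {..<p * dm}. (\<forall>j<p. block p dm u j \<in> Q j) \<and> Ci p c u \<in> Y}"
proof -
  let ?\<rho> = "\<lambda>j. density (leb dm) (indicator (Q j))"
  let ?F = "\<lambda>y. \<lambda>j\<in>{..<p}. cinv (c j) (y j)"
  let ?Z = "{u \<in> extensional {..<p * dm}. (\<forall>j<p. block p dm u j \<in> Q j) \<and> Ci p c u \<in> Y}"
  have fin: "finite_measure (?\<rho> j)" if "j < p" for j
    using Q[OF that] by (intro finite_measureI) (simp add: emeasure_density_indicator)
  have cm: "cinv (c j) \<in> measurable (leb dm) BX" if "j < p" for j using ch that measurable_cinv by (auto simp: charts_def)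
  have Fm: "?F \<in> measurable (Pi\<^sub>M {..<p} (\<lambda>_. leb dm)) (BXp p)"
    using cm by (intro measurable_restrict measurable_compose[OF measurable_component_singleton]) auto
  have PQ: "Pi\<^sub>E {..<p} Q \<in> sets (Pi\<^sub>M {..<p} (\<lambda>_. leb dm))" using Q by (intro sets_PiM_I_finite) auto
  have FY: "?F -` Y \<inter> space (Pi\<^sub>M {..<p} (\<lambda>_. leb dm)) \<in> sets (Pi\<^sub>M {..<p} (\<lambda>_. leb dm))" using Fm Y by (rule measurable_sets)
  have d: "Pi\<^sub>M {..<p} ?\<rho> = density (Pi\<^sub>M {..<p} (\<lambda>_. leb dm)) (indicator (Pi\<^sub>E {..<p} Q))"
    using Q fin sigma_finite_leb by (intro PiM_density_indicator) (auto simp: finite_measure_def)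
  have "distr (Pi\<^sub>M {..<p} ?\<rho>) (BXp p) (\<lambda>y. \<lambda>j\<in>{..<p}. cinv (c j) (y (id j))) = Pi\<^sub>M {..<p} (\<lambda>j. distr (?\<rho> (id j)) BX (cinv (c j)))"
    using fin cm by (intro distr_PiM_reindex_map) auto
  then have "emeasure (Pi\<^sub>M {..<p} (\<lambda>j. distr (?\<rho> j) BX (cinv (c j)))) Y = emeasure (distr (Pi\<^sub>M {..<p} ?\<rho>) (BXp p) ?F) Y" by simp
  also have "\<dots> = emeasure (Pi\<^sub>M {..<p} (\<lambda>_. leb dm)) (Pi\<^sub>E {..<p} Q \<inter> (?F -` Y \<inter> space (Pi\<^sub>M {..<p} (\<lambda>_. leb dm))))"
    unfolding d using Fm Y PQ FY by (subst emeasure_distr) (auto simp: emeasure_density_indicator)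
  also have "Pi\<^sub>E {..<p} Q \<inter> (?F -` Y \<inter> space (Pi\<^sub>M {..<p} (\<lambda>_. leb dm))) = unblock p dm -` ?Z \<inter> space (Pi\<^sub>M {..<p} (\<lambda>_. leb dm))"
  proof -
    have "v \<in> Pi\<^sub>E {..<p} Q \<and> ?F v \<in> Y \<longleftrightarrow> unblock p dm v \<in> ?Z" if v: "v \<in> space (Pi\<^sub>M {..<p} (\<lambda>_. leb dm))" for v
    proof -
      have ve: "v \<in> Pi\<^sub>E {..<p} (\<lambda>_. extensional {..<dm})" using v by (simp only: space_PiM[of "{..<p}"] space_leb)
      have b: "block p dm (unblock p dm v) = v" by (rule block_unblock[OF ve])
      have "unblock p dm v \<in> extensional {..<p * dm}" by (simp add: unblock_def)
      moreover have "Ci p c (unblock p dm v) = ?F v" unfolding Ci_def b ..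
      ultimately show ?thesis using ve by (auto simp: b PiE_iff)
    qed
    then show ?thesis by blast
  qed
  also have "emeasure (Pi\<^sub>M {..<p} (\<lambda>_. leb dm)) \<dots> = emeasure (distr (Pi\<^sub>M {..<p} (\<lambda>_. leb dm)) (leb (p * dm)) (unblock p dm)) ?Z"
  proof (rule emeasure_distr[symmetric])
    show "?Z \<in> sets (leb (p * dm))" using Q Y by (intro blocks_Ci_sets[OF ch]) auto
  qed simp
  finally show ?thesis by (simp only: distr_unblock)
qed

text \<open>Restrict each factor to its chart domain and push it to coordinates. The image is
  absolutely continuous because the factor vanishes on locally null sets, and products of absolutely
  continuous measures are absolutely continuous.\<close>

lemma knull_if_chart_null:
  assumes ch: "charts p c" and N: "N \<in> sets (BXp p)" "N \<subseteq> W p c" and null: "Cm p c ` N \<in> null_sets (leb (p * dm))"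
  shows "knull p N"
  unfolding knull_def
proof (intro conjI allI impI N(1))
  fix \<rho> :: "nat \<Rightarrow> 'x measure" assume \<rho>: "\<forall>j<p. ac_prob (\<rho> j)"
  have sets\<rho> [measurable_cong]: "sets (\<rho> j) = sets BX" if "j < p" for j using \<rho> that by (simp add: ac_prob_def)
  have space\<rho>: "space (\<rho> j) = topspace T" if "j < p" for j using sets_eq_imp_space_eq[OF sets\<rho>[OF that]] by simp
  have pr: "prob_space (\<rho> j)" if "j < p" for j using \<rho> that by (simp add: ac_prob_def)
  have cj: "c j \<in> atlas X" if "j < p" for j using ch that by (simp add: charts_def)
  have Dj: "fst (c j) \<in> sets BX" if "j < p" for j using chart_open(1)[OF cj[OF that]] by blast
  let ?\<rho> = "\<lambda>j. density (\<rho> j) (indicator (fst (c j)))"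
  have fin: "finite_measure (?\<rho> j)" if "j < p" for j
  proof (rule finite_measureI)
    interpret prob_space "\<rho> j" by (rule pr[OF that])
    have D: "fst (c j) \<in> sets (\<rho> j)" using Dj[OF that] sets\<rho>[OF that] by simp
    have "emeasure (?\<rho> j) (space (?\<rho> j)) = emeasure (\<rho> j) (fst (c j) \<inter> space (\<rho> j))"
      using emeasure_density_indicator[OF D sets.top] by (simp only: space_density)
    then show "emeasure (?\<rho> j) (space (?\<rho> j)) \<noteq> \<infinity>" by (simp only: emeasure_finite infinity_ennreal_def not_False_eq_True)
  qed
  have d: "Pi\<^sub>M {..<p} ?\<rho> = density (Pi\<^sub>M {..<p} \<rho>) (indicator (W p c))"
    unfolding W_def using pr fin Dj sets\<rho>
    by (intro PiM_density_indicator) (auto simp: finite_measure_def intro: prob_space_imp_sigma_finite)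
  have setsP: "sets (Pi\<^sub>M {..<p} \<rho>) = sets (BXp p)" using sets\<rho> by (intro sets_PiM_cong) auto
  have setsP': "sets (Pi\<^sub>M {..<p} ?\<rho>) = sets (BXp p)" using sets\<rho> by (intro sets_PiM_cong) auto
  define \<kappa> where "\<kappa> j = distr (?\<rho> j) (leb dm) (crd (c j))" for j
  have cm: "crd (c j) \<in> measurable (?\<rho> j) (leb dm)" if "j < p" for j
    using measurable_crd[OF cj[OF that]] sets\<rho>[OF that] by (simp cong: measurable_cong_sets)
  let ?G = "\<lambda>y. \<lambda>j\<in>{..<p}. crd (c j) (y j)"
  have "distr (Pi\<^sub>M {..<p} ?\<rho>) (Pi\<^sub>M {..<p} (\<lambda>_. leb dm)) (\<lambda>y. \<lambda>j\<in>{..<p}. crd (c j) (y (id j))) =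
      Pi\<^sub>M {..<p} (\<lambda>j. distr (?\<rho> (id j)) (leb dm) (crd (c j)))"
    using fin cm by (intro distr_PiM_reindex_map) auto
  then have \<kappa>P: "distr (Pi\<^sub>M {..<p} ?\<rho>) (Pi\<^sub>M {..<p} (\<lambda>_. leb dm)) ?G = Pi\<^sub>M {..<p} \<kappa>"
    unfolding \<kappa>_def[abs_def] by simp
  have ac: "absolutely_continuous (leb dm) (\<kappa> j)" if j: "j < p" for j
    unfolding absolutely_continuous_def
  proof
    fix E assume E: "E \<in> null_sets (leb dm)"
    let ?E = "fst (c j) \<inter> (crd (c j) -` E \<inter> space BX)"
    have Em: "?E \<in> sets BX" using measurable_sets[OF measurable_crd[OF cj[OF j]], of E] E Dj[OF j] by auto
    have "locnull ?E"
    proof (rule locnullI[OF Em])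
      fix y assume y: "y \<in> ?E"
      have "snd (c j) ` (?E \<inter> fst (c j)) \<in> null_sets (leb dm)"
        using E chart_image_sets[OF cj[OF j] Em] by (rule null_sets_subset) (auto simp: crd_def)
      then show "\<exists>c\<in>atlas X. y \<in> fst c \<and> snd c ` (?E \<inter> fst c) \<in> null_sets (leb dm)" using y cj[OF j] by blast
    qed
    then have "emeasure (\<rho> j) ?E = 0" using \<rho> j by (simp add: ac_prob_def)
    moreover have "emeasure (\<kappa> j) E = emeasure (\<rho> j) ?E"
    proof -
      have "emeasure (\<kappa> j) E = emeasure (?\<rho> j) (crd (c j) -` E \<inter> space (?\<rho> j))"
        unfolding \<kappa>_def using cm[OF j] E by (intro emeasure_distr) auto
      also have "crd (c j) -` E \<inter> space (?\<rho> j) = crd (c j) -` E \<inter> space BX" using space\<rho>[OF j] by simp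
      also have "emeasure (?\<rho> j) \<dots> = emeasure (\<rho> j) ?E"
        using Dj[OF j] measurable_sets[OF measurable_crd[OF cj[OF j]], of E] E
        by (intro emeasure_density_indicator) (auto simp: sets\<rho>[OF j])
      finally show ?thesis .
    qed
    ultimately show "E \<in> null_sets (\<kappa> j)" using E by (auto simp: null_sets_def \<kappa>_def)
  qed
  have acP: "absolutely_continuous (Pi\<^sub>M {..<p} (\<lambda>_. leb dm)) (Pi\<^sub>M {..<p} \<kappa>)"
  proof (rule absolutely_continuous_PiM)
    show "sigma_finite_measure (\<kappa> i)" if "i \<in> {..<p}" for i
      using that fin cm unfolding \<kappa>_def by (intro finite_measure.sigma_finite_measure finite_measure.finite_measure_distr) auto
  qed (use ac sigma_finite_leb in \<open>auto simp: \<kappa>_def\<close>)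
  let ?Z = "unblock p dm -` (Cm p c ` N) \<inter> space (Pi\<^sub>M {..<p} (\<lambda>_. leb dm))"
  have "?Z \<in> null_sets (Pi\<^sub>M {..<p} (\<lambda>_. leb dm))"
  proof -
    have m: "?Z \<in> sets (Pi\<^sub>M {..<p} (\<lambda>_. leb dm))" using null by (intro measurable_sets[OF measurable_unblock]) auto
    have "emeasure (Pi\<^sub>M {..<p} (\<lambda>_. leb dm)) ?Z = emeasure (distr (Pi\<^sub>M {..<p} (\<lambda>_. leb dm)) (leb (p * dm)) (unblock p dm)) (Cm p c ` N)"
      using null by (intro emeasure_distr[symmetric]) auto
    then show ?thesis using null m by (simp add: distr_unblock null_sets_def)
  qed
  then have Z0: "emeasure (Pi\<^sub>M {..<p} \<kappa>) ?Z = 0" "?Z \<in> sets (Pi\<^sub>M {..<p} (\<lambda>_. leb dm))"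
    using acP by (auto simp: absolutely_continuous_def null_sets_def)
  have Gm: "?G \<in> measurable (Pi\<^sub>M {..<p} ?\<rho>) (Pi\<^sub>M {..<p} (\<lambda>_. leb dm))"
    using cm by (intro measurable_restrict measurable_compose[OF measurable_component_singleton]) auto
  have "emeasure (Pi\<^sub>M {..<p} \<rho>) N = emeasure (Pi\<^sub>M {..<p} ?\<rho>) N"
  proof -
    have "W p c \<inter> N = N" using N(2) by blast
    then show ?thesis unfolding d using N(1) W_sets[OF ch] by (simp add: emeasure_density_indicator setsP)
  qed
  also have "\<dots> \<le> emeasure (Pi\<^sub>M {..<p} ?\<rho>) (?G -` ?Z \<inter> space (Pi\<^sub>M {..<p} ?\<rho>))"
  proof (rule emeasure_mono)
    show "?G -` ?Z \<inter> space (Pi\<^sub>M {..<p} ?\<rho>) \<in> sets (Pi\<^sub>M {..<p} ?\<rho>)" using Gm Z0(2) by (rule measurable_sets)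
    have sp: "N \<subseteq> space (Pi\<^sub>M {..<p} ?\<rho>)" using sets.sets_into_space[of N "Pi\<^sub>M {..<p} ?\<rho>"] N(1) setsP' by simp
    show "N \<subseteq> ?G -` ?Z \<inter> space (Pi\<^sub>M {..<p} ?\<rho>)"
    proof
      fix y assume y: "y \<in> N"
      then have "unblock p dm (?G y) = Cm p c y" using N(2) Cr_eq_Cm[of y p c] by (auto simp: Cr_def)
      moreover have "?G y \<in> space (Pi\<^sub>M {..<p} (\<lambda>_. leb dm))" using measurable_space[OF Gm] sp y by blast
      ultimately show "y \<in> ?G -` ?Z \<inter> space (Pi\<^sub>M {..<p} ?\<rho>)" using y sp by auto
    qed
  qed
  also have "\<dots> = emeasure (Pi\<^sub>M {..<p} \<kappa>) ?Z"
    unfolding \<kappa>P[symmetric] using Gm Z0(2) by (rule emeasure_distr[symmetric])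
  finally show "emeasure (Pi\<^sub>M {..<p} \<rho>) N = 0" using Z0(1) by simp
qed

text \<open>Uniform distributions on cubes are admissible test measures, and up to a constant their
  products are Lebesgue measure on boxes. Countably many boxes with rational cubes as sides cover
  the image of the chart.\<close>

lemma chart_null_if_knull:
  assumes ch: "charts p c" and N: "knull p N" "N \<subseteq> W p c"
  shows "Cm p c ` N \<in> null_sets (leb (p * dm))"
proof -
  have Nm: "N \<in> sets (BXp p)" using N(1) by (simp add: knull_def)
  have cj: "c j \<in> atlas X" if "j < p" for j using ch that by (simp add: charts_def)
  define F where "F = {f \<in> Pi\<^sub>E {..<p} (\<lambda>_. ratcubes dm). \<forall>j<p. cube dm (fst (f j)) (snd (f j)) \<subseteq> snd (c j) ` fst (c j)}"
  have cF: "countable F" unfolding F_def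
    by (rule countable_subset[OF _ countable_PiE[of "{..<p}" "\<lambda>_. ratcubes dm"]]) (auto simp: countable_ratcubes)
  define Z where "Z f = {u \<in> extensional {..<p * dm}. (\<forall>j<p. block p dm u j \<in> cube dm (fst (f j)) (snd (f j))) \<and> Ci p c u \<in> N}" for f :: "nat \<Rightarrow> (nat \<Rightarrow> real) \<times> real"
  have Zm: "Z f \<in> sets (leb (p * dm))" for f
  proof -
    show ?thesis unfolding Z_def by (rule blocks_Ci_sets[OF ch _ Nm]) simp
  qed
  have Z0: "Z f \<in> null_sets (leb (p * dm))" if f: "f \<in> F" for f
  proof -
    let ?Q = "\<lambda>j. cube dm (fst (f j)) (snd (f j))"
    let ?\<sigma> = "\<lambda>j. distr (uniform_measure (leb dm) (?Q j)) BX (cinv (c j))"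
    let ?\<rho> = "\<lambda>j. distr (density (leb dm) (indicator (?Q j))) BX (cinv (c j))"
    have r: "snd (f j) > 0" if "j < p" for j
    proof -
      have "f j \<in> ratcubes dm" using f that by (auto simp: F_def)
      then show ?thesis by (cases "f j") (simp add: ratcubes_def)
    qed
    have em: "emeasure (leb dm) (?Q j) = ennreal ((2 * snd (f j)) ^ dm)" if "j < p" for j
      using r[OF that] by (intro emeasure_cube) simp
    have a: "ac_prob (?\<sigma> j)" if "j < p" for j
      using f that r by (intro ac_prob_uniform_cube cj) (auto simp: F_def)
    have fin: "finite_measure (?\<rho> j)" if "j < p" for j
      using em[OF that] measurable_cinv[OF cj[OF that]]
      by (intro finite_measure.finite_measure_distr finite_measureI) (auto simp: emeasure_density_indicator)
    have "emeasure (Pi\<^sub>M {..<p} ?\<rho>) N \<le> (\<Prod>j\<in>{..<p}. ennreal ((2 * snd (f j)) ^ dm)) * emeasure (Pi\<^sub>M {..<p} ?\<sigma>) N"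
    proof (rule emeasure_PiM_le_scaled)
      show "sigma_finite_measure (?\<rho> j)" if "j \<in> {..<p}" for j using fin that by (auto simp: finite_measure_def)
      show "sigma_finite_measure (?\<sigma> j)" if "j \<in> {..<p}" for j using a that by (auto simp: ac_prob_def intro: prob_space_imp_sigma_finite)
      fix j A assume j: "j \<in> {..<p}" and "A \<in> sets (?\<sigma> j)"
      then have A: "A \<in> sets BX" by simp
      let ?A = "cinv (c j) -` A \<inter> space (leb dm)"
      have Am: "?A \<in> sets (leb dm)" using j measurable_sets[OF measurable_cinv[OF cj] A] by auto
      have cm: "cinv (c j) \<in> measurable (leb dm) BX" using j measurable_cinv[OF cj] by auto
      have "emeasure (?\<rho> j) A = emeasure (leb dm) (?Q j \<inter> ?A)"
        using cm A Am by (subst emeasure_distr) (auto simp: emeasure_density_indicator)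
      also have "\<dots> = ennreal ((2 * snd (f j)) ^ dm) * (emeasure (leb dm) (?Q j \<inter> ?A) / emeasure (leb dm) (?Q j))"
        using em[of j] r[of j] j by (subst ennreal_times_divide, subst mult_divide_eq_ennreal[symmetric]) (auto simp: mult.commute)
      also have "emeasure (leb dm) (?Q j \<inter> ?A) / emeasure (leb dm) (?Q j) = emeasure (?\<sigma> j) A"
        using cm A Am by (subst emeasure_distr) (auto simp: emeasure_uniform_measure)
      finally show "emeasure (?\<rho> j) A \<le> ennreal ((2 * snd (f j)) ^ dm) * emeasure (?\<sigma> j) A" by simp
    next
      have "sets (Pi\<^sub>M {..<p} ?\<sigma>) = sets (BXp p)" by (intro sets_PiM_cong) auto
      then show "N \<in> sets (Pi\<^sub>M {..<p} ?\<sigma>)" using Nm by simp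
    qed auto
    also have "emeasure (Pi\<^sub>M {..<p} ?\<sigma>) N = 0" using N(1) a by (simp add: knull_def)
    finally have "emeasure (Pi\<^sub>M {..<p} ?\<rho>) N = 0" by simp
    moreover have "emeasure (Pi\<^sub>M {..<p} ?\<rho>) N = emeasure (leb (p * dm)) (Z f)"
      unfolding Z_def using em by (intro emeasure_PiM_cubes[OF ch _ Nm]) auto
    ultimately show ?thesis using Zm by (auto simp: null_sets_def)
  qed
  have "(\<Union>f\<in>F. Z f) \<in> null_sets (leb (p * dm))" using cF Z0 by (rule null_sets_UN')
  moreover have "Cm p c ` N \<in> sets (leb (p * dm))"
  proof -
    have "N \<inter> W p c = N" using N(2) by blast
    then show ?thesis using Cm_image_sets[OF ch Nm] by simp
  qed
  moreover have "Cm p c ` N \<subseteq> (\<Union>f\<in>F. Z f)"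
  proof
    fix u assume "u \<in> Cm p c ` N"
    then obtain x where x: "u = Cm p c x" "x \<in> N" by blast
    then have xW: "x \<in> W p c" using N(2) by blast
    have "\<forall>j. \<exists>f. j < p \<longrightarrow> f \<in> ratcubes dm \<and> block p dm u j \<in> cube dm (fst f) (snd f) \<and> cube dm (fst f) (snd f) \<subseteq> snd (c j) ` fst (c j)"
    proof (intro allI)
      fix j
      show "\<exists>f. j < p \<longrightarrow> f \<in> ratcubes dm \<and> block p dm u j \<in> cube dm (fst f) (snd f) \<and> cube dm (fst f) (snd f) \<subseteq> snd (c j) ` fst (c j)"
      proof (cases "j < p")
        case True
        have "block p dm u j \<in> snd (c j) ` fst (c j)" using Cm_block[OF ch xW True] xW True x(1) by (auto simp: W_def)
        from openin_ratcube[OF chart_open(2)[OF cj[OF True]] this] show ?thesis by force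
      qed simp
    qed
    then obtain f where f: "\<And>j. j < p \<Longrightarrow> f j \<in> ratcubes dm \<and> block p dm u j \<in> cube dm (fst (f j)) (snd (f j)) \<and> cube dm (fst (f j)) (snd (f j)) \<subseteq> snd (c j) ` fst (c j)"
      by metis
    have "restrict f {..<p} \<in> F" using f by (auto simp: F_def)
    moreover have "u \<in> Z (restrict f {..<p})" using f x xW Cm_ext[OF ch] by (simp add: Z_def Ci_Cm[OF ch])
    ultimately show "u \<in> (\<Union>f\<in>F. Z f)" by blast
  qed
  ultimately show ?thesis by (rule null_sets_subset)
qed

end

lemma Rn_lebesgue_localize:
  assumes loc: "\<And>u. u \<in> A \<Longrightarrow> \<exists>S. openin (Rn N) S \<and> u \<in> S \<and> A \<inter> S \<in> sets (Rn_lebesgue N)"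
  shows "A \<in> sets (Rn_lebesgue N)"
proof -
  have "\<exists>Q. countable Q \<and> A \<subseteq> (\<Union>c\<in>Q. cube N (fst c) (snd c)) \<and> (\<forall>c\<in>Q. A \<inter> cube N (fst c) (snd c) \<in> sets (Rn_lebesgue N))"
  proof (rule ratcubes_localize[where P = "\<lambda>S. A \<inter> S \<in> sets (Rn_lebesgue N)", OF loc])
    fix S q \<rho> assume s: "A \<inter> S \<in> sets (Rn_lebesgue N)" and sub: "cube N q \<rho> \<subseteq> S"
    have "A \<inter> cube N q \<rho> = (A \<inter> S) \<inter> cube N q \<rho>" using sub by blast
    moreover have "cube N q \<rho> \<in> sets (Rn_lebesgue N)" unfolding Rn_lebesgue_def by (rule sets_completionI_sets) simp
    ultimately show "A \<inter> cube N q \<rho> \<in> sets (Rn_lebesgue N)" using s by simp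
  qed
  then obtain Q where Q: "countable Q" "A \<subseteq> (\<Union>c\<in>Q. cube N (fst c) (snd c))"
    "\<And>c. c\<in>Q \<Longrightarrow> A \<inter> cube N (fst c) (snd c) \<in> sets (Rn_lebesgue N)" by blast
  have "(\<Union>c\<in>Q. A \<inter> cube N (fst c) (snd c)) \<in> sets (Rn_lebesgue N)" using Q(1,3) by (rule sets.countable_UN'')
  moreover have "(\<Union>c\<in>Q. A \<inter> cube N (fst c) (snd c)) = A" using Q(2) by blast
  ultimately show ?thesis by simp
qed

lemma null_sets_completion_sub:
  "A \<subseteq> N \<Longrightarrow> N \<in> null_sets M \<Longrightarrow> A \<in> null_sets (completion M)"
  using null_sets_completionI[of N M] null_sets_completion[of N M A]
    null_sets_subset[of N "completion M" A] by blast

lemma null_sets_completionE: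
  assumes "A \<in> null_sets (completion M)"
  obtains N where "N \<in> null_sets M" "A \<subseteq> N"
  using assms null_sets_completion_iff2[of A M] by blast

section \<open>The measures on the powers\<close>

locale C1_action_measures = C1_action X act
  for X :: "'x manifold" and act :: "'g::{topological_group_add, t2_space} \<Rightarrow> 'x \<Rightarrow> 'x" +
  fixes M :: "nat \<Rightarrow> (nat \<Rightarrow> 'x) measure"
  assumes M: "\<forall>p\<ge>1. \<exists>g. riemannian_metric (power_manifold p X) g \<and>
                   riemannian_measure (power_manifold p X) g (M p)"
begin

abbreviation "Xp p \<equiv> Pi\<^sub>E {..<p::nat} (\<lambda>_. topspace T)"

lemma topspace_power_top: "topspace (power_top T p) = Xp p"
  by simp

lemma power_manifold_sel [simp]: "mtop (power_manifold p X) = power_top T p" "mdim (power_manifold p X) = p * dm"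
  "atlas (power_manifold p X) = power_chart dm p ` {c. charts p c}"
  by (auto simp: power_manifold_def charts_def)

lemma power_chart_sel [simp]: "fst (power_chart dm p c) = W p c" "snd (power_chart dm p c) = Cm p c"
  by (simp_all add: power_chart_def W_def Cm_def)

lemma W_subset: "charts p c \<Longrightarrow> W p c \<subseteq> Xp p"
  unfolding W_def by (intro PiE_mono) (use chart_subset in \<open>auto simp: charts_def\<close>)

lemma charts_at: "x \<in> Xp p \<Longrightarrow> \<exists>c. charts p c \<and> x \<in> W p c"
proof -
  assume x: "x \<in> Xp p"
  have "\<forall>i. \<exists>c. i < p \<longrightarrow> c \<in> atlas X \<and> x i \<in> fst c"
    using x chart_cover by (metis PiE_mem lessThan_iff)
  then obtain c where "\<And>i. i < p \<Longrightarrow> c i \<in> atlas X \<and> x i \<in> fst (c i)" by metis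
  then show ?thesis using x by (intro exI[of _ c]) (auto simp: charts_def W_def PiE_iff)
qed

lemma space_M: "p \<ge> 1 \<Longrightarrow> space (M p) = Xp p"
  using M by (auto simp: riemannian_measure_def)

lemma sets_M: "p \<ge> 1 \<Longrightarrow> A \<in> sets (M p) \<longleftrightarrow> A \<subseteq> Xp p \<and> (\<forall>c. charts p c \<longrightarrow> Cm p c ` (A \<inter> W p c) \<in> sets (Rn_lebesgue (p * dm)))"
  using M by (auto simp: riemannian_measure_def)

lemma Cm_inj: "charts p c \<Longrightarrow> inj_on (Cm p c) (W p c)"
  by (rule inj_on_inverseI[of _ "Ci p c"]) (simp add: Ci_Cm)

text \<open>A kernel vector of the Gram matrix would be a nonzero vector of length zero.\<close>

lemma det_pos:
  assumes "riemannian_metric Y g" "c \<in> atlas Y" "x \<in> fst c"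
  shows "Determinant.det (Matrix.mat (mdim Y) (mdim Y) (\<lambda>(i, j). g c x i j)) \<noteq> 0"
proof
  let ?n = "mdim Y" and ?A = "Matrix.mat (mdim Y) (mdim Y) (\<lambda>(i, j). g c x i j)"
  assume "Determinant.det ?A = 0"
  then obtain v where v: "v \<in> carrier_vec ?n" "v \<noteq> 0\<^sub>v ?n" "?A *\<^sub>v v = 0\<^sub>v ?n"
    using det_0_iff_vec_prod_zero_field[of ?A ?n] by auto
  have "\<exists>i<?n. v $ i \<noteq> 0" using v(1,2) by (metis eq_vecI carrier_vecD index_zero_vec)
  then have pos: "0 < (\<Sum>i<?n. \<Sum>j<?n. g c x i j * v $ i * v $ j)"
    using assms unfolding riemannian_metric_def by blast
  have "(\<Sum>j<?n. g c x i j * v $ j) = 0" if i: "i < ?n" for i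
  proof -
    have "(?A *\<^sub>v v) $ i = 0" using v(3) i by simp
    moreover have "(?A *\<^sub>v v) $ i = (\<Sum>j<?n. g c x i j * v $ j)"
      using i v(1) by (simp add: scalar_prod_def lessThan_atLeast0)
    ultimately show ?thesis by simp
  qed
  then have "(\<Sum>i<?n. v $ i * (\<Sum>j<?n. g c x i j * v $ j)) = 0" by simp
  then have "(\<Sum>i<?n. \<Sum>j<?n. g c x i j * v $ i * v $ j) = 0"
    by (simp add: sum_distrib_left mult_ac)
  with pos show False by simp
qed

lemma Cm_continuous_inverse:
  assumes "charts p c"
  shows "continuous_map (subtopology (Rn (p * dm)) (Cm p c ` W p c)) (power_top T p) (Ci p c)"
  unfolding continuous_map
proof (intro conjI allI impI)
  show "Ci p c ` topspace (subtopology (Rn (p * dm)) (Cm p c ` W p c)) \<subseteq> topspace (power_top T p)"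
  proof (rule image_subsetI)
    fix u assume "u \<in> topspace (subtopology (Rn (p * dm)) (Cm p c ` W p c))"
    then obtain x where x: "u = Cm p c x" "x \<in> W p c" by auto
    then have "Ci p c u = x" by (simp add: Ci_Cm[OF assms])
    then show "Ci p c u \<in> topspace (power_top T p)" using W_subset[OF assms] x(2) unfolding topspace_power_top by blast
  qed
  fix U assume U: "openin (power_top T p) U"
  let ?V = "{u \<in> topspace (subtopology (Rn (p * dm)) (Cm p c ` W p c)). Ci p c u \<in> U}"
  have "openin (Rn (p * dm)) ?V"
  proof (subst openin_subopen, intro ballI)
    fix u assume u: "u \<in> ?V"
    then obtain x where x: "u = Cm p c x" "x \<in> W p c" by auto
    then have "x \<in> U" using u Ci_Cm[OF assms] by simp
    have "\<exists>Ob. finite {i \<in> {..<p}. Ob i \<noteq> topspace T} \<and> (\<forall>i\<in>{..<p}. openin T (Ob i)) \<and> x \<in> Pi\<^sub>E {..<p} Ob \<and> Pi\<^sub>E {..<p} Ob \<subseteq> U"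
      by (rule bspec[OF U[unfolded openin_product_topology_alt] \<open>x \<in> U\<close>])
    then obtain Ob where Ob: "\<forall>i\<in>{..<p}. openin T (Ob i)" "x \<in> Pi\<^sub>E {..<p} Ob" "Pi\<^sub>E {..<p} Ob \<subseteq> U" by (elim exE conjE)
    have "openin (Rn (p * dm)) (Cm p c ` (Pi\<^sub>E {..<p} Ob \<inter> W p c))" using Ob(1) by (intro Cm_image_box[OF assms]) auto
    moreover have "u \<in> Cm p c ` (Pi\<^sub>E {..<p} Ob \<inter> W p c)" using x Ob(2) by blast
    moreover have "Cm p c ` (Pi\<^sub>E {..<p} Ob \<inter> W p c) \<subseteq> ?V"
    proof
      fix w assume "w \<in> Cm p c ` (Pi\<^sub>E {..<p} Ob \<inter> W p c)"
      then obtain y where y: "w = Cm p c y" "y \<in> W p c" "y \<in> U" using Ob(3) by blast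
      then show "w \<in> ?V" using Ci_Cm[OF assms y(2)] Cm_ext[OF assms] by (auto simp: topspace_Rn)
    qed
    ultimately show "\<exists>S. openin (Rn (p * dm)) S \<and> u \<in> S \<and> S \<subseteq> ?V" by blast
  qed
  then show "openin (subtopology (Rn (p * dm)) (Cm p c ` W p c)) ?V"
    by (subst openin_open_subtopology[OF Cm_image_open[OF assms]]) auto
qed

lemma measurable_on_open_Rn:
  fixes h :: "(nat \<Rightarrow> real) \<Rightarrow> real"
  assumes U: "openin (Rn N) U" and h: "continuous_map (subtopology (Rn N) U) euclideanreal h"
  shows "(\<lambda>u. if u \<in> U then h u else 0) \<in> borel_measurable (leb N)"
proof (rule borel_measurableI)
  fix A :: "real set" assume A: "open A"
  have Us: "U \<subseteq> extensional {..<N}" using openin_subset[OF U] by (simp add: topspace_Rn)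
  have "openin (subtopology (Rn N) U) {u \<in> topspace (subtopology (Rn N) U). h u \<in> A}"
    using A by (intro openin_continuous_map_preimage[OF h]) simp
  then have o: "openin (Rn N) {u \<in> topspace (subtopology (Rn N) U). h u \<in> A}"
    using openin_trans_full[OF _ U] by blast
  have t: "topspace (subtopology (Rn N) U) = U" using Us by (auto simp: topspace_Rn)
  have "(\<lambda>u. if u \<in> U then h u else 0) -` A \<inter> space (leb N) = {u \<in> U. h u \<in> A} \<union> (if 0 \<in> A then space (leb N) - U else {})"
    using Us by (auto simp: space_leb split: if_splits)
  also have "\<dots> \<in> sets (leb N)" using openin_sets_leb[OF o[unfolded t]] openin_sets_leb[OF U] by auto
  finally show "(\<lambda>u. if u \<in> U then h u else 0) -` A \<inter> space (leb N) \<in> sets (leb N)" .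
qed

text \<open>The density of \<open>M p\<close> in a chart is positive, and continuity makes it
  measurable. This is how the Riemannian structure enters: the null sets of \<open>M p\<close>
  inside a chart are the Lebesgue null sets.\<close>

lemma null_M_chart:
  assumes p: "p \<ge> 1" and c: "charts p c" and A: "A \<in> sets (M p)" "A \<subseteq> W p c"
  shows "emeasure (M p) A = 0 \<longleftrightarrow> Cm p c ` A \<in> null_sets (Rn_lebesgue (p * dm))"
proof -
  obtain g where g: "riemannian_metric (power_manifold p X) g" "riemannian_measure (power_manifold p X) g (M p)"
    using M p by blast
  let ?P = "power_chart dm p c" and ?N = "p * dm"
  have Pin: "?P \<in> atlas (power_manifold p X)" using c by auto
  let ?I = "Cm p c ` W p c"
  define D where "D x = Determinant.det (Matrix.mat ?N ?N (\<lambda>(i, j). g ?P x i j))" for x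
  define h where "h u = sqrt \<bar>D (inv_into (W p c) (Cm p c) u)\<bar>" for u
  have inv: "inv_into (W p c) (Cm p c) u = Ci p c u" if "u \<in> ?I" for u
    using that Ci_Cm[OF c] Cm_inj[OF c] by auto
  have Wo: "topspace (subtopology (power_top T p) (W p c)) = W p c" using W_subset[OF c] by auto
  have Dc: "continuous_map (subtopology (power_top T p) (W p c)) euclideanreal D"
  proof -
    have "continuous_map (subtopology (power_top T p) (W p c)) euclideanreal (\<lambda>x. g ?P x i j)" if "i < ?N" "j < ?N" for i j
      using g(1) Pin that unfolding riemannian_metric_def by fastforce
    then have "continuous_map (subtopology (power_top T p) (W p c)) euclideanreal
      (\<lambda>x. \<Sum>q\<in>{q. q permutes {0..<?N}}. signof q * (\<Prod>i = 0..<?N. g ?P x i (q i)))"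
      by (intro continuous_intros) (auto simp: finite_permutations permutes_in_image)
    moreover have "D = (\<lambda>x. \<Sum>q\<in>{q. q permutes {0..<?N}}. signof q * (\<Prod>i = 0..<?N. g ?P x i (q i)))"
      unfolding D_def Determinant.det_def
      by (rule ext) (auto intro!: sum.cong prod.cong simp: permutes_in_image)
    ultimately show ?thesis by (simp only:)
  qed
  have hc: "continuous_map (subtopology (Rn ?N) ?I) euclideanreal (\<lambda>u. sqrt \<bar>D (Ci p c u)\<bar>)"
  proof -
    have "continuous_map (subtopology (Rn ?N) ?I) (subtopology (power_top T p) (W p c)) (Ci p c)"
      by (rule continuous_map_into_subtopology[OF Cm_continuous_inverse[OF c]]) (auto simp: Ci_Cm[OF c])
    from continuous_map_compose[OF this Dc]
    have "continuous_map (subtopology (Rn ?N) ?I) euclideanreal (\<lambda>u. D (Ci p c u))" by (simp add: comp_def)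
    then show ?thesis by (intro continuous_map_sqrt continuous_map_real_abs)
  qed
  have hm: "(\<lambda>u. if u \<in> ?I then sqrt \<bar>D (Ci p c u)\<bar> else 0) \<in> borel_measurable (Rn_lebesgue ?N)"
    unfolding Rn_lebesgue_def by (intro measurable_completion measurable_on_open_Rn Cm_image_open[OF c] hc)
  have CA: "Cm p c ` A \<in> sets (Rn_lebesgue ?N)"
  proof -
    have "A \<inter> W p c = A" using A(2) by blast
    then show ?thesis using A(1) c sets_M[OF p] by metis
  qed
  have "\<forall>A\<in>sets (M p). A \<subseteq> fst ?P \<longrightarrow>
        emeasure (M p) A = (\<integral>\<^sup>+u. indicator (snd ?P ` A) u * ennreal (sqrt \<bar>Determinant.det (Matrix.mat ?N ?N
               (\<lambda>(i, j). g ?P (inv_into (fst ?P) (snd ?P) u) i j))\<bar>) \<partial>Rn_lebesgue ?N)"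
    using g(2) Pin unfolding riemannian_measure_def power_manifold_sel(2) by blast
  then have "emeasure (M p) A = (\<integral>\<^sup>+u. indicator (Cm p c ` A) u * ennreal (h u) \<partial>Rn_lebesgue ?N)"
    using A unfolding h_def D_def by simp
  also have "\<dots> = (\<integral>\<^sup>+u. indicator (Cm p c ` A) u * ennreal (if u \<in> ?I then sqrt \<bar>D (Ci p c u)\<bar> else 0) \<partial>Rn_lebesgue ?N)"
    using A(2) inv by (intro nn_integral_cong) (auto simp: h_def indicator_def)
  finally have e: "emeasure (M p) A = (\<integral>\<^sup>+u. indicator (Cm p c ` A) u * ennreal (if u \<in> ?I then sqrt \<bar>D (Ci p c u)\<bar> else 0) \<partial>Rn_lebesgue ?N)" .
  have nz: "sqrt \<bar>D (Ci p c u)\<bar> > 0" if "u \<in> ?I" for u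
  proof -
    have "Ci p c u \<in> W p c" using that Ci_Cm[OF c] by auto
    then have "D (Ci p c u) \<noteq> 0" using det_pos[OF g(1) Pin] unfolding D_def by simp
    then show ?thesis by simp
  qed
  have "emeasure (M p) A = 0 \<longleftrightarrow> (AE u in Rn_lebesgue ?N. indicator (Cm p c ` A) u * ennreal (if u \<in> ?I then sqrt \<bar>D (Ci p c u)\<bar> else 0) = 0)"
    unfolding e using CA hm by (intro nn_integral_0_iff_AE borel_measurable_times_ennreal) auto
  also have "\<dots> \<longleftrightarrow> (AE u in Rn_lebesgue ?N. u \<notin> Cm p c ` A)"
  proof (intro eventually_subst always_eventually allI)
    fix u
    show "(indicator (Cm p c ` A) u * ennreal (if u \<in> ?I then sqrt \<bar>D (Ci p c u)\<bar> else 0) = 0) = (u \<notin> Cm p c ` A)"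
    proof (cases "u \<in> Cm p c ` A")
      case True
      then have "u \<in> ?I" using A(2) by blast
      then show ?thesis using True nz[of u] by simp
    qed simp
  qed
  also have "\<dots> \<longleftrightarrow> Cm p c ` A \<in> null_sets (Rn_lebesgue ?N)"
    using CA by (rule AE_iff_null_sets[symmetric])
  finally show ?thesis .
qed

text \<open>The exceptional sets of \<open>locally_AE\<close> statements, by
  \<open>lnull_imp_locally_AE\<close> and \<open>lnull_if_locally_AE\<close>. Subsets are included
  since the chart measure is complete.\<close>

definition lnull :: "nat \<Rightarrow> (nat \<Rightarrow> 'x) set \<Rightarrow> bool" where
  "lnull p A \<longleftrightarrow> A \<subseteq> Xp p \<and> (\<forall>c. charts p c \<longrightarrow> Cm p c ` (A \<inter> W p c) \<in> null_sets (Rn_lebesgue (p * dm)))"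

lemma lnull_sets: "p \<ge> 1 \<Longrightarrow> lnull p A \<Longrightarrow> A \<in> sets (M p)"
  by (auto simp: lnull_def sets_M)

lemma lnull_subset: "lnull p A \<Longrightarrow> B \<subseteq> A \<Longrightarrow> lnull p B"
  unfolding lnull_def
proof (intro conjI allI impI)
  assume A: "A \<subseteq> Xp p \<and> (\<forall>c. charts p c \<longrightarrow> Cm p c ` (A \<inter> W p c) \<in> null_sets (Rn_lebesgue (p * dm)))" and BA: "B \<subseteq> A"
  then show "B \<subseteq> Xp p" by blast
  fix c assume "charts p c"
  then have "Cm p c ` (A \<inter> W p c) \<in> null_sets (completion (leb (p * dm)))" using A unfolding Rn_lebesgue_def by blast
  then obtain N where "N \<in> null_sets (leb (p * dm))" "Cm p c ` (A \<inter> W p c) \<subseteq> N"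
    by (rule null_sets_completionE)
  moreover have "Cm p c ` (B \<inter> W p c) \<subseteq> Cm p c ` (A \<inter> W p c)" using BA by blast
  ultimately show "Cm p c ` (B \<inter> W p c) \<in> null_sets (Rn_lebesgue (p * dm))"
    unfolding Rn_lebesgue_def by (intro null_sets_completion_sub[of _ N]) auto
qed

lemma lnull_UN: "(\<And>n::'n::countable. lnull p (A n)) \<Longrightarrow> lnull p (\<Union>n. A n)"
  unfolding lnull_def
proof (intro conjI allI impI)
  assume A: "\<And>n. A n \<subseteq> Xp p \<and> (\<forall>c. charts p c \<longrightarrow> Cm p c ` (A n \<inter> W p c) \<in> null_sets (Rn_lebesgue (p * dm)))"
  then show "(\<Union>n. A n) \<subseteq> Xp p" by blast
  fix c assume "charts p c"
  then have "(\<Union>n. Cm p c ` (A n \<inter> W p c)) \<in> null_sets (Rn_lebesgue (p * dm))" using A by (intro null_sets_UN) blast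
  moreover have "(\<Union>n. Cm p c ` (A n \<inter> W p c)) = Cm p c ` ((\<Union>n. A n) \<inter> W p c)" by blast
  ultimately show "Cm p c ` ((\<Union>n. A n) \<inter> W p c) \<in> null_sets (Rn_lebesgue (p * dm))" by simp
qed

lemma W_open: "charts p c \<Longrightarrow> openin (power_top T p) (W p c)"
  unfolding W_def by (subst openin_PiE_gen) (auto simp: charts_def chart_open)

lemma openin_sets_M: "p \<ge> 1 \<Longrightarrow> openin (power_top T p) U \<Longrightarrow> U \<in> sets (M p)"
proof -
  assume p: "p \<ge> 1" and U: "openin (power_top T p) U"
  have UX: "U \<subseteq> Xp p" using openin_subset[OF U] by simp
  have "Cm p c ` (U \<inter> W p c) \<in> sets (Rn_lebesgue (p * dm))" if c: "charts p c" for c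
  proof -
    have "openin (subtopology (Rn (p * dm)) (Cm p c ` W p c)) {u \<in> topspace (subtopology (Rn (p * dm)) (Cm p c ` W p c)). Ci p c u \<in> U}"
      by (rule openin_continuous_map_preimage[OF Cm_continuous_inverse[OF c] U])
    then have "openin (Rn (p * dm)) {u \<in> topspace (subtopology (Rn (p * dm)) (Cm p c ` W p c)). Ci p c u \<in> U}"
      by (rule openin_trans_full[OF _ Cm_image_open[OF c]])
    moreover have "{u \<in> topspace (subtopology (Rn (p * dm)) (Cm p c ` W p c)). Ci p c u \<in> U} = Cm p c ` (U \<inter> W p c)"
      using Ci_Cm[OF c] Cm_ext[OF c] by (auto simp: topspace_Rn)
    ultimately show ?thesis unfolding Rn_lebesgue_def by (auto intro: openin_sets_leb)
  qed
  then show "U \<in> sets (M p)" using UX sets_M[OF p] by blast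
qed

lemma W_sets_M: "p \<ge> 1 \<Longrightarrow> charts p c \<Longrightarrow> W p c \<in> sets (M p)"
  by (rule openin_sets_M[OF _ W_open])

text \<open>A compact set is covered by finitely many chart domains.\<close>

lemma lnull_imp_locally_AE:
  assumes p: "p \<ge> 1" and A: "lnull p A"
  shows "locally_AE (power_top T p) (M p) (\<lambda>y. y \<notin> A)"
  unfolding locally_AE_def
proof (intro allI impI)
  fix K assume K: "compactin (power_top T p) K"
  have "\<exists>\<F>. finite \<F> \<and> \<F> \<subseteq> W p ` {c. charts p c} \<and> K \<subseteq> \<Union>\<F>"
  proof -
    have op: "\<forall>U\<in>W p ` {c. charts p c}. openin (power_top T p) U" using W_open by blast
    have sub: "K \<subseteq> \<Union> (W p ` {c. charts p c})"
    proof
      fix x assume "x \<in> K"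
      then have "x \<in> Xp p" using compactin_subset_topspace[OF K] unfolding topspace_power_top by blast
      then show "x \<in> \<Union> (W p ` {c. charts p c})" using charts_at by blast
    qed
    show ?thesis by (rule K[unfolded compactin_def, THEN conjunct2, rule_format, OF conjI[OF op sub]])
  qed
  then obtain \<F> where F: "finite \<F>" "\<F> \<subseteq> W p ` {c. charts p c}" "K \<subseteq> \<Union>\<F>" by (elim exE conjE)
  have "A \<inter> U \<in> null_sets (M p)" if UF: "U \<in> \<F>" for U
  proof -
    obtain c where c: "charts p c" "U = W p c" using F(2) UF by blast
    have s: "A \<inter> U \<in> sets (M p)" using lnull_sets[OF p A] W_sets_M[OF p c(1)] c(2) by auto
    have "emeasure (M p) (A \<inter> W p c) = 0 \<longleftrightarrow> Cm p c ` (A \<inter> W p c) \<in> null_sets (Rn_lebesgue (p * dm))"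
      using s c by (intro null_M_chart[OF p]) auto
    then show ?thesis using A c s by (auto simp: lnull_def null_sets_def)
  qed
  then have "(\<Union>U\<in>\<F>. A \<inter> U) \<in> null_sets (M p)" using F(1) by (intro null_sets_UN' countable_finite)
  then have "AE y in M p. y \<notin> (\<Union>U\<in>\<F>. A \<inter> U)" by (rule AE_not_in)
  then show "AE y in M p. y \<in> K \<longrightarrow> y \<notin> A" by (rule eventually_mono) (use F(3) in blast)
qed

lemma compactin_closed_cube:
  "compactin (Rn N) (Pi\<^sub>E {..<N} (\<lambda>i. {x i - r .. x i + r}))"
  unfolding Rn_def by (subst compactin_PiE) auto

text \<open>Closed cubes in the image of a chart correspond to compact sets of the power, and
  countably many open cubes inside them cover the image of \<open>A\<close>.\<close>

lemma lnull_if_locally_AE: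
  assumes p: "p \<ge> 1" and A: "A \<in> sets (M p)" and ae: "locally_AE (power_top T p) (M p) (\<lambda>y. y \<notin> A)"
  shows "lnull p A"
  unfolding lnull_def
proof (intro conjI allI impI)
  show "A \<subseteq> Xp p" using A sets_M[OF p] by blast
  fix c assume c: "charts p c"
  let ?N = "p * dm" and ?CA = "Cm p c ` (A \<inter> W p c)"
  have CAs: "?CA \<in> sets (Rn_lebesgue ?N)" using A c sets_M[OF p] by blast
  have "\<exists>Q. countable Q \<and> ?CA \<subseteq> (\<Union>c\<in>Q. cube ?N (fst c) (snd c)) \<and> (\<forall>q\<in>Q. ?CA \<inter> cube ?N (fst q) (snd q) \<in> null_sets (Rn_lebesgue ?N))"
  proof (rule ratcubes_localize[where P = "\<lambda>S. ?CA \<inter> S \<in> null_sets (Rn_lebesgue ?N)"])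
    fix u assume "u \<in> ?CA"
    then have uI: "u \<in> Cm p c ` W p c" by blast
    then obtain r where r: "r > 0" "cube ?N u r \<subseteq> Cm p c ` W p c" using Cm_image_open[OF c] unfolding openin_Rn by blast
    have ue: "u \<in> extensional {..<?N}" using uI Cm_ext[OF c] by blast
    \<comment> \<open>Half the radius keeps the closed cube inside the image of the chart.\<close>
    let ?K = "Pi\<^sub>E {..<?N} (\<lambda>i. {u i - r / 2 .. u i + r / 2})"
    have Ksub: "?K \<subseteq> cube ?N u r"
    proof
      fix w assume w: "w \<in> ?K"
      have "\<bar>w i - u i\<bar> < r" if "i < ?N" for i
      proof -
        have "w i \<in> {u i - r / 2 .. u i + r / 2}" using w that by (intro PiE_mem[OF w]) simp
        then show ?thesis using r(1) by (simp add: abs_less_iff) 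
      qed
      then show "w \<in> cube ?N u r" using w by (simp add: mem_cube PiE_iff)
    qed
    have QK: "cube ?N u (r / 2) \<subseteq> ?K"
    proof
      fix w assume w: "w \<in> cube ?N u (r / 2)"
      have "w i \<in> {u i - r / 2 .. u i + r / 2}" if "i < ?N" for i
      proof -
        have "\<bar>w i - u i\<bar> < r / 2" using w that by (simp add: mem_cube)
        then show ?thesis unfolding atLeastAtMost_iff by linarith
      qed
      then show "w \<in> ?K" using w by (simp add: mem_cube PiE_iff)
    qed
    have "compactin (subtopology (Rn ?N) (Cm p c ` W p c)) ?K"
      using compactin_closed_cube Ksub r(2) by (auto simp: compactin_subtopology)
    from image_compactin[OF this Cm_continuous_inverse[OF c]]
    have "AE y in M p. y \<in> Ci p c ` ?K \<longrightarrow> y \<notin> A" using ae unfolding locally_AE_def by blast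
    then obtain Z where Z: "Z \<in> null_sets (M p)" "{y \<in> space (M p). \<not> (y \<in> Ci p c ` ?K \<longrightarrow> y \<notin> A)} \<subseteq> Z"
      by (auto elim!: AE_E simp: null_sets_def)
    let ?B = "Z \<inter> W p c"
    have Bs: "?B \<in> sets (M p)" using Z(1) W_sets_M[OF p c] by auto
    have "emeasure (M p) ?B = 0"
    proof -
      have "emeasure (M p) ?B \<le> emeasure (M p) Z" using Z(1) by (intro emeasure_mono) auto
      then show ?thesis using Z(1) by (simp add: null_sets_def)
    qed
    then have nB: "Cm p c ` ?B \<in> null_sets (Rn_lebesgue ?N)" using null_M_chart[OF p c Bs] by auto
    have sub: "?CA \<inter> cube ?N u (r / 2) \<subseteq> Cm p c ` ?B"
    proof
      fix w assume w: "w \<in> ?CA \<inter> cube ?N u (r / 2)"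
      then obtain y where y: "w = Cm p c y" "y \<in> A" "y \<in> W p c" by blast
      then have "y = Ci p c w" by (simp add: Ci_Cm[OF c])
      then have "y \<in> Ci p c ` ?K" using w QK by blast
      moreover have "y \<in> space (M p)" using y W_subset[OF c] space_M[OF p] by blast
      ultimately have "y \<in> Z" using Z(2) y(2) by blast
      then show "w \<in> Cm p c ` ?B" using y by blast
    qed
    have "cube ?N u (r / 2) \<in> sets (Rn_lebesgue ?N)" unfolding Rn_lebesgue_def by (rule sets_completionI_sets) simp
    then have "?CA \<inter> cube ?N u (r / 2) \<in> null_sets (Rn_lebesgue ?N)"
      using CAs by (intro null_sets_subset[OF nB _ sub]) (rule sets.Int)
    moreover have "u \<in> cube ?N u (r / 2)" using ue r(1) by (intro center_in_cube) auto
    ultimately show "\<exists>S. openin (Rn ?N) S \<and> u \<in> S \<and> ?CA \<inter> S \<in> null_sets (Rn_lebesgue ?N)"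
      by (intro exI[of _ "cube ?N u (r / 2)"]) simp
  next
    fix S q \<rho> assume n: "?CA \<inter> S \<in> null_sets (Rn_lebesgue ?N)" and sub: "cube ?N q \<rho> \<subseteq> S"
    have "cube ?N q \<rho> \<in> sets (Rn_lebesgue ?N)" unfolding Rn_lebesgue_def by (rule sets_completionI_sets) simp
    then show "?CA \<inter> cube ?N q \<rho> \<in> null_sets (Rn_lebesgue ?N)"
      using CAs by (intro null_sets_subset[OF n]) (use sub in auto)
  qed
  then obtain Q where Q: "countable Q" "?CA \<subseteq> (\<Union>c\<in>Q. cube ?N (fst c) (snd c))"
    "\<And>q. q\<in>Q \<Longrightarrow> ?CA \<inter> cube ?N (fst q) (snd q) \<in> null_sets (Rn_lebesgue ?N)" by blast
  have "(\<Union>q\<in>Q. ?CA \<inter> cube ?N (fst q) (snd q)) \<in> null_sets (Rn_lebesgue ?N)" using Q(1,3) by (rule null_sets_UN')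
  moreover have "(\<Union>q\<in>Q. ?CA \<inter> cube ?N (fst q) (snd q)) = ?CA" using Q(2) by blast
  ultimately show "?CA \<in> null_sets (Rn_lebesgue ?N)" by simp
qed

text \<open>Makes locally null sets accessible to the product kernels, one product chart at a time:
  a Borel null cover in coordinates is pulled back.\<close>

lemma lnull_imp_knull:
  assumes A: "lnull p A" and c: "charts p c"
  shows "\<exists>N. knull p N \<and> A \<inter> W p c \<subseteq> N \<and> N \<subseteq> W p c"
proof -
  have "Cm p c ` (A \<inter> W p c) \<in> null_sets (completion (leb (p * dm)))"
    using A c unfolding lnull_def Rn_lebesgue_def by blast
  then obtain Z where Z: "Z \<in> null_sets (leb (p * dm))" "Cm p c ` (A \<inter> W p c) \<subseteq> Z"
    by (rule null_sets_completionE)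
  let ?N = "{x \<in> W p c. Cm p c x \<in> Z}"
  have Ns: "?N \<in> sets (BXp p)" using Z(1) by (intro Cm_vimage_sets[OF c]) auto
  have "Cm p c ` ?N \<in> null_sets (leb (p * dm))"
  proof (rule null_sets_subset[OF Z(1)])
    have "?N \<inter> W p c = ?N" by blast
    then show "Cm p c ` ?N \<in> sets (leb (p * dm))" using Cm_image_sets[OF c Ns] by simp
  qed blast
  then have "knull p ?N" by (intro knull_if_chart_null[OF c Ns]) auto
  then show ?thesis using Z(2) by (intro exI[of _ ?N]) auto
qed

text \<open>In coordinates \<open>A\<close> is a Borel set together with part of a null set. Both
  pull back to the product sigma-algebra, and the null set becomes \<open>knull\<close>.\<close>

lemma Borel_approximation:
  assumes p: "p \<ge> 1" and A: "A \<in> sets (M p)" and c: "charts p c"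
  shows "\<exists>S N. S \<in> sets (BXp p) \<and> knull p N \<and> S \<subseteq> W p c \<and> N \<subseteq> W p c \<and> A \<inter> W p c - N = S - N"
proof -
  have "Cm p c ` (A \<inter> W p c) \<in> sets (completion (leb (p * dm)))" using A c sets_M[OF p] unfolding Rn_lebesgue_def by blast
  then obtain S' K K' where S': "Cm p c ` (A \<inter> W p c) = S' \<union> K" "K \<subseteq> K'" "K' \<in> null_sets (leb (p * dm))" "S' \<in> sets (leb (p * dm))"
    by (rule sets_completionE)
  let ?S = "{x \<in> W p c. Cm p c x \<in> S'}" and ?N = "{x \<in> W p c. Cm p c x \<in> K'}"
  have Ss: "?S \<in> sets (BXp p)" by (rule Cm_vimage_sets[OF c S'(4)])
  have Ns: "?N \<in> sets (BXp p)" using S'(3) by (intro Cm_vimage_sets[OF c]) auto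
  have "Cm p c ` ?N \<in> null_sets (leb (p * dm))"
  proof (rule null_sets_subset[OF S'(3)])
    have "?N \<inter> W p c = ?N" by blast
    then show "Cm p c ` ?N \<in> sets (leb (p * dm))" using Cm_image_sets[OF c Ns] by simp
  qed blast
  then have kn: "knull p ?N" by (intro knull_if_chart_null[OF c Ns]) auto
  have "x \<in> A \<longleftrightarrow> Cm p c x \<in> S' \<union> K" if "x \<in> W p c" for x
    using that inj_onD[OF Cm_inj[OF c]] unfolding S'(1)[symmetric] by blast
  then have "A \<inter> W p c - ?N = ?S - ?N" using S'(2) by blast
  moreover have "?S \<subseteq> W p c" "?N \<subseteq> W p c" by blast+
  ultimately show ?thesis using Ss kn by (rule_tac x = ?S in exI, rule_tac x = ?N in exI) (intro conjI)
qed

text \<open>Membership in \<open>sets (M p)\<close> can be tested on open boxes and modulo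
  \<open>knull\<close> sets. It is applied to preimages of Lebesgue measurable sets under the action
  and under maps of coordinates.\<close>

lemma sets_M_localize:
  assumes p: "p \<ge> 1" and A: "A \<subseteq> Xp p"
    and loc: "\<And>x. x \<in> A \<Longrightarrow> \<exists>Ob S N. (\<forall>i<p. openin T (Ob i)) \<and> x \<in> Pi\<^sub>E {..<p} Ob \<and> S \<in> sets (BXp p) \<and> knull p N \<and>
       A \<inter> Pi\<^sub>E {..<p} Ob - N = S \<inter> Pi\<^sub>E {..<p} Ob - N"
  shows "A \<in> sets (M p)"
  unfolding sets_M[OF p]
proof (intro conjI A allI impI)
  fix c assume c: "charts p c"
  let ?CA = "Cm p c ` (A \<inter> W p c)"
  show "?CA \<in> sets (Rn_lebesgue (p * dm))"
  proof (rule Rn_lebesgue_localize)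
    fix u assume "u \<in> ?CA"
    then obtain x where x: "u = Cm p c x" "x \<in> A" "x \<in> W p c" by blast
    from loc[OF x(2)] obtain Ob S N where Ob: "\<forall>i<p. openin T (Ob i)" "x \<in> Pi\<^sub>E {..<p} Ob" and S: "S \<in> sets (BXp p)" and N: "knull p N"
      and eq: "A \<inter> Pi\<^sub>E {..<p} Ob - N = S \<inter> Pi\<^sub>E {..<p} Ob - N" by (elim exE conjE)
    let ?V = "Cm p c ` (Pi\<^sub>E {..<p} Ob \<inter> W p c)"
    have V: "openin (Rn (p * dm)) ?V" using Ob(1) by (intro Cm_image_box[OF c]) auto
    have Ns: "N \<in> sets (BXp p)" using N by (simp add: knull_def)
    have NW: "knull p (N \<inter> W p c)"
      unfolding knull_def
    proof (intro conjI allI impI)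
      show "N \<inter> W p c \<in> sets (BXp p)" using Ns W_sets[OF c] by auto
      fix \<rho> :: "nat \<Rightarrow> 'x measure" assume \<rho>: "\<forall>j<p. ac_prob (\<rho> j)"
      then have "sets (Pi\<^sub>M {..<p} \<rho>) = sets (BXp p)" by (intro sets_PiM_cong) (auto simp: ac_prob_def)
      then have "emeasure (Pi\<^sub>M {..<p} \<rho>) (N \<inter> W p c) \<le> emeasure (Pi\<^sub>M {..<p} \<rho>) N" using Ns by (intro emeasure_mono) auto
      then show "emeasure (Pi\<^sub>M {..<p} \<rho>) (N \<inter> W p c) = 0" using N \<rho> by (simp add: knull_def)
    qed
    have nN: "Cm p c ` (N \<inter> W p c) \<in> null_sets (leb (p * dm))" using NW by (intro chart_null_if_knull[OF c]) auto
    have 1: "Cm p c ` (S \<inter> W p c) - Cm p c ` (N \<inter> W p c) \<in> sets (completion (leb (p * dm)))"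
      using Cm_image_sets[OF c S] nN by (intro sets_completionI_sets sets.Diff) auto
    have 2: "?V \<in> sets (completion (leb (p * dm)))" using openin_sets_leb[OF V] by (rule sets_completionI_sets)
    have 3: "?CA \<inter> ?V \<inter> Cm p c ` (N \<inter> W p c) \<in> sets (completion (leb (p * dm)))" using nN by (rule null_sets_completion) blast
    have "?CA \<inter> ?V = ((Cm p c ` (S \<inter> W p c) - Cm p c ` (N \<inter> W p c)) \<inter> ?V) \<union> (?CA \<inter> ?V \<inter> Cm p c ` (N \<inter> W p c))"
    proof -
      have inj: "Cm p c x = Cm p c y \<Longrightarrow> x \<in> W p c \<Longrightarrow> y \<in> W p c \<Longrightarrow> x = y" for x y
        using inj_onD[OF Cm_inj[OF c]] by blast
      have "(w \<in> ?CA \<longleftrightarrow> w \<in> Cm p c ` (S \<inter> W p c))" if wV: "w \<in> ?V" and wN: "w \<notin> Cm p c ` (N \<inter> W p c)" for w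
      proof -
        obtain y where y: "w = Cm p c y" "y \<in> Pi\<^sub>E {..<p} Ob" "y \<in> W p c" using wV by blast
        have "y \<notin> N" using wN y by blast
        then have "y \<in> A \<longleftrightarrow> y \<in> S" using eq y(2) by blast
        moreover have "w \<in> ?CA \<longleftrightarrow> y \<in> A" using y inj by blast
        moreover have "w \<in> Cm p c ` (S \<inter> W p c) \<longleftrightarrow> y \<in> S" using y inj by blast
        ultimately show ?thesis by blast
      qed
      then show ?thesis by blast
    qed
    also have "\<dots> \<in> sets (Rn_lebesgue (p * dm))" unfolding Rn_lebesgue_def by (rule sets.Un[OF sets.Int[OF 1 2] 3])
    finally show "\<exists>S. openin (Rn (p * dm)) S \<and> u \<in> S \<and> ?CA \<inter> S \<in> sets (Rn_lebesgue (p * dm))"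
      using V x Ob(2) by blast
  qed
qed

end

section \<open>A locally finite cover by coordinate cubes\<close>

context C1_action
begin

text \<open>Paracompactness refines the cover by coordinate cubes. The factor 3 leaves room in the
  chart: cubes of radius at most \<open>rV V\<close> around points of \<open>V\<close> stay inside
  (\<open>Q_subset\<close>), and so does the closed cube around \<open>V\<close>
  (\<open>cover_closure\<close>).\<close>

lemma good_cover_exists:
  "\<exists>VV cV zV rV. (\<forall>V\<in>VV. openin T V \<and> cV V \<in> atlas X \<and> 0 < rV V \<and> rV V \<le> 1 \<and>
      V \<subseteq> {x \<in> fst (cV V). snd (cV V) x \<in> cube dm (zV V) (rV V)} \<and> cube dm (zV V) (3 * rV V) \<subseteq> snd (cV V) ` fst (cV V)) \<and>
    \<Union>VV = topspace T \<and> locally_finite_in T VV"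
proof -
  define P where "P V c z r \<longleftrightarrow> openin T V \<and> c \<in> atlas X \<and> 0 < r \<and> r \<le> (1::real) \<and>
      V \<subseteq> {x \<in> fst c. snd c x \<in> cube dm z r} \<and> cube dm z (3 * r) \<subseteq> snd c ` fst c" for V c z r
  define \<U> where "\<U> = {U. \<exists>c z r. P U c z r}"
  have "\<forall>U\<in>\<U>. openin T U" by (auto simp: \<U>_def P_def)
  moreover have "\<Union>\<U> = topspace T"
  proof
    show "\<Union>\<U> \<subseteq> topspace T" using openin_subset by (auto simp: \<U>_def P_def)
    show "topspace T \<subseteq> \<Union>\<U>"
    proof
      fix x assume x: "x \<in> topspace T"
      then obtain c where c: "c \<in> atlas X" "x \<in> fst c" using chart_cover by blast
      from chart_cube_at[OF c openin_topspace x] obtain r0 where r0: "r0 > 0" "cube dm (snd c x) r0 \<subseteq> snd c ` fst c" by blast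
      \<comment> \<open>The bound 1 will give all cubes \<open>Q n V y\<close> a radius of at most
        \<open>1 / (n + 1)\<close>, whatever \<open>V\<close> is.\<close>
      define r where "r = min 1 (r0 / 3)"
      have r: "0 < r" "r \<le> 1" "3 * r \<le> r0" using r0(1) by (auto simp: r_def)
      let ?U = "{y \<in> fst c. snd c y \<in> cube dm (snd c x) r}"
      have "P ?U c (snd c x) r" unfolding P_def
        using r c r0(2) cube_mono[OF r(3), of dm "snd c x"] chart_open_preimage[OF c(1) openin_cube] by blast
      then have "?U \<in> \<U>" unfolding \<U>_def by blast
      moreover have "x \<in> ?U" using c r(1) chart_image_subset[OF c(1)] by (auto intro!: center_in_cube)
      ultimately show "x \<in> \<Union>\<U>" by blast
    qed
  qed
  ultimately have "\<exists>\<V>. (\<forall>V\<in>\<V>. openin T V \<and> (\<exists>U\<in>\<U>. V \<subseteq> U)) \<and> \<Union>\<V> = topspace T \<and> locally_finite_in T \<V>"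
    using manifold unfolding differentiable_manifold_def paracompact_space_def by blast
  then obtain VV where VV: "\<forall>V\<in>VV. openin T V \<and> (\<exists>U\<in>\<U>. V \<subseteq> U)" "\<Union>VV = topspace T" "locally_finite_in T VV" by (elim exE conjE)
  \<comment> \<open>A member of the refinement inherits chart, centre and radius from a set that
    contains it.\<close>
  have "\<forall>V. \<exists>c z r. V \<in> VV \<longrightarrow> P V c z r"
  proof
    fix V
    show "\<exists>c z r. V \<in> VV \<longrightarrow> P V c z r"
    proof (cases "V \<in> VV")
      case True
      then obtain U where U: "U \<in> \<U>" "V \<subseteq> U" "openin T V" using VV(1) by blast
      then obtain c z r where "P U c z r" unfolding \<U>_def by blast
      then have "P V c z r" using U(2,3) unfolding P_def by blast
      then show ?thesis by blast
    qed blast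
  qed
  then obtain cV zV rV where "\<And>V. V \<in> VV \<Longrightarrow> P V (cV V) (zV V) (rV V)" by metis
  then show ?thesis using VV(2,3) unfolding P_def by (intro exI[of _ VV] exI[of _ cV] exI[of _ zV] exI[of _ rV]) blast
qed

end

section \<open>The averaging kernels\<close>

locale C1_cover = C1_action_measures X act M
  for X :: "'x manifold" and act :: "'g::{topological_group_add, t2_space} \<Rightarrow> 'x \<Rightarrow> 'x" and M +
  fixes VV :: "'x set set" and cV :: "'x set \<Rightarrow> 'x chart" and zV :: "'x set \<Rightarrow> nat \<Rightarrow> real" and rV :: "'x set \<Rightarrow> real"
  assumes VV: "V \<in> VV \<Longrightarrow> openin T V \<and> cV V \<in> atlas X \<and> 0 < rV V \<and> rV V \<le> 1 \<and>
      V \<subseteq> {x \<in> fst (cV V). snd (cV V) x \<in> cube dm (zV V) (rV V)} \<and> cube dm (zV V) (3 * rV V) \<subseteq> snd (cV V) ` fst (cV V)"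
    and VV_cover: "\<Union>VV = topspace T" and VV_finite: "locally_finite_in T VV"
begin

definition Q :: "nat \<Rightarrow> 'x set \<Rightarrow> 'x \<Rightarrow> (nat \<Rightarrow> real) set" where
  "Q n V y = cube dm (snd (cV V) y) (rV V / (real n + 1))"

definition Vs :: "'x \<Rightarrow> 'x set set" where
  "Vs y = {V \<in> VV. y \<in> V}"

lemma Vs_finite: "y \<in> topspace T \<Longrightarrow> finite (Vs y)"
proof -
  assume "y \<in> topspace T"
  then obtain U where U: "y \<in> U" "finite {V \<in> VV. V \<inter> U \<noteq> {}}" using VV_finite unfolding locally_finite_in_def by blast
  show ?thesis by (rule finite_subset[OF _ U(2)]) (use U(1) in \<open>auto simp: Vs_def\<close>)
qed

lemma Vs_nonempty: "y \<in> topspace T \<Longrightarrow> Vs y \<noteq> {}"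
  using VV_cover by (auto simp: Vs_def)

lemma emeasure_Q: "V \<in> VV \<Longrightarrow> emeasure (leb dm) (Q n V y) = ennreal ((2 * (rV V / (real n + 1))) ^ dm)"
  unfolding Q_def using VV[of V] by (intro emeasure_cube) auto

lemma Q_bounds: "V \<in> VV \<Longrightarrow> emeasure (leb dm) (Q n V y) \<noteq> 0 \<and> emeasure (leb dm) (Q n V y) \<noteq> \<infinity>"
  using VV[of V] by (auto simp: emeasure_Q)

lemma sets_Q [simp]: "Q n V y \<in> sets (leb dm)"
  by (simp add: Q_def)

lemma Q_subset: "V \<in> VV \<Longrightarrow> y \<in> V \<Longrightarrow> Q n V y \<subseteq> snd (cV V) ` fst (cV V)"
proof -
  assume V: "V \<in> VV" and y: "y \<in> V"
  have r: "rV V / (real n + 1) \<le> rV V" using VV[OF V] by (simp add: divide_le_eq)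
  have "Q n V y \<subseteq> cube dm (zV V) (3 * rV V)"
  proof
    fix w assume w: "w \<in> Q n V y"
    have "\<bar>w i - zV V i\<bar> < 3 * rV V" if "i < dm" for i
    proof -
      have "\<bar>w i - snd (cV V) y i\<bar> < rV V / (real n + 1)" using w that by (simp add: Q_def mem_cube)
      moreover have "\<bar>snd (cV V) y i - zV V i\<bar> < rV V" using VV[OF V] y that by (auto simp: mem_cube)
      ultimately show ?thesis using r VV[OF V] by linarith
    qed
    then show "w \<in> cube dm (zV V) (3 * rV V)" using w by (simp add: mem_cube Q_def)
  qed
  then show ?thesis using VV[OF V] by blast
qed

text \<open>Its share of the volume of the cube is the probability of landing in \<open>E\<close>,
  given that the cover member \<open>V\<close> was drawn.\<close>

definition sec :: "nat \<Rightarrow> 'x \<Rightarrow> 'x set \<Rightarrow> 'x set \<Rightarrow> 'g \<Rightarrow> (nat \<Rightarrow> real) set" where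
  "sec n x V E g = {u \<in> Q n V (act (- g) x). act g (cinv (cV V) u) \<in> E}"

text \<open>\<open>kap n x g\<close> is the law of \<open>g y\<close>, where \<open>y\<close> is uniform in a cube of size about \<open>1/n\<close> around \<open>g\<^sup>-\<^sup>1 x\<close>, in the chart of a random member of the cover that contains \<open>g\<^sup>-\<^sup>1 x\<close>. The point of this shape is that \<open>kap n (s x) (s g)\<close> is the image of \<open>kap n x g\<close> under \<open>s\<close>.\<close>

definition kap :: "nat \<Rightarrow> 'x \<Rightarrow> 'g \<Rightarrow> 'x measure" where
  "kap n x g = measure_pmf (pmf_of_set (Vs (act (- g) x))) \<bind>
     (\<lambda>V. if V \<in> VV then distr (uniform_measure (leb dm) (Q n V (act (- g) x))) BX (\<lambda>u. act g (cinv (cV V) u)) else null_measure BX)"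

context
  fixes x assumes x: "x \<in> topspace T"
begin

lemma actx: "act g x \<in> topspace T"
  using x by (rule act_in)

lemma measurable_act_cinv: "V \<in> VV \<Longrightarrow> (\<lambda>u. act g (cinv (cV V) u)) \<in> measurable (leb dm) BX"
  using VV[of V] measurable_compose[OF measurable_cinv measurable_act] by blast

lemma prob_kap_part: "V \<in> VV \<Longrightarrow> prob_space (distr (uniform_measure (leb dm) (Q n V y)) BX (\<lambda>u. act g (cinv (cV V) u)))"
  using Q_bounds[of V n y] measurable_act_cinv[of V g]
  by (intro prob_space.prob_space_distr prob_space_uniform_measure) auto

lemma kap_part_emeasure: "V \<in> VV \<Longrightarrow> E \<in> sets BX \<Longrightarrow>
   emeasure (distr (uniform_measure (leb dm) (Q n V (act (- g) x))) BX (\<lambda>u. act g (cinv (cV V) u))) E =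
   emeasure (leb dm) (sec n x V E g) / emeasure (leb dm) (Q n V (act (- g) x))"
proof -
  assume V: "V \<in> VV" and E: "E \<in> sets BX"
  have m: "(\<lambda>u. act g (cinv (cV V) u)) \<in> measurable (uniform_measure (leb dm) (Q n V (act (- g) x))) BX"
    using measurable_act_cinv[OF V] by simp
  have s: "(\<lambda>u. act g (cinv (cV V) u)) -` E \<inter> space (leb dm) \<in> sets (leb dm)"
    using measurable_act_cinv[OF V] E by (rule measurable_sets)
  have e: "Q n V (act (- g) x) \<inter> ((\<lambda>u. act g (cinv (cV V) u)) -` E \<inter> space (leb dm)) = sec n x V E g"
    using cube_subset unfolding sec_def Q_def space_leb by blast
  show ?thesis using m E s by (subst emeasure_distr) (auto simp: emeasure_uniform_measure e)
qed

lemma subprob_null_BX: "subprob_space (null_measure BX)"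
  using nonempty by (intro subprob_spaceI) auto

text \<open>A \<open>measure_pmf\<close> lives on the whole type, so the kernel must be a
  subprobability measure for every set \<open>V\<close>; off the cover the null measure serves as
  the default.\<close>

lemma kap_kernel:
  "(\<lambda>V. if V \<in> VV then distr (uniform_measure (leb dm) (Q n V y)) BX (\<lambda>u. act g (cinv (cV V) u)) else null_measure BX)
     \<in> measurable (measure_pmf q) (subprob_algebra BX)"
proof -
  have "(if V \<in> VV then distr (uniform_measure (leb dm) (Q n V y)) BX (\<lambda>u. act g (cinv (cV V) u)) else null_measure BX) \<in> space (subprob_algebra BX)" for V
  proof (cases "V \<in> VV")
    case True
    then show ?thesis using prob_space_imp_subprob_space[OF prob_kap_part[OF True]] by (simp add: space_subprob_algebra)
  next
    case False
    then show ?thesis using subprob_null_BX by (simp add: space_subprob_algebra)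
  qed
  then show ?thesis by simp
qed

lemma sets_kap [simp]: "sets (kap n x g) = sets BX"
  unfolding kap_def using sets_kernel[OF kap_kernel] by (subst sets_bind[where N = BX]) auto

lemma space_kap [simp]: "space (kap n x g) = topspace T"
  using sets_eq_imp_space_eq[OF sets_kap] by simp

lemma emeasure_kap:
  assumes E: "E \<in> sets BX"
  shows "emeasure (kap n x g) E = (\<Sum>V\<in>Vs (act (- g) x). emeasure (leb dm) (sec n x V E g) / emeasure (leb dm) (Q n V (act (- g) x)))
    / of_nat (card (Vs (act (- g) x)))"
proof -
  note ne = Vs_nonempty[OF actx, of "- g"] Vs_finite[OF actx, of "- g"]
  have "emeasure (kap n x g) E = (\<integral>\<^sup>+V. emeasure (if V \<in> VV then distr (uniform_measure (leb dm) (Q n V (act (- g) x))) BX (\<lambda>u. act g (cinv (cV V) u)) else null_measure BX) E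
     \<partial>measure_pmf (pmf_of_set (Vs (act (- g) x))))"
    unfolding kap_def by (rule emeasure_bind[OF _ kap_kernel E]) simp
  also have "\<dots> = (\<Sum>V\<in>Vs (act (- g) x). emeasure (if V \<in> VV then distr (uniform_measure (leb dm) (Q n V (act (- g) x))) BX (\<lambda>u. act g (cinv (cV V) u)) else null_measure BX) E)
     / of_nat (card (Vs (act (- g) x)))"
    by (subst nn_integral_pmf_of_set[OF ne]) (simp add: ennreal_of_nat_eq_real_of_nat)
  also have "(\<Sum>V\<in>Vs (act (- g) x). emeasure (if V \<in> VV then distr (uniform_measure (leb dm) (Q n V (act (- g) x))) BX (\<lambda>u. act g (cinv (cV V) u)) else null_measure BX) E)
     = (\<Sum>V\<in>Vs (act (- g) x). emeasure (leb dm) (sec n x V E g) / emeasure (leb dm) (Q n V (act (- g) x)))"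
    using E by (intro sum.cong refl) (auto simp: Vs_def kap_part_emeasure)
  finally show ?thesis .
qed

lemma sec_space: "sec n x V (topspace T) g = Q n V (act (- g) x)" if "V \<in> VV"
  unfolding sec_def using cinv_topspace[of "cV V"] VV[OF that] act_in by blast

lemma prob_kap: "prob_space (kap n x g)"
proof (rule prob_spaceI)
  let ?S = "Vs (act (- g) x)"
  have E: "topspace T \<in> sets BX" by blast
  have "(\<Sum>V\<in>?S. emeasure (leb dm) (sec n x V (topspace T) g) / emeasure (leb dm) (Q n V (act (- g) x))) = (\<Sum>V\<in>?S. 1)"
  proof (rule sum.cong[OF refl])
    fix V assume "V \<in> ?S"
    then have "V \<in> VV" by (simp add: Vs_def)
    then show "emeasure (leb dm) (sec n x V (topspace T) g) / emeasure (leb dm) (Q n V (act (- g) x)) = 1"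
      using Q_bounds[of V n "act (- g) x"] by (simp add: sec_space ennreal_divide_self top.not_eq_extremum)
  qed
  then show "emeasure (kap n x g) (space (kap n x g)) = 1"
    using Vs_nonempty[OF actx, of "- g"] Vs_finite[OF actx, of "- g"]
    by (simp add: emeasure_kap[OF E] ennreal_divide_self card_gt_0_iff ennreal_of_nat_eq_real_of_nat)
qed

definition mV :: "nat \<Rightarrow> 'x set \<Rightarrow> 'x set \<Rightarrow> 'g \<Rightarrow> real" where
  "mV n V E g = (if act (- g) x \<in> V then measure (leb dm) (sec n x V E g) / (2 * (rV V / (real n + 1))) ^ dm else 0)"

text \<open>The numerator of \<open>kap\<close>, kept apart from the number of cover members: for
  open \<open>E\<close> it is lower semicontinuous in \<open>g\<close>, which the quotient need not
  be.\<close>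

definition mS :: "nat \<Rightarrow> 'x set \<Rightarrow> 'g \<Rightarrow> real" where
  "mS n E g = (\<Sum>V\<in>Vs (act (- g) x). mV n V E g)"

lemma sec_finite: "V \<in> VV \<Longrightarrow> emeasure (leb dm) (sec n x V E g) \<noteq> \<infinity>"
proof -
  assume V: "V \<in> VV"
  have "emeasure (leb dm) (sec n x V E g) \<le> emeasure (leb dm) (Q n V (act (- g) x))"
    by (rule emeasure_mono) (auto simp: sec_def)
  then show ?thesis using Q_bounds[OF V, of n "act (- g) x"] by (metis infinity_ennreal_def neq_top_trans)
qed

lemma measure_kap:
  assumes E: "E \<in> sets BX"
  shows "measure (kap n x g) E = mS n E g / real (card (Vs (act (- g) x)))"
proof -
  let ?S = "Vs (act (- g) x)"
  have "emeasure (leb dm) (sec n x V E g) / emeasure (leb dm) (Q n V (act (- g) x)) = ennreal (mV n V E g)" if "V \<in> ?S" for V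
  proof -
    have V: "V \<in> VV" "act (- g) x \<in> V" using that by (auto simp: Vs_def)
    have "emeasure (leb dm) (sec n x V E g) = ennreal (measure (leb dm) (sec n x V E g))"
      using sec_finite[OF V(1)] by (intro emeasure_eq_ennreal_measure) auto
    then show ?thesis using VV[OF V(1)] V(2) by (simp add: emeasure_Q[OF V(1)] mV_def divide_ennreal)
  qed
  moreover have nn: "mV n V E g \<ge> 0" if "V \<in> ?S" for V
    using that VV[of V] by (auto simp: mV_def Vs_def)
  ultimately have "emeasure (kap n x g) E = ennreal (mS n E g) / of_nat (card ?S)"
    unfolding emeasure_kap[OF E] mS_def by (subst sum_ennreal[symmetric]) auto
  also have "\<dots> = ennreal (mS n E g / real (card ?S))"
    using Vs_nonempty[OF actx, of "- g"] Vs_finite[OF actx, of "- g"] nn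
    unfolding ennreal_of_nat_eq_real_of_nat mS_def by (intro divide_ennreal sum_nonneg) (auto simp: card_gt_0_iff)
  finally show ?thesis using nn by (simp add: measure_def mS_def sum_nonneg)
qed

lemma sec_graph_open:
  assumes V: "V \<in> VV" and E: "openin T E"
  shows "openin (prod_topology euclidean (Rn dm)) {(g, u). act (- g) x \<in> V \<and> u \<in> sec n x V E g}"
proof -
  let ?c = "cV V" and ?P = "prod_topology (euclidean :: 'g topology) (Rn dm)"
  have c: "?c \<in> atlas X" using VV[OF V] by blast
  have orb: "continuous_map ?P T (\<lambda>z. act (- fst z) x)"
  proof -
    have "continuous_map ?P euclidean (\<lambda>z. - fst z)"
    proof -
      have "continuous_map (euclidean :: 'g topology) euclidean (uminus :: 'g \<Rightarrow> 'g)"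
        by (simp add: continuous_on_minus continuous_on_id)
      from continuous_map_compose[OF continuous_map_fst this] show ?thesis by (simp add: comp_def)
    qed
    then have "continuous_map ?P (prod_topology euclidean T) (\<lambda>z. (- fst z, x))"
      using x by (intro continuous_map_pairedI) auto
    from continuous_map_compose[OF this act_continuous] show ?thesis by (simp add: comp_def)
  qed
  \<comment> \<open>On this open set both chart maps are applied inside their domains and are
    continuous; the whole graph lies in it by \<open>Q_subset\<close>.\<close>
  define O1 where "O1 = {z \<in> topspace ?P. act (- fst z) x \<in> V} \<inter> {z \<in> topspace ?P. snd z \<in> snd ?c ` fst ?c}"
  have O1: "openin ?P O1" unfolding O1_def
    using VV[OF V] chart_open(2)[OF c]
    by (intro openin_Int openin_continuous_map_preimage[OF orb] openin_continuous_map_preimage[OF continuous_map_snd]) auto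
  have tO1: "topspace (subtopology ?P O1) = O1" using openin_subset[OF O1] by auto
  let ?S = "subtopology ?P O1"
  have c1: "continuous_map ?S T (\<lambda>z. act (fst z) (cinv ?c (snd z)))"
  proof -
    have inv: "continuous_map (subtopology (Rn dm) (snd ?c ` fst ?c)) T (cinv ?c)"
      unfolding continuous_map
    proof (intro conjI allI impI)
      show "cinv ?c ` topspace (subtopology (Rn dm) (snd ?c ` fst ?c)) \<subseteq> topspace T" using cinv_topspace[OF c] by blast
      fix U assume U: "openin T U"
      have "{u \<in> topspace (subtopology (Rn dm) (snd ?c ` fst ?c)). cinv ?c u \<in> U} = snd ?c ` (U \<inter> fst ?c)"
        using chart_image_subset[OF c] cinv_chart[OF c] by (auto simp: topspace_Rn)
      then show "openin (subtopology (Rn dm) (snd ?c ` fst ?c)) {u \<in> topspace (subtopology (Rn dm) (snd ?c ` fst ?c)). cinv ?c u \<in> U}"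
        using chart_open_image[OF c U] by (subst openin_open_subtopology[OF chart_open(2)[OF c]]) auto
    qed
    have "continuous_map ?S (subtopology (Rn dm) (snd ?c ` fst ?c)) snd"
      using continuous_map_from_subtopology[OF continuous_map_snd] by (rule continuous_map_into_subtopology) (auto simp: O1_def)
    from continuous_map_compose[OF this inv] have "continuous_map ?S T (\<lambda>z. cinv ?c (snd z))" by (simp add: comp_def)
    then have "continuous_map ?S (prod_topology euclidean T) (\<lambda>z. (fst z, cinv ?c (snd z)))"
      by (intro continuous_map_pairedI continuous_map_from_subtopology[OF continuous_map_fst])
    from continuous_map_compose[OF this act_continuous] show ?thesis by (simp add: comp_def)
  qed
  have c2: "continuous_map ?S euclideanreal (\<lambda>z. \<bar>snd z i - snd ?c (act (- fst z) x) i\<bar>)" if i: "i < dm" for i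
  proof -
    have proj: "continuous_map (Rn dm) euclideanreal (\<lambda>u. u i)"
      unfolding Rn_def using i by (intro continuous_map_product_projection) simp
    have 1: "continuous_map ?S euclideanreal (\<lambda>z. snd z i)"
      using continuous_map_compose[OF continuous_map_from_subtopology[OF continuous_map_snd] proj] by (simp add: comp_def)
    have "continuous_map (subtopology T (fst ?c)) (Rn dm) (snd ?c)"
      using homeomorphic_imp_continuous_map[OF chart_homeo[OF c]] by (rule continuous_map_into_fulltopology)
    moreover have "continuous_map ?S (subtopology T (fst ?c)) (\<lambda>z. act (- fst z) x)"
      using continuous_map_from_subtopology[OF orb] by (rule continuous_map_into_subtopology) (use VV[OF V] in \<open>auto simp: O1_def\<close>)
    ultimately have "continuous_map ?S (Rn dm) (snd ?c \<circ> (\<lambda>z. act (- fst z) x))"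
      by (intro continuous_map_compose)
    then have "continuous_map ?S (Rn dm) (\<lambda>z. snd ?c (act (- fst z) x))" by (simp only: comp_def)
    from continuous_map_compose[OF this proj] have 2: "continuous_map ?S euclideanreal (\<lambda>z. snd ?c (act (- fst z) x) i)" by (simp add: comp_def)
    show ?thesis using 1 2 by (intro continuous_map_real_abs continuous_map_diff)
  qed
  let ?r = "rV V / (real n + 1)"
  have A: "openin ?P {z \<in> O1. act (fst z) (cinv ?c (snd z)) \<in> E}"
    using openin_trans_full[OF openin_continuous_map_preimage[OF c1 E] O1] unfolding tO1 .
  have B: "openin ?P {z \<in> O1. \<bar>snd z i - snd ?c (act (- fst z) x) i\<bar> \<in> {..< ?r}}" if "i < dm" for i
    using openin_trans_full[OF openin_continuous_map_preimage[OF c2[OF that], of "{..< ?r}"] O1] unfolding tO1 by simp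
  have "openin ?P (\<Inter> (insert {z \<in> O1. act (fst z) (cinv ?c (snd z)) \<in> E}
      ((\<lambda>i. {z \<in> O1. \<bar>snd z i - snd ?c (act (- fst z) x) i\<bar> \<in> {..< ?r}}) ` {..<dm})))"
    using A B by (intro openin_Inter) auto
  moreover have "\<Inter> (insert {z \<in> O1. act (fst z) (cinv ?c (snd z)) \<in> E}
      ((\<lambda>i. {z \<in> O1. \<bar>snd z i - snd ?c (act (- fst z) x) i\<bar> \<in> {..< ?r}}) ` {..<dm}))
     = {(g, u). act (- g) x \<in> V \<and> u \<in> sec n x V E g}"
  proof (intro equalityI subsetI)
    fix z assume z: "z \<in> \<Inter> (insert {z \<in> O1. act (fst z) (cinv ?c (snd z)) \<in> E}
      ((\<lambda>i. {z \<in> O1. \<bar>snd z i - snd ?c (act (- fst z) x) i\<bar> \<in> {..< ?r}}) ` {..<dm}))"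
    then have zO: "z \<in> O1" and zE: "act (fst z) (cinv ?c (snd z)) \<in> E" by blast+
    have "\<bar>snd z i - snd ?c (act (- fst z) x) i\<bar> < ?r" if "i < dm" for i using z that by blast
    moreover have "snd z \<in> extensional {..<dm}" using zO chart_image_subset[OF c] by (auto simp: O1_def)
    ultimately have "snd z \<in> Q n V (act (- fst z) x)" by (simp add: Q_def mem_cube)
    then show "z \<in> {(g, u). act (- g) x \<in> V \<and> u \<in> sec n x V E g}" using zO zE by (auto simp: sec_def O1_def split_def)
  next
    fix z assume "z \<in> {(g, u). act (- g) x \<in> V \<and> u \<in> sec n x V E g}"
    then have z: "act (- fst z) x \<in> V" "snd z \<in> Q n V (act (- fst z) x)" "act (fst z) (cinv ?c (snd z)) \<in> E"
      by (auto simp: sec_def split_def)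
    then have "snd z \<in> snd ?c ` fst ?c" using Q_subset[OF V] by blast
    then have zO: "z \<in> O1" using z(1) chart_image_subset[OF c] by (cases z) (auto simp: O1_def topspace_Rn)
    have "\<bar>snd z i - snd ?c (act (- fst z) x) i\<bar> < ?r" if "i < dm" for i using z(2) that by (simp add: Q_def mem_cube)
    then show "z \<in> \<Inter> (insert {z \<in> O1. act (fst z) (cinv ?c (snd z)) \<in> E}
      ((\<lambda>i. {z \<in> O1. \<bar>snd z i - snd ?c (act (- fst z) x) i\<bar> \<in> {..< ?r}}) ` {..<dm}))" using zO z(3) by simp
  qed
  ultimately show ?thesis by simp
qed

lemma mV_lsc:
  assumes V: "V \<in> VV" and E: "openin T E" and a: "a < mV n V E g0" and V0: "act (- g0) x \<in> V"
  shows "eventually (\<lambda>g. a < mV n V E g) (nhds g0)"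
\<comment> \<open>\<open>ennreal\<close> would send a negative bound to 0; since \<open>mV\<close>
  is nonnegative, this case is separate and immediate.\<close>
proof (cases "a < 0")
  case True
  have "mV n V E g \<ge> 0" for g using VV[OF V] by (simp add: mV_def)
  then show ?thesis using True by (intro always_eventually allI) (meson less_le_trans)
next
  case False
  let ?W = "{(g, u). act (- g) x \<in> V \<and> u \<in> sec n x V E g}" and ?q = "(2 * (rV V / (real n + 1))) ^ dm"
  have q: "?q > 0" using VV[OF V] by simp
  have em: "emeasure (leb dm) (sec n x V E g) = ennreal (measure (leb dm) (sec n x V E g))" for g
    using sec_finite[OF V] by (intro emeasure_eq_ennreal_measure) auto
  have "a * ?q < measure (leb dm) (sec n x V E g0)" using a q V0 by (simp add: mV_def pos_less_divide_eq)
  then have "ennreal (a * ?q) < emeasure (leb dm) (sec n x V E g0)" unfolding em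
    using False q by (intro ennreal_lessI) (auto intro: le_less_trans[of 0 "a * ?q"])
  moreover have "{u. (g0, u) \<in> ?W} = sec n x V E g0" using V0 by auto
  ultimately have "eventually (\<lambda>g. ennreal (a * ?q) < emeasure (leb dm) {u. (g, u) \<in> ?W}) (nhds g0)"
    by (intro section_emeasure_lower_semicontinuous[OF sec_graph_open[OF V E]]) simp
  then show ?thesis
  proof eventually_elim
    case (elim g)
    have gV: "act (- g) x \<in> V"
    proof (rule ccontr)
      assume "act (- g) x \<notin> V"
      then show False using elim by simp
    qed
    then have "ennreal (a * ?q) < ennreal (measure (leb dm) (sec n x V E g))" using elim em[of g] by simp
    then have "a * ?q < measure (leb dm) (sec n x V E g)" using False q by (subst (asm) ennreal_less_iff) auto
    then show ?case using q gV by (simp add: mV_def pos_less_divide_eq)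
  qed
qed

lemma orbit_continuous: "openin T V \<Longrightarrow> open {g. act (- g) x \<in> V}"
proof -
  assume V: "openin T V"
  have "continuous_map (euclidean :: 'g topology) euclidean (uminus :: 'g \<Rightarrow> 'g)"
    by (simp add: continuous_on_minus continuous_on_id)
  then have "continuous_map (euclidean :: 'g topology) (prod_topology euclidean T) (\<lambda>g. (- g, x))"
    using x by (intro continuous_map_pairedI) auto
  from continuous_map_compose[OF this act_continuous]
  have "continuous_map euclidean T (\<lambda>g. act (- g) x)" by (simp add: comp_def)
  from openin_continuous_map_preimage[OF this V] show ?thesis by (simp add: open_openin[symmetric])
qed

text \<open>The cover may be uncountable, so measurability of the single terms would not suffice.
  Instead the sum is lower semicontinuous: the finitely many terms present at \<open>g0\<close>
  persist up to a small loss, and terms that appear nearby are nonnegative.\<close>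

lemma mS_measurable:
  assumes E: "openin T E"
  shows "mS n E \<in> borel_measurable borel"
  unfolding borel_measurable_iff_greater
proof (intro allI)
  fix a :: real
  have "open {g. a < mS n E g}"
    unfolding open_subopen[of "{g. a < mS n E g}"]
  proof (intro ballI)
    fix g0 assume "g0 \<in> {g. a < mS n E g}"
    then have a: "a < mS n E g0" by simp
    let ?S0 = "Vs (act (- g0) x)"
    have fin: "finite ?S0" by (rule Vs_finite[OF actx])
    \<comment> \<open>The gap is shared among the terms at \<open>g0\<close>; the summand 1 keeps
      the total loss strictly below the gap.\<close>
    define \<delta> where "\<delta> = (mS n E g0 - a) / (real (card ?S0) + 1)"
    have \<delta>: "\<delta> > 0" using a by (simp add: \<delta>_def)
    have ev1: "eventually (\<lambda>g. \<forall>V\<in>?S0. mV n V E g0 - \<delta> < mV n V E g) (nhds g0)"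
      using fin
    proof (rule eventually_ball_finite, intro ballI)
      fix V assume "V \<in> ?S0"
      then show "eventually (\<lambda>g. mV n V E g0 - \<delta> < mV n V E g) (nhds g0)"
        using \<delta> E by (intro mV_lsc) (auto simp: Vs_def)
    qed
    have ev2: "eventually (\<lambda>g. \<forall>V\<in>?S0. act (- g) x \<in> V) (nhds g0)"
      using fin
    proof (rule eventually_ball_finite, intro ballI)
      fix V assume "V \<in> ?S0"
      then have "open {g. act (- g) x \<in> V}" "g0 \<in> {g. act (- g) x \<in> V}"
        using orbit_continuous VV by (auto simp: Vs_def)
      then show "eventually (\<lambda>g. act (- g) x \<in> V) (nhds g0)" unfolding eventually_nhds by blast
    qed
    from ev1 ev2 have "eventually (\<lambda>g. a < mS n E g) (nhds g0)"
    proof eventually_elim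
      case (elim g)
      have sub: "?S0 \<subseteq> Vs (act (- g) x)" using elim(2) by (auto simp: Vs_def)
      have "real (card ?S0) * \<delta> < mS n E g0 - a"
      proof -
        have "real (card ?S0) * \<delta> < (real (card ?S0) + 1) * \<delta>" using \<delta> by simp
        also have "\<dots> = mS n E g0 - a" by (simp add: \<delta>_def)
        finally show ?thesis .
      qed
      then have "a < mS n E g0 - real (card ?S0) * \<delta>" by simp
      also have "\<dots> = (\<Sum>V\<in>?S0. mV n V E g0 - \<delta>)" by (simp add: mS_def sum_subtractf)
      also have "\<dots> \<le> (\<Sum>V\<in>?S0. mV n V E g)" using elim(1) by (intro sum_mono) (simp add: less_imp_le)
      also have "\<dots> \<le> mS n E g" unfolding mS_def
      proof (intro sum_mono2 sub Vs_finite[OF actx])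
        fix V assume "V \<in> Vs (act (- g) x) - ?S0"
        then show "0 \<le> mV n V E g" using VV[of V] by (simp add: mV_def Vs_def)
      qed
      finally show ?case .
    qed
    then show "\<exists>U. open U \<and> g0 \<in> U \<and> U \<subseteq> {g. a < mS n E g}" unfolding eventually_nhds by blast
  qed
  then show "{g \<in> space borel. a < mS n E g} \<in> sets borel" by simp
qed

text \<open>Every term of the numerator is 1 for the whole space, so the denominator of
  \<open>kap\<close> is itself a value of \<open>mS\<close> and is measurable for the same
  reason.\<close>

lemma card_Vs_eq: "real (card (Vs (act (- g) x))) = mS n (topspace T) g"
proof -
  have "mV n V (topspace T) g = 1" if "V \<in> Vs (act (- g) x)" for V
  proof -
    have V: "V \<in> VV" "act (- g) x \<in> V" using that by (auto simp: Vs_def)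
    have "measure (leb dm) (Q n V (act (- g) x)) = (2 * (rV V / (real n + 1))) ^ dm"
      using VV[OF V(1)] by (simp add: measure_def emeasure_Q[OF V(1)])
    then show ?thesis using V VV[OF V(1)] by (simp add: mV_def sec_space)
  qed
  then show ?thesis by (simp add: mS_def)
qed

text \<open>Open sets generate \<open>BX\<close> and are stable under intersection, and on them
  \<open>kap\<close> is a quotient of two lower semicontinuous functions of
  \<open>g\<close>.\<close>

lemma kap_measurable: "kap n x \<in> measurable borel (subprob_algebra BX)"
proof (rule measurable_subprob_algebra_generated[OF sets_BX])
  show "Int_stable {U. openin T U}" by (auto simp: Int_stable_def)
  show "{U. openin T U} \<subseteq> Pow (topspace T)" using openin_subset by blast
  show "subprob_space (kap n x g)" for g using prob_kap by (rule prob_space_imp_subprob_space)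
  show "sets (kap n x g) = sets BX" for g by simp
  have m: "(\<lambda>g. emeasure (kap n x g) E) \<in> borel_measurable borel" if E: "openin T E" for E
  proof -
    have "emeasure (kap n x g) E = ennreal (mS n E g / mS n (topspace T) g)" for g
    proof -
      interpret prob_space "kap n x g" by (rule prob_kap)
      show ?thesis using E by (simp add: emeasure_eq_measure measure_kap openin_sets_BX card_Vs_eq[of g n])
    qed
    then show ?thesis using mS_measurable[OF E] mS_measurable[OF openin_topspace] by simp
  qed
  then show "(\<lambda>g. emeasure (kap n x g) E) \<in> borel_measurable borel" if "E \<in> {U. openin T U}" for E using that by simp
  show "(\<lambda>g. emeasure (kap n x g) (topspace T)) \<in> borel_measurable borel" by (rule m) simp
qed

end

end

section \<open>Averages over the group and their domination by cubes\<close>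

locale C1_kernel = C1_cover X act M VV cV zV rV
  for X :: "'x manifold" and act :: "'g::{topological_group_add, t2_space} \<Rightarrow> 'x \<Rightarrow> 'x" and M VV cV zV rV +
  fixes \<nu> :: "'g measure"
  assumes Haar: "left_haar_measure \<nu>"
begin

lemma sets_nu [measurable_cong, simp]: "sets \<nu> = sets borel"
  using Haar by (simp add: left_haar_measure_def)

lemma space_nu [simp]: "space \<nu> = UNIV"
  using sets_eq_imp_space_eq[OF sets_nu] by simp

lemma measurable_translation: "(\<lambda>h. s + h) \<in> measurable borel (borel :: 'g measure)"
  by (intro borel_measurable_continuous_onI continuous_intros)

lemma distr_translation: "distr \<nu> borel (\<lambda>h. s + h) = \<nu>"
proof (rule measure_eqI)
  fix A assume "A \<in> sets (distr \<nu> borel (\<lambda>h. s + h))"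
  then have A: "A \<in> sets borel" by simp
  have m: "(\<lambda>h. s + h) \<in> measurable \<nu> borel" using measurable_translation by simp
  have e: "(\<lambda>h. s + h) -` A = (+) (- s) ` A"
  proof (intro equalityI subsetI)
    fix h assume "h \<in> (\<lambda>h. s + h) -` A"
    then have "s + h \<in> A" by simp
    moreover have "h = - s + (s + h)" by (simp add: add.assoc[symmetric])
    ultimately show "h \<in> (+) (- s) ` A" by blast
  qed (auto simp: add.assoc[symmetric])
  have "emeasure (distr \<nu> borel (\<lambda>h. s + h)) A = emeasure \<nu> ((+) (- s) ` A)"
    using m A by (simp add: emeasure_distr e)
  also have "\<dots> = emeasure \<nu> A" using Haar A unfolding left_haar_measure_def by blast
  finally show "emeasure (distr \<nu> borel (\<lambda>h. s + h)) A = emeasure \<nu> A" .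
qed simp

lemma nn_integral_translation:
  assumes "f \<in> borel_measurable \<nu>"
  shows "(\<integral>\<^sup>+g. f g \<partial>\<nu>) = (\<integral>\<^sup>+h. f (s + h) \<partial>\<nu>)"
proof -
  have "(\<integral>\<^sup>+g. f g \<partial>\<nu>) = (\<integral>\<^sup>+g. f g \<partial>distr \<nu> borel (\<lambda>h. s + h))" by (simp add: distr_translation)
  also have "\<dots> = (\<integral>\<^sup>+h. f (s + h) \<partial>\<nu>)" using assms measurable_translation[of s] by (intro nn_integral_distr) auto
  finally show ?thesis .
qed

text \<open>The weight is arbitrary because parts of mass below 1 are needed as well: weights cut
  off to a set of good \<open>g\<close>, and the minimum of two weights.\<close>

definition Kw :: "nat \<Rightarrow> 'x \<Rightarrow> ('g \<Rightarrow> ennreal) \<Rightarrow> 'x measure" where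
  "Kw n x w = density \<nu> w \<bind> kap n x"

context
  fixes x assumes x: "x \<in> topspace T"
begin

lemma kap_measurable_density: "kap n x \<in> measurable (density \<nu> w) (subprob_algebra BX)"
  using kap_measurable[OF x, of n] by (simp cong: measurable_cong_sets)

lemma sets_Kw [simp]: "sets (Kw n x w) = sets BX"
  unfolding Kw_def by (rule sets_bind) (use sets_kap[OF x] in auto)

lemma space_Kw [simp]: "space (Kw n x w) = topspace T"
  using sets_eq_imp_space_eq[OF sets_Kw] by simp

lemma emeasure_kap_measurable: "E \<in> sets BX \<Longrightarrow> (\<lambda>g. emeasure (kap n x g) E) \<in> borel_measurable \<nu>"
  using measurable_emeasure_subprob_algebra[of E BX] kap_measurable[OF x, of n]
  by (auto intro: measurable_compose cong: measurable_cong_sets)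

lemma emeasure_Kw:
  assumes "w \<in> borel_measurable \<nu>" "E \<in> sets BX"
  shows "emeasure (Kw n x w) E = (\<integral>\<^sup>+g. w g * emeasure (kap n x g) E \<partial>\<nu>)"
proof -
  have "emeasure (Kw n x w) E = (\<integral>\<^sup>+g. emeasure (kap n x g) E \<partial>density \<nu> w)"
    unfolding Kw_def by (rule emeasure_bind[OF _ kap_measurable_density assms(2)]) simp
  also have "\<dots> = (\<integral>\<^sup>+g. w g * emeasure (kap n x g) E \<partial>\<nu>)"
    by (rule nn_integral_density[OF assms(1) emeasure_kap_measurable[OF assms(2)]])
  finally show ?thesis .
qed

lemma emeasure_Kw_space:
  assumes "w \<in> borel_measurable \<nu>"
  shows "emeasure (Kw n x w) (topspace T) = (\<integral>\<^sup>+g. w g \<partial>\<nu>)"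
proof -
  have "emeasure (kap n x g) (topspace T) = 1" for g
    using prob_space.emeasure_space_1[OF prob_kap[OF x, of n g]] by (simp add: space_kap[OF x])
  then show ?thesis by (simp add: emeasure_Kw[OF assms openin_sets_BX[OF openin_topspace]])
qed

lemma emeasure_Kw_mono:
  assumes "w \<in> borel_measurable \<nu>" "w' \<in> borel_measurable \<nu>" "\<And>g. w' g \<le> w g" "E \<in> sets BX"
  shows "emeasure (Kw n x w') E \<le> emeasure (Kw n x w) E"
  using assms by (simp add: emeasure_Kw nn_integral_mono mult_right_mono)

text \<open>The preimage of \<open>E\<close> under \<open>act g\<close> is locally null by
  \<open>locnull_act\<close>, hence null in the chart of each \<open>V\<close>.\<close>

lemma kap_locnull: "locnull E \<Longrightarrow> emeasure (kap n x g) E = 0"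
proof -
  assume E: "locnull E"
  then have Em: "E \<in> sets BX" by (simp add: locnull_def)
  have "emeasure (leb dm) (sec n x V E g) = 0" if "V \<in> Vs (act (- g) x)" for V
  proof -
    have V: "V \<in> VV" "act (- g) x \<in> V" using that by (auto simp: Vs_def)
    have c: "cV V \<in> atlas X" using VV[OF V(1)] by blast
    have null: "snd (cV V) ` ({y \<in> topspace T. act g y \<in> E} \<inter> fst (cV V)) \<in> null_sets (leb dm)"
      using locnull_act[OF E, of g] c by (simp add: locnull_def)
    have "sec n x V E g \<subseteq> snd (cV V) ` ({y \<in> topspace T. act g y \<in> E} \<inter> fst (cV V))"
    proof
      fix u assume u: "u \<in> sec n x V E g"
      then have "u \<in> snd (cV V) ` fst (cV V)" using Q_subset[OF V] by (auto simp: sec_def)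
      from cinv_in[OF c this] have "cinv (cV V) u \<in> fst (cV V)" "u = snd (cV V) (cinv (cV V) u)" by auto
      moreover have "act g (cinv (cV V) u) \<in> E" using u by (simp add: sec_def)
      ultimately show "u \<in> snd (cV V) ` ({y \<in> topspace T. act g y \<in> E} \<inter> fst (cV V))"
        using cinv_topspace[OF c] by blast
    qed
    then have "emeasure (leb dm) (sec n x V E g) \<le> emeasure (leb dm) (snd (cV V) ` ({y \<in> topspace T. act g y \<in> E} \<inter> fst (cV V)))"
      using null by (intro emeasure_mono) auto
    then show ?thesis using null by (simp add: null_sets_def)
  qed
  then show ?thesis by (simp add: emeasure_kap[OF x Em])
qed

lemma ac_prob_Kw:
  assumes w: "w \<in> borel_measurable \<nu>" "(\<integral>\<^sup>+g. w g \<partial>\<nu>) = 1"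
  shows "ac_prob (Kw n x w)"
  unfolding ac_prob_def
proof (intro conjI allI impI sets_Kw)
  show "prob_space (Kw n x w)" using emeasure_Kw_space[OF w(1)] w(2) by (intro prob_spaceI) simp
  fix E assume E: "locnull E"
  then have "E \<in> sets BX" by (simp add: locnull_def)
  then show "emeasure (Kw n x w) E = 0" by (simp add: emeasure_Kw[OF w(1)] kap_locnull[OF E])
qed

text \<open>The inverse of \<open>s + h\<close> carries \<open>act s x\<close> to
  \<open>act (- h) x\<close>, so both sides involve the same cover members and the same
  cubes.\<close>

lemma emeasure_kap_shift:
  assumes E: "E \<in> sets BX"
  shows "emeasure (kap n (act s x) (s + h)) E = emeasure (kap n x h) {y \<in> topspace T. act s y \<in> E}"
proof -
  have sx: "act s x \<in> topspace T" using x by (rule act_in)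
  have E': "{y \<in> topspace T. act s y \<in> E} \<in> sets BX" by (rule act_vimage_sets[OF E])
  have pt: "act (- (s + h)) (act s x) = act (- h) x"
  proof -
    have "act (- h + - s) (act s x) = act (- h) (act (- s) (act s x))" by (rule act_add[OF sx])
    then show ?thesis by (simp only: minus_add act_minus(1)[OF x])
  qed
  have "sec n (act s x) V E (s + h) = sec n x V {y \<in> topspace T. act s y \<in> E} h" if "V \<in> VV" for V
  proof -
    have "act (s + h) (cinv (cV V) u) = act s (act h (cinv (cV V) u))" for u
      using cinv_topspace[of "cV V" u] VV[OF that] by (intro act_add) blast
    moreover have "act h (cinv (cV V) u) \<in> topspace T" for u
      using cinv_topspace[of "cV V" u] VV[OF that] by (intro act_in) blast
    ultimately show ?thesis unfolding sec_def pt by simp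
  qed
  then show ?thesis unfolding emeasure_kap[OF sx E] emeasure_kap[OF x E'] pt
    by (intro arg_cong2[of _ _ _ _ "(/)"] sum.cong refl) (auto simp: Vs_def)
qed

end

text \<open>Left invariance of Haar measure allows the substitution of \<open>s + h\<close> for
  \<open>g\<close>. After it only the weights distinguish the kernel at \<open>act s x\<close> from
  the image of the kernel at \<open>x\<close>.\<close>

lemma emeasure_Kw_shift:
  assumes x: "x \<in> topspace T" and w: "w \<in> borel_measurable \<nu>" and E: "E \<in> sets BX"
  shows "emeasure (Kw n (act s x) w) E = emeasure (Kw n x (\<lambda>h. w (s + h))) {y \<in> topspace T. act s y \<in> E}"
proof -
  have sx: "act s x \<in> topspace T" using x by (rule act_in)
  have E': "{y \<in> topspace T. act s y \<in> E} \<in> sets BX" by (rule act_vimage_sets[OF E])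
  have ws: "(\<lambda>h. w (s + h)) \<in> borel_measurable \<nu>"
    using measurable_compose[OF measurable_translation, of w borel s] w by (simp cong: measurable_cong_sets)
  have "emeasure (Kw n (act s x) w) E = (\<integral>\<^sup>+g. w g * emeasure (kap n (act s x) g) E \<partial>\<nu>)"
    by (rule emeasure_Kw[OF sx w E])
  also have "\<dots> = (\<integral>\<^sup>+h. w (s + h) * emeasure (kap n (act s x) (s + h)) E \<partial>\<nu>)"
    using w emeasure_kap_measurable[OF sx E] by (intro nn_integral_translation) auto
  also have "\<dots> = emeasure (Kw n x (\<lambda>h. w (s + h))) {y \<in> topspace T. act s y \<in> E}"
    by (simp add: emeasure_kap_shift[OF x E] emeasure_Kw[OF x ws E'])
  finally show ?thesis .
qed

text \<open>\<open>V\<close> lies in the part of its chart over a closed cube, which is compact and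
  hence closed in the Hausdorff space \<open>X\<close>. So the closure of \<open>V\<close> does not
  leave the chart domain.\<close>

lemma cover_closure:
  assumes V: "V \<in> VV" and y: "y \<in> topspace T" "y \<notin> fst (cV V)"
  shows "\<exists>U. openin T U \<and> y \<in> U \<and> U \<inter> V = {}"
proof -
  let ?c = "cV V"
  have c: "?c \<in> atlas X" using VV[OF V] by blast
  let ?K = "Pi\<^sub>E {..<dm} (\<lambda>i. {zV V i - rV V .. zV V i + rV V})"
  have Ksub: "?K \<subseteq> cube dm (zV V) (3 * rV V)"
  proof
    fix w assume w: "w \<in> ?K"
    have "\<bar>w i - zV V i\<bar> < 3 * rV V" if "i < dm" for i
    proof -
      have "w i \<in> {zV V i - rV V .. zV V i + rV V}" using that by (intro PiE_mem[OF w]) simp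
      then show ?thesis using VV[OF V] unfolding atLeastAtMost_iff by linarith
    qed
    then show "w \<in> cube dm (zV V) (3 * rV V)" using w by (simp add: mem_cube PiE_iff)
  qed
  then have Kimg: "?K \<subseteq> snd ?c ` fst ?c" using VV[OF V] by blast
  let ?A = "{x \<in> fst ?c. snd ?c x \<in> ?K}"
  have "snd ?c ` ?A = ?K" using Kimg by blast
  then have "compactin (subtopology (Rn dm) (snd ?c ` fst ?c)) (snd ?c ` ?A)"
    using compactin_closed_cube[of dm "zV V" "rV V"] Kimg by (simp add: compactin_subtopology)
  then have "compactin (subtopology T (fst ?c)) ?A"
    using homeomorphic_map_compactness[OF chart_homeo[OF c], of ?A] chart_subset[OF c] by auto
  then have "compactin T ?A" by (simp add: compactin_subtopology)
  then have cl: "closedin T ?A"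
    using manifold compactin_imp_closedin unfolding differentiable_manifold_def by blast
  have "V \<subseteq> ?A"
  proof
    fix v assume "v \<in> V"
    then have v: "v \<in> fst ?c" "snd ?c v \<in> cube dm (zV V) (rV V)" using VV[OF V] by blast+
    have "snd ?c v i \<in> {zV V i - rV V .. zV V i + rV V}" if "i < dm" for i
    proof -
      have "\<bar>snd ?c v i - zV V i\<bar> < rV V" using v(2) that by (simp add: mem_cube)
      then show ?thesis unfolding atLeastAtMost_iff by linarith
    qed
    then have "snd ?c v \<in> ?K" using v(2) by (simp add: mem_cube PiE_iff)
    then show "v \<in> ?A" using v by blast
  qed
  moreover have "openin T (topspace T - ?A)" using cl by (rule openin_diff[OF openin_topspace])
  ultimately show ?thesis using y by (intro exI[of _ "topspace T - ?A"]) blast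
qed

text \<open>\<open>bnd c x m n\<close> is, up to a constant that does not depend on \<open>n\<close>, the uniform distribution on the cube of radius \<open>m/(n+1)\<close> around \<open>x\<close> in the chart \<open>c\<close>.\<close>

definition bnd :: "'x chart \<Rightarrow> 'x \<Rightarrow> nat \<Rightarrow> nat \<Rightarrow> 'x set \<Rightarrow> ennreal" where
  "bnd c x m n E = ennreal (real m * (real n + 1) ^ dm) *
     emeasure (leb dm) (snd c ` (E \<inter> fst c) \<inter> cube dm (snd c x) (real m / (real n + 1)))"

text \<open>The single number \<open>m\<close> serves as constant, as multiple of the radius and, in
  the bounds below, as the index from which they hold. Finitely many bounds are merged by taking the
  maximum.\<close>

lemma bnd_mono: "c \<in> atlas X \<Longrightarrow> E \<in> sets BX \<Longrightarrow> m \<le> m' \<Longrightarrow> bnd c x m n E \<le> bnd c x m' n E"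
proof -
  assume c: "c \<in> atlas X" and E: "E \<in> sets BX" and m: "m \<le> m'"
  have "cube dm (snd c x) (real m / (real n + 1)) \<subseteq> cube dm (snd c x) (real m' / (real n + 1))"
    using m by (intro cube_mono divide_right_mono) auto
  then have "emeasure (leb dm) (snd c ` (E \<inter> fst c) \<inter> cube dm (snd c x) (real m / (real n + 1)))
     \<le> emeasure (leb dm) (snd c ` (E \<inter> fst c) \<inter> cube dm (snd c x) (real m' / (real n + 1)))"
    using chart_image_sets[OF c E] by (intro emeasure_mono) auto
  then show ?thesis unfolding bnd_def using m by (intro mult_mono ennreal_leI mult_right_mono) auto
qed

text \<open>If \<open>act (- g0) x\<close> is outside the chart of \<open>V\<close>, nearby
  \<open>g\<close> do not bring \<open>x\<close> into \<open>V\<close>. Otherwise two Lipschitz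
  bounds are used: that of \<open>act g\<close> (\<open>B1\<close>) places the image of the small
  cube in a cube around \<open>x\<close>, and that of \<open>act (- g)\<close> (\<open>B2\<close>)
  bounds the volume of the preimage.\<close>

lemma local_bound:
  assumes c: "c \<in> atlas X" and xc: "x \<in> fst c" and V: "V \<in> VV"
  shows "\<exists>N m. open N \<and> g0 \<in> N \<and> (\<forall>g\<in>N. act (- g) x \<in> V \<longrightarrow> (\<forall>n\<ge>m. \<forall>E\<in>sets BX.
     emeasure (leb dm) (sec n x V E g) / emeasure (leb dm) (Q n V (act (- g) x)) \<le> bnd c x m n E))"
proof -
  have x: "x \<in> topspace T" using chart_subset[OF c] xc by blast
  let ?c' = "cV V" and ?yo = "act (- g0) x"
  have c': "?c' \<in> atlas X" using VV[OF V] by blast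
  have y0: "?yo \<in> topspace T" using x by (rule act_in)
  show ?thesis
  proof (cases "?yo \<in> fst ?c'")
    case False
    from cover_closure[OF V y0 False] obtain U where U: "openin T U" "?yo \<in> U" "U \<inter> V = {}" by (elim exE conjE)
    have "open {g. act (- g) x \<in> U}" using x U(1) by (rule orbit_continuous)
    then show ?thesis using U(2,3) by (intro exI[of _ "{g. act (- g) x \<in> U}"] exI[of _ 0]) blast
  next
    case True
    have g0y: "act g0 ?yo \<in> fst c" using x xc by simp
    from act_Lipschitz[OF c' c True g0y] obtain A1 \<rho>1 B1 where A1: "open A1" "g0 \<in> A1" "\<rho>1 > 0" "B1 \<ge> 0"
        "cube dm (snd ?c' ?yo) \<rho>1 \<subseteq> snd ?c' ` fst ?c'"
      and A1in: "\<forall>s\<in>A1. \<forall>u\<in>cube dm (snd ?c' ?yo) \<rho>1. act s (cinv ?c' u) \<in> fst c"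
      and A1L: "\<forall>s\<in>A1. \<forall>u\<in>cube dm (snd ?c' ?yo) \<rho>1. \<forall>v\<in>cube dm (snd ?c' ?yo) \<rho>1. \<forall>r. (\<forall>j<dm. \<bar>u j - v j\<bar> \<le> r) \<longrightarrow>
      (\<forall>i<dm. \<bar>snd c (act s (cinv ?c' u)) i - snd c (act s (cinv ?c' v)) i\<bar> \<le> B1 * r)"
      by (elim exE conjE) (rule that, assumption+)
    from act_Lipschitz[OF c c' xc True] obtain A2 \<rho>2 B2 where A2: "open A2" "- g0 \<in> A2" "\<rho>2 > 0" "B2 \<ge> 0"
        "cube dm (snd c x) \<rho>2 \<subseteq> snd c ` fst c"
      and A2L: "\<forall>s\<in>A2. \<forall>u\<in>cube dm (snd c x) \<rho>2. \<forall>v\<in>cube dm (snd c x) \<rho>2. \<forall>r. (\<forall>j<dm. \<bar>u j - v j\<bar> \<le> r) \<longrightarrow>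
      (\<forall>i<dm. \<bar>snd ?c' (act s (cinv c u)) i - snd ?c' (act s (cinv c v)) i\<bar> \<le> B2 * r)"
      by (elim exE conjE) (rule that, assumption+)
    let ?U = "{y \<in> fst ?c'. snd ?c' y \<in> cube dm (snd ?c' ?yo) (\<rho>1 / 2)}"
    have U: "openin T ?U" by (rule chart_open_preimage[OF c' openin_cube])
    have oU: "open {g. act (- g) x \<in> ?U}" using x U by (rule orbit_continuous)
    have gU: "g0 \<in> {g. act (- g) x \<in> ?U}"
      using True A1(3) chart_image_subset[OF c'] by (auto intro!: center_in_cube)
    have oA2: "open {g. - g \<in> A2}"
    proof -
      have "continuous_on UNIV (uminus :: 'g \<Rightarrow> 'g)" by (intro continuous_on_minus continuous_on_id)
      from open_vimage[OF A2(1) this] show ?thesis by (simp only: vimage_def)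
    qed
    let ?N = "A1 \<inter> {g. - g \<in> A2} \<inter> {g. act (- g) x \<in> ?U}"
    have oN: "open ?N" using A1(1) oA2 oU by (intro open_Int)
    have gN: "g0 \<in> ?N" using A1(2) A2(2) gU by blast
    \<comment> \<open>Four demands: the constant absorbs the volume ratio; the cube of radius
      \<open>m / (n + 1)\<close> contains the image; for \<open>n\<close> at least \<open>m\<close>
      the cube around \<open>act (- g) x\<close> lies in the domain of the bound \<open>B1\<close>,
      and the cube around \<open>x\<close> in that of \<open>B2\<close>.\<close>
    define m where "m = nat \<lceil>max ((4 * (B2 + 1)) ^ dm / (2 * rV V) ^ dm) (max (B1 + 1) (max (2 / \<rho>1) ((B1 + 1) / \<rho>2)))\<rceil>"
    have m: "(4 * (B2 + 1)) ^ dm / (2 * rV V) ^ dm \<le> real m" "B1 + 1 \<le> real m" "2 / \<rho>1 \<le> real m" "(B1 + 1) / \<rho>2 \<le> real m"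
    proof -
      have "max ((4 * (B2 + 1)) ^ dm / (2 * rV V) ^ dm) (max (B1 + 1) (max (2 / \<rho>1) ((B1 + 1) / \<rho>2))) \<le> real m"
        unfolding m_def by (rule real_nat_ceiling_ge)
      then show "(4 * (B2 + 1)) ^ dm / (2 * rV V) ^ dm \<le> real m" "B1 + 1 \<le> real m" "2 / \<rho>1 \<le> real m" "(B1 + 1) / \<rho>2 \<le> real m" by auto
    qed
    have "emeasure (leb dm) (sec n x V E g) / emeasure (leb dm) (Q n V (act (- g) x)) \<le> bnd c x m n E"
      if g: "g \<in> ?N" and gV: "act (- g) x \<in> V" and n: "m \<le> n" and E: "E \<in> sets BX" for g n E
    proof -
      let ?y = "act (- g) x" and ?q = "rV V / (real n + 1)"
      have r: "0 < rV V" "rV V \<le> 1" using VV[OF V] by auto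
      have gA1: "g \<in> A1" and gA2: "- g \<in> A2" and yU: "?y \<in> ?U" using g by blast+
      have q1: "?q < \<rho>1 / 2"
      proof -
        have "2 / \<rho>1 < real n + 1" using m(3) n by linarith
        then have "2 < \<rho>1 * (real n + 1)" using A1(3) by (simp add: divide_less_eq mult.commute)
        then have "1 / (real n + 1) < \<rho>1 / 2" by (simp add: divide_less_eq)
        moreover have "?q \<le> 1 / (real n + 1)" using r by (intro divide_right_mono) auto
        ultimately show ?thesis by linarith
      qed
      have q2: "(B1 + 1) / (real n + 1) < \<rho>2"
      proof -
        have "(B1 + 1) / \<rho>2 < real n + 1" using m(4) n by linarith
        then show ?thesis using A2(3) by (simp add: divide_less_eq mult.commute)
      qed
      have QC: "Q n V ?y \<subseteq> cube dm (snd ?c' ?yo) \<rho>1"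
      proof
        fix u assume u: "u \<in> Q n V ?y"
        have "\<bar>u i - snd ?c' ?yo i\<bar> < \<rho>1" if "i < dm" for i
        proof -
          have "\<bar>u i - snd ?c' ?y i\<bar> < ?q" using u that by (simp add: Q_def mem_cube)
          moreover have "\<bar>snd ?c' ?y i - snd ?c' ?yo i\<bar> < \<rho>1 / 2" using yU that by (simp add: mem_cube)
          ultimately show ?thesis using q1 by linarith
        qed
        then show "u \<in> cube dm (snd ?c' ?yo) \<rho>1" using u by (simp add: Q_def mem_cube)
      qed
      have yC: "snd ?c' ?y \<in> cube dm (snd ?c' ?yo) \<rho>1"
      proof -
        have "cube dm (snd ?c' ?yo) (\<rho>1 / 2) \<subseteq> cube dm (snd ?c' ?yo) \<rho>1" using A1(3) by (intro cube_mono) simp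
        then show ?thesis using yU by blast
      qed
      have ginv: "act g (cinv ?c' (snd ?c' ?y)) = x" using yU c' x by simp
      let ?R = "cube dm (snd c x) ((B1 + 1) / (real n + 1))"
      have RC: "?R \<subseteq> cube dm (snd c x) \<rho>2" using q2 by (intro cube_mono) simp
      have QR: "act g (cinv ?c' u) \<in> fst c \<and> snd c (act g (cinv ?c' u)) \<in> ?R" if u: "u \<in> Q n V ?y" for u
      proof
        show f: "act g (cinv ?c' u) \<in> fst c" using A1in gA1 QC u by blast
        have "\<bar>snd c (act g (cinv ?c' u)) i - snd c x i\<bar> < (B1 + 1) / (real n + 1)" if i: "i < dm" for i
        proof -
          have "\<bar>u j - snd ?c' ?y j\<bar> \<le> 1 / (real n + 1)" if "j < dm" for j
          proof -
            have "\<bar>u j - snd ?c' ?y j\<bar> < ?q" using u that by (simp add: Q_def mem_cube)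
            moreover have "?q \<le> 1 / (real n + 1)" using r by (intro divide_right_mono) auto
            ultimately show ?thesis by linarith
          qed
          then have "\<bar>snd c (act g (cinv ?c' u)) i - snd c (act g (cinv ?c' (snd ?c' ?y))) i\<bar> \<le> B1 * (1 / (real n + 1))"
            by (intro A1L[rule_format, OF gA1 _ yC _ i]) (use QC u in auto)
          also have "\<dots> < (B1 + 1) / (real n + 1)" by (simp add: divide_strict_right_mono)
          finally show ?thesis unfolding ginv .
        qed
        then show "snd c (act g (cinv ?c' u)) \<in> ?R" using f chart_image_subset[OF c] by (auto simp: mem_cube)
      qed
      let ?E = "snd c ` (E \<inter> fst c) \<inter> ?R"
      have Em: "?E \<in> sets (leb dm)" using chart_image_sets[OF c E] by auto
      have "sec n x V E g \<subseteq> Q n V ?y \<inter> {u. snd c (act g (cinv ?c' u)) \<in> ?E}"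
        using QR by (auto simp: sec_def)
      moreover have "Q n V ?y \<inter> {u. snd c (act g (cinv ?c' u)) \<in> ?E} \<subseteq> sec n x V E g"
      proof
        fix u assume u: "u \<in> Q n V ?y \<inter> {u. snd c (act g (cinv ?c' u)) \<in> ?E}"
        then obtain z where z: "z \<in> E" "z \<in> fst c" "snd c (act g (cinv ?c' u)) = snd c z" by blast
        have "act g (cinv ?c' u) = z" using z QR[of u] u chart_inj[OF c] by (auto dest: inj_onD)
        then show "u \<in> sec n x V E g" using z u by (simp add: sec_def)
      qed
      ultimately have sE: "sec n x V E g = Q n V ?y \<inter> {u. snd c (act g (cinv ?c' u)) \<in> ?E}" by (rule equalityI)
      have "emeasure (leb dm) (sec n x V E g) \<le> ennreal ((4 * (B2 + 1)) ^ dm) * emeasure (leb dm) ?E"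
        unfolding sE
      proof (rule expansive_chart[OF c' c sets_Q Q_subset[OF V gV] QR A2(4) _ Em])
        fix v w r i assume vw: "v \<in> ?R" "w \<in> ?R" and vr: "\<And>j. j < dm \<Longrightarrow> \<bar>v j - w j\<bar> \<le> r" and i: "i < dm"
        show "\<bar>snd ?c' (act (- g) (cinv c v)) i - snd ?c' (act (- g) (cinv c w)) i\<bar> \<le> B2 * r"
          by (rule A2L[rule_format, OF gA2 _ _ vr i]) (use RC vw in auto)
      qed
      then have "emeasure (leb dm) (sec n x V E g) / emeasure (leb dm) (Q n V ?y) \<le>
         (ennreal ((4 * (B2 + 1)) ^ dm) * emeasure (leb dm) ?E) / ennreal ((2 * ?q) ^ dm)"
        unfolding emeasure_Q[OF V] by (rule divide_right_mono_ennreal)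
      also have "\<dots> = (ennreal ((4 * (B2 + 1)) ^ dm) / ennreal ((2 * ?q) ^ dm)) * emeasure (leb dm) ?E"
        by (simp add: divide_ennreal_def mult_ac)
      also have "ennreal ((4 * (B2 + 1)) ^ dm) / ennreal ((2 * ?q) ^ dm) = ennreal ((4 * (B2 + 1)) ^ dm / (2 * ?q) ^ dm)"
        using A2(4) r by (intro divide_ennreal) auto
      \<comment> \<open>Separates the dependence on \<open>n\<close>, which is the factor in
        \<open>bnd\<close>, from the constant that \<open>m\<close> absorbs.\<close>
      also have "(4 * (B2 + 1)) ^ dm / (2 * ?q) ^ dm = (4 * (B2 + 1)) ^ dm / (2 * rV V) ^ dm * (real n + 1) ^ dm"
        by (simp add: power_divide power_mult_distrib)
      also have "ennreal ((4 * (B2 + 1)) ^ dm / (2 * rV V) ^ dm * (real n + 1) ^ dm) * emeasure (leb dm) ?E \<le> bnd c x m n E"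
        unfolding bnd_def
      proof (intro mult_mono ennreal_leI mult_right_mono emeasure_mono m(1))
        have "?R \<subseteq> cube dm (snd c x) (real m / (real n + 1))" using m(2) by (intro cube_mono divide_right_mono) auto
        then show "?E \<subseteq> snd c ` (E \<inter> fst c) \<inter> cube dm (snd c x) (real m / (real n + 1))" by blast
        show "snd c ` (E \<inter> fst c) \<inter> cube dm (snd c x) (real m / (real n + 1)) \<in> sets (leb dm)" using chart_image_sets[OF c E] by auto
      qed auto
      finally show ?thesis .
    qed
    then have "\<forall>g\<in>?N. act (- g) x \<in> V \<longrightarrow> (\<forall>n\<ge>m. \<forall>E\<in>sets BX.
       emeasure (leb dm) (sec n x V E g) / emeasure (leb dm) (Q n V (act (- g) x)) \<le> bnd c x m n E)" by blast
    then show ?thesis using oN gN by blast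
  qed
qed

text \<open>By local finiteness only finitely many cover members matter for \<open>g\<close> near
  \<open>g0\<close>, so one \<open>m\<close> serves all of them, and an average of terms below
  \<open>bnd\<close> is below \<open>bnd\<close>.\<close>

lemma kap_local_bound:
  assumes c: "c \<in> atlas X" and xc: "x \<in> fst c"
  shows "\<exists>N m. open N \<and> g0 \<in> N \<and> (\<forall>g\<in>N. \<forall>n\<ge>m. \<forall>E\<in>sets BX. emeasure (kap n x g) E \<le> bnd c x m n E)"
proof -
  have x: "x \<in> topspace T" using chart_subset[OF c] xc by blast
  have y0: "act (- g0) x \<in> topspace T" using x by (rule act_in)
  obtain Y where Y: "openin T Y" "act (- g0) x \<in> Y" "finite {V \<in> VV. V \<inter> Y \<noteq> {}}"
    using VV_finite y0 unfolding locally_finite_in_def by blast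
  let ?F = "{V \<in> VV. V \<inter> Y \<noteq> {}}"
  have "\<forall>V. \<exists>N m. V \<in> VV \<longrightarrow> open N \<and> g0 \<in> N \<and> (\<forall>g\<in>N. act (- g) x \<in> V \<longrightarrow> (\<forall>n\<ge>m. \<forall>E\<in>sets BX.
     emeasure (leb dm) (sec n x V E g) / emeasure (leb dm) (Q n V (act (- g) x)) \<le> bnd c x m n E))"
  proof
    fix V
    show "\<exists>N m. V \<in> VV \<longrightarrow> open N \<and> g0 \<in> N \<and> (\<forall>g\<in>N. act (- g) x \<in> V \<longrightarrow> (\<forall>n\<ge>m. \<forall>E\<in>sets BX.
     emeasure (leb dm) (sec n x V E g) / emeasure (leb dm) (Q n V (act (- g) x)) \<le> bnd c x m n E))"
    proof (cases "V \<in> VV")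
      case True
      from local_bound[OF c xc True, of g0] show ?thesis by (simp only: True simp_thms)
    qed simp
  qed
  from choice[OF this] obtain N where "\<forall>V. \<exists>m. V \<in> VV \<longrightarrow> open (N V) \<and> g0 \<in> N V \<and> (\<forall>g\<in>N V. act (- g) x \<in> V \<longrightarrow> (\<forall>n\<ge>m. \<forall>E\<in>sets BX.
     emeasure (leb dm) (sec n x V E g) / emeasure (leb dm) (Q n V (act (- g) x)) \<le> bnd c x m n E))" by (rule exE)
  from choice[OF this] obtain m where "\<forall>V. V \<in> VV \<longrightarrow> open (N V) \<and> g0 \<in> N V \<and> (\<forall>g\<in>N V. act (- g) x \<in> V \<longrightarrow> (\<forall>n\<ge>m V. \<forall>E\<in>sets BX.
     emeasure (leb dm) (sec n x V E g) / emeasure (leb dm) (Q n V (act (- g) x)) \<le> bnd c x (m V) n E))" by (rule exE)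
  then have Nm: "open (N V) \<and> g0 \<in> N V \<and> (\<forall>g\<in>N V. act (- g) x \<in> V \<longrightarrow> (\<forall>n\<ge>m V. \<forall>E\<in>sets BX.
     emeasure (leb dm) (sec n x V E g) / emeasure (leb dm) (Q n V (act (- g) x)) \<le> bnd c x (m V) n E))" if "V \<in> VV" for V
    using that by (elim allE[of _ V] impE)
  define m' where "m' = Max (insert 0 (m ` ?F))"
  have m': "m V \<le> m'" if "V \<in> ?F" for V unfolding m'_def using Y(3) that by (intro Max_ge) auto
  let ?N = "{g. act (- g) x \<in> Y} \<inter> (\<Inter>V\<in>?F. N V)"
  have oN: "open ?N" using orbit_continuous[OF x Y(1)] Y(3) Nm by (intro open_Int open_INT) auto
  have gN: "g0 \<in> ?N" using Y(2) Nm by blast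
  have "emeasure (kap n x g) E \<le> bnd c x m' n E" if g: "g \<in> ?N" and n: "m' \<le> n" and E: "E \<in> sets BX" for g n E
  proof -
    let ?S = "Vs (act (- g) x)"
    have y: "act (- g) x \<in> topspace T" using x by (rule act_in)
    have SF: "?S \<subseteq> ?F" using g by (auto simp: Vs_def)
    have le: "emeasure (leb dm) (sec n x V E g) / emeasure (leb dm) (Q n V (act (- g) x)) \<le> bnd c x m' n E" if V: "V \<in> ?S" for V
    proof -
      have VF: "V \<in> ?F" using SF V by blast
      have "emeasure (leb dm) (sec n x V E g) / emeasure (leb dm) (Q n V (act (- g) x)) \<le> bnd c x (m V) n E"
        using Nm[of V] VF g V n m'[OF VF] E by (simp add: Vs_def)
      also have "\<dots> \<le> bnd c x m' n E" by (rule bnd_mono[OF c E m'[OF VF]])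
      finally show ?thesis .
    qed
    have "emeasure (kap n x g) E \<le> (\<Sum>V\<in>?S. bnd c x m' n E) / of_nat (card ?S)"
      unfolding emeasure_kap[OF x E] by (intro divide_right_mono_ennreal sum_mono le)
    also have "\<dots> = bnd c x m' n E"
      using Vs_nonempty[OF y] Vs_finite[OF y]
      mult_divide_eq_ennreal[of "of_nat (card ?S)" "bnd c x m' n E"]
      by (simp add: mult.commute[of "of_nat (card ?S)"] card_gt_0_iff)
    finally show ?thesis .
  qed
  then have "\<forall>g\<in>?N. \<forall>n\<ge>m'. \<forall>E\<in>sets BX. emeasure (kap n x g) E \<le> bnd c x m' n E" by blast
  then show ?thesis using oN gN by blast
qed

text \<open>The group elements with a bound for a given \<open>m\<close> exhaust the group as
  \<open>m\<close> grows, so by monotone convergence a part of mass at least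
  \<open>1 - \<epsilon>\<close> of the weight lives where one \<open>m\<close> works.\<close>

lemma Kw_concentration:
  assumes c: "c \<in> atlas X" and xc: "x \<in> fst c" and w: "w \<in> borel_measurable \<nu>" "(\<integral>\<^sup>+g. w g \<partial>\<nu>) = 1" and "\<epsilon> > 0"
  shows "\<exists>w' m. w' \<in> borel_measurable \<nu> \<and> (\<forall>g. w' g \<le> w g) \<and> ennreal (1 - \<epsilon>) \<le> (\<integral>\<^sup>+g. w' g \<partial>\<nu>) \<and>
     (\<forall>n\<ge>m. \<forall>E\<in>sets BX. emeasure (Kw n x w') E \<le> bnd c x m n E)"
proof -
  have x: "x \<in> topspace T" using chart_subset[OF c] xc by blast
  define good where "good m g \<longleftrightarrow> (\<forall>n\<ge>m. \<forall>E\<in>sets BX. emeasure (kap n x g) E \<le> bnd c x m n E)" for m g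
  \<comment> \<open>The interior of the good set is taken, not the set itself, so that the cut-off
    weight is measurable.\<close>
  define G where "G m = \<Union>{N. open N \<and> (\<forall>g\<in>N. good m g)}" for m
  have good_mono: "good m g \<Longrightarrow> m \<le> m' \<Longrightarrow> good m' g" for m m' g
    unfolding good_def using bnd_mono[OF c] by (meson order_trans)
  have oG: "open (G m)" for m unfolding G_def by (intro open_Union) auto
  have inc: "incseq G" unfolding incseq_def G_def using good_mono by (intro allI impI Union_mono) blast
  have UG: "(\<Union>m. G m) = UNIV"
  proof -
    have "g0 \<in> (\<Union>m. G m)" for g0
    proof -
      from kap_local_bound[OF c xc, of g0] obtain N m where N: "open N" "g0 \<in> N"
        "\<forall>g\<in>N. \<forall>n\<ge>m. \<forall>E\<in>sets BX. emeasure (kap n x g) E \<le> bnd c x m n E" by (elim exE conjE)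
      then have "\<forall>g\<in>N. good m g" unfolding good_def by blast
      with N(1,2) show ?thesis unfolding G_def by blast
    qed
    then show ?thesis by blast
  qed
  have Gm: "G m \<in> sets borel" for m using oG by simp
  have wm: "(\<lambda>g. w g * indicator (G m) g) \<in> borel_measurable \<nu>" for m
    using w(1) Gm by (intro borel_measurable_times_ennreal) auto
  have "(SUP m. \<integral>\<^sup>+g. w g * indicator (G m) g \<partial>\<nu>) = (\<integral>\<^sup>+g. (SUP m. w g * indicator (G m) g) \<partial>\<nu>)"
  proof (rule nn_integral_monotone_convergence_SUP[symmetric])
    show "incseq (\<lambda>m g. w g * indicator (G m) g)"
      using inc by (auto simp: incseq_def le_fun_def indicator_def)
  qed (use wm in auto)
  also have "\<dots> = (\<integral>\<^sup>+g. w g \<partial>\<nu>)"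
  proof (rule nn_integral_cong)
    fix g :: 'g
    obtain m where "g \<in> G m" using UG by blast
    then have "w g \<le> (SUP m. w g * indicator (G m) g)" by (intro SUP_upper2[of m]) auto
    moreover have "(SUP m. w g * indicator (G m) g) \<le> w g" by (intro SUP_least) (auto simp: indicator_def)
    ultimately show "(SUP m. w g * indicator (G m) g) = w g" by (rule antisym[rotated])
  qed
  finally have S: "(SUP m. \<integral>\<^sup>+g. w g * indicator (G m) g \<partial>\<nu>) = 1" using w(2) by simp
  have "ennreal (1 - \<epsilon>) < 1" using \<open>\<epsilon> > 0\<close> by (subst ennreal_1[symmetric], intro ennreal_lessI) auto
  then have "ennreal (1 - \<epsilon>) < (SUP m. \<integral>\<^sup>+g. w g * indicator (G m) g \<partial>\<nu>)" unfolding S .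
  then obtain m where m: "ennreal (1 - \<epsilon>) < (\<integral>\<^sup>+g. w g * indicator (G m) g \<partial>\<nu>)" unfolding less_SUP_iff by blast
  have "emeasure (Kw n x (\<lambda>g. w g * indicator (G m) g)) E \<le> bnd c x m n E" if n: "n \<ge> m" and E: "E \<in> sets BX" for n E
  proof -
    have "emeasure (Kw n x (\<lambda>g. w g * indicator (G m) g)) E = (\<integral>\<^sup>+g. w g * indicator (G m) g * emeasure (kap n x g) E \<partial>\<nu>)"
      by (rule emeasure_Kw[OF x wm E])
    also have "\<dots> \<le> (\<integral>\<^sup>+g. bnd c x m n E * w g \<partial>\<nu>)"
    proof (rule nn_integral_mono)
      fix g :: 'g
      show "w g * indicator (G m) g * emeasure (kap n x g) E \<le> bnd c x m n E * w g"
      proof (cases "g \<in> G m")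
        case True
        then have "good m g" unfolding G_def by blast
        then have "emeasure (kap n x g) E \<le> bnd c x m n E" using n E unfolding good_def by blast
        then show ?thesis using True by (simp add: mult.commute mult_left_mono)
      qed simp
    qed
    also have "\<dots> = bnd c x m n E" using w by (simp add: nn_integral_cmult)
    finally show ?thesis .
  qed
  then show ?thesis using wm m by (intro exI[of _ "\<lambda>g. w g * indicator (G m) g"] exI[of _ m]) (auto simp: indicator_def less_imp_le)
qed

end

section \<open>The limit along the net\<close>

text \<open>Values bounded coordinatewise stay in a compact product of intervals. A cluster point
  lies in every closed set that the family eventually enters, and all properties of the lifting are
  read off from such closed sets.\<close>

lemma cluster_functional:
  fixes V :: "'j \<Rightarrow> 'c \<Rightarrow> real"
  assumes F: "F \<noteq> bot" and B: "\<And>j c. \<bar>V j c\<bar> \<le> B c"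
  shows "\<exists>L. \<forall>S. closed S \<and> eventually (\<lambda>j. V j \<in> S) F \<longrightarrow> L \<in> S"
proof -
  let ?K = "Pi\<^sub>E UNIV (\<lambda>c. {- B c .. B c})"
  have "compactin (product_topology (\<lambda>_. euclideanreal) UNIV) ?K" by (subst compactin_PiE) auto
  then have "compact ?K" by (metis euclidean_product_topology compactin_euclidean_iff)
  moreover have "eventually (\<lambda>x. x \<in> ?K) (filtermap V F)"
    unfolding eventually_filtermap
  proof (intro always_eventually allI)
    fix j
    have "V j c \<in> {- B c..B c}" for c using B[of j c] by (simp add: abs_le_iff minus_le_iff)
    then show "V j \<in> ?K" unfolding PiE_UNIV_domain by blast
  qed
  moreover have "filtermap V F \<noteq> bot" using F by (simp add: filtermap_bot_iff)
  ultimately obtain L where L: "inf (nhds L) (filtermap V F) \<noteq> bot" unfolding compact_filter by blast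
  have "L \<in> S" if S: "closed S" "eventually (\<lambda>j. V j \<in> S) F" for S
  proof (rule ccontr)
    assume "L \<notin> S"
    then have "eventually (\<lambda>\<phi>. \<phi> \<in> - S) (nhds L)" using S(1) by (intro eventually_nhds_in_open) auto
    moreover have "eventually (\<lambda>\<phi>. \<phi> \<in> S) (filtermap V F)" using S(2) by (simp add: eventually_filtermap)
    ultimately have "eventually (\<lambda>\<phi>. False) (inf (nhds L) (filtermap V F))"
      unfolding eventually_inf by (intro exI[of _ "\<lambda>\<phi>. \<phi> \<in> - S"] exI[of _ "\<lambda>\<phi>. \<phi> \<in> S"] conjI) auto
    then show False using L by (simp add: eventually_False)
  qed
  then show ?thesis by blast
qed

text \<open>First \<open>n \<rightarrow> \<infinity>\<close> for fixed \<open>i\<close>, then the limit along the net: density points are handled by \<open>n\<close> alone, equivariance by \<open>i\<close> alone.\<close>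

definition iterated_filter :: "'i set \<Rightarrow> ('i \<Rightarrow> 'i \<Rightarrow> bool) \<Rightarrow> ('i \<times> nat) filter" where
  "iterated_filter I rel = Abs_filter (\<lambda>P. \<exists>i0\<in>I. \<forall>i\<in>I. rel i0 i \<longrightarrow> eventually (\<lambda>n. P (i, n)) sequentially)"

lemma eventually_iterated_filter:
  assumes "directed_set I rel"
  shows "eventually P (iterated_filter I rel) \<longleftrightarrow> (\<exists>i0\<in>I. \<forall>i\<in>I. rel i0 i \<longrightarrow> eventually (\<lambda>n. P (i, n)) sequentially)"
  unfolding iterated_filter_def
proof (rule eventually_Abs_filter, rule is_filter.intro)
  obtain i0 where "i0 \<in> I" using assms by (auto simp: directed_set_def)
  then show "\<exists>i0\<in>I. \<forall>i\<in>I. rel i0 i \<longrightarrow> eventually (\<lambda>n. True) sequentially" by auto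
next
  fix P Q assume P: "\<exists>i0\<in>I. \<forall>i\<in>I. rel i0 i \<longrightarrow> eventually (\<lambda>n. P (i, n)) sequentially"
    and Q: "\<exists>i0\<in>I. \<forall>i\<in>I. rel i0 i \<longrightarrow> eventually (\<lambda>n. Q (i, n)) sequentially"
  obtain i1 where i1: "i1 \<in> I" "\<And>i. i \<in> I \<Longrightarrow> rel i1 i \<Longrightarrow> eventually (\<lambda>n. P (i, n)) sequentially" using P by blast
  obtain i2 where i2: "i2 \<in> I" "\<And>i. i \<in> I \<Longrightarrow> rel i2 i \<Longrightarrow> eventually (\<lambda>n. Q (i, n)) sequentially" using Q by blast
  have "\<forall>i\<in>I. \<forall>j\<in>I. \<exists>k\<in>I. rel i k \<and> rel j k" using assms unfolding directed_set_def by (elim conjE)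
  then obtain k where k: "k \<in> I" "rel i1 k" "rel i2 k" using i1(1) i2(1) by blast
  have tr: "rel a c" if "a \<in> I" "b \<in> I" "c \<in> I" "rel a b" "rel b c" for a b c
  proof -
    have "\<forall>i\<in>I. \<forall>j\<in>I. \<forall>k\<in>I. rel i j \<and> rel j k \<longrightarrow> rel i k" using assms unfolding directed_set_def by (elim conjE)
    from this[rule_format, OF that(1,2,3)] that(4,5) show ?thesis by simp
  qed
  have "eventually (\<lambda>n. P (i, n) \<and> Q (i, n)) sequentially" if i: "i \<in> I" "rel k i" for i
  proof -
    have "rel i1 i" "rel i2 i" using tr[OF i1(1) k(1) i(1)] tr[OF i2(1) k(1) i(1)] k i by simp_all
    then show ?thesis using i1(2)[OF i(1)] i2(2)[OF i(1)] by (intro eventually_conj)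
  qed
  then show "\<exists>i0\<in>I. \<forall>i\<in>I. rel i0 i \<longrightarrow> eventually (\<lambda>n. P (i, n) \<and> Q (i, n)) sequentially" using k(1) by blast
next
  fix P Q :: "'a \<times> nat \<Rightarrow> bool" assume PQ: "\<forall>x. P x \<longrightarrow> Q x" and P: "\<exists>i0\<in>I. \<forall>i\<in>I. rel i0 i \<longrightarrow> eventually (\<lambda>n. P (i, n)) sequentially"
  obtain i0 where i0: "i0 \<in> I" "\<And>i. i \<in> I \<Longrightarrow> rel i0 i \<Longrightarrow> eventually (\<lambda>n. P (i, n)) sequentially" using P by blast
  have "eventually (\<lambda>n. Q (i, n)) sequentially" if "i \<in> I" "rel i0 i" for i
    using i0(2)[OF that] by (rule eventually_mono) (use PQ in blast)
  then show "\<exists>i0\<in>I. \<forall>i\<in>I. rel i0 i \<longrightarrow> eventually (\<lambda>n. Q (i, n)) sequentially" using i0(1) by blast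
qed

lemma iterated_filter_not_bot:
  assumes "directed_set I rel" shows "iterated_filter I rel \<noteq> bot"
proof
  assume "iterated_filter I rel = bot"
  then have "eventually (\<lambda>_. False) (iterated_filter I rel)" by simp
  then obtain i0 where i0: "i0 \<in> I" "\<forall>i\<in>I. rel i0 i \<longrightarrow> eventually (\<lambda>n::nat. False) sequentially"
    unfolding eventually_iterated_filter[OF assms] by blast
  have "\<forall>i\<in>I. rel i i" using assms unfolding directed_set_def by (elim conjE)
  then show False using i0 by fastforce
qed

text \<open>\<open>R\<close> lies below \<open>P\<close>, so integrals of the nonnegative functions
  \<open>B - h\<close> and \<open>B + h\<close> do not decrease from \<open>R\<close> to
  \<open>P\<close>; the two inequalities are the two sides of the bound.\<close>

lemma integral_diff_common_part:
  fixes h :: "'z \<Rightarrow> real"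
  assumes P: "prob_space P" and R: "finite_measure R" "sets R = sets P" "\<And>A. A \<in> sets P \<Longrightarrow> emeasure R A \<le> emeasure P A"
    and h: "h \<in> borel_measurable P" "\<And>y. \<bar>h y\<bar> \<le> B"
  shows "\<bar>(\<integral>y. h y \<partial>P) - (\<integral>y. h y \<partial>R)\<bar> \<le> B * (1 - measure R (space R))"
proof -
  interpret P: prob_space P by fact
  interpret R: finite_measure R by fact
  have hR: "h \<in> borel_measurable R" using h(1) R(2) by (simp cong: measurable_cong_sets)
  have iP: "integrable P h" using h by (intro P.integrable_const_bound[of _ B]) auto
  have iR: "integrable R h" using h hR by (intro R.integrable_const_bound[of _ B]) auto
  have le: "(\<integral>y. k y \<partial>R) \<le> (\<integral>y. k y \<partial>P)" if k: "integrable P k" "integrable R k" "\<And>y. k y \<ge> 0" for k :: "'z \<Rightarrow> real"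
  proof -
    have "(\<integral>\<^sup>+y. ennreal (k y) \<partial>R) \<le> 1 * (\<integral>\<^sup>+y. ennreal (k y) \<partial>P)"
      using R(2,3) k(1) by (intro nn_integral_le_scaled) auto
    then show ?thesis using k by (simp add: nn_integral_eq_integral)
  qed
  have B: "B \<ge> 0" using h(2)[of undefined] by simp
  have sp: "measure P (space P) = 1" by (rule P.prob_space)
  have 1: "(\<integral>y. B - h y \<partial>R) \<le> (\<integral>y. B - h y \<partial>P)"
    using iP iR h(2) by (intro le Bochner_Integration.integrable_diff) (auto simp: abs_le_iff)
  have 2: "(\<integral>y. B + h y \<partial>R) \<le> (\<integral>y. B + h y \<partial>P)"
  proof (intro le Bochner_Integration.integrable_add)
    fix y show "0 \<le> B + h y" using h(2)[of y] by linarith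
  qed (use iP iR in auto)
  have "B * measure R (space R) - (\<integral>y. h y \<partial>R) \<le> B - (\<integral>y. h y \<partial>P)"
    using 1 iP iR sp by (simp add: mult.commute)
  moreover have "B * measure R (space R) + (\<integral>y. h y \<partial>R) \<le> B + (\<integral>y. h y \<partial>P)"
    using 2 iP iR sp by (simp add: mult.commute)
  ultimately show ?thesis by (simp add: abs_le_iff algebra_simps)
qed

lemma prod_ge_one_minus:
  assumes "\<And>j. j < p \<Longrightarrow> 1 - \<delta> \<le> (a j :: real)" "0 \<le> \<delta>" "\<delta> \<le> 1"
  shows "1 - real p * \<delta> \<le> (\<Prod>j<p. a j)"
proof -
  have "1 + real p * (- \<delta>) \<le> (1 + (- \<delta>)) ^ p" using assms(3) by (intro Bernoulli_inequality) simp
  also have "\<dots> = (\<Prod>j<p. 1 - \<delta>)" by simp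
  also have "\<dots> \<le> (\<Prod>j<p. a j)" using assms by (intro prod_mono) auto
  finally show ?thesis by simp
qed

locale C1_amenable = C1_kernel X act M VV cV zV rV \<nu>
  for X :: "'x manifold" and act :: "'g::{topological_group_add, t2_space} \<Rightarrow> 'x \<Rightarrow> 'x" and M VV cV zV rV \<nu> +
  fixes I :: "'i set" and rel :: "'i \<Rightarrow> 'i \<Rightarrow> bool" and \<mu> :: "'i \<Rightarrow> 'g \<Rightarrow> 'x \<Rightarrow> real"
  assumes dir: "directed_set I rel"
    and \<mu>_cont: "i \<in> I \<Longrightarrow> continuous_map (prod_topology euclidean T) euclideanreal (\<lambda>(g, x). \<mu> i g x)"
    and \<mu>_nonneg: "i \<in> I \<Longrightarrow> x \<in> topspace T \<Longrightarrow> 0 \<le> \<mu> i g x"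
    and \<mu>_int: "i \<in> I \<Longrightarrow> x \<in> topspace T \<Longrightarrow> (\<integral>g. \<mu> i g x \<partial>\<nu>) = 1"
    and \<mu>_inv: "compactin (prod_topology euclidean T) K \<Longrightarrow> e > 0 \<Longrightarrow> \<exists>i0\<in>I. \<forall>i\<in>I. rel i0 i \<longrightarrow>
       (\<forall>(s, x)\<in>K. (\<integral>g. \<bar>\<mu> i (s + g) (act s x) - \<mu> i g x\<bar> \<partial>\<nu>) < e)"
begin

definition wt :: "'i \<Rightarrow> 'x \<Rightarrow> 'g \<Rightarrow> ennreal" where
  "wt i x g = ennreal (\<mu> i g x)"

lemma mu_borel: "i \<in> I \<Longrightarrow> x \<in> topspace T \<Longrightarrow> (\<lambda>g. \<mu> i g x) \<in> borel_measurable \<nu>"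
proof -
  assume i: "i \<in> I" and x: "x \<in> topspace T"
  have "continuous_map (euclidean :: 'g topology) (prod_topology euclidean T) (\<lambda>g. (g, x))"
    using x by (intro continuous_map_pairedI) auto
  from continuous_map_compose[OF this \<mu>_cont[OF i]]
  have "continuous_on UNIV (\<lambda>g. \<mu> i g x)" by (simp add: comp_def)
  then have "(\<lambda>g. \<mu> i g x) \<in> borel_measurable borel" by (rule borel_measurable_continuous_onI)
  then show ?thesis by (simp cong: measurable_cong_sets)
qed

lemma wt_borel: "i \<in> I \<Longrightarrow> x \<in> topspace T \<Longrightarrow> wt i x \<in> borel_measurable \<nu>"
  using mu_borel[of i x] unfolding wt_def[abs_def] by simp

text \<open>The integral of a function that is not integrable is 0 by convention, so the value 1
  forces integrability.\<close>

lemma mu_integrable: "i \<in> I \<Longrightarrow> x \<in> topspace T \<Longrightarrow> integrable \<nu> (\<lambda>g. \<mu> i g x)"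
  using \<mu>_int[of i x] not_integrable_integral_eq[of \<nu> "\<lambda>g. \<mu> i g x"] by fastforce

lemma wt_int: "i \<in> I \<Longrightarrow> x \<in> topspace T \<Longrightarrow> (\<integral>\<^sup>+g. wt i x g \<partial>\<nu>) = 1"
  using mu_integrable[of i x] \<mu>_int[of i x] \<mu>_nonneg[of i x] by (simp add: wt_def nn_integral_eq_integral)

section \<open>Product kernels and their concentration near the base point\<close>

definition Kn :: "'i \<Rightarrow> nat \<Rightarrow> 'x \<Rightarrow> 'x measure" where
  "Kn i n x = Kw n x (wt i x)"

definition P :: "'i \<Rightarrow> nat \<Rightarrow> nat \<Rightarrow> (nat \<Rightarrow> 'x) \<Rightarrow> (nat \<Rightarrow> 'x) measure" where
  "P i n p x = Pi\<^sub>M {..<p} (\<lambda>j. Kn i n (x j))"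

lemma ac_prob_Kn: "i \<in> I \<Longrightarrow> x \<in> topspace T \<Longrightarrow> ac_prob (Kn i n x)"
  unfolding Kn_def by (intro ac_prob_Kw wt_borel wt_int)

lemma sets_Kn: "x \<in> topspace T \<Longrightarrow> sets (Kn i n x) = sets BX"
  unfolding Kn_def by (rule sets_Kw)

lemma sets_P: "x \<in> Xp p \<Longrightarrow> sets (P i n p x) = sets (BXp p)"
  unfolding P_def by (rule sets_PiM_cong[OF refl]) (rule sets_Kn, erule PiE_mem)

lemma space_P: "x \<in> Xp p \<Longrightarrow> space (P i n p x) = Xp p"
proof -
  assume "x \<in> Xp p"
  then have "space (P i n p x) = space (BXp p)" by (intro sets_eq_imp_space_eq sets_P)
  also have "\<dots> = Xp p" by (simp add: space_PiM)
  finally show "space (P i n p x) = Xp p" .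
qed

lemma prob_P: "i \<in> I \<Longrightarrow> x \<in> Xp p \<Longrightarrow> prob_space (P i n p x)"
  unfolding P_def by (rule prob_space_PiM) (use ac_prob_Kn in \<open>auto simp: ac_prob_def PiE_iff\<close>)

lemma knull_P: "i \<in> I \<Longrightarrow> x \<in> Xp p \<Longrightarrow> knull p N \<Longrightarrow> N \<in> null_sets (P i n p x)"
  using sets_P[of x p i n] ac_prob_Kn unfolding knull_def P_def by (auto simp: null_sets_def PiE_iff)

text \<open>Up to mass \<open>\<epsilon> / 2\<close> the kernel is dominated by
  \<open>k ^ p * (n + 1) ^ (p * dm)\<close> times Lebesgue measure on the cube of radius
  \<open>k / (n + 1)\<close>. The complement of \<open>S\<close> fills at most the fraction
  \<open>a\<close> of this cube. The powers of \<open>n + 1\<close> cancel, and \<open>a\<close>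
  times a constant remains.\<close>

lemma P_density_concentration:
  assumes i: "i \<in> I" and c: "charts p c" and x: "x \<in> W p c" and S: "S \<in> sets (leb (p * dm))"
    and dens: "\<And>a. a > 0 \<Longrightarrow> \<exists>r0>0. \<forall>r. 0 < r \<and> r < r0 \<longrightarrow> emeasure (leb (p * dm)) (cube (p * dm) (Cm p c x) r - S) \<le> ennreal (a * (2 * r) ^ (p * dm))"
    and "\<epsilon> > 0"
  shows "eventually (\<lambda>n. measure (P i n p x) {y \<in> W p c. Cm p c y \<in> S} \<ge> 1 - \<epsilon>) sequentially"
proof -
  have xX: "x \<in> Xp p" using x W_subset[OF c] by blast
  define Y where "Y = {y \<in> W p c. Cm p c y \<in> S}"
  have Ys: "Y \<in> sets (BXp p)" unfolding Y_def by (rule Cm_vimage_sets[OF c S])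
  \<comment> \<open>Each factor may lose the mass \<delta>, so the product loses at most
    \<open>real p * \<delta>\<close> by Bernoulli's inequality, which asks for a \<delta> of at most
    1.\<close>
  define \<delta> where "\<delta> = min 1 (\<epsilon> / (2 * (real p + 1)))"
  have \<delta>: "0 < \<delta>" "\<delta> \<le> 1" "real p * \<delta> \<le> \<epsilon> / 2"
  proof -
    show "0 < \<delta>" "\<delta> \<le> 1" using \<open>\<epsilon> > 0\<close> by (auto simp: \<delta>_def)
    have "real p * \<delta> \<le> (real p + 1) * \<delta>" using \<open>0 < \<delta>\<close> by simp
    also have "\<dots> \<le> (real p + 1) * (\<epsilon> / (2 * (real p + 1)))" by (intro mult_left_mono) (auto simp: \<delta>_def)
    also have "\<dots> = \<epsilon> / 2" by (simp add: field_simps)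
    finally show "real p * \<delta> \<le> \<epsilon> / 2" .
  qed
  have cj: "c j \<in> atlas X" "x j \<in> fst (c j)" "x j \<in> topspace T" if "j < p" for j
    using that c x xX by (auto simp: charts_def W_def PiE_iff)
  have "\<exists>w m. w \<in> borel_measurable \<nu> \<and> (\<forall>g. w g \<le> wt i (x j) g) \<and> ennreal (1 - \<delta>) \<le> (\<integral>\<^sup>+g. w g \<partial>\<nu>) \<and>
     (\<forall>n\<ge>m. \<forall>E\<in>sets BX. emeasure (Kw n (x j) w) E \<le> bnd (c j) (x j) m n E)" if j: "j < p" for j
    using cj[OF j] i \<delta>(1) by (intro Kw_concentration wt_borel wt_int)
  then have "\<forall>j. \<exists>w m. j < p \<longrightarrow> w \<in> borel_measurable \<nu> \<and> (\<forall>g. w g \<le> wt i (x j) g) \<and> ennreal (1 - \<delta>) \<le> (\<integral>\<^sup>+g. w g \<partial>\<nu>) \<and>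
     (\<forall>n\<ge>m. \<forall>E\<in>sets BX. emeasure (Kw n (x j) w) E \<le> bnd (c j) (x j) m n E)" by blast
  from choice[OF this] obtain w where "\<forall>j. \<exists>m. j < p \<longrightarrow> w j \<in> borel_measurable \<nu> \<and> (\<forall>g. w j g \<le> wt i (x j) g) \<and> ennreal (1 - \<delta>) \<le> (\<integral>\<^sup>+g. w j g \<partial>\<nu>) \<and>
     (\<forall>n\<ge>m. \<forall>E\<in>sets BX. emeasure (Kw n (x j) (w j)) E \<le> bnd (c j) (x j) m n E)" by (rule exE)
  from choice[OF this] obtain m where wm: "\<forall>j. j < p \<longrightarrow> w j \<in> borel_measurable \<nu> \<and> (\<forall>g. w j g \<le> wt i (x j) g) \<and> ennreal (1 - \<delta>) \<le> (\<integral>\<^sup>+g. w j g \<partial>\<nu>) \<and>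
     (\<forall>n\<ge>m j. \<forall>E\<in>sets BX. emeasure (Kw n (x j) (w j)) E \<le> bnd (c j) (x j) (m j) n E)" by (rule exE)
  have w: "w j \<in> borel_measurable \<nu>" "\<And>g. w j g \<le> wt i (x j) g" "ennreal (1 - \<delta>) \<le> (\<integral>\<^sup>+g. w j g \<partial>\<nu>)" if "j < p" for j
    using wm that by blast+
  \<comment> \<open>The successor makes the radius \<open>k / (n + 1)\<close> positive.\<close>
  define k where "k = Suc (Max (insert 0 (m ` {..<p})))"
  have mk: "m j \<le> k" if "j < p" for j
  proof -
    have "m j \<le> Max (insert 0 (m ` {..<p}))" using that by (intro Max_ge) auto
    then show ?thesis by (simp add: k_def)
  qed
  have "k \<ge> 1" by (simp add: k_def)
  have bk: "emeasure (Kw n (x j) (w j)) E \<le> bnd (c j) (x j) k n E" if "j < p" "n \<ge> k" "E \<in> sets BX" for j n E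
  proof -
    have "emeasure (Kw n (x j) (w j)) E \<le> bnd (c j) (x j) (m j) n E" using wm that mk[OF that(1)] by simp
    also have "\<dots> \<le> bnd (c j) (x j) k n E" by (rule bnd_mono[OF cj(1)[OF that(1)] that(3) mk[OF that(1)]])
    finally show ?thesis .
  qed
  \<comment> \<open>What is left of the domination constant times the volume of the cube once the
    powers of \<open>n + 1\<close> have cancelled.\<close>
  define C where "C = real k ^ p * (2 * real k) ^ (p * dm)"
  have "C > 0" using \<open>k \<ge> 1\<close> by (simp add: C_def)
  define a where "a = \<epsilon> / (2 * C)"
  have "a > 0" using \<open>C > 0\<close> \<open>\<epsilon> > 0\<close> by (simp add: a_def)
  obtain r0 where r0: "r0 > 0" "\<forall>r. 0 < r \<and> r < r0 \<longrightarrow> emeasure (leb (p * dm)) (cube (p * dm) (Cm p c x) r - S) \<le> ennreal (a * (2 * r) ^ (p * dm))"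
    using dens[OF \<open>a > 0\<close>] by blast
  have uI: "Cm p c x \<in> Cm p c ` W p c" using x by blast
  then obtain r1 where r1: "r1 > 0" "cube (p * dm) (Cm p c x) r1 \<subseteq> Cm p c ` W p c"
    using Cm_image_open[OF c] unfolding openin_Rn by blast
  have "\<forall>j. \<exists>r>0. j < p \<longrightarrow> cube dm (snd (c j) (x j)) r \<subseteq> snd (c j) ` fst (c j)"
  proof
    fix j
    show "\<exists>r>0. j < p \<longrightarrow> cube dm (snd (c j) (x j)) r \<subseteq> snd (c j) ` fst (c j)"
    proof (cases "j < p")
      case True
      from chart_cube_at[OF cj(1,2)[OF True] openin_topspace cj(3)[OF True]] show ?thesis by blast
    qed (auto intro: exI[of _ 1])
  qed
  then obtain r2 where r2: "\<And>j. r2 j > 0" "\<And>j. j < p \<Longrightarrow> cube dm (snd (c j) (x j)) (r2 j) \<subseteq> snd (c j) ` fst (c j)" by metis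
  define r3 where "r3 = Min (insert r0 (r2 ` {..<p}))"
  have r3: "r3 > 0" "r3 \<le> r0" "\<And>j. j < p \<Longrightarrow> r3 \<le> r2 j"
  proof -
    show "r3 > 0" unfolding r3_def using r0(1) r2(1) by (subst Min_gr_iff) auto
    show "r3 \<le> r0" unfolding r3_def by (intro Min_le) auto
    show "r3 \<le> r2 j" if "j < p" for j unfolding r3_def using that by (intro Min_le) auto
  qed
  have "(\<lambda>n. real k / (real n + 1)) \<longlonglongrightarrow> 0" by real_asymp
  then have ev: "eventually (\<lambda>n. real k / (real n + 1) < r3) sequentially" using r3(1) by (rule order_tendstoD)
  have "eventually (\<lambda>n. n \<ge> k) sequentially" by (rule eventually_ge_at_top)
  with ev show ?thesis
  proof eventually_elim
    case (elim n)
    let ?r = "real k / (real n + 1)"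
    have r: "0 < ?r" using \<open>k \<ge> 1\<close> by simp
    let ?Q = "\<lambda>j. cube dm (snd (c j) (x j)) ?r"
    let ?R = "\<lambda>j. Kw n (x j) (w j)"
    let ?U = "\<lambda>j. distr (density (leb dm) (indicator (?Q j))) BX (cinv (c j))"
    have Qsub: "?Q j \<subseteq> snd (c j) ` fst (c j)" if "j < p" for j
      using cube_mono[of ?r "r2 j" dm "snd (c j) (x j)"] r2(2)[OF that] r3(3)[OF that] elim(1) by (meson less_imp_le order_trans)
    have Qe: "emeasure (leb dm) (?Q j) = ennreal ((2 * ?r) ^ dm)" for j using r by (intro emeasure_cube) simp
    have setsR: "sets (?R j) = sets BX" if "j < p" for j using cj(3)[OF that] by (rule sets_Kw)
    have R_le: "emeasure (?R j) E \<le> emeasure (Kn i n (x j)) E" if "j < p" "E \<in> sets BX" for j E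
      unfolding Kn_def using w[OF that(1)] wt_borel[OF i cj(3)[OF that(1)]] by (intro emeasure_Kw_mono[OF cj(3)[OF that(1)]] that(2))
    have prK: "prob_space (Kn i n (x j))" if "j < p" for j using ac_prob_Kn[OF i cj(3)[OF that]] by (simp add: ac_prob_def)
    have finR: "finite_measure (?R j)" if "j < p" for j
    proof (rule finite_measureI)
      interpret prob_space "Kn i n (x j)" by (rule prK[OF that])
      have "emeasure (?R j) (topspace T) \<le> emeasure (Kn i n (x j)) (topspace T)" using that by (intro R_le) auto
      then show "emeasure (?R j) (space (?R j)) \<noteq> \<infinity>"
        using space_Kw[OF cj(3)[OF that]] by (metis emeasure_finite infinity_ennreal_def neq_top_trans)
    qed
    have finU: "finite_measure (?U j)" if "j < p" for j
      using Qe measurable_cinv[OF cj(1)[OF that]]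
      by (intro finite_measure.finite_measure_distr finite_measureI) (auto simp: emeasure_density_indicator)
    have U_bnd: "emeasure (?R j) E \<le> ennreal (real k * (real n + 1) ^ dm) * emeasure (?U j) E" if j: "j < p" and E: "E \<in> sets BX" for j E
    proof -
      have cm: "cinv (c j) \<in> measurable (leb dm) BX" using measurable_cinv[OF cj(1)[OF j]] .
      have "emeasure (?U j) E = emeasure (leb dm) (?Q j \<inter> (cinv (c j) -` E \<inter> space (leb dm)))"
        using cm E measurable_sets[OF cm E] by (subst emeasure_distr) (auto simp: emeasure_density_indicator)
      also have "?Q j \<inter> (cinv (c j) -` E \<inter> space (leb dm)) = snd (c j) ` (E \<inter> fst (c j)) \<inter> ?Q j"
      proof (intro equalityI subsetI)
        fix u assume u: "u \<in> ?Q j \<inter> (cinv (c j) -` E \<inter> space (leb dm))"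
        then have "u \<in> snd (c j) ` fst (c j)" using Qsub[OF j] by blast
        from cinv_in[OF cj(1)[OF j] this] have "u = snd (c j) (cinv (c j) u)" "cinv (c j) u \<in> fst (c j)" by auto
        then show "u \<in> snd (c j) ` (E \<inter> fst (c j)) \<inter> ?Q j" using u by blast
      next
        fix u assume u: "u \<in> snd (c j) ` (E \<inter> fst (c j)) \<inter> ?Q j"
        then show "u \<in> ?Q j \<inter> (cinv (c j) -` E \<inter> space (leb dm))"
          using cinv_chart[OF cj(1)[OF j]] cube_subset[of dm "snd (c j) (x j)" ?r] by (auto simp: space_leb)
      qed
      finally show ?thesis using bk[OF j elim(2) E] unfolding bnd_def by simp
    qed
    have sPR: "sets (Pi\<^sub>M {..<p} ?R) = sets (BXp p)" using setsR by (intro sets_PiM_cong) auto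
    have sPU: "sets (Pi\<^sub>M {..<p} ?U) = sets (BXp p)" by (intro sets_PiM_cong) auto
    have total: "ennreal (1 - \<epsilon> / 2) \<le> emeasure (Pi\<^sub>M {..<p} ?R) (Xp p)"
    proof -
      have t: "emeasure (?R j) (topspace T) = ennreal (measure (?R j) (topspace T))" "1 - \<delta> \<le> measure (?R j) (topspace T)" if j: "j < p" for j
      proof -
        interpret finite_measure "?R j" by (rule finR[OF j])
        show e: "emeasure (?R j) (topspace T) = ennreal (measure (?R j) (topspace T))" by (rule emeasure_eq_measure)
        have "ennreal (1 - \<delta>) \<le> emeasure (?R j) (topspace T)"
          using w(3)[OF j] emeasure_Kw_space[OF cj(3)[OF j] w(1)[OF j], of n] by simp
        then show "1 - \<delta> \<le> measure (?R j) (topspace T)" unfolding e by (simp add: ennreal_le_iff)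
      qed
      have "1 - \<epsilon> / 2 \<le> 1 - real p * \<delta>" using \<delta>(3) by simp
      also have "\<dots> \<le> (\<Prod>j<p. measure (?R j) (topspace T))" using t(2) \<delta> by (intro prod_ge_one_minus) auto
      finally have "ennreal (1 - \<epsilon> / 2) \<le> (\<Prod>j<p. ennreal (measure (?R j) (topspace T)))"
        by (subst prod_ennreal) (auto intro: ennreal_leI)
      also have "\<dots> = (\<Prod>j<p. emeasure (?R j) (topspace T))" using t(1) by (intro prod.cong) auto
      also have "\<dots> = emeasure (Pi\<^sub>M {..<p} ?R) (Xp p)"
        using finR setsR by (intro emeasure_PiM_box[symmetric]) (auto simp: finite_measure_def)
      finally show ?thesis .
    qed
    have Yc: "Xp p - Y \<in> sets (BXp p)"
    proof -
      have "space (BXp p) = Xp p" by (simp add: space_PiM)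
      then show ?thesis using sets.compl_sets[OF Ys] by simp
    qed
    have small: "emeasure (Pi\<^sub>M {..<p} ?R) (Xp p - Y) \<le> ennreal (\<epsilon> / 2)"
    proof -
      have "emeasure (Pi\<^sub>M {..<p} ?R) (Xp p - Y) \<le> (\<Prod>j\<in>{..<p}. ennreal (real k * (real n + 1) ^ dm)) * emeasure (Pi\<^sub>M {..<p} ?U) (Xp p - Y)"
        using finR finU setsR U_bnd Yc sPU by (intro emeasure_PiM_le_scaled) (auto simp: finite_measure_def)
      also have "emeasure (Pi\<^sub>M {..<p} ?U) (Xp p - Y) = emeasure (leb (p * dm)) {u \<in> extensional {..<p * dm}. (\<forall>j<p. block p dm u j \<in> ?Q j) \<and> Ci p c u \<in> Xp p - Y}"
        using Qe by (intro emeasure_PiM_cubes[OF c _ Yc]) auto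
      also have "\<dots> \<le> emeasure (leb (p * dm)) (cube (p * dm) (Cm p c x) ?r - S)"
      proof (rule emeasure_mono)
        show "cube (p * dm) (Cm p c x) ?r - S \<in> sets (leb (p * dm))" using S by auto
        show "{u \<in> extensional {..<p * dm}. (\<forall>j<p. block p dm u j \<in> ?Q j) \<and> Ci p c u \<in> Xp p - Y} \<subseteq> cube (p * dm) (Cm p c x) ?r - S"
        proof
          fix u assume u: "u \<in> {u \<in> extensional {..<p * dm}. (\<forall>j<p. block p dm u j \<in> ?Q j) \<and> Ci p c u \<in> Xp p - Y}"
          then have ue: "u \<in> extensional {..<p * dm}" and ub: "\<And>j. j < p \<Longrightarrow> block p dm u j \<in> ?Q j" and uY: "Ci p c u \<notin> Y" by auto
          have Cu: "Ci p c u \<in> W p c \<and> Cm p c (Ci p c u) = u"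
            using ue ub Qsub by (intro Cm_Ci[OF c]) blast+
          then have "u \<notin> S" using uY unfolding Y_def by auto
          moreover have "\<bar>u l - Cm p c x l\<bar> < ?r" if l: "l < p * dm" for l
          proof -
            have a: "l div dm < p" "l mod dm < dm" using block_div[OF l] by auto
            have "block p dm u (l div dm) (l mod dm) = u l" using a by (simp add: block_def)
            moreover have "snd (c (l div dm)) (x (l div dm)) (l mod dm) = Cm p c x l"
              using l by (simp add: Cm_def power_chart_def)
            moreover have "\<bar>block p dm u (l div dm) (l mod dm) - snd (c (l div dm)) (x (l div dm)) (l mod dm)\<bar> < ?r"
              using ub[OF a(1)] a(2) by (simp add: mem_cube)
            ultimately show ?thesis by simp
          qed
          ultimately show "u \<in> cube (p * dm) (Cm p c x) ?r - S" using ue by (simp add: mem_cube)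
        qed
      qed
      also have "\<dots> \<le> ennreal (a * (2 * ?r) ^ (p * dm))" using r0(2)[rule_format, of ?r] r elim(1) r3(2) by simp
      also have "(\<Prod>j\<in>{..<p}. ennreal (real k * (real n + 1) ^ dm)) * ennreal (a * (2 * ?r) ^ (p * dm)) = ennreal (\<epsilon> / 2)"
      proof -
        have "(\<Prod>j\<in>{..<p}. ennreal (real k * (real n + 1) ^ dm)) = ennreal ((real k * (real n + 1) ^ dm) ^ p)"
          by (simp add: ennreal_power)
        moreover have "(real k * (real n + 1) ^ dm) ^ p * (a * (2 * ?r) ^ (p * dm)) = \<epsilon> / 2"
        proof -
          have "(2 * ?r) ^ (p * dm) = (2 * real k) ^ (p * dm) / (real n + 1) ^ (p * dm)" by (simp add: power_divide)
          moreover have "(real k * (real n + 1) ^ dm) ^ p = real k ^ p * (real n + 1) ^ (p * dm)"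
            by (simp add: power_mult_distrib power_mult[symmetric] mult.commute)
          ultimately have "(real k * (real n + 1) ^ dm) ^ p * (a * (2 * ?r) ^ (p * dm)) = a * C"
            by (simp add: C_def)
          also have "\<dots> = \<epsilon> / 2" using \<open>C > 0\<close> by (simp add: a_def)
          finally show ?thesis .
        qed
        moreover have "ennreal ((real k * (real n + 1) ^ dm) ^ p) * ennreal (a * (2 * ?r) ^ (p * dm))
            = ennreal ((real k * (real n + 1) ^ dm) ^ p * (a * (2 * ?r) ^ (p * dm)))"
          using \<open>a > 0\<close> r by (intro ennreal_mult[symmetric] mult_nonneg_nonneg zero_le_power) auto
        ultimately show ?thesis by (simp only:)
      qed
      finally show ?thesis by (simp add: mult_left_mono)
    qed
    have "ennreal (1 - \<epsilon> / 2) \<le> emeasure (Pi\<^sub>M {..<p} ?R) Y + emeasure (Pi\<^sub>M {..<p} ?R) (Xp p - Y)"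
    proof -
      have "Y \<subseteq> Xp p" using sets.sets_into_space[OF Ys] by (simp add: space_PiM)
      then have "Y \<union> (Xp p - Y) = Xp p" by blast
      then show ?thesis using total Ys Yc sPR by (subst plus_emeasure) auto
    qed
    also have "\<dots> \<le> emeasure (P i n p x) Y + ennreal (\<epsilon> / 2)"
    proof (rule add_mono[OF _ small])
      show "emeasure (Pi\<^sub>M {..<p} ?R) Y \<le> emeasure (P i n p x) Y"
        unfolding P_def using finR prK setsR R_le Ys sets_P[OF xX, of i n] sets_Kn cj(3)
        by (intro emeasure_PiM_mono) (auto simp: finite_measure_def P_def intro: prob_space_imp_sigma_finite)
    qed
    also have "\<dots> = ennreal (measure (P i n p x) Y + \<epsilon> / 2)"
    proof -
      interpret prob_space "P i n p x" by (rule prob_P[OF i xX])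
      show ?thesis using \<open>\<epsilon> > 0\<close> by (simp add: emeasure_eq_measure)
    qed
    finally have "1 - \<epsilon> / 2 \<le> measure (P i n p x) Y + \<epsilon> / 2"
      using \<open>\<epsilon> > 0\<close> by (subst (asm) ennreal_le_iff) auto
    then show ?case unfolding Y_def by simp
  qed
qed

text \<open>An open box has an open image in the chart, so every point of it is a density
  point.\<close>

lemma P_box_concentration:
  assumes i: "i \<in> I" and x: "x \<in> Xp p" and Ob: "\<And>j. j < p \<Longrightarrow> openin T (Ob j) \<and> x j \<in> Ob j" and "\<epsilon> > 0"
  shows "eventually (\<lambda>n. measure (P i n p x) (Pi\<^sub>E {..<p} Ob) \<ge> 1 - \<epsilon>) sequentially"
proof -
  obtain c where c: "charts p c" "x \<in> W p c" using charts_at[OF x] by blast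
  let ?B = "Pi\<^sub>E {..<p} Ob"
  have xB: "x \<in> ?B" using x Ob by (simp add: PiE_iff)
  let ?S = "Cm p c ` (?B \<inter> W p c)"
  have So: "openin (Rn (p * dm)) ?S" using Ob by (intro Cm_image_box[OF c(1)]) auto
  have xS: "Cm p c x \<in> ?S" using xB c(2) by blast
  have "eventually (\<lambda>n. measure (P i n p x) {y \<in> W p c. Cm p c y \<in> ?S} \<ge> 1 - \<epsilon>) sequentially"
  proof (rule P_density_concentration[OF i c openin_sets_leb[OF So] _ \<open>\<epsilon> > 0\<close>])
    show "\<exists>r0>0. \<forall>r. 0 < r \<and> r < r0 \<longrightarrow> emeasure (leb (p * dm)) (cube (p * dm) (Cm p c x) r - ?S) \<le> ennreal (a * (2 * r) ^ (p * dm))" for a :: real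
      by (rule density_at_interior_point[OF So xS])
  qed
  then show ?thesis
  proof eventually_elim
    case (elim n)
    interpret prob_space "P i n p x" by (rule prob_P[OF i x])
    have "{y \<in> W p c. Cm p c y \<in> ?S} \<subseteq> ?B"
    proof
      fix y assume "y \<in> {y \<in> W p c. Cm p c y \<in> ?S}"
      then obtain z where "y \<in> W p c" "z \<in> ?B" "z \<in> W p c" "Cm p c y = Cm p c z" by blast
      then show "y \<in> ?B" using inj_onD[OF Cm_inj[OF c(1)]] by blast
    qed
    moreover have "?B \<in> sets (P i n p x)" unfolding sets_P[OF x] using Ob by (intro sets_PiM_I_finite) auto
    ultimately have "prob {y \<in> W p c. Cm p c y \<in> ?S} \<le> prob ?B" by (intro finite_measure_mono)
    then show ?case using elim by simp
  qed
qed

end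

lemma prob_integral_close:
  fixes h k :: "'z \<Rightarrow> real"
  assumes Q: "prob_space Q" and h: "h \<in> borel_measurable Q" "\<And>y. \<bar>h y\<bar> \<le> B" and k: "k \<in> borel_measurable Q" "\<And>y. \<bar>k y\<bar> \<le> B'"
    and Y: "Y \<in> sets Q" "measure Q Y \<ge> 1 - \<epsilon>" and e: "AE y in Q. y \<in> Y \<longrightarrow> \<bar>h y - k y\<bar> \<le> e" "e \<ge> 0"
  shows "\<bar>(\<integral>y. h y \<partial>Q) - (\<integral>y. k y \<partial>Q)\<bar> \<le> e + (B + B') * \<epsilon>"
proof -
  interpret prob_space Q by fact
  have ih: "integrable Q h" using h by (intro integrable_const_bound[of _ B]) auto
  have ik: "integrable Q k" using k by (intro integrable_const_bound[of _ B']) auto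
  have B: "0 \<le> B" "0 \<le> B'" using h(2)[of undefined] k(2)[of undefined] by linarith+
  have Yc: "space Q - Y \<in> sets Q" using Y(1) by blast
  have "\<bar>(\<integral>y. h y \<partial>Q) - (\<integral>y. k y \<partial>Q)\<bar> = \<bar>\<integral>y. h y - k y \<partial>Q\<bar>" using ih ik by simp
  also have "\<dots> \<le> (\<integral>y. \<bar>h y - k y\<bar> \<partial>Q)" by (rule integral_abs_bound)
  also have "\<dots> \<le> (\<integral>y. e + (B + B') * indicator (space Q - Y) y \<partial>Q)"
  proof (rule integral_mono_AE)
    show "integrable Q (\<lambda>y. \<bar>h y - k y\<bar>)" using ih ik by (intro integrable_abs Bochner_Integration.integrable_diff)
    show "integrable Q (\<lambda>y. e + (B + B') * indicator (space Q - Y) y)" using Yc by (intro Bochner_Integration.integrable_add integrable_mult_right integrable_real_indicator) (auto simp: emeasure_eq_measure)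
    show "AE y in Q. \<bar>h y - k y\<bar> \<le> e + (B + B') * indicator (space Q - Y) y"
      using e(1) AE_space
    proof eventually_elim
      case (elim y)
      show ?case
      proof (cases "y \<in> Y")
        case False
        have "\<bar>h y - k y\<bar> \<le> B + B'" using h(2)[of y] k(2)[of y] by linarith
        then show ?thesis using False elim e(2) by simp
      qed (use elim in simp)
    qed
  qed
  also have "\<dots> = e + (B + B') * (1 - measure Q Y)"
    using Yc Y(1) by (simp add: emeasure_eq_measure prob_compl[symmetric] prob_space)
  also have "\<dots> \<le> e + (B + B') * \<epsilon>" using B Y(2) by (intro add_left_mono mult_left_mono) auto
  finally show ?thesis .
qed

lemma prob_space_completion: "prob_space Q \<Longrightarrow> prob_space (completion Q)"
  by (rule prob_spaceI) (simp add: prob_space.emeasure_space_1)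

section \<open>The limit of the averages and its values at density points\<close>

context C1_amenable
begin

abbreviation "bm p \<equiv> (bounded_measurable (power_top T p) (M p) :: ((nat \<Rightarrow> 'x) \<Rightarrow> real) set)"

lemma bm_bounded: "f \<in> bm p \<Longrightarrow> \<exists>B. \<forall>y. \<bar>f y\<bar> \<le> B"
proof -
  assume f: "f \<in> bm p"
  then have "bounded (f ` Xp p)" by (simp add: bounded_measurable_def)
  then obtain B where B: "\<And>y. y \<in> Xp p \<Longrightarrow> \<bar>f y\<bar> \<le> B"
    unfolding bounded_iff by (metis imageI real_norm_def)
  have "\<bar>f y\<bar> \<le> max B 0" for y
  proof (cases "y \<in> Xp p")
    case True
    then show ?thesis using B[of y] by simp
  next
    case False
    then show ?thesis using f by (simp add: bounded_measurable_def)
  qed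
  then show ?thesis by blast
qed

lemma knull_UN: "(\<And>n::'n::countable. knull p (A n)) \<Longrightarrow> knull p (\<Union>n. A n)"
  unfolding knull_def
proof (intro conjI allI impI)
  assume A: "\<And>n. A n \<in> sets (BXp p) \<and> (\<forall>\<rho>. (\<forall>j<p. ac_prob (\<rho> j)) \<longrightarrow> emeasure (Pi\<^sub>M {..<p} \<rho>) (A n) = 0)"
  show "(\<Union>n. A n) \<in> sets (BXp p)" using A by (intro sets.countable_UN'') auto
  fix \<rho> assume r: "\<forall>j<p. ac_prob (\<rho> j)"
  have s: "sets (Pi\<^sub>M {..<p} \<rho>) = sets (BXp p)" using r by (intro sets_PiM_cong) (auto simp: ac_prob_def)
  have "A n \<in> null_sets (Pi\<^sub>M {..<p} \<rho>)" for n using A[of n] r s by (auto simp: null_sets_def)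
  then have "(\<Union>n. A n) \<in> null_sets (Pi\<^sub>M {..<p} \<rho>)" by (rule null_sets_UN)
  then show "emeasure (Pi\<^sub>M {..<p} \<rho>) (\<Union>n. A n) = 0" by auto
qed

text \<open>Each sublevel set at a rational level is approximated separately, and the countably many
  exceptional sets are collected in \<open>N\<close>.\<close>

lemma Borel_representative:
  assumes p: "p \<ge> 1" and f: "f \<in> bm p" and c: "charts p c"
  shows "\<exists>N. knull p N \<and> N \<subseteq> W p c \<and> (\<lambda>y. indicator (W p c - N) y * f y) \<in> borel_measurable (BXp p)"
proof -
  have fm: "f \<in> borel_measurable (M p)" using f by (simp add: bounded_measurable_def)
  let ?A = "\<lambda>q::rat. {y \<in> space (M p). f y < of_rat q}"
  have As: "?A q \<in> sets (M p)" for q using fm by measurable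
  have "\<forall>q. \<exists>S N. S \<in> sets (BXp p) \<and> knull p N \<and> S \<subseteq> W p c \<and> N \<subseteq> W p c \<and> ?A q \<inter> W p c - N = S - N"
    using Borel_approximation[OF p As c] by blast
  from choice[OF this] obtain S where "\<forall>q. \<exists>N. S q \<in> sets (BXp p) \<and> knull p N \<and> S q \<subseteq> W p c \<and> N \<subseteq> W p c \<and> ?A q \<inter> W p c - N = S q - N"
    by (rule exE)
  from choice[OF this] obtain N where SN: "\<forall>q. S q \<in> sets (BXp p) \<and> knull p (N q) \<and> S q \<subseteq> W p c \<and> N q \<subseteq> W p c \<and> ?A q \<inter> W p c - N q = S q - N q"
    by (rule exE)
  let ?N = "\<Union>q. N q"
  have kN: "knull p ?N" using SN by (intro knull_UN) blast
  have Ns: "?N \<in> sets (BXp p)" using kN by (simp add: knull_def)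
  have Ws: "W p c - ?N \<in> sets (BXp p)" using W_sets[OF c] Ns by blast
  have Sq: "S q - ?N = ?A q \<inter> W p c - ?N" for q
  proof -
    have "?A q \<inter> W p c - N q = S q - N q" using SN by blast
    then show ?thesis by blast
  qed
  have sp: "space (BXp p) = Xp p" by (simp add: space_PiM)
  have "(\<lambda>y. indicator (W p c - ?N) y * f y) \<in> borel_measurable (BXp p)"
    unfolding borel_measurable_iff_less
  proof
    fix a :: real
    have "{y \<in> space (BXp p). indicator (W p c - ?N) y * f y < a} =
        (\<Union>q\<in>{q. of_rat q \<le> a}. S q - ?N) \<union> (if 0 < a then space (BXp p) - (W p c - ?N) else {})"
    proof (intro equalityI subsetI)
      fix y assume y: "y \<in> {y \<in> space (BXp p). indicator (W p c - ?N) y * f y < a}"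
      show "y \<in> (\<Union>q\<in>{q. of_rat q \<le> a}. S q - ?N) \<union> (if 0 < a then space (BXp p) - (W p c - ?N) else {})"
      proof (cases "y \<in> W p c - ?N")
        case True
        then have "f y < a" using y by simp
        then obtain q where q: "f y < of_rat q" "of_rat q < a" using of_rat_dense by blast
        then have "y \<in> ?A q \<inter> W p c - ?N" using True subsetD[OF W_subset[OF c], of y] space_M[OF p] by simp
        then have "y \<in> S q - ?N" unfolding Sq .
        then show ?thesis using q(2) less_imp_le by blast
      next
        case False
        then have "0 < a" using y by simp
        then show ?thesis using False y by simp
      qed
    next
      fix y assume "y \<in> (\<Union>q\<in>{q. of_rat q \<le> a}. S q - ?N) \<union> (if 0 < a then space (BXp p) - (W p c - ?N) else {})"
      then consider q where "of_rat q \<le> a" "y \<in> S q - ?N" | "0 < a" "y \<in> space (BXp p)" "y \<notin> W p c - ?N" by (auto split: if_splits)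
      then show "y \<in> {y \<in> space (BXp p). indicator (W p c - ?N) y * f y < a}"
      proof cases
        case 1
        have y: "y \<in> W p c - ?N" "f y < of_rat q" using 1(2) unfolding Sq by auto
        then show ?thesis using 1(1) W_subset[OF c] sp by auto
      next
        case 2
        then show ?thesis by simp
      qed
    qed
    moreover have "(\<Union>q\<in>{q. of_rat q \<le> a}. S q - ?N) \<in> sets (BXp p)"
      using SN Ns by (intro sets.countable_UN'' countable_subset[OF subset_UNIV countableI_type]) blast
    ultimately show "{y \<in> space (BXp p). indicator (W p c - ?N) y * f y < a} \<in> sets (BXp p)"
      using Ws by auto
  qed
  moreover have "?N \<subseteq> W p c" using SN by blast
  ultimately show ?thesis using kN by blast
qed

text \<open>Lebesgue measurable functions enter only through completions; this returns to the
  product measure itself, where images and Fubini are available.\<close>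

lemma completion_of_representative:
  fixes g h :: "(nat \<Rightarrow> 'x) \<Rightarrow> real"
  assumes i: "i \<in> I" and x: "x \<in> Xp p" and N: "knull p N" and g: "g \<in> borel_measurable (BXp p)"
    and e: "\<And>y. y \<in> Xp p \<Longrightarrow> y \<notin> N \<Longrightarrow> g y = h y"
  shows "h \<in> borel_measurable (completion (P i n p x))"
    and "(\<integral>y. h y \<partial>completion (P i n p x)) = (\<integral>y. g y \<partial>P i n p x)"
proof -
  let ?P = "P i n p x"
  have gm: "g \<in> borel_measurable ?P" using g sets_P[OF x] by (simp cong: measurable_cong_sets)
  have ae: "AE y in ?P. g y = h y"
    using knull_P[OF i x N] e space_P[OF x] by (intro AE_I'[of N]) auto
  then have ae': "AE y in completion ?P. g y = h y" by (rule AE_completion)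
  have gc: "g \<in> borel_measurable (completion ?P)" using gm by (rule measurable_completion)
  show hm: "h \<in> borel_measurable (completion ?P)"
  proof (rule measurableI)
    fix A :: "real set" assume A: "A \<in> sets borel"
    have 1: "g -` A \<inter> space (completion ?P) \<in> sets (completion ?P)" using gc A by (rule measurable_sets)
    have 2: "AE y in completion ?P. y \<in> g -` A \<inter> space (completion ?P) \<longleftrightarrow> y \<in> h -` A \<inter> space (completion ?P)"
      using ae' by eventually_elim simp
    show "h -` A \<inter> space (completion ?P) \<in> sets (completion ?P)"
      by (rule completion.in_sets_AE[OF 2 1]) blast
  qed simp
  have "(\<integral>y. h y \<partial>completion ?P) = (\<integral>y. g y \<partial>completion ?P)"
    using hm gc ae' by (intro integral_cong_AE) auto
  also have "\<dots> = (\<integral>y. g y \<partial>?P)" using gm by (rule integral_completion)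
  finally show "(\<integral>y. h y \<partial>completion ?P) = (\<integral>y. g y \<partial>?P)" .
qed

definition Ch :: "nat \<Rightarrow> (nat \<Rightarrow> 'x) \<Rightarrow> nat \<Rightarrow> 'x chart" where
  "Ch p x = (SOME c. charts p c \<and> x \<in> W p c)"

lemma Ch: "x \<in> Xp p \<Longrightarrow> charts p (Ch p x)" "x \<in> Xp p \<Longrightarrow> x \<in> W p (Ch p x)"
  using someI_ex[OF charts_at[of x p]] unfolding Ch_def by auto

text \<open>A Lebesgue measurable function on \<open>X\<^sup>p\<close> need not be measurable for the completion of \<open>P i n p x\<close> when \<open>X\<close> is not second countable, hence the restriction to one product chart around \<open>x\<close>. As \<open>n \<rightarrow> \<infinity>\<close> the choice of the chart becomes irrelevant.\<close>

definition cut :: "nat \<Rightarrow> (nat \<Rightarrow> 'x) \<Rightarrow> ((nat \<Rightarrow> 'x) \<Rightarrow> real) \<Rightarrow> (nat \<Rightarrow> 'x) \<Rightarrow> real" where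
  "cut p x f y = indicator (W p (Ch p x)) y * f y"

definition avg :: "'i \<Rightarrow> nat \<Rightarrow> nat \<Rightarrow> ((nat \<Rightarrow> 'x) \<Rightarrow> real) \<Rightarrow> (nat \<Rightarrow> 'x) \<Rightarrow> real" where
  "avg i n p f x = (\<integral>y. cut p x f y \<partial>completion (P i n p x))"

lemma cut_bound: "\<forall>y. \<bar>f y\<bar> \<le> B \<Longrightarrow> \<bar>cut p x f y\<bar> \<le> B"
  using order_trans[OF abs_ge_zero, of "f y" B] by (simp add: cut_def indicator_def)

lemma cut_measurable: "p \<ge> 1 \<Longrightarrow> f \<in> bm p \<Longrightarrow> i \<in> I \<Longrightarrow> x \<in> Xp p \<Longrightarrow> cut p x f \<in> borel_measurable (completion (P i n p x))"
proof -
  assume p: "p \<ge> 1" and f: "f \<in> bm p" and i: "i \<in> I" and x: "x \<in> Xp p"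
  obtain N where N: "knull p N" "N \<subseteq> W p (Ch p x)" "(\<lambda>y. indicator (W p (Ch p x) - N) y * f y) \<in> borel_measurable (BXp p)"
    using Borel_representative[OF p f Ch(1)[OF x]] by blast
  show ?thesis
    by (rule completion_of_representative(1)[OF i x N(1) N(3)]) (auto simp: cut_def indicator_def)
qed

lemma prob_Pc: "i \<in> I \<Longrightarrow> x \<in> Xp p \<Longrightarrow> prob_space (completion (P i n p x))"
  by (intro prob_space_completion prob_P)

lemma cut_integrable: "p \<ge> 1 \<Longrightarrow> f \<in> bm p \<Longrightarrow> i \<in> I \<Longrightarrow> x \<in> Xp p \<Longrightarrow> integrable (completion (P i n p x)) (cut p x f)"
proof -
  assume p: "p \<ge> 1" and f: "f \<in> bm p" and i: "i \<in> I" and x: "x \<in> Xp p"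
  interpret prob_space "completion (P i n p x)" by (rule prob_Pc[OF i x])
  obtain B where "\<forall>y. \<bar>f y\<bar> \<le> B" using bm_bounded[OF f] by blast
  then show ?thesis using cut_bound[of f B p x] cut_measurable[OF p f i x]
    by (intro integrable_const_bound[of _ B]) auto
qed

lemma W_concentration:
  assumes i: "i \<in> I" and x: "x \<in> Xp p" and c: "charts p c" "x \<in> W p c" and "\<epsilon> > 0"
  shows "eventually (\<lambda>n. measure (P i n p x) (W p c) \<ge> 1 - \<epsilon>) sequentially"
  unfolding W_def using c by (intro P_box_concentration[OF i x _ \<open>\<epsilon> > 0\<close>]) (auto simp: charts_def W_def chart_open PiE_iff)

lemma avg_mono:
  assumes p: "p \<ge> 1" and f: "f \<in> bm p" "f' \<in> bm p" and D: "lnull p D" "\<And>y. y \<notin> D \<Longrightarrow> f y \<le> f' y" and i: "i \<in> I" and x: "x \<in> Xp p"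
  shows "avg i n p f x \<le> avg i n p f' x"
  unfolding avg_def
proof (rule integral_mono_AE[OF cut_integrable[OF p f(1) i x] cut_integrable[OF p f(2) i x]])
  obtain N where N: "knull p N" "D \<inter> W p (Ch p x) \<subseteq> N" using lnull_imp_knull[OF D(1) Ch(1)[OF x]] by blast
  have "cut p x f y \<le> cut p x f' y" if "y \<notin> N" for y
    using that D(2)[of y] N(2) by (auto simp: cut_def indicator_def)
  then show "AE y in completion (P i n p x). cut p x f y \<le> cut p x f' y"
    using knull_P[OF i x N(1)] by (intro AE_completion AE_I'[of N]) auto
qed

text \<open>The value 0 at meaningless indices makes relations between coordinates hold for all
  pairs \<open>(i, n)\<close>, so that they define closed sets containing the whole family.\<close>

definition V :: "'i \<times> nat \<Rightarrow> nat \<times> ((nat \<Rightarrow> 'x) \<Rightarrow> real) \<times> (nat \<Rightarrow> 'x) \<Rightarrow> real" where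
  "V = (\<lambda>(i, n) (p, f, x). if i \<in> I \<and> p \<ge> 1 \<and> f \<in> bm p \<and> x \<in> Xp p then avg i n p f x else 0)"

lemma V_bounded: "\<exists>B. \<forall>j. \<bar>V j c\<bar> \<le> B"
proof -
  obtain p f x where c: "c = (p, f, x)" by (cases c)
  show ?thesis
  proof (cases "p \<ge> 1 \<and> f \<in> bm p \<and> x \<in> Xp p")
    case True
    then have p: "p \<ge> 1" and f: "f \<in> bm p" and x: "x \<in> Xp p" by auto
    obtain B where B: "\<forall>y. \<bar>f y\<bar> \<le> B" using bm_bounded[OF f] by blast
    then have "0 \<le> B" by (meson abs_ge_zero order_trans)
    have "\<bar>avg i n p f x\<bar> \<le> B" if i: "i \<in> I" for i n
    proof -
      interpret prob_space "completion (P i n p x)" by (rule prob_Pc[OF i x])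
      have "\<bar>avg i n p f x\<bar> \<le> (\<integral>y. \<bar>cut p x f y\<bar> \<partial>completion (P i n p x))" unfolding avg_def by (rule integral_abs_bound)
      also have "\<dots> \<le> (\<integral>y. B \<partial>completion (P i n p x))"
        using cut_integrable[OF p f i x] cut_bound[OF B] by (intro integral_mono) auto
      finally show ?thesis using prob_space by simp
    qed
    then show ?thesis using \<open>0 \<le> B\<close> by (intro exI[of _ B]) (auto simp: V_def c)
  qed (auto simp: V_def c)
qed

definition L0 :: "nat \<times> ((nat \<Rightarrow> 'x) \<Rightarrow> real) \<times> (nat \<Rightarrow> 'x) \<Rightarrow> real" where
  "L0 = (SOME L. \<forall>S. closed S \<and> eventually (\<lambda>j. V j \<in> S) (iterated_filter I rel) \<longrightarrow> L \<in> S)"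

definition L :: "nat \<Rightarrow> ((nat \<Rightarrow> 'x) \<Rightarrow> real) \<Rightarrow> (nat \<Rightarrow> 'x) \<Rightarrow> real" where
  "L p f x = L0 (p, f, x)"

lemma L0_in: "closed S \<Longrightarrow> eventually (\<lambda>j. V j \<in> S) (iterated_filter I rel) \<Longrightarrow> L0 \<in> S"
proof -
  have "\<forall>c. \<exists>B. \<forall>j. \<bar>V j c\<bar> \<le> B" using V_bounded by blast
  from choice[OF this] obtain B where "\<forall>c j. \<bar>V j c\<bar> \<le> B c" by (rule exE)
  then have "\<exists>L. \<forall>S. closed S \<and> eventually (\<lambda>j. V j \<in> S) (iterated_filter I rel) \<longrightarrow> L \<in> S"
    by (intro cluster_functional[OF iterated_filter_not_bot[OF dir], of V B]) blast
  from someI_ex[OF this] show "closed S \<Longrightarrow> eventually (\<lambda>j. V j \<in> S) (iterated_filter I rel) \<Longrightarrow> L0 \<in> S"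
    unfolding L0_def by blast
qed

lemma continuous_coordinate: "continuous_on UNIV (\<lambda>\<phi>::'c \<Rightarrow> real. \<phi> c)"
  by (rule continuous_on_product_coordinates)

lemma L0_always: "closed S \<Longrightarrow> (\<And>j. V j \<in> S) \<Longrightarrow> L0 \<in> S"
  by (rule L0_in) (auto intro: always_eventually)

text \<open>Coordinates depend continuously on the point of the product, so a linear relation
  defines a closed set.\<close>

lemma L0_sum_eq:
  assumes "\<And>j. V j c = (\<Sum>k\<in>K. a k * V j (d k))"
  shows "L0 c = (\<Sum>k\<in>K. a k * L0 (d k))"
proof -
  have "L0 \<in> {\<phi>. \<phi> c = (\<Sum>k\<in>K. a k * \<phi> (d k))}"
    by (rule L0_always, intro closed_Collect_eq continuous_intros continuous_coordinate) (use assms in auto)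
  then show ?thesis by simp
qed

lemma L0_le: "(\<And>j. V j c \<le> V j d) \<Longrightarrow> L0 c \<le> L0 d"
proof -
  assume a: "\<And>j. V j c \<le> V j d"
  have "L0 \<in> {\<phi>. \<phi> c \<le> \<phi> d}"
    by (rule L0_always, intro closed_Collect_le continuous_intros continuous_coordinate) (use a in auto)
  then show ?thesis by simp
qed

lemma L0_close:
  assumes "\<And>i. i \<in> I \<Longrightarrow> eventually (\<lambda>n. \<bar>V (i, n) c - r\<bar> \<le> e) sequentially"
  shows "\<bar>L0 c - r\<bar> \<le> e"
proof -
  obtain i0 where "i0 \<in> I" using dir by (auto simp: directed_set_def)
  then have "eventually (\<lambda>j. V j \<in> {\<phi>. \<bar>\<phi> c - r\<bar> \<le> e}) (iterated_filter I rel)"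
    unfolding eventually_iterated_filter[OF dir] using assms by auto
  moreover have "closed {\<phi>::nat \<times> ((nat \<Rightarrow> 'x) \<Rightarrow> real) \<times> (nat \<Rightarrow> 'x) \<Rightarrow> real. \<bar>\<phi> c - r\<bar> \<le> e}"
    by (intro closed_Collect_le continuous_intros continuous_coordinate)
  ultimately have "L0 \<in> {\<phi>. \<bar>\<phi> c - r\<bar> \<le> e}" by (intro L0_in)
  then show ?thesis by simp
qed

lemma L0_eq:
  assumes "\<And>e. e > 0 \<Longrightarrow> eventually (\<lambda>j. \<bar>V j c - V j d\<bar> \<le> e) (iterated_filter I rel)"
  shows "L0 c = L0 d"
proof -
  have "\<bar>L0 c - L0 d\<bar> \<le> e" if "e > 0" for e
  proof -
    have "closed {\<phi>::nat \<times> ((nat \<Rightarrow> 'x) \<Rightarrow> real) \<times> (nat \<Rightarrow> 'x) \<Rightarrow> real. \<bar>\<phi> c - \<phi> d\<bar> \<le> e}"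
      by (intro closed_Collect_le continuous_intros continuous_coordinate)
    moreover have "eventually (\<lambda>j. V j \<in> {\<phi>. \<bar>\<phi> c - \<phi> d\<bar> \<le> e}) (iterated_filter I rel)" using assms[OF that] by simp
    ultimately have "L0 \<in> {\<phi>. \<bar>\<phi> c - \<phi> d\<bar> \<le> e}" by (rule L0_in)
    then show ?thesis by simp
  qed
  then have "\<bar>L0 c - L0 d\<bar> \<le> 0" using field_le_epsilon[of "\<bar>L0 c - L0 d\<bar>" 0] by simp
  then show ?thesis by simp
qed

lemma L_mono:
  assumes "p \<ge> 1" "f \<in> bm p" "f' \<in> bm p" "lnull p D" "\<And>y. y \<notin> D \<Longrightarrow> f y \<le> f' y"
  shows "L p f x \<le> L p f' x"
  unfolding L_def
proof (rule L0_le)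
  fix j :: "'i \<times> nat"
  obtain i :: 'i and n where j: "j = (i, n)" by (cases j)
  show "V j (p, f, x) \<le> V j (p, f', x)"
    using avg_mono[OF assms, of i x n] assms(1-3) by (auto simp: V_def j)
qed

lemma L_cong:
  assumes "p \<ge> 1" "f \<in> bm p" "f' \<in> bm p" "lnull p D" "\<And>y. y \<notin> D \<Longrightarrow> f y = f' y"
  shows "L p f x = L p f' x"
  using L_mono[OF assms(1-4), of x] L_mono[OF assms(1,3,2,4), of x] assms(5) by (intro antisym) auto

lemma L_outside: "x \<notin> Xp p \<Longrightarrow> L p f x = 0"
proof -
  assume x: "x \<notin> Xp p"
  \<comment> \<open>The empty sum states that the coordinate is 0.\<close>
  have "L0 (p, f, x) = (\<Sum>k\<in>({} :: nat set). 0 * L0 (p, f, x))" by (rule L0_sum_eq) (simp add: V_def x split_beta)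
  then show ?thesis by (simp add: L_def)
qed

lemma L_sum:
  fixes K :: "'b set"
  assumes p: "p \<ge> 1" and K: "finite K" and f: "\<And>k. k \<in> K \<Longrightarrow> f k \<in> bm p" and s: "(\<lambda>y. \<Sum>k\<in>K. a k * f k y) \<in> bm p"
  shows "L p (\<lambda>y. \<Sum>k\<in>K. a k * f k y) x = (\<Sum>k\<in>K. a k * L p (f k) x)"
  unfolding L_def
proof (rule L0_sum_eq)
  fix j :: "'i \<times> nat"
  obtain i :: 'i and n where j: "j = (i, n)" by (cases j)
  show "V j (p, \<lambda>y. \<Sum>k\<in>K. a k * f k y, x) = (\<Sum>k\<in>K. a k * V j (p, f k, x))"
  proof (cases "i \<in> I \<and> x \<in> Xp p")
    case True
    have "avg i n p (\<lambda>y. \<Sum>k\<in>K. a k * f k y) x = (\<integral>y. (\<Sum>k\<in>K. a k * cut p x (f k) y) \<partial>completion (P i n p x))"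
    proof -
      have "cut p x (\<lambda>y. \<Sum>k\<in>K. a k * f k y) y = (\<Sum>k\<in>K. a k * cut p x (f k) y)" for y
        by (simp add: cut_def sum_distrib_left mult.left_commute)
      then show ?thesis unfolding avg_def by (rule Bochner_Integration.integral_cong[OF refl])
    qed
    also have "\<dots> = (\<Sum>k\<in>K. a k * avg i n p (f k) x)"
      unfolding avg_def using True f p by (subst Bochner_Integration.integral_sum) (auto intro: cut_integrable)
    finally show ?thesis using True f s p by (simp add: V_def j)
  next
    case False
    then have "V j (p, h, x) = 0" for h unfolding V_def j by auto
    then show ?thesis by simp
  qed
qed

text \<open>For large \<open>n\<close> the kernel at the density point \<open>x\<close> puts almost
  all its mass where \<open>f\<close> is within \<open>e\<close> of \<open>r\<close>. The rest
  contributes at most its mass times \<open>B + \<bar>r\<bar>\<close>, and \<epsilon> is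
  arbitrary.\<close>

lemma L_squeeze:
  assumes p: "p \<ge> 1" and f: "f \<in> bm p" and c: "charts p c" and x: "x \<in> W p c" and S: "S \<in> sets (leb (p * dm))"
    and dens: "\<And>a. a > 0 \<Longrightarrow> \<exists>r0>0. \<forall>r. 0 < r \<and> r < r0 \<longrightarrow> emeasure (leb (p * dm)) (cube (p * dm) (Cm p c x) r - S) \<le> ennreal (a * (2 * r) ^ (p * dm))"
    and fS: "\<And>y. y \<in> W p c \<Longrightarrow> Cm p c y \<in> S \<Longrightarrow> \<bar>f y - r\<bar> \<le> e" and e: "e \<ge> 0"
  shows "\<bar>L p f x - r\<bar> \<le> e"
proof -
  have xX: "x \<in> Xp p" using x W_subset[OF c] by blast
  obtain B where B: "\<forall>y. \<bar>f y\<bar> \<le> B" using bm_bounded[OF f] by blast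
  let ?Y = "{y \<in> W p c. Cm p c y \<in> S}"
  have B0: "B \<ge> 0" using B by (meson abs_ge_zero order_trans)
  let ?C = "2 * (B + \<bar>r\<bar>)"
  have main: "\<bar>L p f x - r\<bar> \<le> e + ?C * \<epsilon>" if \<epsilon>: "\<epsilon> > 0" for \<epsilon>
    unfolding L_def
  proof (rule L0_close)
    fix i assume i: "i \<in> I"
    have "eventually (\<lambda>n. measure (P i n p x) ?Y \<ge> 1 - \<epsilon>) sequentially"
      by (rule P_density_concentration[OF i c x S dens \<epsilon>])
    then show "eventually (\<lambda>n. \<bar>V (i, n) (p, f, x) - r\<bar> \<le> e + ?C * \<epsilon>) sequentially"
      using W_concentration[OF i xX Ch(1)[OF xX] Ch(2)[OF xX] \<epsilon>]
    proof eventually_elim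
      case (elim n)
      interpret prob_space "P i n p x" by (rule prob_P[OF i xX])
      \<comment> \<open>The chart used by \<open>cut\<close> need not be \<open>c\<close>. On this
        intersection \<open>cut p x f\<close> equals \<open>f\<close>, and two exceptional sets of
        mass at most \<epsilon> are lost.\<close>
      let ?Z = "?Y \<inter> W p (Ch p x)"
      have Ys: "?Y \<in> sets (P i n p x)" "W p (Ch p x) \<in> sets (P i n p x)"
        unfolding sets_P[OF xX] using Cm_vimage_sets[OF c S] W_sets[OF Ch(1)[OF xX]] by auto
      have "measure (P i n p x) (?Y \<union> W p (Ch p x)) + measure (P i n p x) ?Z = measure (P i n p x) ?Y + measure (P i n p x) (W p (Ch p x))"
        using measure_Un3[of ?Y "P i n p x" "W p (Ch p x)"] Ys by (simp add: fmeasurable_eq_sets)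
      moreover have "measure (P i n p x) (?Y \<union> W p (Ch p x)) \<le> 1" by simp
      ultimately have Z: "measure (P i n p x) ?Z \<ge> 1 - 2 * \<epsilon>" using elim by linarith
      have "\<bar>(\<integral>y. cut p x f y \<partial>completion (P i n p x)) - (\<integral>y. r \<partial>completion (P i n p x))\<bar> \<le> e + (B + \<bar>r\<bar>) * (2 * \<epsilon>)"
      proof (rule prob_integral_close[OF prob_Pc[OF i xX] cut_measurable[OF p f i xX] cut_bound[OF B] _ _ _ _ _ e])
        show "?Z \<in> sets (completion (P i n p x))" using Ys by auto
        show "1 - 2 * \<epsilon> \<le> measure (completion (P i n p x)) ?Z" using Z Ys by (subst measure_completion) auto
        have "\<bar>cut p x f y - r\<bar> \<le> e" if "y \<in> ?Z" for y using fS[of y] that by (simp add: cut_def)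
        then show "AE y in completion (P i n p x). y \<in> ?Z \<longrightarrow> \<bar>cut p x f y - r\<bar> \<le> e" by (intro AE_I2 impI)
      qed auto
      moreover have "(\<integral>y. r \<partial>completion (P i n p x)) = r"
        using prob_space.prob_space[OF prob_Pc[OF i xX]] by (subst lebesgue_integral_const) simp
      moreover have "V (i, n) (p, f, x) = (\<integral>y. cut p x f y \<partial>completion (P i n p x))"
        using i p f xX unfolding V_def avg_def by simp
      moreover have "(B + \<bar>r\<bar>) * (2 * \<epsilon>) = ?C * \<epsilon>" by simp
      ultimately show ?case by (simp only:)
    qed
  qed
  show ?thesis
  proof (rule field_le_epsilon)
    fix d :: real assume d: "d > 0"
    \<comment> \<open>\<open>?C\<close> may be 0, hence the denominator
      \<open>?C + 1\<close>.\<close>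
    have "?C * (d / (?C + 1)) \<le> d" using B0 d by (simp add: divide_simps) 
    then show "\<bar>L p f x - r\<bar> \<le> e + d" using main[of "d / (?C + 1)"] B0 d by (simp add: add_pos_nonneg)
  qed
qed

end

context C1_amenable
begin

lemma L_squeeze_box:
  assumes p: "p \<ge> 1" and f: "f \<in> bm p" and Ob: "\<And>j. j < p \<Longrightarrow> openin T (Ob j)" and x: "x \<in> Pi\<^sub>E {..<p} Ob"
    and e: "\<And>y. y \<in> Pi\<^sub>E {..<p} Ob \<Longrightarrow> \<bar>f y - r\<bar> \<le> e" "e \<ge> 0"
  shows "\<bar>L p f x - r\<bar> \<le> e"
proof -
  have "Pi\<^sub>E {..<p} Ob \<subseteq> Xp p" using openin_subset[OF Ob] by (intro PiE_mono) auto
  then have xX: "x \<in> Xp p" using x by blast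
  let ?c = "Ch p x"
  note c = Ch[OF xX]
  let ?S = "Cm p ?c ` (Pi\<^sub>E {..<p} Ob \<inter> W p ?c)"
  have So: "openin (Rn (p * dm)) ?S" using Ob by (intro Cm_image_box[OF c(1)]) auto
  have xS: "Cm p ?c x \<in> ?S" using x c(2) by blast
  show ?thesis
  proof (rule L_squeeze[OF p f c openin_sets_leb[OF So] _ _ e(2)])
    show "\<exists>r0>0. \<forall>r. 0 < r \<and> r < r0 \<longrightarrow> emeasure (leb (p * dm)) (cube (p * dm) (Cm p ?c x) r - ?S) \<le> ennreal (a * (2 * r) ^ (p * dm))" for a :: real
      by (rule density_at_interior_point[OF So xS])
  next
    fix y assume y: "y \<in> W p ?c" "Cm p ?c y \<in> ?S"
    then obtain z where "z \<in> Pi\<^sub>E {..<p} Ob" "z \<in> W p ?c" "Cm p ?c y = Cm p ?c z" by blast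
    then have "y \<in> Pi\<^sub>E {..<p} Ob" using inj_onD[OF Cm_inj[OF c(1)], of y z] y(1) by simp
    then show "\<bar>f y - r\<bar> \<le> e" by (rule e(1))
  qed
qed

text \<open>The squeeze with the whole power as box, centre 0 and tolerance
  \<open>B\<close>.\<close>

lemma L_bounded: "p \<ge> 1 \<Longrightarrow> f \<in> bm p \<Longrightarrow> \<forall>y. \<bar>f y\<bar> \<le> B \<Longrightarrow> \<bar>L p f x\<bar> \<le> B"
proof -
  assume p: "p \<ge> 1" and f: "f \<in> bm p" and B: "\<forall>y. \<bar>f y\<bar> \<le> B"
  have "B \<ge> 0" using order_trans[OF abs_ge_zero B[rule_format, of undefined]] .
  then show ?thesis
    using L_squeeze_box[OF p f, of "\<lambda>_. topspace T" x 0 B] L_outside[of x p f] B by (cases "x \<in> Xp p") auto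
qed

lemma L_continuous:
  assumes p: "p \<ge> 1" and f: "f \<in> bm p" and cont: "continuous_map (power_top T p) euclideanreal f"
  shows "L p f = f"
proof
  fix x
  show "L p f x = f x"
  proof (cases "x \<in> Xp p")
    case True
    have "\<bar>L p f x - f x\<bar> \<le> e" if e: "e > 0" for e
    proof -
      have "openin (power_top T p) {y \<in> topspace (power_top T p). f y \<in> ball (f x) e}"
        by (rule openin_continuous_map_preimage[OF cont]) simp
      then obtain Ob where Ob: "\<forall>j\<in>{..<p}. openin T (Ob j)" "x \<in> Pi\<^sub>E {..<p} Ob" "Pi\<^sub>E {..<p} Ob \<subseteq> {y \<in> topspace (power_top T p). f y \<in> ball (f x) e}"
        using True e unfolding openin_product_topology_alt by force
      show ?thesis
      proof (rule L_squeeze_box[OF p f _ Ob(2)])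
        fix y assume "y \<in> Pi\<^sub>E {..<p} Ob"
        then have "f y \<in> ball (f x) e" using Ob(3) by blast
        then show "\<bar>f y - f x\<bar> \<le> e" by (simp add: dist_real_def abs_minus_commute)
      qed (use Ob e in auto)
    qed
    then have "\<bar>L p f x - f x\<bar> \<le> 0" using field_le_epsilon[of "\<bar>L p f x - f x\<bar>" 0] by simp
    then show ?thesis by simp
  next
    case False
    then show ?thesis using f by (simp add: L_outside bounded_measurable_def)
  qed
qed

text \<open>At a density point of \<open>E (a, b)\<close>, the squeeze with the midpoint and half
  the length of the interval gives a limit value between \<open>a\<close> and \<open>b\<close>.
  Where the limit differs from \<open>f\<close>, some rational interval around the value of
  \<open>f\<close> excludes it, and there are countably many intervals.\<close>

lemma L_AE:
  assumes p: "p \<ge> 1" and f: "f \<in> bm p"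
  shows "lnull p {x \<in> Xp p. L p f x \<noteq> f x}"
proof -
  have fm: "f \<in> borel_measurable (M p)" using f by (simp add: bounded_measurable_def)
  define E where "E = (\<lambda>(a::rat, b::rat). {x \<in> Xp p. of_rat a < f x \<and> f x < of_rat b})"
  define D where "D = (\<lambda>(a::rat, b::rat). {x \<in> E (a, b). \<bar>L p f x - of_rat (a + b) / 2\<bar> > of_rat (b - a) / 2})"
  have null: "lnull p (D ab)" for ab
  proof -
    obtain a b where ab: "ab = (a, b)" by (cases ab)
    have EX: "E ab \<subseteq> Xp p" unfolding ab E_def by auto
    have "{x \<in> space (M p). of_rat a < f x \<and> f x < of_rat b} \<in> sets (M p)" using fm by measurable
    then have Es: "E ab \<in> sets (M p)" unfolding ab E_def using space_M[OF p] by simp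
    have "Cm p c ` (D ab \<inter> W p c) \<in> null_sets (Rn_lebesgue (p * dm))" if c: "charts p c" for c
    proof -
      have "Cm p c ` (E ab \<inter> W p c) \<in> sets (Rn_lebesgue (p * dm))" using Es c unfolding sets_M[OF p] by blast
      from Lebesgue_density[OF this] obtain S Z where S: "S \<in> sets (leb (p * dm))" "Z \<in> null_sets (leb (p * dm))" "S \<subseteq> Cm p c ` (E ab \<inter> W p c)"
        and dens: "\<forall>x\<in>Cm p c ` (E ab \<inter> W p c) - Z. \<forall>a>0. \<exists>r0>0. \<forall>r. 0 < r \<and> r < r0 \<longrightarrow>
             emeasure (leb (p * dm)) (cube (p * dm) x r - S) \<le> ennreal (a * (2 * r) ^ (p * dm))"
        by (elim bexE conjE)
      have "Cm p c ` (D ab \<inter> W p c) \<subseteq> Z"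
      proof (rule ccontr)
        assume "\<not> ?thesis"
        then obtain x where x: "x \<in> D ab" "x \<in> W p c" "Cm p c x \<notin> Z" by blast
        have xE: "x \<in> E ab" using x(1) unfolding ab D_def by simp
        then have lt: "(of_rat a :: real) < of_rat b" unfolding ab E_def by auto
        have "\<bar>L p f x - of_rat (a + b) / 2\<bar> \<le> of_rat (b - a) / 2"
        proof (rule L_squeeze[OF p f c x(2) S(1)])
          show "\<exists>r0>0. \<forall>r. 0 < r \<and> r < r0 \<longrightarrow> emeasure (leb (p * dm)) (cube (p * dm) (Cm p c x) r - S) \<le> ennreal (t * (2 * r) ^ (p * dm))"
            if "t > 0" for t using dens xE x(2,3) that by blast
          show "0 \<le> (of_rat (b - a) / 2 :: real)" using lt by (simp add: of_rat_diff)
          fix y assume y: "y \<in> W p c" "Cm p c y \<in> S"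
          then obtain z where z: "z \<in> E ab" "z \<in> W p c" "Cm p c y = Cm p c z" using S(3) by blast
          then have "y = z" using inj_onD[OF Cm_inj[OF c], of y z] y(1) by simp
          then have "of_rat a < f y" "f y < of_rat b" using z(1) unfolding ab E_def by auto
          then show "\<bar>f y - of_rat (a + b) / 2\<bar> \<le> of_rat (b - a) / 2" unfolding of_rat_diff of_rat_add abs_le_iff by (auto simp: field_simps)
        qed
        then show False using x(1) unfolding ab D_def by simp
      qed
      then show ?thesis unfolding Rn_lebesgue_def using S(2) by (rule null_sets_completion_sub)
    qed
    moreover have "D ab \<subseteq> Xp p" using EX unfolding ab D_def by auto
    ultimately show ?thesis unfolding lnull_def by blast
  qed
  have "{x \<in> Xp p. L p f x \<noteq> f x} \<subseteq> (\<Union>ab. D ab)"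
  proof
    fix x assume x: "x \<in> {x \<in> Xp p. L p f x \<noteq> f x}"
    define d where "d = \<bar>L p f x - f x\<bar>"
    have d: "d > 0" using x by (simp add: d_def)
    obtain a where a: "f x - d < of_rat a" "of_rat a < f x" using of_rat_dense[of "f x - d" "f x"] d by auto
    obtain b where b: "f x < of_rat b" "of_rat b < f x + d" using of_rat_dense[of "f x" "f x + d"] d by auto
    have "L p f x > of_rat b \<or> L p f x < of_rat a" using a b unfolding d_def by linarith
    moreover have "\<bar>l - (u + v) / 2\<bar> > (v - u) / 2" if "l > v \<or> l < u" "u < v" for l u v :: real
      using that by (auto simp: abs_if field_simps)
    ultimately have "\<bar>L p f x - of_rat (a + b) / 2\<bar> > of_rat (b - a) / 2"
      using a b unfolding of_rat_diff of_rat_add by simp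
    then have "x \<in> D (a, b)" using x a b by (simp add: D_def E_def)
    then show "x \<in> (\<Union>ab. D ab)" by blast
  qed
  then show ?thesis by (rule lnull_subset[OF lnull_UN[OF null]])
qed

text \<open>The limit differs from \<open>f\<close> on a locally null set only, and every subset of
  such a set belongs to \<open>sets (M p)\<close>.\<close>

lemma L_bm:
  assumes p: "p \<ge> 1" and f: "f \<in> bm p"
  shows "L p f \<in> bm p"
proof -
  let ?D = "{x \<in> Xp p. L p f x \<noteq> f x}"
  note D = L_AE[OF p f]
  have fm: "f \<in> borel_measurable (M p)" using f by (simp add: bounded_measurable_def)
  have "L p f \<in> borel_measurable (M p)"
  proof (rule measurableI)
    fix A :: "real set" assume A: "A \<in> sets borel"
    have "L p f -` A \<inter> space (M p) = ((f -` A \<inter> space (M p)) - ?D) \<union> (L p f -` A \<inter> ?D)"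
      using space_M[OF p] by auto
    moreover have "f -` A \<inter> space (M p) \<in> sets (M p)" using fm A by (rule measurable_sets)
    moreover have "?D \<in> sets (M p)" "L p f -` A \<inter> ?D \<in> sets (M p)"
      using lnull_sets[OF p D] lnull_sets[OF p lnull_subset[OF D]] by auto
    ultimately show "L p f -` A \<inter> space (M p) \<in> sets (M p)" by simp
  qed simp
  moreover obtain B where "\<forall>y. \<bar>f y\<bar> \<le> B" using bm_bounded[OF f] by blast
  then have "bounded (L p f ` topspace (power_top T p))"
    using L_bounded[OF p f] unfolding bounded_iff by (intro exI[of _ B]) auto
  moreover have "\<forall>y. y \<notin> topspace (power_top T p) \<longrightarrow> L p f y = 0" using L_outside by simp
  ultimately show ?thesis unfolding bounded_measurable_def by blast
qed

section \<open>Equivariance and maps of coordinates\<close>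

lemma overlap:
  assumes i: "i \<in> I" and u: "u \<in> topspace T" and d: "(\<integral>g. \<bar>\<mu> i (s + g) (act s u) - \<mu> i g u\<bar> \<partial>\<nu>) < \<delta>"
  shows "\<exists>w. w \<in> borel_measurable \<nu> \<and> (\<forall>h. w h \<le> wt i u h) \<and> (\<forall>h. w h \<le> wt i (act s u) (s + h)) \<and> ennreal (1 - \<delta>) \<le> (\<integral>\<^sup>+h. w h \<partial>\<nu>)"
proof -
  have su: "act s u \<in> topspace T" using u by (rule act_in)
  let ?a = "\<lambda>h. \<mu> i (s + h) (act s u)" and ?b = "\<lambda>h. \<mu> i h u"
  have tm: "(\<lambda>h. s + h) \<in> measurable \<nu> borel" using measurable_translation by simp
  have "integrable (distr \<nu> borel (\<lambda>h. s + h)) (\<lambda>g. \<mu> i g (act s u))" unfolding distr_translation by (rule mu_integrable[OF i su])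
  then have ia: "integrable \<nu> ?a" using mu_borel[OF i su] by (subst (asm) integrable_distr_eq[OF tm]) (auto cong: measurable_cong_sets)
  have ib: "integrable \<nu> ?b" by (rule mu_integrable[OF i u])
  have im: "integrable \<nu> (\<lambda>h. min (?a h) (?b h))" using ia ib by (rule integrable_min)
  \<comment> \<open>The common part is the minimum of the two weights, which is at least
    \<open>b - \<bar>a - b\<bar>\<close> for weights \<open>a\<close> and \<open>b\<close>.\<close>
  have "1 - \<delta> \<le> (\<integral>h. ?b h \<partial>\<nu>) - (\<integral>h. \<bar>?a h - ?b h\<bar> \<partial>\<nu>)" using d \<mu>_int[OF i u] by simp
  also have "\<dots> = (\<integral>h. ?b h - \<bar>?a h - ?b h\<bar> \<partial>\<nu>)" using ia ib by simp
  also have "\<dots> \<le> (\<integral>h. min (?a h) (?b h) \<partial>\<nu>)" using ia ib im by (intro integral_mono) auto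
  finally have le: "1 - \<delta> \<le> (\<integral>h. min (?a h) (?b h) \<partial>\<nu>)" .
  have "(\<integral>\<^sup>+h. ennreal (min (?a h) (?b h)) \<partial>\<nu>) = ennreal (\<integral>h. min (?a h) (?b h) \<partial>\<nu>)"
    using im \<mu>_nonneg[OF i u] \<mu>_nonneg[OF i su] by (intro nn_integral_eq_integral) auto
  then have "ennreal (1 - \<delta>) \<le> (\<integral>\<^sup>+h. ennreal (min (?a h) (?b h)) \<partial>\<nu>)" using le by (simp add: ennreal_leI)
  then show ?thesis using im
    by (intro exI[of _ "\<lambda>h. ennreal (min (?a h) (?b h))"]) (auto simp: wt_def intro!: ennreal_leI)
qed

text \<open>Translations, permutations and the omission of a coordinate are all composition with such a map, with \<open>\<tau>\<close> injective.\<close>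

definition mv :: "'g \<Rightarrow> nat \<Rightarrow> (nat \<Rightarrow> nat) \<Rightarrow> (nat \<Rightarrow> 'x) \<Rightarrow> nat \<Rightarrow> 'x" where
  "mv s p \<tau> y = (\<lambda>j\<in>{..<p}. act s (y (\<tau> j)))"

definition pull :: "nat \<Rightarrow> 'g \<Rightarrow> nat \<Rightarrow> (nat \<Rightarrow> nat) \<Rightarrow> ((nat \<Rightarrow> 'x) \<Rightarrow> real) \<Rightarrow> (nat \<Rightarrow> 'x) \<Rightarrow> real" where
  "pull q s p \<tau> f y = (if y \<in> Xp q then f (mv s p \<tau> y) else 0)"

context
  fixes s :: "'g" and p q :: nat and \<tau> :: "nat \<Rightarrow> nat"
  assumes p: "p \<ge> 1" and q: "q \<ge> 1" and \<tau>: "inj_on \<tau> {..<p}" "\<tau> ` {..<p} \<subseteq> {..<q}"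
begin

lemma tau_lt: "j < p \<Longrightarrow> \<tau> j < q"
  using \<tau>(2) by auto

lemma mv_in: "y \<in> Xp q \<Longrightarrow> mv s p \<tau> y \<in> Xp p"
  using tau_lt act_in by (auto simp: mv_def PiE_iff)

lemma mv_measurable: "mv s p \<tau> \<in> measurable (BXp q) (BXp p)"
proof -
  have "(\<lambda>y. act s (y (\<tau> j))) \<in> measurable (BXp q) BX" if "j \<in> {..<p}" for j
  proof -
    have "(\<lambda>y. y (\<tau> j)) \<in> measurable (BXp q) BX" using that tau_lt by (intro measurable_component_singleton) simp
    then show ?thesis by (rule measurable_compose[OF _ measurable_act])
  qed
  then show ?thesis unfolding mv_def[abs_def] by (rule measurable_restrict)
qed

lemma mv_vimage: "A \<in> sets (BXp p) \<Longrightarrow> {y \<in> Xp q. mv s p \<tau> y \<in> A} \<in> sets (BXp q)"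
proof -
  assume A: "A \<in> sets (BXp p)"
  have "{y \<in> Xp q. mv s p \<tau> y \<in> A} = mv s p \<tau> -` A \<inter> space (BXp q)" by (auto simp: space_PiM)
  then show ?thesis using measurable_sets[OF mv_measurable A] by simp
qed

lemma distr_mv:
  assumes "\<And>l. l < q \<Longrightarrow> ac_prob (\<rho> l)"
  shows "distr (Pi\<^sub>M {..<q} \<rho>) (BXp p) (mv s p \<tau>) = Pi\<^sub>M {..<p} (\<lambda>j. distr (\<rho> (\<tau> j)) BX (act s))"
  unfolding mv_def[abs_def]
proof (rule distr_PiM_reindex_map)
  show "finite_measure (\<rho> l)" if "l \<in> {..<q}" for l using assms[of l] that by (simp add: ac_prob_def prob_space.finite_measure)
  show "prob_space (\<rho> l)" if "l \<in> {..<q} - \<tau> ` {..<p}" for l using assms[of l] that by (simp add: ac_prob_def)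
  show "act s \<in> measurable (\<rho> (\<tau> j)) BX" if "j \<in> {..<p}" for j
    using assms[OF tau_lt[of j]] that measurable_act[of s] unfolding ac_prob_def by (auto cong: measurable_cong_sets)
qed (use \<tau> in auto)

text \<open>The map carries a product of admissible test measures to a product of admissible test
  measures, so invariance of the null sets is immediate from their definition.\<close>

lemma knull_mv: "knull p N \<Longrightarrow> knull q {y \<in> Xp q. mv s p \<tau> y \<in> N}"
  unfolding knull_def
proof (intro conjI allI impI)
  assume N: "N \<in> sets (BXp p) \<and> (\<forall>\<rho>. (\<forall>j<p. ac_prob (\<rho> j)) \<longrightarrow> emeasure (Pi\<^sub>M {..<p} \<rho>) N = 0)"
  then show "{y \<in> Xp q. mv s p \<tau> y \<in> N} \<in> sets (BXp q)" by (intro mv_vimage) blast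
  fix \<rho> :: "nat \<Rightarrow> 'x measure" assume \<rho>: "\<forall>j<q. ac_prob (\<rho> j)"
  have s\<rho>: "sets (Pi\<^sub>M {..<q} \<rho>) = sets (BXp q)" using \<rho> by (intro sets_PiM_cong) (auto simp: ac_prob_def)
  have sp: "space (Pi\<^sub>M {..<q} \<rho>) = Xp q" using sets_eq_imp_space_eq[OF s\<rho>] by (simp add: space_PiM)
  have m: "mv s p \<tau> \<in> measurable (Pi\<^sub>M {..<q} \<rho>) (BXp p)" using mv_measurable s\<rho> by (simp cong: measurable_cong_sets)
  have "{y \<in> Xp q. mv s p \<tau> y \<in> N} = mv s p \<tau> -` N \<inter> space (Pi\<^sub>M {..<q} \<rho>)" unfolding sp by blast
  then have "emeasure (Pi\<^sub>M {..<q} \<rho>) {y \<in> Xp q. mv s p \<tau> y \<in> N} = emeasure (distr (Pi\<^sub>M {..<q} \<rho>) (BXp p) (mv s p \<tau>)) N"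
    using N m by (simp add: emeasure_distr)
  also have "\<dots> = emeasure (Pi\<^sub>M {..<p} (\<lambda>j. distr (\<rho> (\<tau> j)) BX (act s))) N"
    using \<rho> by (subst distr_mv) auto
  also have "\<dots> = 0"
  proof -
    have "\<forall>j<p. ac_prob (distr (\<rho> (\<tau> j)) BX (act s))" using \<rho> tau_lt by (auto intro: ac_prob_distr_act)
    then show ?thesis using N by simp
  qed
  finally show "emeasure (Pi\<^sub>M {..<q} \<rho>) {y \<in> Xp q. mv s p \<tau> y \<in> N} = 0" .
qed

lemma mv_box:
  assumes c: "charts p c" and x: "x \<in> Xp q" "mv s p \<tau> x \<in> W p c"
  shows "\<exists>Ob. (\<forall>l<q. openin T (Ob l)) \<and> x \<in> Pi\<^sub>E {..<q} Ob \<and> (\<forall>y\<in>Pi\<^sub>E {..<q} Ob. mv s p \<tau> y \<in> W p c)"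
proof -
  define Ob where "Ob l = (if l \<in> \<tau> ` {..<p} then {u \<in> topspace T. act s u \<in> fst (c (inv_into {..<p} \<tau> l))} else topspace T)" for l
  have Obj: "Ob (\<tau> j) = {u \<in> topspace T. act s u \<in> fst (c j)}" if "j < p" for j
    using that \<tau>(1) by (simp add: Ob_def)
  have op: "openin T (Ob l)" for l
  proof (cases "l \<in> \<tau> ` {..<p}")
    case True
    then obtain j where j: "l = \<tau> j" "j < p" by auto
    have "openin T (fst (c j))" using c j(2) chart_open(1) by (simp add: charts_def)
    then show ?thesis unfolding j(1) Obj[OF j(2)] by (rule openin_continuous_map_preimage[OF act_continuous_right])
  qed (simp add: Ob_def)
  have mvj: "mv s p \<tau> y j = act s (y (\<tau> j))" if "j < p" for y j using that by (simp add: mv_def)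
  have "x \<in> Pi\<^sub>E {..<q} Ob"
  proof (rule PiE_I)
    fix l assume l: "l \<in> {..<q}"
    show "x l \<in> Ob l"
    proof (cases "l \<in> \<tau> ` {..<p}")
      case True
      then obtain j where j: "l = \<tau> j" "j < p" by auto
      have "mv s p \<tau> x j \<in> fst (c j)" using x(2) j(2) unfolding W_def by (intro PiE_mem[of _ _ "\<lambda>i. fst (c i)"]) auto
      then show ?thesis using PiE_mem[OF x(1) l] unfolding j(1) Obj[OF j(2)] mvj[OF j(2)] by simp
    next
      case False
      then show ?thesis using PiE_mem[OF x(1) l] by (simp add: Ob_def)
    qed
  next
    fix l assume "l \<notin> {..<q}"
    then show "x l = undefined" by (rule PiE_arb[OF x(1)])
  qed
  moreover have "mv s p \<tau> y \<in> W p c" if y: "y \<in> Pi\<^sub>E {..<q} Ob" for y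
    unfolding W_def
  proof (rule PiE_I)
    fix j assume "j \<in> {..<p}"
    then have j: "j < p" by simp
    have "y (\<tau> j) \<in> Ob (\<tau> j)" using tau_lt[OF j] by (intro PiE_mem[OF y]) simp
    then show "mv s p \<tau> y j \<in> fst (c j)" unfolding Obj[OF j] mvj[OF j] by simp
  qed (simp add: mv_def)
  ultimately show ?thesis using op by blast
qed

text \<open>Near each point the set is replaced by a Borel one up to a \<open>knull\<close> set;
  both pull back well, and \<open>sets_M_localize\<close> reassembles the preimage.\<close>

lemma mv_vimage_M:
  assumes A: "A \<in> sets (M p)" shows "{y \<in> Xp q. mv s p \<tau> y \<in> A} \<in> sets (M q)"
proof (rule sets_M_localize[OF q])
  fix x assume x: "x \<in> {y \<in> Xp q. mv s p \<tau> y \<in> A}"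
  then have xX: "x \<in> Xp q" by blast
  let ?c = "Ch p (mv s p \<tau> x)"
  note c = Ch[OF mv_in[OF xX]]
  from mv_box[OF c(1) xX c(2)] obtain Ob where Ob: "\<forall>l<q. openin T (Ob l)" "x \<in> Pi\<^sub>E {..<q} Ob" "\<forall>y\<in>Pi\<^sub>E {..<q} Ob. mv s p \<tau> y \<in> W p ?c"
    by (elim exE conjE)
  from Borel_approximation[OF p A c(1)] obtain S N where S: "S \<in> sets (BXp p)" "knull p N" "A \<inter> W p ?c - N = S - N"
    by (elim exE conjE)
  have OX: "Pi\<^sub>E {..<q} Ob \<subseteq> Xp q" using Ob(1) openin_subset by (intro PiE_mono) auto
  show "\<exists>Ob S N. (\<forall>i<q. openin T (Ob i)) \<and> x \<in> Pi\<^sub>E {..<q} Ob \<and> S \<in> sets (BXp q) \<and> knull q N \<and>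
       {y \<in> Xp q. mv s p \<tau> y \<in> A} \<inter> Pi\<^sub>E {..<q} Ob - N = S \<inter> Pi\<^sub>E {..<q} Ob - N"
  proof (rule exI[of _ Ob], rule exI[of _ "{y \<in> Xp q. mv s p \<tau> y \<in> S}"], rule exI[of _ "{y \<in> Xp q. mv s p \<tau> y \<in> N}"], intro conjI Ob mv_vimage[OF S(1)] knull_mv[OF S(2)])
    have "mv s p \<tau> y \<in> A \<longleftrightarrow> mv s p \<tau> y \<in> S" if "y \<in> Pi\<^sub>E {..<q} Ob" "mv s p \<tau> y \<notin> N" for y
      using S(3) Ob(3) that by blast
    then show "{y \<in> Xp q. mv s p \<tau> y \<in> A} \<inter> Pi\<^sub>E {..<q} Ob - {y \<in> Xp q. mv s p \<tau> y \<in> N} =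
      {y \<in> Xp q. mv s p \<tau> y \<in> S} \<inter> Pi\<^sub>E {..<q} Ob - {y \<in> Xp q. mv s p \<tau> y \<in> N}" by blast
  qed
qed blast

lemma pull_bm:
  assumes f: "f \<in> bm p" shows "pull q s p \<tau> f \<in> bm q"
proof -
  have fm: "f \<in> borel_measurable (M p)" using f by (simp add: bounded_measurable_def)
  have "pull q s p \<tau> f \<in> borel_measurable (M q)"
  proof (rule measurableI)
    fix A :: "real set" assume A: "A \<in> sets borel"
    have "f -` A \<inter> space (M p) \<in> sets (M p)" using fm A by (rule measurable_sets)
    from mv_vimage_M[OF this] have "{y \<in> Xp q. mv s p \<tau> y \<in> f -` A \<inter> space (M p)} \<in> sets (M q)" .
    moreover have "{y \<in> Xp q. mv s p \<tau> y \<in> f -` A \<inter> space (M p)} = pull q s p \<tau> f -` A \<inter> space (M q)"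
      using mv_in unfolding space_M[OF p] space_M[OF q] by (auto simp: pull_def)
    ultimately show "pull q s p \<tau> f -` A \<inter> space (M q) \<in> sets (M q)" by simp
  qed simp
  moreover obtain B where B: "\<forall>y. \<bar>f y\<bar> \<le> B" using bm_bounded[OF f] by blast
  then have "bounded (pull q s p \<tau> f ` topspace (power_top T q))"
    unfolding bounded_iff by (intro exI[of _ B]) (auto simp: pull_def)
  moreover have "\<forall>y. y \<notin> topspace (power_top T q) \<longrightarrow> pull q s p \<tau> f y = 0" by (auto simp: pull_def)
  ultimately show ?thesis unfolding bounded_measurable_def by blast
qed

text \<open>Almost invariance of \<open>\<mu>\<close> gives a measure of mass close to 1 below both the kernel at the translated point and the translated kernel.\<close>

lemma common_part:
  assumes i: "i \<in> I" and x: "x \<in> Xp q" and \<delta>: "0 \<le> \<delta>" "\<delta> \<le> 1"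
    and d: "\<And>j. j < p \<Longrightarrow> (\<integral>g. \<bar>\<mu> i (s + g) (act s (x (\<tau> j))) - \<mu> i g (x (\<tau> j))\<bar> \<partial>\<nu>) < \<delta>"
  shows "\<exists>R. finite_measure R \<and> sets R = sets (BXp p) \<and> 1 - real p * \<delta> \<le> measure R (space R) \<and>
    (\<forall>A\<in>sets (BXp p). emeasure R A \<le> emeasure (P i n p (mv s p \<tau> x)) A) \<and>
    (\<forall>A\<in>sets (BXp p). emeasure R A \<le> emeasure (distr (P i n q x) (BXp p) (mv s p \<tau>)) A)"
proof -
  have xj: "x (\<tau> j) \<in> topspace T" if "j < p" for j using tau_lt[OF that] by (intro PiE_mem[OF x]) simp
  have sxj: "act s (x (\<tau> j)) \<in> topspace T" if "j < p" for j using xj[OF that] by (rule act_in)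
  have "\<forall>j. \<exists>w. j < p \<longrightarrow> w \<in> borel_measurable \<nu> \<and> (\<forall>h. w h \<le> wt i (x (\<tau> j)) h) \<and> (\<forall>h. w h \<le> wt i (act s (x (\<tau> j))) (s + h)) \<and> ennreal (1 - \<delta>) \<le> (\<integral>\<^sup>+h. w h \<partial>\<nu>)"
    using overlap[OF i xj d] by blast
  from choice[OF this] obtain w where w: "\<forall>j. j < p \<longrightarrow> w j \<in> borel_measurable \<nu> \<and> (\<forall>h. w j h \<le> wt i (x (\<tau> j)) h) \<and> (\<forall>h. w j h \<le> wt i (act s (x (\<tau> j))) (s + h)) \<and> ennreal (1 - \<delta>) \<le> (\<integral>\<^sup>+h. w j h \<partial>\<nu>)"
    by (rule exE)
  have wm: "w j \<in> borel_measurable \<nu>" if "j < p" for j using w that by blast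
  \<comment> \<open>\<open>w j\<close> lies below both weights. By \<open>emeasure_Kw_shift\<close>
    the image under \<open>s\<close> of the kernel with the shifted weight is the kernel at
    \<open>act s (x (\<tau> j))\<close>.\<close>
  let ?R = "\<lambda>j. distr (Kw n (x (\<tau> j)) (w j)) BX (act s)"
  let ?D = "\<lambda>j. distr (Kn i n (x (\<tau> j))) BX (act s)"
  have aK: "act s \<in> measurable (Kw n (x (\<tau> j)) v) BX" if "j < p" for j v
    using measurable_act[of s] sets_Kw[OF xj[OF that], of n v] by (simp cong: measurable_cong_sets)
  note E' = act_vimage_sets
  have eD: "emeasure (distr (Kw n (x (\<tau> j)) v) BX (act s)) E = emeasure (Kw n (x (\<tau> j)) v) {y \<in> topspace T. act s y \<in> E}" if "j < p" "E \<in> sets BX" for j E v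
  proof -
    have "act s -` E \<inter> space (Kw n (x (\<tau> j)) v) = {y \<in> topspace T. act s y \<in> E}" unfolding space_Kw[OF xj[OF that(1)]] by blast
    then show ?thesis using that aK by (simp add: emeasure_distr)
  qed
  have RD: "emeasure (?R j) E \<le> emeasure (?D j) E" if j: "j < p" "E \<in> sets BX" for j E
    unfolding Kn_def eD[OF j] using w j wt_borel[OF i xj[OF j(1)]] E'[OF j(2)] by (intro emeasure_Kw_mono[OF xj]) auto
  have RK: "emeasure (?R j) E \<le> emeasure (Kn i n (mv s p \<tau> x j)) E" if j: "j < p" "E \<in> sets BX" for j E
  proof -
    let ?v = "\<lambda>h. wt i (act s (x (\<tau> j))) (s + h)"
    have vm: "?v \<in> borel_measurable \<nu>"
      using measurable_compose[OF measurable_translation, of "wt i (act s (x (\<tau> j)))" borel s] wt_borel[OF i sxj[OF j(1)]]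
      by (simp cong: measurable_cong_sets)
    have "emeasure (?R j) E \<le> emeasure (Kw n (x (\<tau> j)) ?v) {y \<in> topspace T. act s y \<in> E}"
      unfolding eD[OF j] using w j vm E'[OF j(2)] by (intro emeasure_Kw_mono[OF xj]) auto
    also have "\<dots> = emeasure (Kw n (act s (x (\<tau> j))) (wt i (act s (x (\<tau> j))))) E"
      using wt_borel[OF i sxj[OF j(1)]] j(2) by (intro emeasure_Kw_shift[OF xj[OF j(1)], symmetric])
    finally show ?thesis using j(1) by (simp add: Kn_def mv_def)
  qed
  have pD: "prob_space (?D j)" if "j < p" for j using ac_prob_distr_act[OF ac_prob_Kn[OF i xj[OF that]]] by (simp add: ac_prob_def)
  have pK: "prob_space (Kn i n (mv s p \<tau> x j))" "sets (Kn i n (mv s p \<tau> x j)) = sets BX" if "j < p" for j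
    using ac_prob_Kn[OF i, of "mv s p \<tau> x j"] PiE_mem[OF mv_in[OF x], of j] that by (auto simp: ac_prob_def)
  have fR: "finite_measure (?R j)" if j: "j < p" for j
  proof (rule finite_measureI)
    interpret prob_space "?D j" by (rule pD[OF j])
    have "emeasure (?R j) (topspace T) \<le> emeasure (?D j) (topspace T)" using j by (intro RD) auto
    then have "emeasure (?R j) (topspace T) \<noteq> \<infinity>" by (metis emeasure_finite infinity_ennreal_def neq_top_trans)
    then show "emeasure (?R j) (space (?R j)) \<noteq> \<infinity>" by simp
  qed
  let ?PR = "Pi\<^sub>M {..<p} ?R"
  have sR: "sets ?PR = sets (BXp p)" by (intro sets_PiM_cong) auto
  have spR: "space ?PR = Xp p" using sets_eq_imp_space_eq[OF sR] by (simp add: space_PiM)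
  have box: "emeasure ?PR (Xp p) = (\<Prod>j<p. emeasure (?R j) (topspace T))"
    using fR by (intro emeasure_PiM_box) (auto simp: finite_measure_def)
  have t: "emeasure (?R j) (topspace T) = ennreal (measure (?R j) (topspace T))" "1 - \<delta> \<le> measure (?R j) (topspace T)" if j: "j < p" for j
  proof -
    interpret finite_measure "?R j" by (rule fR[OF j])
    show e: "emeasure (?R j) (topspace T) = ennreal (measure (?R j) (topspace T))" by (rule emeasure_eq_measure)
    have "{y \<in> topspace T. act s y \<in> topspace T} = topspace T" using act_in by blast
    then have "emeasure (?R j) (topspace T) = emeasure (Kw n (x (\<tau> j)) (w j)) (topspace T)"
      using eD[OF j openin_sets_BX[OF openin_topspace], of "w j"] by simp
    also have "\<dots> = (\<integral>\<^sup>+h. w j h \<partial>\<nu>)" by (rule emeasure_Kw_space[OF xj[OF j] wm[OF j]])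
    finally have "ennreal (1 - \<delta>) \<le> emeasure (?R j) (topspace T)" using w j by simp
    then show "1 - \<delta> \<le> measure (?R j) (topspace T)" unfolding e by (simp add: ennreal_le_iff)
  qed
  have eq: "emeasure ?PR (Xp p) = ennreal (\<Prod>j<p. measure (?R j) (topspace T))"
    unfolding box using t(1) by (subst prod_ennreal[symmetric]) auto
  have fin: "finite_measure ?PR" using eq spR by (intro finite_measureI) simp
  have "1 - real p * \<delta> \<le> (\<Prod>j<p. measure (?R j) (topspace T))" using t(2) \<delta> by (intro prod_ge_one_minus) auto
  also have "\<dots> = measure ?PR (space ?PR)" unfolding spR measure_def eq by (simp add: prod_nonneg)
  finally have mass: "1 - real p * \<delta> \<le> measure ?PR (space ?PR)" .
  have sfR: "sigma_finite_measure (?R j)" if "j < p" for j using fR[OF that] by (simp add: finite_measure_def)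
  have le1: "emeasure ?PR A \<le> emeasure (P i n p (mv s p \<tau> x)) A" if A: "A \<in> sets (BXp p)" for A
    unfolding P_def
  proof (rule emeasure_PiM_mono)
    show "A \<in> sets (Pi\<^sub>M {..<p} (\<lambda>j. Kn i n (mv s p \<tau> x j)))" using sets_P[OF mv_in[OF x], of i n] A unfolding P_def by simp
    show "sigma_finite_measure (?R j)" if "j \<in> {..<p}" for j using that sfR by simp
    show "sigma_finite_measure (Kn i n (mv s p \<tau> x j))" if "j \<in> {..<p}" for j using that pK(1) by (intro prob_space_imp_sigma_finite) simp
    show "sets (?R j) = sets (Kn i n (mv s p \<tau> x j))" if "j \<in> {..<p}" for j using that pK(2)[of j] by (simp only: sets_distr lessThan_iff)
    show "emeasure (?R j) E \<le> emeasure (Kn i n (mv s p \<tau> x j)) E" if "j \<in> {..<p}" "E \<in> sets (Kn i n (mv s p \<tau> x j))" for j E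
      using that pK(2)[of j] RK[of j E] by (simp only: lessThan_iff)
  qed simp
  have dP: "distr (P i n q x) (BXp p) (mv s p \<tau>) = Pi\<^sub>M {..<p} ?D"
    unfolding P_def using ac_prob_Kn[OF i] PiE_mem[OF x] by (intro distr_mv) auto
  have le2: "emeasure ?PR A \<le> emeasure (distr (P i n q x) (BXp p) (mv s p \<tau>)) A" if A: "A \<in> sets (BXp p)" for A
    unfolding dP
  proof (rule emeasure_PiM_mono)
    have "sets (Pi\<^sub>M {..<p} ?D) = sets (BXp p)" by (intro sets_PiM_cong) auto
    then show "A \<in> sets (Pi\<^sub>M {..<p} ?D)" using A by simp
    show "sigma_finite_measure (?R j)" if "j \<in> {..<p}" for j using that sfR by simp
    show "sigma_finite_measure (?D j)" if "j \<in> {..<p}" for j using that pD by (intro prob_space_imp_sigma_finite) simp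
    show "emeasure (?R j) E \<le> emeasure (?D j) E" if "j \<in> {..<p}" "E \<in> sets (?D j)" for j E
      using that RD[of j E] by (simp only: lessThan_iff sets_distr)
  qed simp_all
  show ?thesis using fin sR mass le1 le2 by blast
qed

text \<open>Both averages are compared with integrals of one Borel representative \<open>g\<close>
  of \<open>f\<close>. Changing charts costs \<open>4 * B * \<epsilon>\<close>, twice the bound on
  \<open>g\<close> times the lost mass \<open>2 * \<epsilon>\<close>. The two kernels are each
  compared with their common part, at the price \<open>B * (real p * \<delta>)\<close> each.\<close>

lemma V_pull:
  assumes f: "f \<in> bm p" and B: "\<forall>y. \<bar>f y\<bar> \<le> B" and i: "i \<in> I" and x: "x \<in> Xp q" and \<delta>: "0 \<le> \<delta>" "\<delta> \<le> 1" and "\<epsilon> > 0"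
    and d: "\<And>j. j < p \<Longrightarrow> (\<integral>g. \<bar>\<mu> i (s + g) (act s (x (\<tau> j))) - \<mu> i g (x (\<tau> j))\<bar> \<partial>\<nu>) < \<delta>"
  shows "eventually (\<lambda>n. \<bar>V (i, n) (q, pull q s p \<tau> f, x) - V (i, n) (p, f, mv s p \<tau> x)\<bar> \<le> 4 * B * \<epsilon> + 2 * B * (real p * \<delta>)) sequentially"
proof -
  have B0: "B \<ge> 0" using order_trans[OF abs_ge_zero B[rule_format, of undefined]] .
  let ?z = "mv s p \<tau> x"
  have z: "?z \<in> Xp p" using x by (rule mv_in)
  note c = Ch[OF z] and c' = Ch[OF x]
  obtain N where N: "knull p N" "N \<subseteq> W p (Ch p ?z)" "(\<lambda>y. indicator (W p (Ch p ?z) - N) y * f y) \<in> borel_measurable (BXp p)"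
    using Borel_representative[OF p f c(1)] by blast
  define g where "g y = indicator (W p (Ch p ?z) - N) y * f y" for y
  have gm: "g \<in> borel_measurable (BXp p)" using N(3) unfolding g_def[abs_def] .
  have gB: "\<bar>g y\<bar> \<le> B" for y using B B0 by (simp add: g_def indicator_def)
  have pfbm: "pull q s p \<tau> f \<in> bm q" by (rule pull_bm[OF f])
  have pB: "\<forall>y. \<bar>pull q s p \<tau> f y\<bar> \<le> B" using B B0 by (simp add: pull_def)
  from mv_box[OF c(1) x c(2)] obtain Ob where Ob: "\<forall>l<q. openin T (Ob l)" "x \<in> Pi\<^sub>E {..<q} Ob" "\<forall>y\<in>Pi\<^sub>E {..<q} Ob. mv s p \<tau> y \<in> W p (Ch p ?z)"
    by (elim exE conjE)
  have "eventually (\<lambda>n. measure (P i n q x) (Pi\<^sub>E {..<q} Ob) \<ge> 1 - \<epsilon>) sequentially"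
    using Ob PiE_mem[OF Ob(2)] by (intro P_box_concentration[OF i x _ \<open>\<epsilon> > 0\<close>]) auto
  then show ?thesis using W_concentration[OF i x c' \<open>\<epsilon> > 0\<close>]
  proof eventually_elim
    case (elim n)
    let ?P = "P i n q x" and ?Y = "Pi\<^sub>E {..<q} Ob \<inter> W q (Ch q x)"
    interpret prob_space ?P by (rule prob_P[OF i x])
    have Ys: "Pi\<^sub>E {..<q} Ob \<in> sets ?P" "W q (Ch q x) \<in> sets ?P"
      unfolding sets_P[OF x] using Ob(1) W_sets[OF c'(1)] by (auto intro!: sets_PiM_I_finite)
    have "prob (Pi\<^sub>E {..<q} Ob \<union> W q (Ch q x)) + prob ?Y = prob (Pi\<^sub>E {..<q} Ob) + prob (W q (Ch q x))"
      using measure_Un3[of "Pi\<^sub>E {..<q} Ob" ?P "W q (Ch q x)"] Ys by (simp add: fmeasurable_eq_sets)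
    moreover have "prob (Pi\<^sub>E {..<q} Ob \<union> W q (Ch q x)) \<le> 1" by simp
    ultimately have Y: "prob ?Y \<ge> 1 - 2 * \<epsilon>" using elim by linarith
    have mP: "mv s p \<tau> \<in> measurable ?P (BXp p)" using mv_measurable sets_P[OF x, of i n] by (simp cong: measurable_cong_sets)
    have gmv: "(\<lambda>y. g (mv s p \<tau> y)) \<in> borel_measurable ?P" using mP gm by (rule measurable_compose)
    have 1: "\<bar>(\<integral>y. cut q x (pull q s p \<tau> f) y \<partial>completion ?P) - (\<integral>y. g (mv s p \<tau> y) \<partial>completion ?P)\<bar> \<le> 0 + (B + B) * (2 * \<epsilon>)"
    proof (rule prob_integral_close[OF prob_Pc[OF i x] cut_measurable[OF q pfbm i x] cut_bound[OF pB] measurable_completion[OF gmv] gB])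
      show "?Y \<in> sets (completion ?P)" using Ys by auto
      show "1 - 2 * \<epsilon> \<le> measure (completion ?P) ?Y" using Y Ys by (subst measure_completion) auto
      have "\<bar>cut q x (pull q s p \<tau> f) y - g (mv s p \<tau> y)\<bar> \<le> 0" if "y \<in> ?Y" "y \<notin> {y \<in> Xp q. mv s p \<tau> y \<in> N}" for y
      proof -
        have yX: "y \<in> Xp q" using that(1) W_subset[OF c'(1)] by blast
        have "mv s p \<tau> y \<in> W p (Ch p ?z)" using that(1) Ob(3) by blast
        then show ?thesis using that yX by (simp add: cut_def pull_def g_def)
      qed
      then have "AE y in ?P. y \<in> ?Y \<longrightarrow> \<bar>cut q x (pull q s p \<tau> f) y - g (mv s p \<tau> y)\<bar> \<le> 0"
        by (intro AE_I'[OF knull_P[OF i x knull_mv[OF N(1)]]]) blast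
      then show "AE y in completion ?P. y \<in> ?Y \<longrightarrow> \<bar>cut q x (pull q s p \<tau> f) y - g (mv s p \<tau> y)\<bar> \<le> 0" by (rule AE_completion)
    qed simp
    have 2: "(\<integral>y. g (mv s p \<tau> y) \<partial>completion ?P) = (\<integral>y. g y \<partial>distr ?P (BXp p) (mv s p \<tau>))"
      using integral_completion[OF gmv] integral_distr[OF mP gm] by simp
    have 3: "(\<integral>y. cut p ?z f y \<partial>completion (P i n p ?z)) = (\<integral>y. g y \<partial>P i n p ?z)"
      by (rule completion_of_representative(2)[OF i z N(1) gm]) (auto simp: g_def cut_def indicator_def)
    have "\<exists>R. finite_measure R \<and> sets R = sets (BXp p) \<and> 1 - real p * \<delta> \<le> measure R (space R) \<and>
      (\<forall>A\<in>sets (BXp p). emeasure R A \<le> emeasure (P i n p (mv s p \<tau> x)) A) \<and>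
      (\<forall>A\<in>sets (BXp p). emeasure R A \<le> emeasure (distr (P i n q x) (BXp p) (mv s p \<tau>)) A)"
      by (rule common_part[OF i x \<delta> d])
    then obtain R where R: "finite_measure R" "sets R = sets (BXp p)" "1 - real p * \<delta> \<le> measure R (space R)"
      "\<forall>A\<in>sets (BXp p). emeasure R A \<le> emeasure (P i n p (mv s p \<tau> x)) A"
      "\<forall>A\<in>sets (BXp p). emeasure R A \<le> emeasure (distr (P i n q x) (BXp p) (mv s p \<tau>)) A" by (elim exE conjE)
    have 4: "\<bar>(\<integral>y. g y \<partial>P i n p ?z) - (\<integral>y. g y \<partial>R)\<bar> \<le> B * (1 - measure R (space R))"
      using R sets_P[OF z, of i n] gm gB by (intro integral_diff_common_part prob_P[OF i z]) (auto cong: measurable_cong_sets)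
    have 5: "\<bar>(\<integral>y. g y \<partial>distr ?P (BXp p) (mv s p \<tau>)) - (\<integral>y. g y \<partial>R)\<bar> \<le> B * (1 - measure R (space R))"
      using R gm gB by (intro integral_diff_common_part prob_space_distr[OF mP]) auto
    have 6: "B * (1 - measure R (space R)) \<le> B * (real p * \<delta>)" using R(3) B0 by (intro mult_left_mono) auto
    have 7: "V (i, n) (q, pull q s p \<tau> f, x) = (\<integral>y. cut q x (pull q s p \<tau> f) y \<partial>completion ?P)"
      using i q pfbm x unfolding V_def avg_def by simp
    have 8: "V (i, n) (p, f, ?z) = (\<integral>y. cut p ?z f y \<partial>completion (P i n p ?z))"
      using i p f z unfolding V_def avg_def by simp
    have 9: "0 + (B + B) * (2 * \<epsilon>) = 4 * B * \<epsilon>" by simp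
    have 10: "2 * B * (real p * \<delta>) = B * (real p * \<delta>) + B * (real p * \<delta>)" by simp
    show ?case using 1 4 5 6 unfolding 2 3 7 8 9 10 by linarith
  qed
qed

text \<open>The error in \<epsilon> vanishes with \<open>n\<close> and the error in \<delta> along
  the net, so the difference of the two coordinates is eventually below any \<open>e\<close> in the
  iterated filter.\<close>

lemma L_pull:
  assumes f: "f \<in> bm p" and x: "x \<in> Xp q"
  shows "L q (pull q s p \<tau> f) x = L p f (mv s p \<tau> x)"
  unfolding L_def
proof (rule L0_eq)
  fix e :: real assume e: "e > 0"
  obtain B where B: "\<forall>y. \<bar>f y\<bar> \<le> B" using bm_bounded[OF f] by blast
  have B0: "B \<ge> 0" using order_trans[OF abs_ge_zero B[rule_format, of undefined]] .
  \<comment> \<open>Both parameters are set so that each of the two errors of \<open>V_pull\<close>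
    is at most \<open>e / 2\<close>; \<open>B + 1\<close> and \<open>real p + 1\<close> avoid
    division by zero.\<close>
  define \<epsilon> where "\<epsilon> = e / (8 * (B + 1))"
  define \<delta> where "\<delta> = min 1 (e / (4 * (B + 1) * (real p + 1)))"
  have \<epsilon>: "\<epsilon> > 0" using e B0 by (simp add: \<epsilon>_def)
  have \<delta>: "0 < \<delta>" "\<delta> \<le> 1" using e B0 by (auto simp: \<delta>_def)
  have b1: "4 * B * \<epsilon> \<le> e / 2"
  proof -
    have "4 * B * \<epsilon> \<le> 4 * (B + 1) * \<epsilon>" using \<epsilon> by simp
    also have "\<dots> = e / 2" using B0 by (simp add: \<epsilon>_def divide_simps)
    finally show ?thesis .
  qed
  have b2: "2 * B * (real p * \<delta>) \<le> e / 2"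
  proof -
    have "2 * B * (real p * \<delta>) \<le> 2 * (B + 1) * ((real p + 1) * \<delta>)" using \<delta> B0 by (intro mult_mono) auto
    also have "\<dots> \<le> 2 * (B + 1) * ((real p + 1) * (e / (4 * (B + 1) * (real p + 1))))" using B0 by (intro mult_left_mono) (auto simp: \<delta>_def)
    also have "\<dots> = e / 2" using B0 by (simp add: divide_simps)
    finally show ?thesis .
  qed
  \<comment> \<open>Almost invariance is applied at the coordinates selected by
    \<open>\<tau>\<close>, which form a finite and hence compact set.\<close>
  let ?K = "(\<lambda>j. (s, x (\<tau> j))) ` {..<p}"
  have "?K \<subseteq> topspace (prod_topology euclidean T)" using PiE_mem[OF x] tau_lt by auto
  then have "compactin (prod_topology euclidean T) ?K" by (intro finite_imp_compactin) auto
  from \<mu>_inv[OF this \<delta>(1)] obtain i0 where i0: "i0 \<in> I" "\<forall>i\<in>I. rel i0 i \<longrightarrow>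
       (\<forall>(s, x)\<in>?K. (\<integral>g. \<bar>\<mu> i (s + g) (act s x) - \<mu> i g x\<bar> \<partial>\<nu>) < \<delta>)" by blast
  show "eventually (\<lambda>j. \<bar>V j (q, pull q s p \<tau> f, x) - V j (p, f, mv s p \<tau> x)\<bar> \<le> e) (iterated_filter I rel)"
    unfolding eventually_iterated_filter[OF dir]
  proof (intro bexI[OF _ i0(1)] ballI impI)
    fix i assume i: "i \<in> I" "rel i0 i"
    have "(\<integral>g. \<bar>\<mu> i (s + g) (act s (x (\<tau> j))) - \<mu> i g (x (\<tau> j))\<bar> \<partial>\<nu>) < \<delta>" if "j < p" for j
      using i0(2) i that by fastforce
    from V_pull[OF f B i(1) x less_imp_le[OF \<delta>(1)] \<delta>(2) \<epsilon> this]
    show "eventually (\<lambda>n. \<bar>V (i, n) (q, pull q s p \<tau> f, x) - V (i, n) (p, f, mv s p \<tau> x)\<bar> \<le> e) sequentially"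
    proof (rule eventually_mono)
      fix n assume "\<bar>V (i, n) (q, pull q s p \<tau> f, x) - V (i, n) (p, f, mv s p \<tau> x)\<bar> \<le> 4 * B * \<epsilon> + 2 * B * (real p * \<delta>)"
      then show "\<bar>V (i, n) (q, pull q s p \<tau> f, x) - V (i, n) (p, f, mv s p \<tau> x)\<bar> \<le> e" using b1 b2 by linarith
    qed
  qed
qed

end

end

section \<open>Real and complex scalars\<close>

no_notation scalar_prod (infix "\<bullet>" 70)

text \<open>Multiplication by a scalar is real linear, so its components are real combinations of
  components. This reduces linearity over \<open>'k\<close> to \<open>L_sum\<close>.\<close>

lemma mult_inner_Basis:
  fixes a z e :: "'k::{real_normed_field, euclidean_space}"
  shows "(a * z) \<bullet> e = (\<Sum>b\<in>Basis. ((a * b) \<bullet> e) * (z \<bullet> b))"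
proof -
  have "a * z = a * (\<Sum>b\<in>Basis. (z \<bullet> b) *\<^sub>R b)" by (simp add: euclidean_representation)
  also have "\<dots> = (\<Sum>b\<in>Basis. (z \<bullet> b) *\<^sub>R (a * b))" by (simp add: sum_distrib_left)
  finally show ?thesis by (simp add: inner_sum_left mult.commute)
qed

lemma sign_inner:
  fixes z e :: "'k::{real_normed_field, euclidean_space}"
  shows "((- 1) ^ j * z) \<bullet> e = (- 1) ^ j * (z \<bullet> e)"
  by (cases "even j") simp_all

lemma locally_AE_mono: "locally_AE S N Q \<Longrightarrow> (\<And>y. Q y \<Longrightarrow> R y) \<Longrightarrow> locally_AE S N R"
  unfolding locally_AE_def by (fast elim: eventually_mono)

context C1_amenable
begin

abbreviation bk :: "nat \<Rightarrow> ((nat \<Rightarrow> 'x) \<Rightarrow> 'k::{real_normed_field, euclidean_space}) set" where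
  "bk p \<equiv> bounded_measurable (power_top T p) (M p)"

abbreviation cls :: "nat \<Rightarrow> ((nat \<Rightarrow> 'x) \<Rightarrow> 'k::{real_normed_field, euclidean_space}) \<Rightarrow> ((nat \<Rightarrow> 'x) \<Rightarrow> 'k) set" where
  "cls p f \<equiv> Linf_class (power_top T p) (M p) f"

lemma bmI:
  assumes "f \<in> borel_measurable (M p)" "\<And>y. \<bar>f y\<bar> \<le> B" "\<And>y. y \<notin> Xp p \<Longrightarrow> f y = 0"
  shows "f \<in> bm p"
proof -
  have "bounded (f ` topspace (power_top T p))" using assms(2) unfolding bounded_iff by (intro exI[of _ B]) auto
  then show ?thesis using assms(1,3) unfolding bounded_measurable_def topspace_power_top by blast
qed

lemma bm_sum:
  assumes K: "finite K" and f: "\<And>k. k \<in> K \<Longrightarrow> f k \<in> bm p"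
  shows "(\<lambda>y. \<Sum>k\<in>K. a k * f k y) \<in> bm p"
proof -
  have "\<forall>k. \<exists>B. k \<in> K \<longrightarrow> (\<forall>y. \<bar>f k y\<bar> \<le> B)" using bm_bounded[OF f] by blast
  from choice[OF this] obtain B where B: "\<forall>k. k \<in> K \<longrightarrow> (\<forall>y. \<bar>f k y\<bar> \<le> B k)" by (rule exE)
  show ?thesis
  proof (rule bmI)
    show "(\<lambda>y. \<Sum>k\<in>K. a k * f k y) \<in> borel_measurable (M p)"
      using f unfolding bounded_measurable_def by (intro borel_measurable_sum borel_measurable_times) auto
    fix y
    have "\<bar>\<Sum>k\<in>K. a k * f k y\<bar> \<le> (\<Sum>k\<in>K. \<bar>a k * f k y\<bar>)" by (rule sum_abs)
    also have "\<dots> \<le> (\<Sum>k\<in>K. \<bar>a k\<bar> * B k)" using B by (intro sum_mono) (simp add: abs_mult mult_left_mono)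
    finally show "\<bar>\<Sum>k\<in>K. a k * f k y\<bar> \<le> (\<Sum>k\<in>K. \<bar>a k\<bar> * B k)" .
    show "(\<Sum>k\<in>K. a k * f k y) = 0" if "y \<notin> Xp p"
      using f that unfolding bounded_measurable_def topspace_power_top by (intro sum.neutral ballI) auto
  qed
qed

lemma bm_comp:
  fixes f :: "(nat \<Rightarrow> 'x) \<Rightarrow> 'k::{real_normed_field, euclidean_space}"
  assumes f: "f \<in> bk p" and \<phi>: "\<phi> \<in> borel_measurable borel" "\<And>z. \<bar>\<phi> z\<bar> \<le> norm z"
  shows "(\<lambda>y. \<phi> (f y)) \<in> bm p"
proof -
  have f': "f \<in> borel_measurable (M p)" "bounded (f ` Xp p)" "\<And>y. y \<notin> Xp p \<Longrightarrow> f y = 0"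
    using f unfolding bounded_measurable_def topspace_power_top by auto
  obtain B where B: "\<And>y. y \<in> Xp p \<Longrightarrow> norm (f y) \<le> B" using f'(2) unfolding bounded_iff by (metis imageI)
  show ?thesis
  proof (rule bmI)
    show "(\<lambda>y. \<phi> (f y)) \<in> borel_measurable (M p)" using f'(1) \<phi>(1) by (rule measurable_compose)
    show "\<phi> (f y) = 0" if "y \<notin> Xp p" for y using \<phi>(2)[of 0] f'(3)[OF that] by simp
    show "\<bar>\<phi> (f y)\<bar> \<le> max B 0" for y
    proof (cases "y \<in> Xp p")
      case True
      then show ?thesis using B[OF True] \<phi>(2)[of "f y"] by simp
    next
      case False
      then show ?thesis using \<phi>(2)[of 0] f'(3)[OF False] by simp
    qed
  qed
qed

lemma bm_inner:
  assumes f: "f \<in> bk p" and b: "norm b = 1" shows "(\<lambda>y. f y \<bullet> b) \<in> bm p"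
proof (rule bm_comp[OF f])
  show "\<bar>z \<bullet> b\<bar> \<le> norm z" for z using Cauchy_Schwarz_ineq2[of z b] b by simp
qed simp

lemma bk_componentwise:
  fixes f :: "(nat \<Rightarrow> 'x) \<Rightarrow> 'k::{real_normed_field, euclidean_space}"
  assumes "\<And>b. b \<in> Basis \<Longrightarrow> (\<lambda>y. f y \<bullet> b) \<in> bm p"
  shows "f \<in> bk p"
  unfolding bounded_measurable_def topspace_power_top
proof (intro CollectI conjI allI impI)
  show "f \<in> borel_measurable (M p)"
    using assms unfolding borel_measurable_euclidean_space[of f] bounded_measurable_def by blast
  have "\<forall>b. \<exists>B. b \<in> Basis \<longrightarrow> (\<forall>y. \<bar>f y \<bullet> b\<bar> \<le> B)" using bm_bounded[OF assms] by blast
  from choice[OF this] obtain B where B: "\<forall>b. b \<in> Basis \<longrightarrow> (\<forall>y. \<bar>f y \<bullet> b\<bar> \<le> B b)" by (rule exE)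
  have "norm (f y) \<le> (\<Sum>b\<in>Basis. B b)" for y
    using norm_le_l1[of "f y"] B by (elim order_trans) (intro sum_mono, simp)
  then show "bounded (f ` Xp p)" unfolding bounded_iff by (intro exI[of _ "\<Sum>b\<in>Basis. B b"]) blast
  fix y assume "y \<notin> Xp p"
  then have "f y \<bullet> b = 0" if "b \<in> Basis" for b
    using assms[OF that] unfolding bounded_measurable_def topspace_power_top by blast
  then show "f y = 0" using euclidean_eqI[of "f y" 0] by simp
qed

text \<open>Real and complex functions are treated together: the real limit operator is applied to
  each component with respect to \<open>Basis\<close>.\<close>

definition Lk :: "nat \<Rightarrow> ((nat \<Rightarrow> 'x) \<Rightarrow> 'k::{real_normed_field, euclidean_space}) \<Rightarrow> (nat \<Rightarrow> 'x) \<Rightarrow> 'k" where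
  "Lk p f x = (\<Sum>b\<in>Basis. L p (\<lambda>y. f y \<bullet> b) x *\<^sub>R b)"

lemma Lk_inner [simp]: "b \<in> Basis \<Longrightarrow> Lk p f x \<bullet> b = L p (\<lambda>y. f y \<bullet> b) x"
  unfolding Lk_def by (rule inner_sum_left_Basis)

lemma Lk_eqI: "(\<And>b. b \<in> Basis \<Longrightarrow> L p (\<lambda>y. f y \<bullet> b) x = z \<bullet> b) \<Longrightarrow> Lk p f x = z"
  by (rule euclidean_eqI) simp

lemma Lk_bk: "p \<ge> 1 \<Longrightarrow> f \<in> bk p \<Longrightarrow> Lk p f \<in> bk p"
proof (rule bk_componentwise)
  fix b :: 'a assume p: "p \<ge> 1" and f: "f \<in> bk p" and b: "b \<in> Basis"
  have "L p (\<lambda>y. f y \<bullet> b) \<in> bm p" using b by (intro L_bm[OF p] bm_inner[OF f]) simp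
  then show "(\<lambda>y. Lk p f y \<bullet> b) \<in> bm p" using b by simp
qed

lemma Lk_cong:
  assumes p: "p \<ge> 1" and f: "f \<in> bk p" "h \<in> bk p" and ae: "locally_AE (power_top T p) (M p) (\<lambda>y. h y = f y)"
  shows "Lk p h = Lk p f"
proof
  fix x
  show "Lk p h x = Lk p f x"
  proof (rule Lk_eqI)
    fix b :: 'a assume b: "b \<in> Basis"
    have fb: "(\<lambda>y. f y \<bullet> b) \<in> bm p" "(\<lambda>y. h y \<bullet> b) \<in> bm p" using b f by (auto intro: bm_inner)
    then have fm: "(\<lambda>y. f y \<bullet> b) \<in> borel_measurable (M p)" "(\<lambda>y. h y \<bullet> b) \<in> borel_measurable (M p)"
      by (auto simp: bounded_measurable_def)
    \<comment> \<open>Measurability of this set is what allows the passage from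
      \<open>locally_AE\<close> to \<open>lnull\<close>.\<close>
    let ?D = "{y \<in> space (M p). h y \<bullet> b \<noteq> f y \<bullet> b}"
    have "?D \<in> sets (M p)" by (rule borel_measurable_neq[OF fm(2,1)])
    moreover have "locally_AE (power_top T p) (M p) (\<lambda>y. y \<notin> ?D)" using ae by (rule locally_AE_mono) simp
    ultimately have "lnull p ?D" by (rule lnull_if_locally_AE[OF p])
    moreover have "h y \<bullet> b = f y \<bullet> b" if "y \<notin> ?D" for y
      using that fb space_M[OF p] by (cases "y \<in> Xp p") (auto simp: bounded_measurable_def)
    ultimately have "L p (\<lambda>y. h y \<bullet> b) x = L p (\<lambda>y. f y \<bullet> b) x" by (rule L_cong[OF p fb(2,1)])
    then show "L p (\<lambda>y. h y \<bullet> b) x = Lk p f x \<bullet> b" using b by simp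
  qed
qed

lemma Lk_AE:
  assumes p: "p \<ge> 1" and f: "f \<in> bk p"
  shows "locally_AE (power_top T p) (M p) (\<lambda>y. Lk p f y = f y)"
  unfolding locally_AE_def
proof (intro allI impI)
  fix K assume K: "compactin (power_top T p) K"
  have "AE y in M p. y \<in> K \<longrightarrow> Lk p f y \<bullet> b = f y \<bullet> b" if b: "b \<in> Basis" for b
  proof -
    have fb: "(\<lambda>y. f y \<bullet> b) \<in> bm p" using b f by (auto intro: bm_inner)
    have "locally_AE (power_top T p) (M p) (\<lambda>y. y \<notin> {y \<in> Xp p. L p (\<lambda>y. f y \<bullet> b) y \<noteq> f y \<bullet> b})"
      by (rule lnull_imp_locally_AE[OF p L_AE[OF p fb]])
    then have "AE y in M p. y \<in> K \<longrightarrow> y \<notin> {y \<in> Xp p. L p (\<lambda>y. f y \<bullet> b) y \<noteq> f y \<bullet> b}"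
      using K unfolding locally_AE_def by blast
    then show ?thesis using AE_space
    proof eventually_elim
      case (elim y)
      then show ?case using b space_M[OF p] by simp
    qed
  qed
  then have "AE y in M p. \<forall>b\<in>Basis. y \<in> K \<longrightarrow> Lk p f y \<bullet> b = f y \<bullet> b" by (intro AE_finite_allI) auto
  then show "AE y in M p. y \<in> K \<longrightarrow> Lk p f y = f y"
    by eventually_elim (auto intro: euclidean_eqI)
qed

lemma Lk_linear:
  fixes f h :: "(nat \<Rightarrow> 'x) \<Rightarrow> 'k::{real_normed_field, euclidean_space}"
  assumes p: "p \<ge> 1" and f: "f \<in> bk p" and h: "h \<in> bk p"
  shows "(\<lambda>y. a * f y + c * h y) \<in> bk p" "Lk p (\<lambda>y. a * f y + c * h y) x = a * Lk p f x + c * Lk p h x"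
proof -
  \<comment> \<open>Components of \<open>f\<close> carry the flag \<open>True\<close>, those of
    \<open>h\<close> the flag \<open>False\<close>; a component of the combination is then a single
    real sum, as in \<open>L_sum\<close>.\<close>
  let ?K = "Basis \<times> {True, False} :: ('k \<times> bool) set"
  let ?F = "\<lambda>(b, t) y. (if t then f y else h y) \<bullet> b"
  let ?a = "\<lambda>e (b, t). ((if t then a else c) * b) \<bullet> e"
  have F: "?F k \<in> bm p" if "k \<in> ?K" for k
    using that f h by (auto intro: bm_inner)
  have fin: "finite ?K" by simp
  have split: "(\<Sum>k\<in>?K. ?a e k * G k) = (\<Sum>b\<in>Basis. ((a * b) \<bullet> e) * G (b, True)) + (\<Sum>b\<in>Basis. ((c * b) \<bullet> e) * G (b, False))" for e and G :: "'k \<times> bool \<Rightarrow> real"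
  proof -
    have "(\<Sum>k\<in>?K. ?a e k * G k) = (\<Sum>b\<in>Basis. \<Sum>t\<in>{True, False}. ?a e (b, t) * G (b, t))"
      unfolding sum.cartesian_product by (rule sum.cong) auto
    then show ?thesis by (simp add: sum.distrib)
  qed
  have e: "(a * f y + c * h y) \<bullet> e = (\<Sum>k\<in>?K. ?a e k * ?F k y)" for y and e :: 'k
    unfolding split by (simp add: inner_add_left mult_inner_Basis[symmetric])
  have s: "(\<lambda>y. \<Sum>k\<in>?K. ?a e k * ?F k y) \<in> bm p" for e by (rule bm_sum[OF fin F])
  show "(\<lambda>y. a * f y + c * h y) \<in> bk p" by (rule bk_componentwise) (simp only: e s)
  show "Lk p (\<lambda>y. a * f y + c * h y) x = a * Lk p f x + c * Lk p h x"
  proof (rule Lk_eqI)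
    fix b :: 'k assume "b \<in> Basis"
    have "L p (\<lambda>y. (a * f y + c * h y) \<bullet> b) x = (\<Sum>k\<in>?K. ?a b k * L p (?F k) x)"
      unfolding e by (rule L_sum[OF p fin F s])
    also have "\<dots> = (a * Lk p f x + c * Lk p h x) \<bullet> b"
      unfolding split inner_add_left mult_inner_Basis[of a "Lk p f x"] mult_inner_Basis[of c "Lk p h x"] by simp
    finally show "L p (\<lambda>y. (a * f y + c * h y) \<bullet> b) x = (a * Lk p f x + c * Lk p h x) \<bullet> b" .
  qed
qed

text \<open>Locally almost everywhere \<open>f\<close> is the nonnegative real function
  \<open>g\<close>, viewed with values in \<open>'k\<close>, so the claim reduces to monotonicity of
  the real operator.\<close>

lemma Lk_nonneg:
  fixes f :: "(nat \<Rightarrow> 'x) \<Rightarrow> 'k::{real_normed_field, euclidean_space}"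
  assumes p: "p \<ge> 1" and f: "f \<in> bk p" and ae: "locally_AE (power_top T p) (M p) (\<lambda>y. nonneg_scalar (f y))"
  shows "nonneg_scalar (Lk p f x)"
proof -
  have n1: "norm (1 :: 'k) = 1" by simp
  define g where "g y = max 0 (f y \<bullet> 1)" for y
  have g: "g \<in> bm p" unfolding g_def[abs_def]
  proof (rule bm_comp[OF f])
    fix z :: 'k
    have "\<bar>z \<bullet> 1\<bar> \<le> norm z" using Cauchy_Schwarz_ineq2[of z 1] by simp
    then show "\<bar>max 0 (z \<bullet> 1)\<bar> \<le> norm z" by simp
  qed simp
  \<comment> \<open>A sum with one term, so that \<open>L_sum\<close> yields homogeneity.\<close>
  have c: "of_real (g y) \<bullet> b = (\<Sum>k\<in>{()}. (1 \<bullet> b) * g y)" for y and b :: 'k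
    by (simp add: of_real_def)
  have gs: "(\<lambda>y. \<Sum>k\<in>{()}. (1 \<bullet> b) * g y) \<in> bm p" for b :: 'k using g by (intro bm_sum) auto
  have h: "(\<lambda>y. of_real (g y) :: 'k) \<in> bk p" by (rule bk_componentwise) (simp only: c gs)
  have "locally_AE (power_top T p) (M p) (\<lambda>y. of_real (g y) = f y)"
    using ae
  proof (rule locally_AE_mono)
    fix y assume "nonneg_scalar (f y)"
    then obtain r where r: "r \<ge> 0" "f y = of_real r" unfolding nonneg_scalar_def by blast
    have "f y \<bullet> 1 = r" unfolding r(2) of_real_def using n1 by (simp add: power2_norm_eq_inner[symmetric])
    then show "of_real (g y) = f y" using r by (simp add: g_def)
  qed
  then have "Lk p f x = Lk p (\<lambda>y. of_real (g y)) x" using Lk_cong[OF p f h] by simp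
  also have "\<dots> = of_real (L p g x)"
  proof (rule Lk_eqI)
    fix b :: 'k
    have "L p (\<lambda>y. of_real (g y) \<bullet> b) x = (\<Sum>k\<in>{()}. (1 \<bullet> b) * L p g x)"
      unfolding c using g gs by (intro L_sum[OF p]) auto
    then show "L p (\<lambda>y. of_real (g y) \<bullet> b) x = of_real (L p g x) \<bullet> b" by (simp add: of_real_def)
  qed
  finally have "Lk p f x = of_real (L p g x)" .
  moreover have "0 \<le> L p g x"
  proof -
    \<comment> \<open>The zero function written as an empty sum: \<open>L_sum\<close> gives it the
      limit 0, and \<open>L_mono\<close> compares it with \<open>g\<close>.\<close>
    have z: "(\<lambda>y. \<Sum>k\<in>({}::unit set). 0 * g y) \<in> bm p" by (rule bm_sum) auto
    have "L p (\<lambda>y. \<Sum>k\<in>({}::unit set). 0 * g y) x = (\<Sum>k\<in>({}::unit set). 0 * L p g x)"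
      by (rule L_sum[OF p _ _ z]) auto
    moreover have "L p (\<lambda>y. \<Sum>k\<in>({}::unit set). 0 * g y) x \<le> L p g x"
      by (rule L_mono[OF p z g, of "{}"]) (auto simp: lnull_def g_def)
    ultimately show ?thesis by simp
  qed
  ultimately show ?thesis unfolding nonneg_scalar_def by blast
qed

lemma continuous_bm:
  assumes p: "p \<ge> 1" and f: "continuous_map (power_top T p) euclideanreal f" "bounded (f ` Xp p)" "\<And>y. y \<notin> Xp p \<Longrightarrow> f y = 0"
  shows "f \<in> bm p"
proof -
  have "f \<in> borel_measurable (M p)"
  proof (rule borel_measurableI)
    fix U :: "real set" assume "open U"
    then have "openin (power_top T p) {y \<in> topspace (power_top T p). f y \<in> U}"
      by (intro openin_continuous_map_preimage[OF f(1)]) simp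
    moreover have "{y \<in> topspace (power_top T p). f y \<in> U} = f -` U \<inter> space (M p)"
      unfolding space_M[OF p] topspace_power_top by blast
    ultimately show "f -` U \<inter> space (M p) \<in> sets (M p)" using openin_sets_M[OF p] by simp
  qed
  then show ?thesis using f(2,3) unfolding bounded_measurable_def topspace_power_top by blast
qed

lemma Lk_continuous:
  fixes f :: "(nat \<Rightarrow> 'x) \<Rightarrow> 'k::{real_normed_field, euclidean_space}"
  assumes p: "p \<ge> 1" and f: "continuous_map (power_top T p) euclidean f" "bounded (f ` Xp p)" "\<And>y. y \<notin> Xp p \<Longrightarrow> f y = 0"
  shows "f \<in> bk p" "Lk p f = f"
proof -
  have cont: "continuous_map (power_top T p) euclideanreal (\<lambda>y. f y \<bullet> b)" for b :: 'k
  proof -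
    have "continuous_map (euclidean :: 'k topology) euclideanreal (\<lambda>z. z \<bullet> b)"
      by (simp add: continuous_on_inner)
    from continuous_map_compose[OF f(1) this] show ?thesis by (simp add: comp_def)
  qed
  have fb: "(\<lambda>y. f y \<bullet> b) \<in> bm p" if "b \<in> Basis" for b :: 'k
  proof (rule continuous_bm[OF p cont])
    obtain B where "\<And>y. y \<in> Xp p \<Longrightarrow> norm (f y) \<le> B" using f(2) unfolding bounded_iff by (metis imageI)
    then have "\<bar>f y \<bullet> b\<bar> \<le> B" if "y \<in> Xp p" for y using Basis_le_norm[OF \<open>b \<in> Basis\<close>, of "f y"] that by force
    then show "bounded ((\<lambda>y. f y \<bullet> b) ` Xp p)" unfolding bounded_iff by (intro exI[of _ B]) auto
  qed (simp add: f(3))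
  then show "f \<in> bk p" by (rule bk_componentwise)
  show "Lk p f = f"
    using L_continuous[OF p fb cont] by (intro ext Lk_eqI) simp
qed

section \<open>Translations, permutations, the coboundary and passage to classes\<close>

definition pullk :: "nat \<Rightarrow> 'g \<Rightarrow> nat \<Rightarrow> (nat \<Rightarrow> nat) \<Rightarrow> ((nat \<Rightarrow> 'x) \<Rightarrow> 'k::zero) \<Rightarrow> (nat \<Rightarrow> 'x) \<Rightarrow> 'k" where
  "pullk q s p \<tau> f y = (if y \<in> Xp q then f (mv s p \<tau> y) else 0)"

lemma pullk_inner: "(\<lambda>y. pullk q s p \<tau> f y \<bullet> b) = pull q s p \<tau> (\<lambda>y. f y \<bullet> b)"
  by (auto simp: pullk_def pull_def)

lemma Lk_pullk:
  fixes f :: "(nat \<Rightarrow> 'x) \<Rightarrow> 'k::{real_normed_field, euclidean_space}"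
  assumes p: "p \<ge> 1" and q: "q \<ge> 1" and \<tau>: "inj_on \<tau> {..<p}" "\<tau> ` {..<p} \<subseteq> {..<q}" and f: "f \<in> bk p"
  shows "pullk q s p \<tau> f \<in> bk q" "Lk q (pullk q s p \<tau> f) = pullk q s p \<tau> (Lk p f)"
proof -
  have fb: "(\<lambda>y. f y \<bullet> b) \<in> bm p" if "b \<in> Basis" for b :: 'k using that f by (auto intro: bm_inner)
  show "pullk q s p \<tau> f \<in> bk q"
    by (rule bk_componentwise) (simp only: pullk_inner pull_bm[OF p q \<tau> fb])
  show "Lk q (pullk q s p \<tau> f) = pullk q s p \<tau> (Lk p f)"
  proof (intro ext Lk_eqI)
    fix x and b :: 'k assume b: "b \<in> Basis"
    show "L q (\<lambda>y. pullk q s p \<tau> f y \<bullet> b) x = pullk q s p \<tau> (Lk p f) x \<bullet> b"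
    proof (cases "x \<in> Xp q")
      case True
      then show ?thesis unfolding pullk_inner using L_pull[OF p q \<tau> fb[OF b] True] b by (simp add: pullk_def)
    next
      case False
      then show ?thesis by (simp add: pullk_def L_outside)
    qed
  qed
qed

lemma translate_eq_pullk: "translate T act p s f = pullk p (- s) p id f"
  by (rule ext) (simp add: translate_def pullk_def mv_def)

lemma permute_eq_pullk:
  assumes "\<pi> permutes {..<p}" shows "permute_coords T p \<pi> f = pullk p 0 p \<pi> f"
proof
  fix x
  have "(\<lambda>i\<in>{..<p}. x (\<pi> i)) = mv 0 p \<pi> x" if "x \<in> Xp p"
    unfolding mv_def
  proof (rule restrict_ext)
    fix i assume "i \<in> {..<p}"
    then have "\<pi> i \<in> {..<p}" using permutes_in_image[OF assms] by blast
    then show "x (\<pi> i) = act 0 (x (\<pi> i))" using PiE_mem[OF that] by simp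
  qed
  then show "permute_coords T p \<pi> f x = pullk p 0 p \<pi> f x" by (simp add: permute_coords_def pullk_def)
qed

definition skip :: "nat \<Rightarrow> nat \<Rightarrow> nat" where
  "skip j i = (if i < j then i else Suc i)"

lemma skip: "inj_on (skip j) {..<p}" "skip j ` {..<p} \<subseteq> {..<Suc p}"
  by (auto simp: skip_def inj_on_def split: if_splits)

lemma coboundary_eq_pullk: "coboundary T p f x = (\<Sum>j\<le>p. (- 1) ^ j * pullk (Suc p) 0 p (skip j) f x)"
proof (cases "x \<in> Xp (Suc p)")
  case True
  have "omit_coord p j x = mv 0 p (skip j) x" for j
    unfolding omit_coord_def mv_def
  proof (rule restrict_ext)
    fix i assume "i \<in> {..<p}"
    then have "skip j i \<in> {..<Suc p}" by (auto simp: skip_def)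
    then have "x (skip j i) \<in> topspace T" by (rule PiE_mem[OF True])
    then show "(if i < j then x i else x (Suc i)) = act 0 (x (skip j i))" by (simp add: skip_def)
  qed
  then show ?thesis using True by (simp add: coboundary_def pullk_def)
qed (simp add: coboundary_def pullk_def)

text \<open>The coboundary is a signed sum of pullbacks along the maps \<open>skip j\<close>, each
  of which commutes with the operator.\<close>

lemma Lk_coboundary:
  fixes f :: "(nat \<Rightarrow> 'x) \<Rightarrow> 'k::{real_normed_field, euclidean_space}"
  assumes p: "p \<ge> 1" and f: "f \<in> bk p"
  shows "coboundary T p f \<in> bk (Suc p)" "Lk (Suc p) (coboundary T p f) = coboundary T p (Lk p f)"
proof -
  have q: "Suc p \<ge> 1" by simp
  let ?F = "\<lambda>b j y. pullk (Suc p) 0 p (skip j) f y \<bullet> b"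
  have c: "coboundary T p f y \<bullet> b = (\<Sum>j\<le>p. (- 1) ^ j * ?F b j y)" for y b
    by (simp add: coboundary_eq_pullk inner_sum_left sign_inner)
  have F: "?F b j \<in> bm (Suc p)" if "b \<in> Basis" for b j
    using that Lk_pullk(1)[OF p q skip f] by (intro bm_inner) auto
  have s: "(\<lambda>y. \<Sum>j\<le>p. (- 1) ^ j * ?F b j y) \<in> bm (Suc p)" if "b \<in> Basis" for b using F[OF that] by (intro bm_sum) auto
  show "coboundary T p f \<in> bk (Suc p)" by (rule bk_componentwise) (simp only: c s)
  show "Lk (Suc p) (coboundary T p f) = coboundary T p (Lk p f)"
  proof (intro ext Lk_eqI)
    fix x and b :: 'k assume b: "b \<in> Basis"
    have "L (Suc p) (\<lambda>y. coboundary T p f y \<bullet> b) x = (\<Sum>j\<le>p. (- 1) ^ j * L (Suc p) (?F b j) x)"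
      unfolding c using F[OF b] s[OF b] by (intro L_sum[OF q]) auto
    also have "\<dots> = (\<Sum>j\<le>p. (- 1) ^ j * (Lk (Suc p) (pullk (Suc p) 0 p (skip j) f) x \<bullet> b))" using b by simp
    also have "\<dots> = coboundary T p (Lk p f) x \<bullet> b"
      unfolding Lk_pullk(2)[OF p q skip f] by (simp add: coboundary_eq_pullk inner_sum_left sign_inner)
    finally show "L (Suc p) (\<lambda>y. coboundary T p f y \<bullet> b) x = coboundary T p (Lk p f) x \<bullet> b" .
  qed
qed

definition class_lift :: "nat \<Rightarrow> ((nat \<Rightarrow> 'x) \<Rightarrow> 'k::{real_normed_field, euclidean_space}) set \<Rightarrow> (nat \<Rightarrow> 'x) \<Rightarrow> 'k" where
  "class_lift p \<phi> = Lk p (SOME h. h \<in> \<phi>)"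

text \<open>The chosen representative of the class may differ from \<open>f\<close>, but
  \<open>Lk\<close> does not see locally null sets.\<close>

lemma class_lift_eq:
  assumes p: "p \<ge> 1" and f: "f \<in> bk p" shows "class_lift p (cls p f) = Lk p f"
proof -
  have "f \<in> cls p f" using f by (simp add: Linf_class_def locally_AE_def)
  then have "(SOME h. h \<in> cls p f) \<in> cls p f" by (rule someI[of "\<lambda>h. h \<in> cls p f"])
  then have "(SOME h. h \<in> cls p f) \<in> bk p" "locally_AE (power_top T p) (M p) (\<lambda>y. (SOME h. h \<in> cls p f) y = f y)"
    unfolding Linf_class_def by blast+
  then show ?thesis unfolding class_lift_def by (rule Lk_cong[OF p f])
qed

lemma class_lift_strong_linear_lifting:
  assumes p: "p \<ge> 1"
  shows "strong_linear_lifting (power_top T p) (M p) (class_lift p :: ((nat \<Rightarrow> 'x) \<Rightarrow> 'k::{real_normed_field, euclidean_space}) set \<Rightarrow> _)"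
proof -
  have strong: "class_lift p (cls p f) = f"
    if "continuous_map (power_top T p) euclidean f" "bounded (f ` topspace (power_top T p))" "\<forall>y. y \<notin> topspace (power_top T p) \<longrightarrow> f y = 0"
    for f :: "(nat \<Rightarrow> 'x) \<Rightarrow> 'k"
  proof -
    have "f \<in> bk p" "Lk p f = f" using that unfolding topspace_power_top by (auto intro: Lk_continuous[OF p])
    then show ?thesis by (simp only: class_lift_eq[OF p])
  qed
  have "linear_lifting (power_top T p) (M p) (class_lift p :: ((nat \<Rightarrow> 'x) \<Rightarrow> 'k) set \<Rightarrow> _)"
    unfolding linear_lifting_def
  proof (intro conjI ballI allI impI)
    fix \<phi> :: "((nat \<Rightarrow> 'x) \<Rightarrow> 'k) set" assume "\<phi> \<in> Linf (power_top T p) (M p)"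
    then obtain f where f: "f \<in> bk p" "\<phi> = cls p f" unfolding Linf_def by blast
    show "class_lift p \<phi> \<in> \<phi>" unfolding f(2) class_lift_eq[OF p f(1)]
      using Lk_bk[OF p f(1)] Lk_AE[OF p f(1)] unfolding Linf_class_def by blast
  next
    fix f h :: "(nat \<Rightarrow> 'x) \<Rightarrow> 'k" and a b assume f: "f \<in> bk p" and h: "h \<in> bk p"
    show "class_lift p (cls p (\<lambda>y. a * f y + b * h y)) = (\<lambda>y. a * class_lift p (cls p f) y + b * class_lift p (cls p h) y)"
      unfolding class_lift_eq[OF p f] class_lift_eq[OF p h] class_lift_eq[OF p Lk_linear(1)[OF p f h]] by (rule ext) (rule Lk_linear(2)[OF p f h])
  next
    fix f :: "(nat \<Rightarrow> 'x) \<Rightarrow> 'k" and y assume f: "f \<in> bk p" and "locally_AE (power_top T p) (M p) (\<lambda>y. nonneg_scalar (f y))"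
    then show "nonneg_scalar (class_lift p (cls p f) y)" unfolding class_lift_eq[OF p f] by (intro Lk_nonneg[OF p])
  next
    show "class_lift p (cls p (indicator (topspace (power_top T p)))) = (indicator (topspace (power_top T p)) :: _ \<Rightarrow> 'k)"
    proof (rule strong)
      show "continuous_map (power_top T p) euclidean (indicator (topspace (power_top T p)) :: _ \<Rightarrow> 'k)"
        by (rule continuous_map_eq[of _ _ "\<lambda>_. 1"]) auto
      show "bounded ((indicator (topspace (power_top T p)) :: _ \<Rightarrow> 'k) ` topspace (power_top T p))"
        unfolding bounded_iff by (intro exI[of _ 1]) auto
    qed simp
  qed
  then show ?thesis using strong unfolding strong_linear_lifting_def by blast
qed

lemma lifting_family:
  "\<exists>\<Lambda> :: nat \<Rightarrow> ((nat \<Rightarrow> 'x) \<Rightarrow> 'k::{real_normed_field, euclidean_space}) set \<Rightarrow> (nat \<Rightarrow> 'x) \<Rightarrow> 'k.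
    equivariant_strong_lifting_family T act M \<Lambda> \<and> intertwines_coboundary T M \<Lambda> \<and> commutes_with_permutations T M \<Lambda>"
proof (intro exI[of _ class_lift] conjI)
  show "equivariant_strong_lifting_family T act M (class_lift :: nat \<Rightarrow> ((nat \<Rightarrow> 'x) \<Rightarrow> 'k) set \<Rightarrow> _)"
    unfolding equivariant_strong_lifting_family_def
  proof (intro allI impI conjI ballI)
    fix p s and f :: "(nat \<Rightarrow> 'x) \<Rightarrow> 'k" assume p: "1 \<le> p" and f: "f \<in> bk p"
    have id: "inj_on id {..<p}" "id ` {..<p} \<subseteq> {..<p}" by auto
    show "class_lift p (cls p (translate T act p s f)) = translate T act p s (class_lift p (cls p f))"
      unfolding translate_eq_pullk class_lift_eq[OF p f] class_lift_eq[OF p Lk_pullk(1)[OF p p id f]] by (rule Lk_pullk(2)[OF p p id f])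
  qed (rule class_lift_strong_linear_lifting)
  show "intertwines_coboundary T M (class_lift :: nat \<Rightarrow> ((nat \<Rightarrow> 'x) \<Rightarrow> 'k) set \<Rightarrow> _)"
    unfolding intertwines_coboundary_def
  proof (intro allI impI ballI)
    fix p and f :: "(nat \<Rightarrow> 'x) \<Rightarrow> 'k" assume p: "1 \<le> p" and f: "f \<in> bk p"
    have q: "1 \<le> Suc p" by simp
    show "class_lift (Suc p) (cls (Suc p) (coboundary T p f)) = coboundary T p (class_lift p (cls p f))"
      unfolding class_lift_eq[OF p f] class_lift_eq[OF q Lk_coboundary(1)[OF p f]] by (rule Lk_coboundary(2)[OF p f])
  qed
  show "commutes_with_permutations T M (class_lift :: nat \<Rightarrow> ((nat \<Rightarrow> 'x) \<Rightarrow> 'k) set \<Rightarrow> _)"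
    unfolding commutes_with_permutations_def
  proof (intro allI impI ballI)
    fix p \<pi> and f :: "(nat \<Rightarrow> 'x) \<Rightarrow> 'k" assume p: "1 \<le> p" and \<pi>: "\<pi> permutes {..<p}" and f: "f \<in> bk p"
    have \<tau>: "inj_on \<pi> {..<p}" "\<pi> ` {..<p} \<subseteq> {..<p}" using permutes_inj_on[OF \<pi>] permutes_image[OF \<pi>] by auto
    show "class_lift p (cls p (permute_coords T p \<pi> f)) = permute_coords T p \<pi> (class_lift p (cls p f))"
      unfolding permute_eq_pullk[OF \<pi>] class_lift_eq[OF p f] class_lift_eq[OF p Lk_pullk(1)[OF p p \<tau> f]] by (rule Lk_pullk(2)[OF p p \<tau> f])
  qed
qed

end

text \<open>Every power with \<open>p \<ge> 1\<close> is empty, so all functions in question are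
  zero, the indicator of the space included.\<close>

lemma lifting_family_empty:
  assumes "topspace T = {}"
  shows "\<exists>\<Lambda> :: nat \<Rightarrow> ((nat \<Rightarrow> 'x) \<Rightarrow> 'k::real_normed_field) set \<Rightarrow> (nat \<Rightarrow> 'x) \<Rightarrow> 'k.
    equivariant_strong_lifting_family T act M \<Lambda> \<and> intertwines_coboundary T M \<Lambda> \<and> commutes_with_permutations T M \<Lambda>"
proof (intro exI[of _ "\<lambda>_ _ _. 0"] conjI)
  have e: "topspace (power_top T p) = {}" if "p \<ge> 1" for p
  proof -
    have "0 \<in> {..<p}" using that by simp
    then show ?thesis unfolding topspace_product_topology PiE_eq_empty_iff using assms by blast
  qed
  have lae: "locally_AE (power_top T p) (M p) Q" if "p \<ge> 1" for p Q
    using compactin_subset_topspace e[OF that] unfolding locally_AE_def by fastforce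
  have "linear_lifting (power_top T p) (M p) (\<lambda>_ _. 0 :: 'k)" if p: "p \<ge> 1" for p
    unfolding linear_lifting_def
  proof (intro conjI ballI allI impI)
    fix \<phi> :: "((nat \<Rightarrow> 'x) \<Rightarrow> 'k) set" assume "\<phi> \<in> Linf (power_top T p) (M p)"
    then obtain f where f: "\<phi> = Linf_class (power_top T p) (M p) f" unfolding Linf_def by blast
    have "(\<lambda>_. 0 :: 'k) \<in> bounded_measurable (power_top T p) (M p)" unfolding bounded_measurable_def e[OF p] by simp
    then show "(\<lambda>_. 0) \<in> \<phi>" using lae[OF p] unfolding f Linf_class_def by blast
  next
    show "nonneg_scalar (0 :: 'k)" unfolding nonneg_scalar_def by (intro exI[of _ 0]) simp
  next
    show "(\<lambda>_. 0 :: 'k) = indicator (topspace (power_top T p))" unfolding e[OF p] by (rule ext) simp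
  qed simp
  moreover have "f = (\<lambda>_. 0)" if "p \<ge> 1" "\<forall>y. y \<notin> topspace (power_top T p) \<longrightarrow> f y = 0" for p and f :: "(nat \<Rightarrow> 'x) \<Rightarrow> 'k"
    using that e by auto
  ultimately have "strong_linear_lifting (power_top T p) (M p) (\<lambda>_ _. 0 :: 'k)" if "p \<ge> 1" for p
    using that unfolding strong_linear_lifting_def by metis
  then show "equivariant_strong_lifting_family T act M (\<lambda>_ _ _. 0 :: 'k)"
    unfolding equivariant_strong_lifting_family_def by (simp add: translate_def)
  show "intertwines_coboundary T M (\<lambda>_ _ _. 0 :: 'k)"
    unfolding intertwines_coboundary_def by (simp add: coboundary_def fun_eq_iff)
  show "commutes_with_permutations T M (\<lambda>_ _ _. 0 :: 'k)"
    unfolding commutes_with_permutations_def by (simp add: permute_coords_def)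
qed

lemma equivariant_lifting_family_exists:
  fixes X :: "'x manifold"
    and act :: "'g::{topological_group_add, t2_space} \<Rightarrow> 'x \<Rightarrow> 'x"
    and M :: "nat \<Rightarrow> (nat \<Rightarrow> 'x) measure"
  assumes X: "differentiable_manifold X" and act: "C1_continuous_action X act" and am: "amenable_action TYPE('i) (mtop X) act"
    and M: "\<forall>p\<ge>1. \<exists>g. riemannian_metric (power_manifold p X) g \<and> riemannian_measure (power_manifold p X) g (M p)"
  shows "\<exists>\<Lambda> :: nat \<Rightarrow> ((nat \<Rightarrow> 'x) \<Rightarrow> 'k::{real_normed_field, euclidean_space}) set \<Rightarrow> (nat \<Rightarrow> 'x) \<Rightarrow> 'k.
            equivariant_strong_lifting_family (mtop X) act M \<Lambda> \<and>
            intertwines_coboundary (mtop X) M \<Lambda> \<and>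
            commutes_with_permutations (mtop X) M \<Lambda>"
proof (cases "topspace (mtop X) = {}")
  case True
  then show ?thesis by (rule lifting_family_empty)
next
  case False
  obtain \<nu> :: "'g measure" and I :: "'i set" and rel and \<mu> :: "'i \<Rightarrow> 'g \<Rightarrow> 'x \<Rightarrow> real" where
    \<nu>: "left_haar_measure \<nu>" and dir: "directed_set I rel"
    and \<mu>: "\<forall>i\<in>I. continuous_map (prod_topology euclidean (mtop X)) euclideanreal (\<lambda>(g, x). \<mu> i g x) \<and>
               (\<forall>g. \<forall>x\<in>topspace (mtop X). 0 \<le> \<mu> i g x) \<and> (\<forall>x\<in>topspace (mtop X). (\<integral>g. \<mu> i g x \<partial>\<nu>) = 1)"
    and inv: "\<forall>K. compactin (prod_topology euclidean (mtop X)) K \<longrightarrow>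
           (\<forall>e>0. \<exists>i0\<in>I. \<forall>i\<in>I. rel i0 i \<longrightarrow> (\<forall>(s, x)\<in>K. (\<integral>g. \<bar>\<mu> i (s + g) (act s x) - \<mu> i g x\<bar> \<partial>\<nu>) < e))"
    using am unfolding amenable_action_def by (elim exE conjE)
  interpret C1_action_measures X act M by unfold_locales (fact X act False M)+
  from good_cover_exists obtain VV cV zV rV where
    VV: "\<forall>V\<in>VV. openin (mtop X) V \<and> cV V \<in> atlas X \<and> 0 < rV V \<and> rV V \<le> 1 \<and>
      V \<subseteq> {x \<in> fst (cV V). snd (cV V) x \<in> cube (mdim X) (zV V) (rV V)} \<and> cube (mdim X) (zV V) (3 * rV V) \<subseteq> snd (cV V) ` fst (cV V)"
    and cover: "\<Union>VV = topspace (mtop X)" and lf: "locally_finite_in (mtop X) VV"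
    by (elim exE conjE)
  interpret C1_amenable X act M VV cV zV rV \<nu> I rel \<mu>
  proof (unfold_locales, goal_cases)
    case (1 V)
    then show ?case by (rule VV[rule_format])
  next
    case (9 K e)
    then show ?case by (rule inv[rule_format])
  qed (use cover lf \<nu> dir \<mu> in auto)
  show ?thesis by (rule lifting_family)
qed

theorem mainTheorem3:
  fixes X :: "'x manifold"
    and act :: "'g::{topological_group_add, t2_space} \<Rightarrow> 'x \<Rightarrow> 'x"
    and M :: "nat \<Rightarrow> (nat \<Rightarrow> 'x) measure"
  assumes "locally_compact_space (euclidean :: 'g topology)"
    and "differentiable_manifold X"
    and "C1_continuous_action X act"
    and "amenable_action TYPE('i) (mtop X) act"
    and "\<forall>p\<ge>1. \<exists>g. riemannian_metric (power_manifold p X) g \<and>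
                   riemannian_measure (power_manifold p X) g (M p)"
  shows "(\<exists>\<Lambda> :: nat \<Rightarrow> ((nat \<Rightarrow> 'x) \<Rightarrow> real) set \<Rightarrow> (nat \<Rightarrow> 'x) \<Rightarrow> real.
            equivariant_strong_lifting_family (mtop X) act M \<Lambda> \<and>
            intertwines_coboundary (mtop X) M \<Lambda> \<and>
            commutes_with_permutations (mtop X) M \<Lambda>) \<and>
         (\<exists>\<Lambda> :: nat \<Rightarrow> ((nat \<Rightarrow> 'x) \<Rightarrow> complex) set \<Rightarrow> (nat \<Rightarrow> 'x) \<Rightarrow> complex.
            equivariant_strong_lifting_family (mtop X) act M \<Lambda> \<and>
            intertwines_coboundary (mtop X) M \<Lambda> \<and>
            commutes_with_permutations (mtop X) M \<Lambda>)"
  using assms(2-5) by (intro conjI equivariant_lifting_family_exists)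

end
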